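(* Let $G$ be a Lie group, $H\subset G$ a compact subgroup acting linearly on a finite-dimensional real vector space $S$, and let $\mu\in\mathfrak g^*$ with $\mu|_{\mathfrak h}=0$. Let $\mathfrak g=\mathfrak g_\mu\oplus\mathfrak o\oplus\mathfrak l\oplus\mathfrak n$ be an adapted splitting, $\mathfrak p$ an $H_\mu$-invariant complement of $\mathfrak h_\mu$ in $\mathfrak g_\mu$, and $\Phi:G\times U_\Phi\to T^*G$ an associated restricted $G$-tube. Let $\mathfrak p_r^*\subset\mathfrak p^*$, $\mathfrak o_r\subset\mathfrak o$ be $H_\mu$-invariant open neighborhoods of zero and $\mathfrak h_r^*\subset\mathfrak h^*$ an $H$-invariant open neighborhood of zero such that, with $(T^*S)_r=\{(a,b)\in T^*S\mid a\diamond_{\mathfrak h}b\in\mathfrak h_r^*\}$, the map $$\mathcal T_0:G\times_{H_\mu}\big(\mathfrak p^*_r\times\mathfrak o_r\times(T^*S)_r\big)\to T^*(G\times_HS),\quad [g,\nu,\lambda,a,b]_{H_\mu}\mapsto\varphi\big(\Phi(g,\nu+\tfrac12\lambda\diamond_{\mathfrak h_\mu}\mathrm{ad}^*_\lambda\mu+a\diamond_{\mathfrak h_\mu}b,\lambda;a\diamond_{\mathfrak l}b);a,b\big)$$ is a Hamiltonian tube around the point $\varphi(e,\mu,0,0)\in T^*(G\times_HS)$. Let $\tau:T^*(G\times_HS)\to G\times_HS$ be the projection and $\mathbf J:T^*(G\times_HS)\to\mathfrak g^*$ the momentum map of the cotangent-lifted $G$-action. Then there is a $G_\mu$-invariant neighborhood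 $\mathcal U_Q$ of $[e,0]_H$ in $G\times_HS$ such that $$\tau^{-1}(\mathcal U_Q)\cap\mathbf J^{-1}(\mu)=\mathcal T_0(Z),$$ where $$Z=\Big\{[g,\nu,\lambda,a,b]_{H_\mu}\in\mathcal T_0^{-1}(\tau^{-1}(\mathcal U_Q))\ \Big|\ g\in G_\mu,\ \nu=0,\ \tfrac12\lambda\diamond_{\mathfrak h_\mu}\mathrm{ad}^*_\lambda\mu+a\diamond_{\mathfrak h_\mu}b=0\Big\}.$$
   Context: **Conventions.** $\mathrm{Ad}^*_g$ and $\mathrm{ad}^*_\xi$ are the dual maps of $\mathrm{Ad}_g$ and $\mathrm{ad}_\xi$, so $\langle\mathrm{ad}^*_\xi\mu,\eta\rangle=\langle\mu,[\xi,\eta]\rangle$. $G$ acts on $\mathfrak g^*$ by $g\cdot\nu=\mathrm{Ad}^*_{g^{-1}}\nu$; $G_\mu$ is the stabilizer of $\mu$, $\mathfrak g_\mu=\{\xi:\mathrm{ad}_\xi^*\mu=0\}$; $H_\mu=H\cap G_\mu$, $\mathfrak h_\mu=\mathfrak h\cap\mathfrak g_\mu$. $^\circ$ denotes annihilator. $T^*G\cong G\times\mathfrak g^*$ by left trivialization, with canonical symplectic form $\omega_{T^*G}(u_1,u_2)=\langle\beta_2,\xi_1\rangle-\langle\beta_1,\xi_2\rangle+\langle\nu,[\xi_1,\xi_2]\rangle$ for $u_i=(\xi_i,\beta_i)\in T_{(g,\nu)}(G\times\mathfrak g^* )$ (tangent vectors to $G$ are left-trivialized). Splittings induce dual splittings;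 thus $\mathfrak g_\mu^*\cong(\mathfrak o\oplus\mathfrak l\oplus\mathfrak n)^\circ\subset\mathfrak g^*$ and $\mathfrak g_\mu^*=\mathfrak h_\mu^*\oplus\mathfrak p^*$. $T^*S=S\times S^*$. The momentum map of a cotangent-lifted action on $T^*Q$ is $\langle\mathbf J(q,p),\xi\rangle=\langle p,\xi_Q(q)\rangle$. **Diamond.** If $V$ carries a linear representation of a Lie group with Lie algebra containing the subspace $\mathfrak k$, then for $a\in V$, $b\in V^*$, $a\diamond_{\mathfrak k}b\in\mathfrak k^*$ is $\langle a\diamond_{\mathfrak k}b,\eta\rangle=\langle b,\eta\cdot a\rangle$ for $\eta\in\mathfrak k$. In $\lambda\diamond_{\mathfrak k}\mathrm{ad}^*_\lambda\mu$ the representation is the adjoint one: $\langle\lambda\diamond_{\mathfrak k}\mathrm{ad}_\lambda^*\mu,\eta\rangle=\langle\mu,[\lambda,[\eta,\lambda]]\rangle$. **Twisted products.** For a compact subgroup $K\subset G$ acting on $A$, $G\times_KA$ is the quotient of $G\times A$ by the twisting action $k\cdot^T(g,a)=(gk^{-1},k\cdot a)$, with $G$-action $g'\cdot[g,a]_K=[g'g,a]_K$. **Adapted splitting.** Let $\Omega^\mu(\xi_1,\xi_2)=-\langle\mu,[\xi_1,\xi_2]\rangle$. An adapted splitting is an $H_\mu$-invariant splitting $\mathfrak g=\mathfrak g_\mu\oplus\mathfrak o\oplus\mathfrak l\oplus\mathfrak n$ with (1) $\mathfrak h=\mathfrak h_\mu\oplus\mathfrak l$; (2) $\Omega^\mu|_{\mathfrak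 o}$ non-degenerate; (3) $\mathfrak l,\mathfrak n$ are $\Omega^\mu$-isotropic and $\Omega^\mu|_{\mathfrak l\oplus\mathfrak n}$ is non-degenerate; (4) $\Omega^\mu(\mathfrak o,\mathfrak l\oplus\mathfrak n)=0$. **Restricted $G$-tube.** A map $\Phi:G\times U_\Phi\to G\times\mathfrak g^*\cong T^*G$ with $U_\Phi\subset\mathfrak g_\mu^*\times\mathfrak o\times\mathfrak l^*$ such that: (1) $U_\Phi$ is a connected $H_\mu$-invariant (open) neighborhood of $0$; (2) $\Phi$ is a diffeomorphism onto its image, equivariant for left multiplication of $G$ on the first factor and for the twisting actions of $H_\mu$ ($h\cdot^T(g,\nu,\lambda,\varepsilon)=(gh^{-1},\mathrm{Ad}^*_{h^{-1}}\nu,\mathrm{Ad}_h\lambda,\mathrm{Ad}^*_{h^{-1}}\varepsilon)$ on the source and $h\cdot^T(g,\nu)=(gh^{-1},\mathrm{Ad}^*_{h^{-1}}\nu)$ on the target), and $\Phi(e,0,0;0)=(e,\mu)$; (3) $(\Phi^*\omega_{T^*G})(u_1,u_2)=\langle\dot\nu_2,\xi_1\rangle-\langle\dot\nu_1,\xi_2\rangle+\langle\nu+\mu,[\xi_1,\xi_2]\rangle-\langle\mu,[\dot\lambda_1,\dot\lambda_2]\rangle$ for $u_i=(\xi_i,\dot\nu_i,\dot\lambda_i,\dot\varepsilon_i)$ at $(g,\nu,\lambda,\varepsilon)$; (4) $\mathbf J_R(\Phi(g,\nu,\lambda,\varepsilon))|_{\mathfrak l}=-\varepsilon$, where $\mathbf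 J_R(g,\nu)=-\nu$. **The map $\varphi$.** $T^*(G\times S)\cong G\times\mathfrak g^*\times S\times S^*$. The cotangent lift of the twisting action of $H$ on $G\times S$ has momentum map $\mathbf J_{H^T}(g,\nu,a,b)=-\nu|_{\mathfrak h}+a\diamond_{\mathfrak h}b$. With $\pi_H:G\times S\to G\times_HS$, the map $\varphi:\mathbf J_{H^T}^{-1}(0)\to T^*(G\times_HS)$ is the surjective submersion determined by $\langle\varphi(x),T\pi_H(v)\rangle=\langle x,v\rangle$ for $x$ a covector at $(g,a)$ and $v\in T_{(g,a)}(G\times S)$. **Hamiltonian tube around $z_0=\varphi(e,\mu,0,0)$.** Let $N_0=\mathfrak o\times S\times S^*$ with symplectic form $\Omega_{N_0}((\lambda_1,v_1,w_1),(\lambda_2,v_2,w_2))=-\langle\mu,[\lambda_1,\lambda_2]\rangle+\langle w_2,v_1\rangle-\langle w_1,v_2\rangle$ and $\mathbf J_{N_0}(\lambda,a,b)=\frac12\lambda\diamond_{\mathfrak h_\mu}\mathrm{ad}_\lambda^*\mu+a\diamond_{\mathfrak h_\mu}b$, and let $Y=G\times_{H_\mu}(\mathfrak p^*\times N_0)$ with the two-form $\Omega_Y$ whose value on the projections of $u_i=(\xi_i,\dot\nu_i,\dot v_i)\in T_{(g,\nu,v)}(G\times\mathfrak p^*\times N_0)$ is $$\langle\dot\nu_2+T_v\mathbf J_{N_0}(\dot v_2),\xi_1\rangle-\langle\dot\nu_1+T_v\mathbf J_{N_0}(\dot v_1),\xi_2\rangle+\langle\nu+\mathbf J_{N_0}(v)+\mu,[\xi_1,\xi_2]\rangle+\Omega_{N_0}(\dot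 v_1,\dot v_2).$$ A map $\mathcal T_0$ from a $G$-invariant open neighborhood $Y_r$ of $[e,0,0]_{H_\mu}$ in $Y$ to $T^*(G\times_HS)$ is a Hamiltonian tube around $z_0$ if $\Omega_Y$ is symplectic on $Y_r$, $\mathcal T_0$ is a $G$-equivariant diffeomorphism onto its (open) image, $\mathcal T_0([e,0,0]_{H_\mu})=z_0$, and $\mathcal T_0^*\omega=\Omega_Y$ with $\omega$ the canonical symplectic form. *)

theory Defs
  imports "HOL-Analysis.Analysis" "HOL-Algebra.Group"
begin

text \<open>
  Finite-dimensional vector spaces are normed types satisfying \<open>fin_dim\<close> (the norm only serves to
  provide the topology), so that dimension 0 is not excluded as it would be by
  \<open>euclidean_space\<close>; the dual of \<open>'v\<close> is \<open>'v \<Rightarrow>\<^sub>L real\<close>.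
\<close>

definition fin_dim :: "'v::real_normed_vector itself \<Rightarrow> bool" where
  "fin_dim _ \<longleftrightarrow> (\<exists>B::'v set. finite B \<and> span B = UNIV)"

type_synonym 'v dual = "'v \<Rightarrow>\<^sub>L real"


section \<open>Smooth manifolds\<close>

text \<open>Class \<open>C\<^sup>k\<close> on an open subset of a finite-dimensional space, by partial derivatives.\<close>

primrec Ck_on :: "nat \<Rightarrow> 'a::real_normed_vector set \<Rightarrow> ('a \<Rightarrow> 'b::real_normed_vector) \<Rightarrow> bool" where
  "Ck_on 0 U f \<longleftrightarrow> continuous_on U f"
| "Ck_on (Suc k) U f \<longleftrightarrow>
     (\<forall>x\<in>U. f differentiable (at x)) \<and> (\<forall>v. Ck_on k U (\<lambda>x. frechet_derivative f (at x) v))"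

definition smooth_on :: "'a::real_normed_vector set \<Rightarrow> ('a \<Rightarrow> 'b::real_normed_vector) \<Rightarrow> bool" where
  "smooth_on U f \<longleftrightarrow> (\<forall>k. Ck_on k U f)"

text \<open>
  A chart is a pair of its domain and its coordinate map. Every point \<open>p\<close> carries a preferred
  chart \<open>chart_at p\<close>; the tangent space at \<open>p\<close> is the model space \<open>'e\<close>, a vector being identified
  with its coordinates in \<open>chart_at p\<close>.
\<close>

type_synonym ('m, 'e) chart = "'m set \<times> ('m \<Rightarrow> 'e)"

record ('m, 'e) manifold =
  mtop :: "'m topology"
  atlas :: "('m, 'e) chart set"
  chart_at :: "'m \<Rightarrow> ('m, 'e) chart"

abbreviation pts :: "('m, 'e) manifold \<Rightarrow> 'm set" where
  "pts M \<equiv> topspace (mtop M)"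

definition chart_inv :: "('m, 'e) chart \<Rightarrow> 'e \<Rightarrow> 'm" where
  "chart_inv C = inv_into (fst C) (snd C)"

definition smooth_manifold :: "('m, 'e::real_normed_vector) manifold \<Rightarrow> bool" where
  "smooth_manifold M \<longleftrightarrow>
     fin_dim TYPE('e) \<and> Hausdorff_space (mtop M) \<and> second_countable (mtop M) \<and>
     (\<forall>C\<in>atlas M. openin (mtop M) (fst C) \<and> open (snd C ` fst C) \<and>
        homeomorphic_map (subtopology (mtop M) (fst C)) (top_of_set (snd C ` fst C)) (snd C)) \<and>
     (\<forall>C\<in>atlas M. \<forall>D\<in>atlas M. smooth_on (snd C ` (fst C \<inter> fst D)) (snd D \<circ> chart_inv C)) \<and>
     (\<forall>p\<in>pts M. chart_at M p \<in> atlas M \<and> p \<in> fst (chart_at M p))"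

definition vec_mfd :: "('e::real_normed_vector, 'e) manifold" where
  "vec_mfd = \<lparr> mtop = euclidean, atlas = {(UNIV, id)}, chart_at = (\<lambda>_. (UNIV, id)) \<rparr>"

definition prod_chart :: "('m, 'e) chart \<Rightarrow> ('n, 'f) chart \<Rightarrow> ('m \<times> 'n, 'e \<times> 'f) chart" where
  "prod_chart C D = (fst C \<times> fst D, map_prod (snd C) (snd D))"

definition prod_mfd ::
  "('m, 'e) manifold \<Rightarrow> ('n, 'f) manifold \<Rightarrow> ('m \<times> 'n, 'e \<times> 'f) manifold" where
  "prod_mfd M N =
     \<lparr> mtop = prod_topology (mtop M) (mtop N),
       atlas = {prod_chart C D | C D. C \<in> atlas M \<and> D \<in> atlas N},
       chart_at = (\<lambda>(p, q). prod_chart (chart_at M p) (chart_at N q)) \<rparr>"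

definition smooth_on_open ::
  "('m, 'e::real_normed_vector) manifold \<Rightarrow> 'm set \<Rightarrow> ('n, 'f::real_normed_vector) manifold
    \<Rightarrow> ('m \<Rightarrow> 'n) \<Rightarrow> bool" where
  "smooth_on_open M W N f \<longleftrightarrow>
     continuous_map (subtopology (mtop M) W) (mtop N) f \<and>
     (\<forall>C\<in>atlas M. \<forall>D\<in>atlas N.
        smooth_on (snd C ` {p \<in> fst C \<inter> W. f p \<in> fst D}) (snd D \<circ> f \<circ> chart_inv C))"

text \<open>
  Smoothness on an arbitrary subset \<open>A\<close>: local existence of smooth extensions. For embedded
  submanifolds \<open>A\<close> this is smoothness for the submanifold structure. All submanifolds below
  (closed subgroups, relatively open subsets of linear subspaces, ...) are treated this way.
\<close>

definition smooth_map ::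
  "('m, 'e::real_normed_vector) manifold \<Rightarrow> 'm set \<Rightarrow> ('n, 'f::real_normed_vector) manifold
    \<Rightarrow> ('m \<Rightarrow> 'n) \<Rightarrow> bool" where
  "smooth_map M A N f \<longleftrightarrow> A \<subseteq> pts M \<and>
     (\<forall>p\<in>A. \<exists>W F. openin (mtop M) W \<and> p \<in> W \<and> smooth_on_open M W N F \<and>
        (\<forall>x\<in>A \<inter> W. F x = f x))"

definition diffeo_onto_image ::
  "('m, 'e::real_normed_vector) manifold \<Rightarrow> 'm set \<Rightarrow> ('n, 'f::real_normed_vector) manifold
    \<Rightarrow> ('m \<Rightarrow> 'n) \<Rightarrow> bool" where
  "diffeo_onto_image M A N f \<longleftrightarrow>
     smooth_map M A N f \<and> inj_on f A \<and> smooth_map N (f ` A) M (inv_into A f)"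

text \<open>
  Tangent map at \<open>p\<close> of a smooth map \<open>f\<close> on the submanifold \<open>A\<close>. Only its values on the tangent
  space of \<open>A\<close> are determined by \<open>f\<close>.
\<close>

definition tmap ::
  "('m, 'e::real_normed_vector) manifold \<Rightarrow> 'm set \<Rightarrow> ('n, 'f::real_normed_vector) manifold
    \<Rightarrow> ('m \<Rightarrow> 'n) \<Rightarrow> 'm \<Rightarrow> 'e \<Rightarrow> 'f" where
  "tmap M A N f p =
     frechet_derivative (snd (chart_at N (f p)) \<circ> f \<circ> chart_inv (chart_at M p))
       (at (snd (chart_at M p) p) within snd (chart_at M p) ` (A \<inter> fst (chart_at M p)))"

text \<open>Tangent space at \<open>p\<close> of a submanifold \<open>A\<close>, as the set of velocities of curves in \<open>A\<close>.\<close>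

definition tangent_space ::
  "('m, 'e::real_normed_vector) manifold \<Rightarrow> 'm set \<Rightarrow> 'm \<Rightarrow> 'e set" where
  "tangent_space M A p =
     {tmap vec_mfd UNIV M c (0::real) 1 | c.
        smooth_map vec_mfd UNIV M c \<and> range c \<subseteq> A \<and> c 0 = p}"

text \<open>
  \<open>coord_change M C p\<close> sends coordinates with respect to the chart \<open>C\<close> of a vector at \<open>p\<close> to
  coordinates with respect to \<open>chart_at M p\<close>.
\<close>

definition coord_change ::
  "('m, 'e::real_normed_vector) manifold \<Rightarrow> ('m, 'e) chart \<Rightarrow> 'm \<Rightarrow> 'e \<Rightarrow> 'e" where
  "coord_change M C p = frechet_derivative (snd (chart_at M p) \<circ> chart_inv C) (at (snd C p))"

definition local_form ::
  "('m, 'e::real_normed_vector) manifold \<Rightarrow> ('m \<Rightarrow> 'e \<Rightarrow> 'e \<Rightarrow> real) \<Rightarrow> ('m, 'e) chart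
    \<Rightarrow> 'e \<Rightarrow> 'e \<Rightarrow> 'e \<Rightarrow> real" where
  "local_form M \<omega> C x u v =
     \<omega> (chart_inv C x) (coord_change M C (chart_inv C x) u) (coord_change M C (chart_inv C x) v)"

text \<open>In the last conjunct the cyclic sum is the exterior derivative, in coordinates.\<close>

definition symplectic_on ::
  "('m, 'e::real_normed_vector) manifold \<Rightarrow> 'm set \<Rightarrow> ('m \<Rightarrow> 'e \<Rightarrow> 'e \<Rightarrow> real) \<Rightarrow> bool" where
  "symplectic_on M W \<omega> \<longleftrightarrow>
     (\<forall>p\<in>W. bilinear (\<omega> p) \<and> (\<forall>u v. \<omega> p v u = - \<omega> p u v) \<and>
        (\<forall>u. (\<forall>v. \<omega> p u v = 0) \<longrightarrow> u = 0)) \<and>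
     (\<forall>C\<in>atlas M. \<forall>u v. smooth_on (snd C ` (fst C \<inter> W)) (\<lambda>x. local_form M \<omega> C x u v)) \<and>
     (\<forall>C\<in>atlas M. \<forall>x\<in>snd C ` (fst C \<inter> W). \<forall>u v w.
        frechet_derivative (\<lambda>y. local_form M \<omega> C y v w) (at x) u +
        frechet_derivative (\<lambda>y. local_form M \<omega> C y w u) (at x) v +
        frechet_derivative (\<lambda>y. local_form M \<omega> C y u v) (at x) w = 0)"


subsection \<open>Cotangent bundles\<close>

text \<open>
  A covector at \<open>q\<close> is a pair \<open>(q, \<alpha>)\<close>, with \<open>\<alpha>\<close> a functional on the tangent space at \<open>q\<close>,
  i.e. expressed in \<open>chart_at Q q\<close>. The topology is the one generated by the induced charts.
\<close>

definition cot_chart ::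
  "('m, 'e::real_normed_vector) manifold \<Rightarrow> ('m, 'e) chart \<Rightarrow> ('m \<times> 'e dual, 'e \<times> 'e dual) chart"
  where
  "cot_chart M C =
     (fst C \<times> UNIV, \<lambda>(q, \<alpha> :: 'e dual). (snd C q, Blinfun (\<lambda>v. \<alpha> (coord_change M C q v))))"

definition cotangent ::
  "('m, 'e::real_normed_vector) manifold \<Rightarrow> ('m \<times> 'e dual, 'e \<times> 'e dual) manifold" where
  "cotangent M =
     \<lparr> mtop = topology (\<lambda>W. W \<subseteq> pts M \<times> UNIV \<and>
         (\<forall>C\<in>atlas M. open (snd (cot_chart M C) ` (W \<inter> fst (cot_chart M C))))),
       atlas = cot_chart M ` atlas M,
       chart_at = (\<lambda>(q, \<alpha>). cot_chart M (chart_at M q)) \<rparr>"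

text \<open>
  The canonical form \<open>dq \<and> dp\<close>: tangent vectors at \<open>(q, \<alpha>)\<close> are expressed in the bundle chart
  induced by \<open>chart_at M q\<close>, which is a canonical coordinate system.
\<close>

definition canonical_form :: "'m \<times> 'e::real_normed_vector dual \<Rightarrow> 'e \<times> 'e dual \<Rightarrow> 'e \<times> 'e dual \<Rightarrow> real"
  where
  "canonical_form z u1 u2 = snd u2 (fst u1) - snd u1 (fst u2)"


section \<open>Linear algebra of splittings\<close>

text \<open>\<open>V\<close> is the internal direct sum of the subspaces in the list \<open>Es\<close>.\<close>

definition direct_sum :: "'v::real_vector set \<Rightarrow> 'v set list \<Rightarrow> bool" where
  "direct_sum V Es \<longleftrightarrow> (\<forall>E\<in>set Es. subspace E) \<and> bij_betw sum_list (listset Es) V"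

definition annih :: "'v::real_normed_vector set \<Rightarrow> 'v dual set" where
  "annih A = {\<beta> :: 'v dual. \<forall>x\<in>A. \<beta> x = 0}"

text \<open>
  If \<open>c\<close> spans a complement of the subspace \<open>k\<close>, the dual of \<open>k\<close> is identified with \<open>annih c\<close>;
  \<open>dual_ext k c f\<close> is the element given by the functional \<open>f\<close> on \<open>k\<close>.
\<close>

definition dual_ext :: "'v::real_normed_vector set \<Rightarrow> 'v set \<Rightarrow> ('v \<Rightarrow> real) \<Rightarrow> 'v dual" where
  "dual_ext k c f = (THE \<beta>. \<beta> \<in> annih c \<and> (\<forall>\<eta>\<in>k. \<beta> \<eta> = f \<eta>))"

definition diamond ::
  "'g::real_normed_vector set \<Rightarrow> 'g set \<Rightarrow> ('g \<Rightarrow> 'v \<Rightarrow> 'v) \<Rightarrow> 'v::real_normed_vector \<Rightarrow> 'v dual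
    \<Rightarrow> 'g dual" where
  "diamond k c act a b = dual_ext k c (\<lambda>\<eta>. b (act \<eta> a))"


section \<open>Lie groups\<close>

record ('a, 'e) lie_grp = "'a monoid" +
  mfd :: "('a, 'e) manifold"

definition lie_group :: "('a, 'g::real_normed_vector) lie_grp \<Rightarrow> bool" where
  "lie_group G \<longleftrightarrow> group G \<and> smooth_manifold (mfd G) \<and> pts (mfd G) = carrier G \<and>
     smooth_map (prod_mfd (mfd G) (mfd G)) (carrier G \<times> carrier G) (mfd G) (\<lambda>(g, h). g \<otimes>\<^bsub>G\<^esub> h) \<and>
     smooth_map (mfd G) (carrier G) (mfd G) (\<lambda>g. inv\<^bsub>G\<^esub> g)"

text \<open>The Lie algebra of \<open>G\<close> is the tangent space \<open>'g\<close> at the identity.\<close>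

definition Ad :: "('a, 'g::real_normed_vector) lie_grp \<Rightarrow> 'a \<Rightarrow> 'g \<Rightarrow> 'g" where
  "Ad G g = tmap (mfd G) (carrier G) (mfd G) (\<lambda>x. g \<otimes>\<^bsub>G\<^esub> x \<otimes>\<^bsub>G\<^esub> inv\<^bsub>G\<^esub> g) \<one>\<^bsub>G\<^esub>"

text \<open>\<open>[\<xi>, \<eta>] = ad \<xi> \<eta>\<close>, where \<open>ad\<close> is the derivative of \<open>Ad\<close> at the identity.\<close>

definition bracket :: "('a, 'g::real_normed_vector) lie_grp \<Rightarrow> 'g \<Rightarrow> 'g \<Rightarrow> 'g" where
  "bracket G \<xi> \<eta> = tmap (mfd G) (carrier G) vec_mfd (\<lambda>g. Ad G g \<eta>) \<one>\<^bsub>G\<^esub> \<xi>"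

definition coAd :: "('a, 'g::real_normed_vector) lie_grp \<Rightarrow> 'a \<Rightarrow> 'g dual \<Rightarrow> 'g dual" where
  "coAd G g \<nu> = Blinfun (\<lambda>\<eta>. \<nu> (Ad G g \<eta>))"

definition coad :: "('a, 'g::real_normed_vector) lie_grp \<Rightarrow> 'g \<Rightarrow> 'g dual \<Rightarrow> 'g dual" where
  "coad G \<xi> \<nu> = Blinfun (\<lambda>\<eta>. \<nu> (bracket G \<xi> \<eta>))"

definition stab :: "('a, 'g::real_normed_vector) lie_grp \<Rightarrow> 'g dual \<Rightarrow> 'a set" where
  "stab G \<mu> = {g \<in> carrier G. coAd G (inv\<^bsub>G\<^esub> g) \<mu> = \<mu>}"

definition stab_alg :: "('a, 'g::real_normed_vector) lie_grp \<Rightarrow> 'g dual \<Rightarrow> 'g set" where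
  "stab_alg G \<mu> = {\<xi>. coad G \<xi> \<mu> = 0}"

definition sub_alg :: "('a, 'g::real_normed_vector) lie_grp \<Rightarrow> 'a set \<Rightarrow> 'g set" where
  "sub_alg G H = tangent_space (mfd G) H \<one>\<^bsub>G\<^esub>"

text \<open>Left trivialization of the tangent bundle.\<close>

definition from_left :: "('a, 'g::real_normed_vector) lie_grp \<Rightarrow> 'a \<Rightarrow> 'g \<Rightarrow> 'g" where
  "from_left G g = tmap (mfd G) (carrier G) (mfd G) (\<lambda>x. g \<otimes>\<^bsub>G\<^esub> x) \<one>\<^bsub>G\<^esub>"

definition to_left :: "('a, 'g::real_normed_vector) lie_grp \<Rightarrow> 'a \<Rightarrow> 'g \<Rightarrow> 'g" where
  "to_left G g = tmap (mfd G) (carrier G) (mfd G) (\<lambda>x. inv\<^bsub>G\<^esub> g \<otimes>\<^bsub>G\<^esub> x) g"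

text \<open>The manifold \<open>G \<times> \<gg>\<^sup>*\<close>, identified with the cotangent bundle of \<open>G\<close> by left trivialization.\<close>

definition TG_dual :: "('a, 'g::real_normed_vector) lie_grp \<Rightarrow> ('a \<times> 'g dual, 'g \<times> 'g dual) manifold"
  where "TG_dual G = prod_mfd (mfd G) vec_mfd"

definition TG_form ::
  "('a, 'g::real_normed_vector) lie_grp \<Rightarrow> 'a \<times> 'g dual \<Rightarrow> 'g \<times> 'g dual \<Rightarrow> 'g \<times> 'g dual \<Rightarrow> real"
  where
  "TG_form G = (\<lambda>(g, \<nu> :: 'g dual) (w1, \<beta>1 :: 'g dual) (w2, \<beta>2 :: 'g dual).
     let \<xi>1 = to_left G g w1; \<xi>2 = to_left G g w2
     in \<beta>2 \<xi>1 - \<beta>1 \<xi>2 + \<nu> (bracket G \<xi>1 \<xi>2))"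

definition lie_representation ::
  "('a, 'g::real_normed_vector) lie_grp \<Rightarrow> 'a set \<Rightarrow> ('a \<Rightarrow> 's::real_normed_vector \<Rightarrow> 's) \<Rightarrow> bool" where
  "lie_representation G H \<rho> \<longleftrightarrow>
     (\<forall>h\<in>H. linear (\<rho> h)) \<and> \<rho> \<one>\<^bsub>G\<^esub> = id \<and> (\<forall>h\<in>H. \<forall>k\<in>H. \<rho> (h \<otimes>\<^bsub>G\<^esub> k) = \<rho> h \<circ> \<rho> k) \<and>
     smooth_map (prod_mfd (mfd G) vec_mfd) (H \<times> UNIV) vec_mfd (\<lambda>(h, a). \<rho> h a)"

text \<open>\<open>\<eta> \<cdot> a\<close> for \<open>\<eta>\<close> in the Lie algebra of \<open>H\<close>: tangent map at the identity of \<open>h \<mapsto> h \<cdot> a\<close>.\<close>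

definition inf_act ::
  "('a, 'g::real_normed_vector) lie_grp \<Rightarrow> 'a set \<Rightarrow> ('a \<Rightarrow> 's::real_normed_vector \<Rightarrow> 's)
    \<Rightarrow> 'g \<Rightarrow> 's \<Rightarrow> 's" where
  "inf_act G H \<rho> \<eta> a = tmap (mfd G) H vec_mfd (\<lambda>h. \<rho> h a) \<one>\<^bsub>G\<^esub> \<eta>"

definition dual_act ::
  "('a, 'g) lie_grp \<Rightarrow> ('a \<Rightarrow> 's::real_normed_vector \<Rightarrow> 's) \<Rightarrow> 'a \<Rightarrow> 's dual \<Rightarrow> 's dual" where
  "dual_act G \<rho> h b = Blinfun (\<lambda>a. b (\<rho> (inv\<^bsub>G\<^esub> h) a))"


subsection \<open>Twisted products\<close>

text \<open>The class \<open>[g, x]\<close> is the orbit of \<open>(g, x)\<close> under the twisting action of \<open>K\<close>.\<close>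

definition tw_class ::
  "('a, 'g) lie_grp \<Rightarrow> 'a set \<Rightarrow> ('a \<Rightarrow> 'v \<Rightarrow> 'v) \<Rightarrow> 'a \<times> 'v \<Rightarrow> ('a \<times> 'v) set" where
  "tw_class G K act = (\<lambda>(g, x). {(g \<otimes>\<^bsub>G\<^esub> inv\<^bsub>G\<^esub> k, act k x) | k. k \<in> K})"

definition tw_left :: "('a, 'g) lie_grp \<Rightarrow> 'a \<Rightarrow> ('a \<times> 'v) set \<Rightarrow> ('a \<times> 'v) set" where
  "tw_left G g' c = (\<lambda>(g, x). (g' \<otimes>\<^bsub>G\<^esub> g, x)) ` c"

text \<open>
  \<open>B\<close> is the quotient manifold \<open>G \<times>\<^sub>K A\<close> for a submanifold \<open>A\<close> of the vector space \<open>'v\<close>: its points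
  are the orbits, and its smooth structure is the unique one for which the projection is a
  submersion. The model type \<open>'q\<close> is thereby forced to have dimension \<open>dim G + dim A - dim K\<close>.
\<close>

definition tw_product ::
  "('a, 'g::real_normed_vector) lie_grp \<Rightarrow> 'a set \<Rightarrow> ('a \<Rightarrow> 'v \<Rightarrow> 'v) \<Rightarrow> 'v::real_normed_vector set
    \<Rightarrow> (('a \<times> 'v) set, 'q::real_normed_vector) manifold \<Rightarrow> bool" where
  "tw_product G K act A B \<longleftrightarrow>
     smooth_manifold B \<and> pts B = tw_class G K act ` (carrier G \<times> A) \<and>
     smooth_map (prod_mfd (mfd G) vec_mfd) (carrier G \<times> A) B (tw_class G K act) \<and>
     (\<forall>p\<in>carrier G \<times> A.
        tmap (prod_mfd (mfd G) vec_mfd) (carrier G \<times> A) B (tw_class G K act) p `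
          tangent_space (prod_mfd (mfd G) vec_mfd) (carrier G \<times> A) p = UNIV)"


section \<open>Splittings and tubes\<close>

definition \<Omega>\<mu> :: "('a, 'g::real_normed_vector) lie_grp \<Rightarrow> 'g dual \<Rightarrow> 'g \<Rightarrow> 'g \<Rightarrow> real" where
  "\<Omega>\<mu> G \<mu> \<xi>1 \<xi>2 = - \<mu> (bracket G \<xi>1 \<xi>2)"

definition nondeg_on :: "('v \<Rightarrow> 'v \<Rightarrow> real) \<Rightarrow> 'v::real_vector set \<Rightarrow> bool" where
  "nondeg_on \<Omega> V \<longleftrightarrow> (\<forall>x\<in>V. (\<forall>y\<in>V. \<Omega> x y = 0) \<longrightarrow> x = 0)"

definition adapted_splitting ::
  "('a, 'g::real_normed_vector) lie_grp \<Rightarrow> 'a set \<Rightarrow> 'g dual \<Rightarrow> 'g set \<Rightarrow> 'g set \<Rightarrow> 'g set \<Rightarrow> bool"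
  where
  "adapted_splitting G H \<mu> \<oo> \<ll> \<nn> \<longleftrightarrow>
     direct_sum UNIV [stab_alg G \<mu>, \<oo>, \<ll>, \<nn>] \<and>
     (\<forall>h\<in>H \<inter> stab G \<mu>. \<forall>V\<in>{stab_alg G \<mu>, \<oo>, \<ll>, \<nn>}. Ad G h ` V \<subseteq> V) \<and>
     direct_sum (sub_alg G H) [sub_alg G H \<inter> stab_alg G \<mu>, \<ll>] \<and>
     nondeg_on (\<Omega>\<mu> G \<mu>) \<oo> \<and>
     (\<forall>x\<in>\<ll>. \<forall>y\<in>\<ll>. \<Omega>\<mu> G \<mu> x y = 0) \<and> (\<forall>x\<in>\<nn>. \<forall>y\<in>\<nn>. \<Omega>\<mu> G \<mu> x y = 0) \<and>
     nondeg_on (\<Omega>\<mu> G \<mu>) (span (\<ll> \<union> \<nn>)) \<and>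
     (\<forall>x\<in>\<oo>. \<forall>y\<in>span (\<ll> \<union> \<nn>). \<Omega>\<mu> G \<mu> x y = 0)"

text \<open>The space \<open>\<gg>\<^sub>\<mu>\<^sup>* \<times> \<oo> \<times> \<ll>\<^sup>*\<close>.\<close>

definition tube_model ::
  "('a, 'g::real_normed_vector) lie_grp \<Rightarrow> 'g dual \<Rightarrow> 'g set \<Rightarrow> 'g set \<Rightarrow> 'g set
    \<Rightarrow> ('g dual \<times> 'g \<times> 'g dual) set" where
  "tube_model G \<mu> \<oo> \<ll> \<nn> = annih (\<oo> \<union> \<ll> \<union> \<nn>) \<times> \<oo> \<times> annih (stab_alg G \<mu> \<union> \<oo> \<union> \<nn>)"

definition tube_act ::
  "('a, 'g::real_normed_vector) lie_grp \<Rightarrow> 'a \<Rightarrow> 'g dual \<times> 'g \<times> 'g dual \<Rightarrow> 'g dual \<times> 'g \<times> 'g dual"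
  where
  "tube_act G h = (\<lambda>(\<nu>, x, \<epsilon>). (coAd G (inv\<^bsub>G\<^esub> h) \<nu>, Ad G h x, coAd G (inv\<^bsub>G\<^esub> h) \<epsilon>))"

definition tube_form ::
  "('a, 'g::real_normed_vector) lie_grp \<Rightarrow> 'g dual \<Rightarrow> 'g dual
    \<Rightarrow> 'g \<times> 'g dual \<times> 'g \<times> 'g dual \<Rightarrow> 'g \<times> 'g dual \<times> 'g \<times> 'g dual \<Rightarrow> real" where
  "tube_form G \<mu> \<nu> = (\<lambda>(\<xi>1, \<nu>1 :: 'g dual, x1, \<epsilon>1 :: 'g dual) (\<xi>2, \<nu>2 :: 'g dual, x2, \<epsilon>2 :: 'g dual).
     \<nu>2 \<xi>1 - \<nu>1 \<xi>2 + (\<nu> + \<mu>) (bracket G \<xi>1 \<xi>2) - \<mu> (bracket G x1 x2))"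

definition restricted_tube ::
  "('a, 'g::real_normed_vector) lie_grp \<Rightarrow> 'a set \<Rightarrow> 'g dual \<Rightarrow> 'g set \<Rightarrow> 'g set \<Rightarrow> 'g set
    \<Rightarrow> ('g dual \<times> 'g \<times> 'g dual) set \<Rightarrow> ('a \<times> 'g dual \<times> 'g \<times> 'g dual \<Rightarrow> 'a \<times> 'g dual) \<Rightarrow> bool"
  where
  "restricted_tube G H \<mu> \<oo> \<ll> \<nn> U \<Phi> \<longleftrightarrow>
     openin (top_of_set (tube_model G \<mu> \<oo> \<ll> \<nn>)) U \<and> connected U \<and> 0 \<in> U \<and>
     (\<forall>h\<in>H \<inter> stab G \<mu>. tube_act G h ` U \<subseteq> U) \<and>
     diffeo_onto_image (prod_mfd (mfd G) vec_mfd) (carrier G \<times> U) (TG_dual G) \<Phi> \<and>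
     (\<forall>g'\<in>carrier G. \<forall>g\<in>carrier G. \<forall>y\<in>U.
        \<Phi> (g' \<otimes>\<^bsub>G\<^esub> g, y) = (g' \<otimes>\<^bsub>G\<^esub> fst (\<Phi> (g, y)), snd (\<Phi> (g, y)))) \<and>
     (\<forall>h\<in>H \<inter> stab G \<mu>. \<forall>g\<in>carrier G. \<forall>y\<in>U.
        \<Phi> (g \<otimes>\<^bsub>G\<^esub> inv\<^bsub>G\<^esub> h, tube_act G h y) =
          (fst (\<Phi> (g, y)) \<otimes>\<^bsub>G\<^esub> inv\<^bsub>G\<^esub> h, coAd G (inv\<^bsub>G\<^esub> h) (snd (\<Phi> (g, y))))) \<and>
     \<Phi> (\<one>\<^bsub>G\<^esub>, 0, 0, 0) = (\<one>\<^bsub>G\<^esub>, \<mu>) \<and>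
     (\<forall>g\<in>carrier G. \<forall>y\<in>U. \<forall>\<xi>1 \<xi>2. \<forall>y1\<in>tube_model G \<mu> \<oo> \<ll> \<nn>. \<forall>y2\<in>tube_model G \<mu> \<oo> \<ll> \<nn>.
        TG_form G (\<Phi> (g, y))
          (tmap (prod_mfd (mfd G) vec_mfd) (carrier G \<times> U) (TG_dual G) \<Phi> (g, y) (from_left G g \<xi>1, y1))
          (tmap (prod_mfd (mfd G) vec_mfd) (carrier G \<times> U) (TG_dual G) \<Phi> (g, y) (from_left G g \<xi>2, y2))
        = tube_form G \<mu> (fst y) (\<xi>1, y1) (\<xi>2, y2)) \<and>
     (\<forall>g\<in>carrier G. \<forall>\<nu> x \<epsilon>. (\<nu>, x, \<epsilon>) \<in> U \<longrightarrow>
        (\<forall>\<eta>\<in>\<ll>. (- snd (\<Phi> (g, \<nu>, x, \<epsilon>))) \<eta> = - \<epsilon> \<eta>))"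


subsection \<open>The cotangent bundle of a twisted product\<close>

text \<open>
  \<open>x = (g, \<nu>, a, b)\<close> stands for the covector on \<open>G \<times> S\<close> at \<open>(g, a)\<close> whose value on \<open>(\<xi>, v)\<close>
  is \<open>\<nu> \<xi> + b v\<close>. The functional exists, and \<open>\<phi>\<close> is meaningful, exactly when \<open>x\<close> is in the zero
  level of the momentum map of the twisting action of \<open>H\<close>, i.e. when \<open>a \<diamondop> b\<close> and \<open>\<nu>\<close> agree on
  the Lie algebra of \<open>H\<close>.
\<close>

definition \<phi> ::
  "('a, 'g::real_normed_vector) lie_grp \<Rightarrow> 'a set \<Rightarrow> ('a \<Rightarrow> 's::real_normed_vector \<Rightarrow> 's)
    \<Rightarrow> (('a \<times> 's) set, 'q::real_normed_vector) manifold
    \<Rightarrow> 'a \<times> 'g dual \<times> 's \<times> 's dual \<Rightarrow> ('a \<times> 's) set \<times> 'q dual" where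
  "\<phi> G H \<rho> Q = (\<lambda>(g, \<nu> :: 'g dual, a, b :: 's dual).
     (tw_class G H \<rho> (g, a),
      THE \<alpha> :: 'q dual. \<forall>\<xi> v.
        \<alpha> (tmap (prod_mfd (mfd G) vec_mfd) (carrier G \<times> UNIV) Q (tw_class G H \<rho>) (g, a)
             (from_left G g \<xi>, v))
        = \<nu> \<xi> + b v))"

text \<open>Momentum map of the cotangent-lifted action: the generator \<open>\<xi>\<^sub>Q(q)\<close> is the tangent map at
  the identity of \<open>g \<mapsto> g \<cdot> q\<close>, applied to \<open>\<xi>\<close>.\<close>

definition momentum ::
  "('a, 'g::real_normed_vector) lie_grp \<Rightarrow> (('a \<times> 's) set, 'q::real_normed_vector) manifold
    \<Rightarrow> ('a \<times> 's) set \<times> 'q dual \<Rightarrow> 'g dual" where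
  "momentum G Q = (\<lambda>(q, \<alpha> :: 'q dual).
     Blinfun (\<lambda>\<xi>. \<alpha> (tmap (mfd G) (carrier G) Q (\<lambda>g. tw_left G g q) \<one>\<^bsub>G\<^esub> \<xi>)))"

definition cot_left ::
  "('a, 'g::real_normed_vector) lie_grp \<Rightarrow> (('a \<times> 's) set, 'q::real_normed_vector) manifold
    \<Rightarrow> 'a \<Rightarrow> ('a \<times> 's) set \<times> 'q dual \<Rightarrow> ('a \<times> 's) set \<times> 'q dual" where
  "cot_left G Q g = (\<lambda>(q, \<alpha> :: 'q dual).
     (tw_left G g q, Blinfun (\<lambda>w. \<alpha> (tmap Q (pts Q) Q (tw_left G (inv\<^bsub>G\<^esub> g)) (tw_left G g q) w))))"


subsection \<open>Hamiltonian tubes\<close>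

definition N0_form ::
  "('a, 'g::real_normed_vector) lie_grp \<Rightarrow> 'g dual
    \<Rightarrow> 'g \<times> 's::real_normed_vector \<times> 's dual \<Rightarrow> 'g \<times> 's \<times> 's dual \<Rightarrow> real" where
  "N0_form G \<mu> = (\<lambda>(x1, v1, w1 :: 's dual) (x2, v2, w2 :: 's dual). - \<mu> (bracket G x1 x2) + w2 v1 - w1 v2)"

text \<open>The argument \<open>c\<close> spans the chosen complement of the Lie algebra of \<open>H\<^sub>\<mu>\<close>.\<close>

definition J_N0 ::
  "('a, 'g::real_normed_vector) lie_grp \<Rightarrow> 'a set \<Rightarrow> ('a \<Rightarrow> 's::real_normed_vector \<Rightarrow> 's)
    \<Rightarrow> 'g dual \<Rightarrow> 'g set \<Rightarrow> 'g \<times> 's \<times> 's dual \<Rightarrow> 'g dual" where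
  "J_N0 G H \<rho> \<mu> c = (\<lambda>(x, a, b).
     (1/2) *\<^sub>R diamond (sub_alg G H \<inter> stab_alg G \<mu>) c (bracket G) x (coad G x \<mu>) +
     diamond (sub_alg G H \<inter> stab_alg G \<mu>) c (inf_act G H \<rho>) a b)"

text \<open>The action of \<open>H\<^sub>\<mu>\<close> on \<open>\<pp>\<^sup>* \<times> N\<^sub>0\<close>.\<close>

definition Y_act ::
  "('a, 'g::real_normed_vector) lie_grp \<Rightarrow> ('a \<Rightarrow> 's::real_normed_vector \<Rightarrow> 's) \<Rightarrow> 'a
    \<Rightarrow> 'g dual \<times> 'g \<times> 's \<times> 's dual \<Rightarrow> 'g dual \<times> 'g \<times> 's \<times> 's dual" where
  "Y_act G \<rho> h = (\<lambda>(\<nu>, x, a, b). (coAd G (inv\<^bsub>G\<^esub> h) \<nu>, Ad G h x, \<rho> h a, dual_act G \<rho> h b))"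

definition Y_class ::
  "('a, 'g::real_normed_vector) lie_grp \<Rightarrow> 'a set \<Rightarrow> ('a \<Rightarrow> 's::real_normed_vector \<Rightarrow> 's) \<Rightarrow> 'g dual
    \<Rightarrow> 'a \<times> 'g dual \<times> 'g \<times> 's \<times> 's dual \<Rightarrow> ('a \<times> 'g dual \<times> 'g \<times> 's \<times> 's dual) set" where
  "Y_class G H \<rho> \<mu> = tw_class G (H \<inter> stab G \<mu>) (Y_act G \<rho>)"

text \<open>\<open>Y_fibre\<close> is \<open>\<pp>\<^sup>* \<times> N\<^sub>0\<close>, where \<open>\<pp>\<^sup>*\<close> is the annihilator of \<open>\<hh>\<^sub>\<mu> \<oplus> \<oo> \<oplus> \<ll> \<oplus> \<nn>\<close>.\<close>

definition Y_fibre ::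
  "('a, 'g::real_normed_vector) lie_grp \<Rightarrow> 'a set \<Rightarrow> 'g dual \<Rightarrow> 'g set \<Rightarrow> 'g set \<Rightarrow> 'g set
    \<Rightarrow> ('g dual \<times> 'g \<times> 's::real_normed_vector \<times> 's dual) set" where
  "Y_fibre G H \<mu> \<oo> \<ll> \<nn> =
     annih ((sub_alg G H \<inter> stab_alg G \<mu>) \<union> \<oo> \<union> \<ll> \<union> \<nn>) \<times> \<oo> \<times> UNIV \<times> UNIV"

text \<open>The value of the lift of \<open>\<Omega>\<^sub>Y\<close> at \<open>(g, \<nu>, v)\<close> on \<open>(\<xi>\<^sub>1, \<nu>\<^sub>1, v\<^sub>1)\<close>, \<open>(\<xi>\<^sub>2, \<nu>\<^sub>2, v\<^sub>2)\<close>;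
  it does not depend on \<open>g\<close>.\<close>

definition Y_lift_form ::
  "('a, 'g::real_normed_vector) lie_grp \<Rightarrow> 'a set \<Rightarrow> ('a \<Rightarrow> 's::real_normed_vector \<Rightarrow> 's)
    \<Rightarrow> 'g dual \<Rightarrow> 'g set \<Rightarrow> 'g set
    \<Rightarrow> 'g dual \<times> 'g \<times> 's \<times> 's dual \<Rightarrow> 'g \<times> 'g dual \<times> 'g \<times> 's \<times> 's dual
    \<Rightarrow> 'g \<times> 'g dual \<times> 'g \<times> 's \<times> 's dual \<Rightarrow> real" where
  "Y_lift_form G H \<rho> \<mu> \<oo> c = (\<lambda>(\<nu> :: 'g dual, v) (\<xi>1, \<nu>1 :: 'g dual, v1) (\<xi>2, \<nu>2 :: 'g dual, v2).
     let TJ = frechet_derivative (J_N0 G H \<rho> \<mu> c) (at v within \<oo> \<times> UNIV \<times> UNIV)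
     in blinfun_apply (\<nu>2 + TJ v2) \<xi>1 - blinfun_apply (\<nu>1 + TJ v1) \<xi>2
        + blinfun_apply (\<nu> + J_N0 G H \<rho> \<mu> c v + \<mu>) (bracket G \<xi>1 \<xi>2) + N0_form G \<mu> v1 v2)"

text \<open>\<open>\<Omega>\<^sub>Y\<close>: the form on \<open>Y\<close> taking the above values on projections of tangent vectors.\<close>

definition Y_form ::
  "('a, 'g::real_normed_vector) lie_grp \<Rightarrow> 'a set \<Rightarrow> ('a \<Rightarrow> 's::real_normed_vector \<Rightarrow> 's)
    \<Rightarrow> 'g dual \<Rightarrow> 'g set \<Rightarrow> 'g set \<Rightarrow> 'g set \<Rightarrow> 'g set
    \<Rightarrow> (('a \<times> 'g dual \<times> 'g \<times> 's \<times> 's dual) set, 'y::real_normed_vector) manifold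
    \<Rightarrow> ('a \<times> 'g dual \<times> 'g \<times> 's \<times> 's dual) set \<Rightarrow> 'y \<Rightarrow> 'y \<Rightarrow> real" where
  "Y_form G H \<rho> \<mu> \<pp> \<oo> \<ll> \<nn> Y y w1 w2 =
     (let F = Y_fibre G H \<mu> \<oo> \<ll> \<nn>;
          Tpr = tmap (prod_mfd (mfd G) vec_mfd) (carrier G \<times> F) Y (Y_class G H \<rho> \<mu>)
      in THE r. \<forall>g\<in>carrier G. \<forall>f\<in>F. \<forall>\<xi>1 \<xi>2. \<forall>f1\<in>F. \<forall>f2\<in>F.
           Y_class G H \<rho> \<mu> (g, f) = y \<and>
           Tpr (g, f) (from_left G g \<xi>1, f1) = w1 \<and> Tpr (g, f) (from_left G g \<xi>2, f2) = w2 \<longrightarrow>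
           r = Y_lift_form G H \<rho> \<mu> \<oo> (\<pp> \<union> \<oo> \<union> \<ll> \<union> \<nn>) f (\<xi>1, f1) (\<xi>2, f2))"

definition hamiltonian_tube ::
  "('a, 'g::real_normed_vector) lie_grp \<Rightarrow> 'a set \<Rightarrow> ('a \<Rightarrow> 's::real_normed_vector \<Rightarrow> 's)
    \<Rightarrow> 'g dual \<Rightarrow> 'g set \<Rightarrow> 'g set \<Rightarrow> 'g set \<Rightarrow> 'g set
    \<Rightarrow> (('a \<times> 's) set, 'q::real_normed_vector) manifold
    \<Rightarrow> (('a \<times> 'g dual \<times> 'g \<times> 's \<times> 's dual) set, 'y::real_normed_vector) manifold
    \<Rightarrow> ('a \<times> 'g dual \<times> 'g \<times> 's \<times> 's dual) set set
    \<Rightarrow> (('a \<times> 'g dual \<times> 'g \<times> 's \<times> 's dual) set \<Rightarrow> ('a \<times> 's) set \<times> 'q dual)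
    \<Rightarrow> ('a \<times> 's) set \<times> 'q dual \<Rightarrow> bool" where
  "hamiltonian_tube G H \<rho> \<mu> \<pp> \<oo> \<ll> \<nn> Q Y Yr T0 z0 \<longleftrightarrow>
     openin (mtop Y) Yr \<and> (\<forall>g\<in>carrier G. tw_left G g ` Yr \<subseteq> Yr) \<and>
     Y_class G H \<rho> \<mu> (\<one>\<^bsub>G\<^esub>, 0, 0, 0, 0) \<in> Yr \<and>
     symplectic_on Y Yr (Y_form G H \<rho> \<mu> \<pp> \<oo> \<ll> \<nn> Y) \<and>
     diffeo_onto_image Y Yr (cotangent Q) T0 \<and> openin (mtop (cotangent Q)) (T0 ` Yr) \<and>
     (\<forall>g\<in>carrier G. \<forall>y\<in>Yr. T0 (tw_left G g y) = cot_left G Q g (T0 y)) \<and>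
     T0 (Y_class G H \<rho> \<mu> (\<one>\<^bsub>G\<^esub>, 0, 0, 0, 0)) = z0 \<and>
     (\<forall>y\<in>Yr. \<forall>w1 w2.
        canonical_form (T0 y) (tmap Y Yr (cotangent Q) T0 y w1) (tmap Y Yr (cotangent Q) T0 y w2)
        = Y_form G H \<rho> \<mu> \<pp> \<oo> \<ll> \<nn> Y y w1 w2)"

end

theory Submission
  imports Defs
begin

text \<open>
  Write \<open>\<Phi> (g, y) = (g A(y), B(y))\<close>. The symplectic form on the tube and the connectedness of \<open>U\<close>
  force \<open>Ad\<^sup>*\<^bsub>A(y)\<^esub>\<^sup>-\<^sup>1 B(y) = \<mu> + \<nu>\<close> for \<open>y = (\<nu>, \<lambda>, \<epsilon>)\<close>, so the momentum at the image of
  \<open>[g, \<nu>, \<lambda>, a, b]\<close> is \<open>Ad\<^sup>*\<^bsub>g\<^esub>\<^sup>-\<^sup>1 (\<mu> + \<nu> + J)\<close> with \<open>J\<close> the value of the momentum map of \<open>N\<^sub>0\<close>.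
  Hence points of \<open>Z\<close> have momentum \<open>\<mu>\<close>. Conversely, a covector of momentum \<open>\<mu>\<close> over \<open>[k g, a]\<close>,
  with \<open>k\<close> in the stabilizer and \<open>g\<close> near the identity, is represented by \<open>(k g, Ad\<^sup>*\<^bsub>g\<^esub> \<mu>, a, b)\<close>.
  By the inverse function theorem twisting with a small \<open>h \<in> H\<close> moves \<open>Ad\<^sup>*\<^bsub>g\<^esub> \<mu>\<close> into the range of \<open>B\<close>,
  say to \<open>B(y)\<close>. Then \<open>g h A(y)\<^sup>-\<^sup>1\<close> is close to the identity and moves \<open>\<mu>\<close> inside the slice
  \<open>\<mu> + (\<oo> \<oplus> \<ll> \<oplus> \<nn>)\<^sup>\<circ>\<close>, which the orbit of \<open>\<mu>\<close> meets only once near \<open>\<mu>\<close>; so this element is in the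
  stabilizer and \<open>\<nu> = 0\<close>. The covector vanishes on the twisting directions, so \<open>B(y)\<close> restricted to
  \<open>\<hh>\<close> is \<open>a \<diamondop> b\<close>, which is therefore small even though \<open>b\<close> need not be; comparing \<open>B\<close> at \<open>y\<close> and at the
  tube coordinates of \<open>(\<lambda>, a, b)\<close> on \<open>\<hh>\<^sub>\<mu>\<close> gives \<open>J = 0\<close>.
\<close>

section \<open>Finite-dimensional normed spaces\<close>

text \<open>Two obstacles shape the proof. The coadjoint orbit of \<open>\<mu>\<close> may return to
  every neighbourhood of \<open>\<mu>\<close>, so closeness of covectors cannot force an element
  into the stabilizer; smallness is therefore measured in \<open>G\<close>, as closeness of
  \<open>g \<otimes> h \<otimes> inv (A y)\<close> to the identity. And \<open>\<phi>\<close> is a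
  definite description, a genuine covector only on the zero level of the twisting momentum map; that
  \<open>T0\<close> feeds it such points is not visible in the formula and is extracted from the
  injectivity of \<open>T0\<close> and the compactness of \<open>H\<close>. The analysis rests on
  strict derivatives at one point, relative to a subset: they suffice for the inverse function
  theorem, compose freely, and make sense on \<open>H\<close> and on relatively open subsets of
  subspaces, where tangent maps are determined only along tangent vectors. Neither the exponential
  map nor flows occur: curves with a given velocity replace one-parameter subgroups. Since the
  bracket is the derivative of \<open>Ad\<close>, its antisymmetry has to be derived from the
  symmetry of second derivatives.\<close>

lemma norm_ge_dist_subspace:
  fixes V :: "'v::real_normed_vector set"
  assumes "closed V" "subspace V" "b \<notin> V"
  shows "\<exists>d>0. \<forall>k. \<forall>y\<in>V. \<bar>k\<bar> * d \<le> norm (k *\<^sub>R b + y)"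
proof -
  obtain d where d: "d > 0" "ball b d \<subseteq> - V"
    using assms by (metis ComplI open_Compl open_contains_ball)
  have "\<bar>k\<bar> * d \<le> norm (k *\<^sub>R b + y)" if "y \<in> V" for k y
  proof (cases "k = 0")
    case True then show ?thesis by simp
  next
    case False
    have "- ((1/k) *\<^sub>R y) \<in> V" using that assms(2) by (simp add: subspace_neg subspace_scale)
    then have "- ((1/k) *\<^sub>R y) \<notin> ball b d" using d by blast
    then have "d \<le> norm (b + (1/k) *\<^sub>R y)" by (simp add: dist_norm)
    then have "\<bar>k\<bar> * d \<le> \<bar>k\<bar> * norm (b + (1/k) *\<^sub>R y)" by (simp add: mult_left_mono)
    also have "\<dots> = norm (k *\<^sub>R (b + (1/k) *\<^sub>R y))" by simp
    also have "k *\<^sub>R (b + (1/k) *\<^sub>R y) = k *\<^sub>R b + y"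
      using False by (simp add: scaleR_add_right)
    finally show ?thesis .
  qed
  with d(1) show ?thesis by blast
qed

text \<open>The span of the earlier generators is complete, hence closed, so a new \<open>b\<close>
  outside it has positive distance \<open>d\<close> from it. This makes the coefficient along
  \<open>b\<close> a Lipschitz function of the vector, and a Cauchy sequence splits into a Cauchy
  sequence of scalars and one in the smaller span.\<close>

lemma complete_span_finite:
  fixes B :: "'v::real_normed_vector set"
  assumes "finite B"
  shows "complete (span B)"
  using assms
proof (induction B)
  case empty
  show ?case
    by (auto simp: complete_def Cauchy_def intro!: tendsto_eventually)
next
  case (insert b B)
  show ?case
  proof (cases "b \<in> span B")
    case True
    then have "span (insert b B) = span B"
      by (simp add: span_redundant)
    with insert show ?thesis by simp
  next
    case False
    have "closed (span B)" using insert by (simp add: complete_imp_closed)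
    from norm_ge_dist_subspace[OF this subspace_span False] obtain d where d: "d > 0"
      and low: "\<And>k y. y \<in> span B \<Longrightarrow> \<bar>k\<bar> * d \<le> norm (k *\<^sub>R b + y)" by blast
    show ?thesis
    proof (rule completeI)
      fix s :: "nat \<Rightarrow> 'v" assume s: "\<forall>n. s n \<in> span (insert b B)" "Cauchy s"
      then have "\<forall>n. \<exists>k. s n - k *\<^sub>R b \<in> span B" by (simp add: span_insert)
      then obtain k where k: "\<And>n. s n - k n *\<^sub>R b \<in> span B" by metis
      have kd: "\<bar>k m - k n\<bar> * d \<le> norm (s m - s n)" for m n
        using low[OF span_diff[OF k[of m] k[of n]], of "k m - k n"] by (simp add: algebra_simps)
      have "Cauchy k"
      proof (rule CauchyI)
        fix e :: real assume "e > 0"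
        then obtain N where N: "\<And>m n. m \<ge> N \<Longrightarrow> n \<ge> N \<Longrightarrow> norm (s m - s n) < e * d"
          using CauchyD[OF s(2), of "e * d"] d by auto
        have "norm (k m - k n) < e" if "m \<ge> N" "n \<ge> N" for m n
          using N[OF that] kd[of m n] d(1)
          by (metis le_less_trans mult_less_cancel_right_pos real_norm_def)
        then show "\<exists>M. \<forall>m\<ge>M. \<forall>n\<ge>M. norm (k m - k n) < e" by blast
      qed
      then obtain l where l: "k \<longlonglongrightarrow> l" using Cauchy_convergent convergent_def by blast
      have kb: "(\<lambda>n. k n *\<^sub>R b) \<longlonglongrightarrow> l *\<^sub>R b" using l by (intro tendsto_intros)
      have "Cauchy (\<lambda>n. s n - k n *\<^sub>R b)"
      proof (rule CauchyI)
        fix e :: real assume "e > 0"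
        then have \<open>e / 2 > 0\<close> by simp
        obtain M where M: "\<forall>m\<ge>M. \<forall>n\<ge>M. norm (s m - s n) < e / 2"
          using CauchyD[OF s(2) \<open>e / 2 > 0\<close>] ..
        obtain N where N: "\<forall>m\<ge>N. \<forall>n\<ge>N. norm (k m *\<^sub>R b - k n *\<^sub>R b) < e / 2"
          using CauchyD[OF LIMSEQ_imp_Cauchy[OF kb] \<open>e / 2 > 0\<close>] ..
        have "norm (s m - k m *\<^sub>R b - (s n - k n *\<^sub>R b)) < e" if "m \<ge> max M N" "n \<ge> max M N" for m n
        proof -
          have "norm (s m - s n) < e / 2" "norm (k m *\<^sub>R b - k n *\<^sub>R b) < e / 2"
            using M N that by auto
          then show ?thesis
            using norm_triangle_ineq4[of "s m - s n" "k m *\<^sub>R b - k n *\<^sub>R b"]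
            by (simp add: algebra_simps)
        qed
        then show "\<exists>M. \<forall>m\<ge>M. \<forall>n\<ge>M. norm (s m - k m *\<^sub>R b - (s n - k n *\<^sub>R b)) < e" by blast
      qed
      then obtain y where y: "y \<in> span B" "(\<lambda>n. s n - k n *\<^sub>R b) \<longlonglongrightarrow> y"
        using insert.IH[unfolded complete_def, rule_format, of "\<lambda>n. s n - k n *\<^sub>R b"] k by blast
      have "(\<lambda>n. (s n - k n *\<^sub>R b) + k n *\<^sub>R b) \<longlonglongrightarrow> y + l *\<^sub>R b"
        by (intro tendsto_add y kb)
      then have "s \<longlonglongrightarrow> y + l *\<^sub>R b" by simp
      moreover have "y + l *\<^sub>R b \<in> span (insert b B)"
        using y by (auto simp: span_insert intro!: exI[of _ l])
      ultimately show "\<exists>l\<in>span (insert b B). s \<longlonglongrightarrow> l" by blast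
    qed
  qed
qed

text \<open>The same induction as for completeness: the coefficient along \<open>b\<close> is at
  most \<open>norm x / d\<close>. The model spaces carry arbitrary norms, and this is what allows
  every linear map on them to be packed by \<open>Blinfun\<close>.\<close>

lemma linear_bounded_on_span:
  fixes f :: "'v::real_normed_vector \<Rightarrow> 'w::real_normed_vector"
  assumes "finite B" "linear f"
  shows "\<exists>K. \<forall>x\<in>span B. norm (f x) \<le> K * norm x"
  using assms(1)
proof (induction B)
  case empty
  then show ?case using assms(2) by (auto simp: linear_0)
next
  case (insert b B)
  then obtain K where K: "\<And>x. x \<in> span B \<Longrightarrow> norm (f x) \<le> K * norm x" by blast
  show ?case
  proof (cases "b \<in> span B")
    case True
    then have "span (insert b B) = span B" by (simp add: span_redundant)
    with K show ?thesis by metis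
  next
    case False
    have "closed (span B)" using insert by (simp add: complete_imp_closed complete_span_finite)
    from norm_ge_dist_subspace[OF this subspace_span False] obtain d where d: "d > 0"
      and low: "\<And>k y. y \<in> span B \<Longrightarrow> \<bar>k\<bar> * d \<le> norm (k *\<^sub>R b + y)" by blast
    have "norm (f x) \<le> (norm (f b) / d + \<bar>K\<bar> * (1 + norm b / d)) * norm x"
      if x: "x \<in> span (insert b B)" for x
    proof -
      obtain k where k: "x - k *\<^sub>R b \<in> span B" using x by (auto simp: span_insert)
      have kd: "\<bar>k\<bar> \<le> norm x / d" using low[OF k, of k] d by (simp add: field_simps)
      have "norm (x - k *\<^sub>R b) \<le> norm x + \<bar>k\<bar> * norm b"
        by (metis norm_scaleR norm_triangle_ineq4)
      also have "\<dots> \<le> norm x + norm x / d * norm b" by (intro add_left_mono mult_right_mono[OF kd]) simp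
      finally have 1: "norm (x - k *\<^sub>R b) \<le> norm x * (1 + norm b / d)" by (simp add: algebra_simps)
      have "f x = k *\<^sub>R f b + f (x - k *\<^sub>R b)"
        using assms(2) by (simp add: linear_diff linear_scale)
      then have "norm (f x) \<le> \<bar>k\<bar> * norm (f b) + norm (f (x - k *\<^sub>R b))"
        by (metis norm_scaleR norm_triangle_ineq)
      also have "\<dots> \<le> norm x / d * norm (f b) + \<bar>K\<bar> * (norm x * (1 + norm b / d))"
      proof (rule add_mono)
        show "\<bar>k\<bar> * norm (f b) \<le> norm x / d * norm (f b)" by (rule mult_right_mono[OF kd]) simp
        have "norm (f (x - k *\<^sub>R b)) \<le> K * norm (x - k *\<^sub>R b)" using K[OF k] .
        also have "\<dots> \<le> \<bar>K\<bar> * norm (x - k *\<^sub>R b)" by (simp add: mult_right_mono)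
        also have "\<dots> \<le> \<bar>K\<bar> * (norm x * (1 + norm b / d))" by (rule mult_left_mono[OF 1]) simp
        finally show "norm (f (x - k *\<^sub>R b)) \<le> \<bar>K\<bar> * (norm x * (1 + norm b / d))" .
      qed
      finally show ?thesis by (simp add: algebra_simps)
    qed
    then show ?thesis by blast
  qed
qed

lemma fin_dim_complete: "fin_dim TYPE('v::real_normed_vector) \<Longrightarrow> complete (UNIV :: 'v set)"
  unfolding fin_dim_def by (metis complete_span_finite)

lemma fin_dim_bounded_linear:
  fixes f :: "'v::real_normed_vector \<Rightarrow> 'w::real_normed_vector"
  assumes "fin_dim TYPE('v)" "linear f"
  shows "bounded_linear f"
proof -
  obtain B :: "'v set" where "finite B" "span B = UNIV" using assms(1) unfolding fin_dim_def by blast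
  with linear_bounded_on_span[OF _ assms(2), of B] obtain K where K: "\<And>x. norm (f x) \<le> K * norm x"
    by auto
  show ?thesis
    using assms(2) K unfolding bounded_linear_def bounded_linear_axioms_def
    by (metis mult.commute)
qed

lemma fin_dim_basis:
  assumes "fin_dim TYPE('v::real_normed_vector)"
  obtains B :: "('v::real_normed_vector) set" and c :: "'v \<Rightarrow> 'v \<Rightarrow> real" where "finite B" "\<And>b. bounded_linear (c b)"
    "\<And>x. x = (\<Sum>b\<in>B. c b x *\<^sub>R b)"
proof -
  obtain S :: "'v set" where S: "finite S" "span S = UNIV" using assms unfolding fin_dim_def by blast
  obtain B where B: "B \<subseteq> S" "independent B" "S \<subseteq> span B" using maximal_independent_subset by blast
  have fB: "finite B" using B S finite_subset by blast
  have sB: "span B = UNIV" using B S by (metis span_eq_iff span_mono span_span top.extremum_uniqueI)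
  have lin: "linear (\<lambda>x. representation B x b)" for b
    by (rule linearI) (use B(2) sB in \<open>simp_all add: representation_add representation_scale\<close>)
  show ?thesis
  proof
    show "finite B" by fact
    show "bounded_linear (\<lambda>x. representation B x b)" for b
      by (rule fin_dim_bounded_linear[OF assms lin])
    show "x = (\<Sum>b\<in>B. representation B x b *\<^sub>R b)" for x
      using sum_representation_eq[OF B(2) _ fB order_refl, of x] sB by simp
  qed
qed

lemma fin_dim_dual:
  assumes "fin_dim TYPE('v::real_normed_vector)"
  shows "fin_dim TYPE(('v::real_normed_vector) dual)"
proof -
  obtain B :: "'v set" and c where B: "finite B" "\<And>b. bounded_linear (c b)"
    "\<And>x. x = (\<Sum>b\<in>B. c b x *\<^sub>R b)" using fin_dim_basis[OF assms] by blast
  have "\<beta> \<in> span ((\<lambda>b. Blinfun (c b)) ` B)" for \<beta> :: "'v dual"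
  proof -
    have "\<beta> = (\<Sum>b\<in>B. \<beta> b *\<^sub>R Blinfun (c b))"
    proof (rule blinfun_eqI)
      fix x
      have "\<beta> x = \<beta> (\<Sum>b\<in>B. c b x *\<^sub>R b)" using B(3) by metis
      also have "\<dots> = (\<Sum>b\<in>B. c b x * \<beta> b)" by (simp add: blinfun.sum_right blinfun.scaleR_right)
      also have "\<dots> = blinfun_apply (\<Sum>b\<in>B. \<beta> b *\<^sub>R Blinfun (c b)) x"
        by (simp add: blinfun.sum_left blinfun.scaleR_left bounded_linear_Blinfun_apply[OF B(2)] mult.commute)
      finally show "\<beta> x = blinfun_apply (\<Sum>b\<in>B. \<beta> b *\<^sub>R Blinfun (c b)) x" .
    qed
    also have "\<dots> \<in> span ((\<lambda>b. Blinfun (c b)) ` B)"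
      by (intro span_sum span_scale span_base) auto
    finally show ?thesis .
  qed
  then show ?thesis unfolding fin_dim_def using B(1) by (intro exI[of _ "(\<lambda>b. Blinfun (c b)) ` B"]) auto
qed

lemma fin_dim_prod:
  assumes "fin_dim TYPE('v::real_normed_vector)" "fin_dim TYPE('w::real_normed_vector)"
  shows "fin_dim TYPE('v \<times> 'w)"
proof -
  obtain B :: "'v set" and C :: "'w set" where BC: "finite B" "span B = UNIV" "finite C" "span C = UNIV"
    using assms unfolding fin_dim_def by blast
  let ?S = "(\<lambda>b. (b, 0 :: 'w)) ` B \<union> (\<lambda>c. (0 :: 'v, c)) ` C"
  have l: "linear (\<lambda>b. (b, 0 :: 'w))" "linear (\<lambda>c. (0 :: 'v, c))"
    by (auto intro!: linearI)
  have "(v, w) \<in> span ?S" for v w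
  proof -
    have "(v, 0) \<in> span ((\<lambda>b. (b, 0 :: 'w)) ` B)" using BC by (simp add: linear_span_image[OF l(1)])
    moreover have "(0, w) \<in> span ((\<lambda>c. (0 :: 'v, c)) ` C)" using BC by (simp add: linear_span_image[OF l(2)])
    ultimately have "(v, 0) + (0, w) \<in> span ?S"
      by (intro span_add) (meson in_mono span_mono sup_ge1 sup_ge2)+
    then show ?thesis by simp
  qed
  then show ?thesis unfolding fin_dim_def using BC by (intro exI[of _ ?S]) auto
qed

lemma fin_dim_real: "fin_dim TYPE(real)"
  unfolding fin_dim_def
proof (intro exI conjI)
  show "span {1 :: real} = UNIV" by (auto simp: span_singleton)
qed simp

lemma blinfun_apply_Blinfun_fin_dim:
  fixes f :: "'v::real_normed_vector \<Rightarrow> 'w::real_normed_vector"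
  assumes "fin_dim TYPE('v)" "linear f"
  shows "blinfun_apply (Blinfun f) = f"
  by (rule bounded_linear_Blinfun_apply[OF fin_dim_bounded_linear[OF assms]])

text \<open>Evaluation on finitely many vectors controls the dual norm, so differentiability and
  convergence of dual-valued maps can be checked one vector at a time.\<close>

lemma fin_dim_dual_norm_le:
  assumes "fin_dim TYPE('v::real_normed_vector)"
  obtains B :: "('v::real_normed_vector) set" and K where "finite B" "K > 0"
    "\<And>\<beta> :: ('v::real_normed_vector) dual. norm \<beta> \<le> K * (\<Sum>b\<in>B. \<bar>blinfun_apply \<beta> b\<bar>)"
proof -
  obtain B :: "'v set" and c where B: "finite B" "\<And>b. bounded_linear (c b)"
    "\<And>x. x = (\<Sum>b\<in>B. c b x *\<^sub>R b)" using fin_dim_basis[OF assms] by blast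
  \<comment> \<open>The summand 1 keeps \<open>K\<close> positive when the basis is empty.\<close>
  define K where "K = 1 + (\<Sum>b\<in>B. onorm (c b))"
  have on: "onorm (c b) \<ge> 0" for b using B(2) onorm_pos_le by blast
  have onK: "onorm (c b) \<le> K" if "b \<in> B" for b
    using member_le_sum[OF that, of "\<lambda>b. onorm (c b)"] on B(1) by (auto simp: K_def)
  have K: "K > 0" using on by (simp add: K_def add_pos_nonneg sum_nonneg)
  have "norm \<beta> \<le> K * (\<Sum>b\<in>B. \<bar>\<beta> b\<bar>)" for \<beta> :: "'v dual"
  proof (rule norm_blinfun_bound)
    show "0 \<le> K * (\<Sum>b\<in>B. \<bar>\<beta> b\<bar>)" using K by (simp add: sum_nonneg)
    fix x
    have "\<beta> x = \<beta> (\<Sum>b\<in>B. c b x *\<^sub>R b)" using B(3) by metis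
    also have "\<dots> = (\<Sum>b\<in>B. c b x * \<beta> b)" by (simp add: blinfun.sum_right blinfun.scaleR_right)
    finally have "norm (\<beta> x) \<le> (\<Sum>b\<in>B. norm (c b x * \<beta> b))" by (metis norm_sum)
    also have "\<dots> \<le> (\<Sum>b\<in>B. K * norm x * \<bar>\<beta> b\<bar>)"
    proof (rule sum_mono)
      fix b assume b: "b \<in> B"
      have "norm (c b x) \<le> onorm (c b) * norm x" using B(2) onorm by blast
      also have "\<dots> \<le> K * norm x" using onK[OF b] by (simp add: mult_right_mono)
      finally show "norm (c b x * \<beta> b) \<le> K * norm x * \<bar>\<beta> b\<bar>" by (simp add: abs_mult mult_right_mono)
    qed
    finally show "norm (\<beta> x) \<le> K * (\<Sum>b\<in>B. \<bar>\<beta> b\<bar>) * norm x"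
      by (simp add: sum_distrib_left mult.commute mult.left_commute)
  qed
  with K B(1) show ?thesis using that by blast
qed

text \<open>Induction on \<open>I\<close>. Either \<open>F j\<close> vanishes on the common kernel
  of the others and gets coefficient 0, or some \<open>u\<close> in that kernel has
  \<open>F j u\<close> nonzero; then \<open>f\<close> minus the multiple of \<open>F j\<close> that
  agrees with it at \<open>u\<close> vanishes on the common kernel of the others.\<close>

lemma span_functionals:
  fixes f :: "'v::real_vector \<Rightarrow> real"
  assumes "finite I" "\<And>i. i \<in> I \<Longrightarrow> linear (F i)" "linear f"
    and "\<And>x. (\<And>i. i \<in> I \<Longrightarrow> F i x = 0) \<Longrightarrow> f x = 0"
  shows "\<exists>c. \<forall>x. f x = (\<Sum>i\<in>I. c i * F i x)"
  using assms
proof (induction I arbitrary: f)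
  case empty
  then show ?case by auto
next
  case (insert j I)
  note lin = linear_add linear_scale linear_diff
  show ?case
  proof (cases "\<forall>x. (\<forall>i\<in>I. F i x = 0) \<longrightarrow> F j x = 0")
    case True
    then have "\<exists>c. \<forall>x. f x = (\<Sum>i\<in>I. c i * F i x)"
      using insert.prems by (intro insert.IH) auto
    then obtain c where c: "\<And>x. f x = (\<Sum>i\<in>I. c i * F i x)" by blast
    have "(\<Sum>i\<in>insert j I. (c(j := 0)) i * F i x) = (\<Sum>i\<in>I. c i * F i x)" for x
      using insert.hyps by (simp, intro sum.cong) auto
    with c show ?thesis by (intro exI[of _ "c(j := 0)"]) simp
  next
    case False
    then obtain u where u: "\<And>i. i \<in> I \<Longrightarrow> F i u = 0" "F j u \<noteq> 0" by blast
    define g where "g x = f x - (f u / F j u) * F j x" for x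
    have lj: "linear (F j)" using insert.prems by simp
    have "linear g" unfolding g_def using insert.prems(2) lj
      by (intro linearI) (auto simp: lin algebra_simps)
    moreover have "g x = 0" if "\<And>i. i \<in> I \<Longrightarrow> F i x = 0" for x
    proof -
      let ?y = "x - (F j x / F j u) *\<^sub>R u"
      have "F i ?y = 0" if "i \<in> insert j I" for i
        using that u insert.prems(1)[OF that] \<open>\<And>i. i \<in> I \<Longrightarrow> F i x = 0\<close>
        by (auto simp: lin)
      then have "f ?y = 0" by (rule insert.prems(3))
      then show ?thesis using u insert.prems(2) by (simp add: g_def lin)
    qed
    ultimately have "\<exists>c. \<forall>x. g x = (\<Sum>i\<in>I. c i * F i x)"
      using insert.prems by (intro insert.IH) auto
    then obtain c where c: "\<And>x. g x = (\<Sum>i\<in>I. c i * F i x)" by blast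
    have "f x = (\<Sum>i\<in>insert j I. (c(j := f u / F j u)) i * F i x)" for x
    proof -
      have "(\<Sum>i\<in>insert j I. (c(j := f u / F j u)) i * F i x)
        = f u / F j u * F j x + (\<Sum>i\<in>I. c i * F i x)"
        using insert.hyps by (simp, intro sum.cong) auto
      with c[of x] show ?thesis by (simp add: g_def)
    qed
    then show ?thesis by blast
  qed
qed

text \<open>By \<open>nd\<close> the functionals given by a basis of \<open>L\<close> have only 0 as
  common zero in \<open>N\<close>, so \<open>span_functionals\<close> writes \<open>f\<close> as a
  combination of them; \<open>P\<close> extends functionals from \<open>N\<close> to the whole type.
  With \<open>L = N\<close> this inverts a symplectic form; with \<open>\<ll>\<close> and
  \<open>\<nn>\<close> it represents functionals on \<open>\<nn>\<close> by elements of
  \<open>\<ll>\<close>.\<close>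

lemma represent_functional:
  fixes \<Omega> :: "'v::real_normed_vector \<Rightarrow> 'v \<Rightarrow> real"
  assumes fd: "fin_dim TYPE('v)" and L: "subspace L" and P: "linear P" "\<And>x. P x \<in> N" "\<And>x. x \<in> N \<Longrightarrow> P x = x"
    and \<Omega>: "bilinear \<Omega>"
    and nd: "\<And>y. y \<in> N \<Longrightarrow> (\<And>x. x \<in> L \<Longrightarrow> \<Omega> x y = 0) \<Longrightarrow> y = 0"
    and f: "linear f"
  shows "\<exists>x\<in>L. \<forall>y\<in>N. \<Omega> x y = f y"
proof -
  obtain S :: "'v set" where S: "finite S" "span S = UNIV" using fd unfolding fin_dim_def by blast
  obtain B where B: "B \<subseteq> L" "independent B" "L \<subseteq> span B" using maximal_independent_subset[of L] by blast
  have fB: "finite B" using independent_span_bound[OF S(1) B(2)] S(2) by auto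
  have lO: "linear (\<Omega> x)" "linear (\<lambda>x. \<Omega> x y)" for x y using \<Omega> by (auto simp: bilinear_def)
  have "\<exists>c. \<forall>x. f (P x) = (\<Sum>b\<in>B. c b * \<Omega> b (P x))"
  proof (rule span_functionals[OF fB])
    show "linear (\<lambda>x. f (P x))" using linear_compose[OF P(1) f] by (simp add: o_def)
    show "linear (\<lambda>x. \<Omega> i (P x))" for i using linear_compose[OF P(1) lO(1)[of i]] by (simp add: o_def)
    fix x assume *: "\<And>i. i \<in> B \<Longrightarrow> \<Omega> i (P x) = 0"
    have "\<Omega> y (P x) = 0" if "y \<in> L" for y
    proof -
      have "y \<in> span B" using that B by blast
      then show ?thesis
        by (induction rule: span_induct_alt)
          (simp_all add: * linear_0[OF lO(2)] linear_add[OF lO(2)] linear_scale[OF lO(2)])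
    qed
    then have "P x = 0" using nd P(2) by blast
    then show "f (P x) = 0" using f by (simp add: linear_0)
  qed
  then obtain c where c: "\<And>x. f (P x) = (\<Sum>b\<in>B. c b * \<Omega> b (P x))" by blast
  have "\<Omega> (\<Sum>b\<in>B. c b *\<^sub>R b) y = f y" if "y \<in> N" for y
  proof -
    have "\<Omega> (\<Sum>b\<in>B. c b *\<^sub>R b) y = (\<Sum>b\<in>B. c b * \<Omega> b y)"
      by (simp only: linear_sum[OF lO(2)[of y]] linear_scale[OF lO(2)[of y]] real_scaleR_def)
    also have "\<dots> = f y" using c[of y] P(3)[OF that] by simp
    finally show ?thesis .
  qed
  moreover have "(\<Sum>b\<in>B. c b *\<^sub>R b) \<in> L" using B L by (intro subspace_sum subspace_scale) auto
  ultimately show ?thesis by blast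
qed

section \<open>Strict differentiability\<close>

text \<open>Both points vary, so the remainder is Lipschitz with an arbitrarily small constant near
  \<open>x\<close>. That is the input of the contraction argument for local inverses, which thus
  needs a derivative at one point only.\<close>

definition strict_deriv ::
  "('a::real_normed_vector \<Rightarrow> 'b::real_normed_vector) \<Rightarrow> ('a \<Rightarrow> 'b) \<Rightarrow> 'a \<Rightarrow> 'a set \<Rightarrow> bool" where
  "strict_deriv f D x S \<longleftrightarrow> bounded_linear D \<and>
     (\<forall>e>0. \<exists>d>0. \<forall>y\<in>S \<inter> ball x d. \<forall>z\<in>S \<inter> ball x d. norm (f y - f z - D (y - z)) \<le> e * norm (y - z))"

lemma strict_derivD:
  assumes "strict_deriv f D x S" "e > 0"
  obtains d where "d > 0" "\<And>y z. y \<in> S \<Longrightarrow> z \<in> S \<Longrightarrow> dist x y < d \<Longrightarrow> dist x z < d \<Longrightarrow>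
    norm (f y - f z - D (y - z)) \<le> e * norm (y - z)"
proof -
  from assms obtain d where d: "d > 0"
    "\<forall>y\<in>S \<inter> ball x d. \<forall>z\<in>S \<inter> ball x d. norm (f y - f z - D (y - z)) \<le> e * norm (y - z)"
    unfolding strict_deriv_def by blast
  show ?thesis by (rule that[OF d(1)]) (use d(2) in auto)
qed

lemma strict_derivI:
  assumes "bounded_linear D"
    and "\<And>e. e > 0 \<Longrightarrow> \<exists>d>0. \<forall>y\<in>S. \<forall>z\<in>S. dist x y < d \<longrightarrow> dist x z < d \<longrightarrow>
      norm (f y - f z - D (y - z)) \<le> e * norm (y - z)"
  shows "strict_deriv f D x S"
  unfolding strict_deriv_def using assms by (metis Int_iff mem_ball)

lemma strict_deriv_linear: "strict_deriv f D x S \<Longrightarrow> bounded_linear D"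
  by (simp add: strict_deriv_def)

lemma strict_deriv_bounded_linear: "bounded_linear D \<Longrightarrow> strict_deriv D D x S"
  by (rule strict_derivI)
    (auto simp: linear_simps bounded_linear.linear intro!: exI[of _ 1])

lemma strict_deriv_const: "strict_deriv (\<lambda>_. c) (\<lambda>_. 0) x S"
  by (rule strict_derivI) (auto intro!: exI[of _ 1])

lemma strict_deriv_transform:
  assumes "strict_deriv f D x S" "r > 0"
    and "\<And>y. y \<in> T \<Longrightarrow> dist x y < r \<Longrightarrow> y \<in> S \<and> g y = f y"
  shows "strict_deriv g D x T"
proof (rule strict_derivI)
  fix e :: real assume "e > 0"
  then obtain d where d: "d > 0" "\<And>y z. y \<in> S \<Longrightarrow> z \<in> S \<Longrightarrow> dist x y < d \<Longrightarrow> dist x z < d \<Longrightarrow>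
    norm (f y - f z - D (y - z)) \<le> e * norm (y - z)" using strict_derivD[OF assms(1)] by blast
  show "\<exists>d>0. \<forall>y\<in>T. \<forall>z\<in>T. dist x y < d \<longrightarrow> dist x z < d \<longrightarrow>
      norm (g y - g z - D (y - z)) \<le> e * norm (y - z)"
  proof (intro exI[of _ "min d r"] conjI ballI impI)
    show "0 < min d r" using d assms by simp
    fix y z assume "y \<in> T" "z \<in> T" "dist x y < min d r" "dist x z < min d r"
    then show "norm (g y - g z - D (y - z)) \<le> e * norm (y - z)"
      using d(2)[of y z] assms(3)[of y] assms(3)[of z] by simp
  qed
qed (use assms strict_deriv_linear in blast)

lemma strict_deriv_lipschitz:
  assumes "strict_deriv f D x S"
  obtains K d where "K > 0" "d > 0"
    "\<And>y z. y \<in> S \<Longrightarrow> z \<in> S \<Longrightarrow> dist x y < d \<Longrightarrow> dist x z < d \<Longrightarrow> norm (f y - f z) \<le> K * norm (y - z)"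
proof -
  obtain d where d: "d > 0" "\<And>y z. y \<in> S \<Longrightarrow> z \<in> S \<Longrightarrow> dist x y < d \<Longrightarrow> dist x z < d \<Longrightarrow>
    norm (f y - f z - D (y - z)) \<le> 1 * norm (y - z)" using strict_derivD[OF assms, of 1] by auto
  obtain K where K: "K > 0" "\<And>x. norm (D x) \<le> norm x * K"
    using bounded_linear.pos_bounded[OF strict_deriv_linear[OF assms]] by blast
  show ?thesis
  proof (rule that[of "K + 1" d])
    fix y z assume "y \<in> S" "z \<in> S" "dist x y < d" "dist x z < d"
    then have "norm (f y - f z - D (y - z)) \<le> norm (y - z)" using d(2) by auto
    moreover have "norm (f y - f z) \<le> norm (f y - f z - D (y - z)) + norm (D (y - z))"
      by (metis norm_triangle_sub add.commute)
    ultimately show "norm (f y - f z) \<le> (K + 1) * norm (y - z)"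
      using K(2)[of "y - z"] by (simp add: algebra_simps)
  qed (use K d in auto)
qed

lemma strict_deriv_has_derivative:
  assumes "strict_deriv f D x S" "x \<in> S"
  shows "(f has_derivative D) (at x within S)"
  unfolding has_derivative_within_alt
proof (intro conjI allI impI)
  show "bounded_linear D" using assms strict_deriv_linear by blast
  fix e :: real assume "e > 0"
  then obtain d where d: "d > 0" "\<And>y z. y \<in> S \<Longrightarrow> z \<in> S \<Longrightarrow> dist x y < d \<Longrightarrow> dist x z < d \<Longrightarrow>
    norm (f y - f z - D (y - z)) \<le> e * norm (y - z)" using strict_derivD[OF assms(1)] by blast
  show "\<exists>d>0. \<forall>y\<in>S. norm (y - x) < d \<longrightarrow> norm (f y - f x - D (y - x)) \<le> e * norm (y - x)"
    using d assms(2) by (intro exI[of _ d]) (auto simp: dist_norm norm_minus_commute)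
qed

lemma strict_deriv_compose:
  assumes f: "strict_deriv f D x S" and g: "strict_deriv g E (f x) T" and x: "x \<in> S"
    and r: "r > 0" "\<And>y. y \<in> S \<Longrightarrow> dist x y < r \<Longrightarrow> f y \<in> T"
  shows "strict_deriv (\<lambda>x. g (f x)) (\<lambda>v. E (D v)) x S"
proof (rule strict_derivI)
  have bE: "bounded_linear E" using g strict_deriv_linear by blast
  show "bounded_linear (\<lambda>v. E (D v))"
    by (rule bounded_linear_compose[OF bE strict_deriv_linear[OF f]])
  obtain KE where KE: "KE > 0" "\<And>x. norm (E x) \<le> norm x * KE"
    using bounded_linear.pos_bounded[OF bE] by blast
  obtain K d1 where K: "K > 0" "d1 > 0"
    "\<And>y z. y \<in> S \<Longrightarrow> z \<in> S \<Longrightarrow> dist x y < d1 \<Longrightarrow> dist x z < d1 \<Longrightarrow> norm (f y - f z) \<le> K * norm (y - z)"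
    using strict_deriv_lipschitz[OF f] by blast
  fix e :: real assume e: "e > 0"
  obtain d2 where d2: "d2 > 0" "\<And>y z. y \<in> T \<Longrightarrow> z \<in> T \<Longrightarrow> dist (f x) y < d2 \<Longrightarrow> dist (f x) z < d2 \<Longrightarrow>
    norm (g y - g z - E (y - z)) \<le> e / (2 * K) * norm (y - z)"
    using strict_derivD[OF g, of "e / (2 * K)"] e K by auto
  obtain d3 where d3: "d3 > 0" "\<And>y z. y \<in> S \<Longrightarrow> z \<in> S \<Longrightarrow> dist x y < d3 \<Longrightarrow> dist x z < d3 \<Longrightarrow>
    norm (f y - f z - D (y - z)) \<le> e / (2 * KE) * norm (y - z)"
    using strict_derivD[OF f, of "e / (2 * KE)"] e KE by auto
  show "\<exists>d>0. \<forall>y\<in>S. \<forall>z\<in>S. dist x y < d \<longrightarrow> dist x z < d \<longrightarrow>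
      norm (g (f y) - g (f z) - E (D (y - z))) \<le> e * norm (y - z)"
  proof (intro exI[of _ "min (min r (d2 / K)) (min d1 d3)"] conjI ballI impI)
    show "0 < min (min r (d2 / K)) (min d1 d3)" using r d2 d3 K by simp
    fix y z assume yz: "y \<in> S" "z \<in> S" "dist x y < min (min r (d2 / K)) (min d1 d3)"
      "dist x z < min (min r (d2 / K)) (min d1 d3)"
    have near: "dist (f x) (f w) < d2" if "w \<in> S" "dist x w < min (min r (d2 / K)) (min d1 d3)" for w
    proof -
      have "norm (f x - f w) \<le> K * norm (x - w)" using K(3)[of x w] K(2) that x by simp
      also have "\<dots> < d2" using that K(1) by (simp add: dist_norm pos_less_divide_eq mult.commute)
      finally show ?thesis by (simp add: dist_norm)
    qed
    have "norm (g (f y) - g (f z) - E (f y - f z)) \<le> e / (2 * K) * norm (f y - f z)"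
      using d2(2)[of "f y" "f z"] r(2) near yz by auto
    also have "\<dots> \<le> e / (2 * K) * (K * norm (y - z))"
      using K(3)[of y z] yz e K(1) by (intro mult_left_mono) auto
    finally have 1: "norm (g (f y) - g (f z) - E (f y - f z)) \<le> e / 2 * norm (y - z)"
      using K(1) by simp
    have "norm (E (f y - f z - D (y - z))) \<le> norm (f y - f z - D (y - z)) * KE" by (rule KE)
    also have "\<dots> \<le> (e / (2 * KE) * norm (y - z)) * KE"
      using d3(2)[of y z] yz KE(1) by (intro mult_right_mono) auto
    finally have 2: "norm (E (f y - f z) - E (D (y - z))) \<le> e / 2 * norm (y - z)"
      using KE(1) linear_diff[OF bounded_linear.linear[OF bE]] by simp
    show "norm (g (f y) - g (f z) - E (D (y - z))) \<le> e * norm (y - z)"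
      using norm_triangle_ineq[of "g (f y) - g (f z) - E (f y - f z)" "E (f y - f z) - E (D (y - z))"] 1 2
      by simp
  qed
qed

lemma strict_deriv_Pair:
  assumes f: "strict_deriv f D x S" and g: "strict_deriv g E x S"
  shows "strict_deriv (\<lambda>x. (f x, g x)) (\<lambda>v. (D v, E v)) x S"
proof (rule strict_derivI)
  show "bounded_linear (\<lambda>v. (D v, E v))"
    by (intro bounded_linear_Pair strict_deriv_linear[OF f] strict_deriv_linear[OF g])
  fix e :: real assume e: "e > 0"
  obtain d2 where d2: "d2 > 0" "\<And>y z. y \<in> S \<Longrightarrow> z \<in> S \<Longrightarrow> dist x y < d2 \<Longrightarrow> dist x z < d2 \<Longrightarrow>
    norm (f y - f z - D (y - z)) \<le> e / 2 * norm (y - z)"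
    using strict_derivD[OF f, of "e / 2"] e by auto
  obtain d3 where d3: "d3 > 0" "\<And>y z. y \<in> S \<Longrightarrow> z \<in> S \<Longrightarrow> dist x y < d3 \<Longrightarrow> dist x z < d3 \<Longrightarrow>
    norm (g y - g z - E (y - z)) \<le> e / 2 * norm (y - z)"
    using strict_derivD[OF g, of "e / 2"] e by auto
  show "\<exists>d>0. \<forall>y\<in>S. \<forall>z\<in>S. dist x y < d \<longrightarrow> dist x z < d \<longrightarrow>
      norm ((f y, g y) - (f z, g z) - (D (y - z), E (y - z))) \<le> e * norm (y - z)"
  proof (intro exI[of _ "min d2 d3"] conjI ballI impI)
    fix y z assume yz: "y \<in> S" "z \<in> S" "dist x y < min d2 d3" "dist x z < min d2 d3"
    have "norm (f y - f z - D (y - z)) + norm (g y - g z - E (y - z)) \<le> e * norm (y - z)"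
      using d2(2)[of y z] d3(2)[of y z] yz by (simp add: algebra_simps)
    then show "norm ((f y, g y) - (f z, g z) - (D (y - z), E (y - z))) \<le> e * norm (y - z)"
      using norm_Pair_le[of "f y - f z - D (y - z)" "g y - g z - E (y - z)"] by simp
  qed (use d2 d3 in simp)
qed

lemma strict_deriv_bilinear:
  assumes "bounded_bilinear p"
  shows "strict_deriv (\<lambda>z. p (fst z) (snd z)) (\<lambda>h. p x0 (snd h) + p (fst h) y0) (x0, y0) S"
proof (rule strict_derivI)
  interpret bounded_bilinear p by fact
  show "bounded_linear (\<lambda>h. p x0 (snd h) + p (fst h) y0)"
    by (intro bounded_linear_add bounded_linear_compose[OF bounded_linear_right bounded_linear_snd]
      bounded_linear_compose[OF bounded_linear_left bounded_linear_fst])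
  obtain K where K: "K > 0" "\<And>a b. norm (p a b) \<le> norm a * norm b * K" using pos_bounded by blast
  fix e :: real assume e: "e > 0"
  show "\<exists>d>0. \<forall>y\<in>S. \<forall>z\<in>S. dist (x0, y0) y < d \<longrightarrow> dist (x0, y0) z < d \<longrightarrow>
      norm (p (fst y) (snd y) - p (fst z) (snd z) - (p x0 (snd (y - z)) + p (fst (y - z)) y0))
        \<le> e * norm (y - z)"
  proof (intro exI[of _ "e / (2 * K)"] conjI ballI impI)
    show "0 < e / (2 * K)" using e K by simp
    fix y z assume "y \<in> S" "z \<in> S"
      and yz: "dist (x0, y0) y < e / (2 * K)" "dist (x0, y0) z < e / (2 * K)"
    obtain y1 y2 z1 z2 where [simp]: "y = (y1, y2)" "z = (z1, z2)" by force
    have 1: "norm (y1 - x0) \<le> e / (2 * K)" 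
      using yz(1) dist_fst_le[of "(x0, y0)" y] by (simp add: dist_norm norm_minus_commute)
    have 2: "norm (z2 - y0) \<le> e / (2 * K)" 
      using yz(2) dist_snd_le[of "(x0, y0)" z] by (simp add: dist_norm norm_minus_commute)
    have 3: "norm (y1 - z1) \<le> norm (y - z)" "norm (y2 - z2) \<le> norm (y - z)"
      using norm_fst_le[of "y1 - z1" "y2 - z2"] norm_snd_le[of "y2 - z2" "y1 - z1"] by auto
    \<comment> \<open>Each of the two remaining products has one factor that is a distance to the
      base point, hence small, and one bounded by \<open>norm (y - z)\<close>.\<close>
    have eq: "p y1 y2 - p z1 z2 - (p x0 (y2 - z2) + p (y1 - z1) y0) = p (y1 - x0) (y2 - z2) + p (y1 - z1) (z2 - y0)"
      by (simp add: diff_left diff_right)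
    have "norm (p (y1 - x0) (y2 - z2)) \<le> e / (2 * K) * norm (y - z) * K"
      by (rule order_trans[OF K(2)]) (intro mult_right_mono mult_mono; use 1 3 e K in simp)
    moreover have "norm (p (y1 - z1) (z2 - y0)) \<le> norm (y - z) * (e / (2 * K)) * K"
      by (rule order_trans[OF K(2)]) (intro mult_right_mono mult_mono; use 2 3 e K in simp)
    ultimately have "norm (p (y1 - x0) (y2 - z2) + p (y1 - z1) (z2 - y0)) \<le> e * norm (y - z)"
      using K(1) norm_triangle_ineq[of "p (y1 - x0) (y2 - z2)" "p (y1 - z1) (z2 - y0)"]
      by (simp add: mult.commute)
    with eq show "norm (p (fst y) (snd y) - p (fst z) (snd z) - (p x0 (snd (y - z)) + p (fst (y - z)) y0))
        \<le> e * norm (y - z)" by simp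
  qed
qed

lemma strict_deriv_bilinear_comp:
  assumes "bounded_bilinear p" "strict_deriv f D x S" "strict_deriv g E x S" "x \<in> S"
  shows "strict_deriv (\<lambda>x. p (f x) (g x)) (\<lambda>h. p (f x) (E h) + p (D h) (g x)) x S"
  using strict_deriv_compose[OF strict_deriv_Pair[OF assms(2,3)] strict_deriv_bilinear[OF assms(1)] assms(4) zero_less_one, of UNIV]
  by simp

lemma strict_deriv_add:
  assumes "strict_deriv f D x S" "strict_deriv g E x S" "x \<in> S"
  shows "strict_deriv (\<lambda>x. f x + g x) (\<lambda>h. D h + E h) x S"
proof -
  have "bounded_linear (\<lambda>z. fst z + snd z)"
    by (intro bounded_linear_add bounded_linear_fst bounded_linear_snd)
  from strict_deriv_compose[OF strict_deriv_Pair[OF assms(1,2)] strict_deriv_bounded_linear[OF this] assms(3) zero_less_one, of UNIV]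
  show ?thesis by simp
qed

lemma strict_deriv_linear_comp:
  assumes "bounded_linear L" "strict_deriv f D x S" "x \<in> S"
  shows "strict_deriv (\<lambda>x. L (f x)) (\<lambda>h. L (D h)) x S"
  using strict_deriv_compose[OF assms(2) strict_deriv_bounded_linear[OF assms(1)] assms(3) zero_less_one, of UNIV]
  by simp

lemma strict_deriv_diff:
  assumes "strict_deriv f D x S" "strict_deriv g E x S" "x \<in> S"
  shows "strict_deriv (\<lambda>x. f x - g x) (\<lambda>h. D h - E h) x S"
  using strict_deriv_add[OF assms(1) strict_deriv_linear_comp[OF bounded_linear_minus[OF bounded_linear_ident] assms(2,3)] assms(3)]
  by simp

lemma strict_deriv_sum:
  assumes "finite I" "\<And>i. i \<in> I \<Longrightarrow> strict_deriv (f i) (D i) x S" "x \<in> S"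
  shows "strict_deriv (\<lambda>x. \<Sum>i\<in>I. f i x) (\<lambda>h. \<Sum>i\<in>I. D i h) x S"
  using assms(1,2)
proof (induction I)
  case empty
  then show ?case by (simp add: strict_deriv_const)
next
  case (insert i I)
  then show ?case using strict_deriv_add[of "f i" "D i" x S] assms(3) by simp
qed

lemma strict_deriv_blinfun:
  fixes F :: "'x::real_normed_vector \<Rightarrow> ('v::real_normed_vector) dual"
  assumes fd: "fin_dim TYPE('v)" and D: "bounded_linear D"
    and pw: "\<And>\<eta>. strict_deriv (\<lambda>x. blinfun_apply (F x) \<eta>) (\<lambda>h. blinfun_apply (D h) \<eta>) x S"
  shows "strict_deriv F D x S"
proof (rule strict_derivI[OF D])
  obtain B :: "'v set" and K where B: "finite B" "K > 0"
    "\<And>\<beta> :: 'v dual. norm \<beta> \<le> K * (\<Sum>b\<in>B. \<bar>blinfun_apply \<beta> b\<bar>)" using fin_dim_dual_norm_le[OF fd] by blast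
  fix e :: real assume e: "e > 0"
  \<comment> \<open>The summand 1 keeps the denominator positive when \<open>B\<close> is
    empty.\<close>
  define e' where "e' = e / (K * (card B + 1))"
  have e': "e' > 0" using e B by (simp add: e'_def)
  have "\<forall>b. \<exists>d>0. \<forall>y\<in>S. \<forall>z\<in>S. dist x y < d \<longrightarrow> dist x z < d \<longrightarrow>
      norm (blinfun_apply (F y) b - blinfun_apply (F z) b - blinfun_apply (D (y - z)) b) \<le> e' * norm (y - z)"
    using strict_derivD[OF pw e'] by metis
  then obtain d where d: "\<And>b. d b > 0" "\<And>b y z. y \<in> S \<Longrightarrow> z \<in> S \<Longrightarrow> dist x y < d b \<Longrightarrow> dist x z < d b \<Longrightarrow>
      norm (blinfun_apply (F y) b - blinfun_apply (F z) b - blinfun_apply (D (y - z)) b) \<le> e' * norm (y - z)" by metis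
  define d0 where "d0 = Min (insert 1 (d ` B))"
  have d0: "d0 > 0" "\<And>b. b \<in> B \<Longrightarrow> d0 \<le> d b" using B(1) d(1) by (auto simp: d0_def)
  show "\<exists>d>0. \<forall>y\<in>S. \<forall>z\<in>S. dist x y < d \<longrightarrow> dist x z < d \<longrightarrow>
      norm (F y - F z - D (y - z)) \<le> e * norm (y - z)"
  proof (intro exI[of _ d0] conjI ballI impI)
    fix y z assume yz: "y \<in> S" "z \<in> S" "dist x y < d0" "dist x z < d0"
    have "norm (F y - F z - D (y - z)) \<le> K * (\<Sum>b\<in>B. \<bar>(F y - F z - D (y - z)) b\<bar>)" by (rule B(3))
    also have "(\<Sum>b\<in>B. \<bar>(F y - F z - D (y - z)) b\<bar>) \<le> (\<Sum>b\<in>B. e' * norm (y - z))"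
    proof (rule sum_mono)
      fix b assume "b \<in> B"
      then show "\<bar>(F y - F z - D (y - z)) b\<bar> \<le> e' * norm (y - z)"
        using d(2)[of y z b] d0(2)[of b] yz by (simp add: blinfun.diff_left)
    qed
    also have "K * (\<Sum>b\<in>B. e' * norm (y - z)) = K * card B * e' * norm (y - z)" by simp
    also have "\<dots> \<le> e * norm (y - z)"
    proof (rule mult_right_mono)
      have "K * card B * e' \<le> K * (card B + 1) * e'" using B(2) e' by (simp add: mult_left_mono mult_right_mono)
      also have "\<dots> = e" using B(2) by (simp add: e'_def)
      finally show "K * card B * e' \<le> e" .
    qed simp
    finally show "norm (F y - F z - D (y - z)) \<le> e * norm (y - z)" using B(2) by simp
  qed (rule d0)
qed

section \<open>Smooth maps, the inverse function theorem, and symmetry of second derivatives\<close>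

text \<open>\<open>Ck_on\<close> gives continuity of each directional derivative separately;
  expansion in a basis turns this into closeness of \<open>?D y\<close> to \<open>?D x\<close> in
  operator norm. The mean value inequality for \<open>f - ?D x\<close> on a ball then compares two
  arbitrary points near \<open>x\<close>.\<close>

lemma C1_strict_deriv:
  fixes f :: "'a::real_normed_vector \<Rightarrow> 'b::real_normed_vector"
  assumes fd: "fin_dim TYPE('a)" and U: "open U" "x \<in> U"
    and dif: "\<And>y. y \<in> U \<Longrightarrow> f differentiable (at y)"
    and cont: "\<And>v. continuous_on U (\<lambda>y. frechet_derivative f (at y) v)"
  shows "strict_deriv f (frechet_derivative f (at x)) x U"
proof (rule strict_derivI)
  let ?D = "\<lambda>y. frechet_derivative f (at y)"
  have hd: "(f has_derivative ?D y) (at y)" if "y \<in> U" for y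
    using dif[OF that] frechet_derivative_works by blast
  then have bl: "bounded_linear (?D y)" if "y \<in> U" for y using that has_derivative_bounded_linear by blast
  show "bounded_linear (?D x)" using bl U by blast
  obtain B :: "'a set" and c :: "'a \<Rightarrow> 'a \<Rightarrow> real" where B: "finite B" "\<And>b. bounded_linear (c b)"
    "\<And>x. x = (\<Sum>b\<in>B. c b x *\<^sub>R b)" using fin_dim_basis[OF fd] by blast
  define K where "K = 1 + (\<Sum>b\<in>B. onorm (c b))"
  have on: "onorm (c b) \<ge> 0" for b using B(2) onorm_pos_le by blast
  have K: "K > 0" using on by (simp add: K_def add_pos_nonneg sum_nonneg)
  fix e :: real assume e: "e > 0"
  have "\<forall>b. \<exists>d>0. \<forall>y\<in>U. dist y x < d \<longrightarrow> dist (?D y b) (?D x b) < e / K"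
    using cont U(2) e K unfolding continuous_on_iff by (metis divide_pos_pos)
  then obtain d where d: "\<And>b. d b > 0" "\<And>b y. y \<in> U \<Longrightarrow> dist y x < d b \<Longrightarrow> dist (?D y b) (?D x b) < e / K"
    by metis
  obtain r where r: "r > 0" "ball x r \<subseteq> U" using U open_contains_ball by blast
  define d0 where "d0 = Min (insert r (d ` B))"
  have d0: "d0 > 0" "\<And>b. b \<in> B \<Longrightarrow> d0 \<le> d b" "d0 \<le> r" using B(1) d(1) r by (auto simp: d0_def)
  have est: "norm (?D y v - ?D x v) \<le> e * norm v" if y: "y \<in> ball x d0" for y v
  proof -
    have yU: "y \<in> U" using y r d0 by auto
    have "?D y v - ?D x v = (\<Sum>b\<in>B. c b v *\<^sub>R (?D y b - ?D x b))"
    proof -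
      have 1: "L v = (\<Sum>b\<in>B. c b v *\<^sub>R L b)" if "bounded_linear L" for L :: "'a \<Rightarrow> 'b"
      proof -
        have "L v = L (\<Sum>b\<in>B. c b v *\<^sub>R b)" using B(3) by metis
        also have "\<dots> = (\<Sum>b\<in>B. c b v *\<^sub>R L b)"
          using bounded_linear.linear[OF that] by (simp add: linear_sum linear_scale)
        finally show ?thesis .
      qed
      show ?thesis
        by (subst 1[OF bl[OF yU]], subst 1[OF bl[OF U(2)]]) (simp add: sum_subtractf scaleR_diff_right)
    qed
    then have "norm (?D y v - ?D x v) \<le> (\<Sum>b\<in>B. norm (c b v *\<^sub>R (?D y b - ?D x b)))" by (metis norm_sum)
    also have "\<dots> \<le> (\<Sum>b\<in>B. (onorm (c b) * norm v) * (e / K))"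
    proof (rule sum_mono)
      fix b assume b: "b \<in> B"
      have "norm (?D y b - ?D x b) \<le> e / K"
        using d(2)[OF yU, of b] d0(2)[OF b] y by (simp add: dist_norm norm_minus_commute)
      moreover have "\<bar>c b v\<bar> \<le> onorm (c b) * norm v" using onorm[OF B(2), of b v] by simp
      ultimately show "norm (c b v *\<^sub>R (?D y b - ?D x b)) \<le> (onorm (c b) * norm v) * (e / K)"
        using e K on mult_mono[of "\<bar>c b v\<bar>" "onorm (c b) * norm v" "norm (?D y b - ?D x b)" "e / K"]
        by simp
    qed
    also have "\<dots> = (\<Sum>b\<in>B. onorm (c b)) * (norm v * (e / K))"
      by (simp only: sum_distrib_right mult.assoc)
    also have "\<dots> \<le> K * (norm v * (e / K))"
      using e K by (intro mult_right_mono) (auto simp: K_def)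
    also have "\<dots> = e * norm v" using K by simp
    finally show ?thesis .
  qed
  show "\<exists>d>0. \<forall>y\<in>U. \<forall>z\<in>U. dist x y < d \<longrightarrow> dist x z < d \<longrightarrow>
      norm (f y - f z - ?D x (y - z)) \<le> e * norm (y - z)"
  proof (intro exI[of _ d0] conjI ballI impI)
    fix y z assume yz: "y \<in> U" "z \<in> U" "dist x y < d0" "dist x z < d0"
    have "norm ((f y - ?D x y) - (f z - ?D x z)) \<le> e * norm (y - z)"
    proof (rule differentiable_bound[of "ball x d0"])
      fix w assume w: "w \<in> ball x d0"
      then have "w \<in> U" using r d0 by auto
      then show "((\<lambda>y. f y - ?D x y) has_derivative (\<lambda>v. ?D w v - ?D x v)) (at w within ball x d0)"
        by (intro has_derivative_diff has_derivative_at_withinI[OF hd]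
          bounded_linear_imp_has_derivative bl U)
      show "onorm (\<lambda>v. ?D w v - ?D x v) \<le> e"
        using est[OF w] e by (intro onorm_bound) auto
    qed (use yz in auto)
    moreover have "?D x (y - z) = ?D x y - ?D x z"
      using bl[OF U(2)] by (simp add: linear_diff bounded_linear.linear)
    moreover have "f y - f z - ?D x (y - z) = (f y - ?D x y) - (f z - ?D x z)"
      unfolding \<open>?D x (y - z) = ?D x y - ?D x z\<close> by simp
    ultimately show "norm (f y - f z - ?D x (y - z)) \<le> e * norm (y - z)" by metis
  qed (rule d0)
qed

lemma smooth_on_derivative: "smooth_on U f \<Longrightarrow> smooth_on U (\<lambda>x. frechet_derivative f (at x) v)"
  unfolding smooth_on_def by (metis Ck_on.simps(2))

lemma smooth_on_differentiable: "smooth_on U f \<Longrightarrow> x \<in> U \<Longrightarrow> f differentiable (at x)"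
  unfolding smooth_on_def by (metis Ck_on.simps(2))

lemma smooth_on_continuous: "smooth_on U f \<Longrightarrow> continuous_on U f"
  unfolding smooth_on_def by (metis Ck_on.simps(1))

lemma smooth_on_strict_deriv:
  fixes f :: "'a::real_normed_vector \<Rightarrow> 'b::real_normed_vector"
  assumes "fin_dim TYPE('a)" "open U" "x \<in> U" "smooth_on U f"
  shows "strict_deriv f (frechet_derivative f (at x)) x U"
  using assms by (intro C1_strict_deriv smooth_on_differentiable smooth_on_continuous smooth_on_derivative)

text \<open>Expanding the vector in a basis makes the tangent map a finite sum of products of
  coordinates with directional derivatives, each of them strictly differentiable.\<close>

lemma smooth_on_derivative_strict_deriv:
  fixes f :: "'a::real_normed_vector \<Rightarrow> 'b::real_normed_vector"
  assumes fd: "fin_dim TYPE('a)" and U: "open U" "x \<in> U" and f: "smooth_on U f"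
  shows "\<exists>D. strict_deriv (\<lambda>z. frechet_derivative f (at (fst z)) (snd z)) D (x, w) (U \<times> UNIV)"
proof -
  let ?D = "\<lambda>y. frechet_derivative f (at y)"
  obtain B :: "'a set" and c :: "'a \<Rightarrow> 'a \<Rightarrow> real" where B: "finite B" "\<And>b. bounded_linear (c b)"
    "\<And>x. x = (\<Sum>b\<in>B. c b x *\<^sub>R b)" using fin_dim_basis[OF fd] by blast
  have mem: "(x, w) \<in> U \<times> UNIV" using U by simp
  have "strict_deriv (\<lambda>z. \<Sum>b\<in>B. c b (snd z) *\<^sub>R ?D (fst z) b)
     (\<lambda>h. \<Sum>b\<in>B. c b (snd (x, w)) *\<^sub>R frechet_derivative (\<lambda>y. ?D y b) (at x) (fst h) + c b (snd h) *\<^sub>R ?D (fst (x, w)) b) (x, w) (U \<times> UNIV)"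
  proof (intro strict_deriv_sum B(1) mem strict_deriv_bilinear_comp[OF bounded_bilinear_scaleR])
    fix b
    show "strict_deriv (\<lambda>z. c b (snd z)) (\<lambda>h. c b (snd h)) (x, w) (U \<times> UNIV)"
      by (intro strict_deriv_bounded_linear bounded_linear_compose[OF B(2) bounded_linear_snd])
    show "strict_deriv (\<lambda>z. ?D (fst z) b) (\<lambda>h. frechet_derivative (\<lambda>y. ?D y b) (at x) (fst h)) (x, w) (U \<times> UNIV)"
    proof (rule strict_deriv_compose[where f = fst and T = U and r = 1])
      show "strict_deriv (\<lambda>y. ?D y b) (frechet_derivative (\<lambda>y. ?D y b) (at x)) (fst (x, w)) U"
        using smooth_on_strict_deriv[OF fd U smooth_on_derivative[OF f]] by simp
    qed (use mem in \<open>auto intro: strict_deriv_bounded_linear bounded_linear_fst\<close>)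
  qed
  moreover have "?D (fst z) (snd z) = (\<Sum>b\<in>B. c b (snd z) *\<^sub>R ?D (fst z) b)" if "fst z \<in> U" for z
  proof -
    have l: "linear (?D (fst z))"
      using smooth_on_differentiable[OF f that] by (simp add: linear_frechet_derivative)
    have "?D (fst z) (snd z) = ?D (fst z) (\<Sum>b\<in>B. c b (snd z) *\<^sub>R b)" using B(3) by metis
    then show ?thesis using l by (simp add: linear_sum linear_scale)
  qed
  ultimately have "strict_deriv (\<lambda>z. ?D (fst z) (snd z))
     (\<lambda>h. \<Sum>b\<in>B. c b (snd (x, w)) *\<^sub>R frechet_derivative (\<lambda>y. ?D y b) (at x) (fst h) + c b (snd h) *\<^sub>R ?D (fst (x, w)) b) (x, w) (U \<times> UNIV)"
    by (elim strict_deriv_transform[OF _ zero_less_one]) auto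
  then show ?thesis by blast
qed

text \<open>A solution of \<open>f y = w\<close> is a fixed point of \<open>y - f y + w\<close>.
  Since the derivative of \<open>f\<close> is the identity, this map contracts with factor 1/2 near
  \<open>x0\<close>, and it preserves the closed ball of radius \<open>r\<close> when
  \<open>w\<close> is within \<open>r / 2\<close> of \<open>f x0\<close>. Later uses first normalise
  the derivative to the identity by a suitable parametrization.\<close>

lemma strict_inverse:
  fixes f :: "'q::real_normed_vector \<Rightarrow> 'q"
  assumes cpl: "complete (UNIV :: 'q set)" and f: "strict_deriv f (\<lambda>x. x) x0 S" and r0: "r0 > 0" "ball x0 r0 \<subseteq> S"
  obtains r1 where "r1 > 0" "r1 < r0"
    "\<And>y z. y \<in> cball x0 r1 \<Longrightarrow> z \<in> cball x0 r1 \<Longrightarrow> norm (y - z) \<le> 2 * norm (f y - f z)"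
    "\<And>r w. 0 < r \<Longrightarrow> r \<le> r1 \<Longrightarrow> w \<in> cball (f x0) (r / 2) \<Longrightarrow> \<exists>y\<in>cball x0 r. f y = w"
proof -
  obtain d where d: "d > 0" "\<And>y z. y \<in> S \<Longrightarrow> z \<in> S \<Longrightarrow> dist x0 y < d \<Longrightarrow> dist x0 z < d \<Longrightarrow>
    norm (f y - f z - (y - z)) \<le> 1/2 * norm (y - z)" using strict_derivD[OF f, of "1/2"] by auto
  \<comment> \<open>Halving puts the closed ball of radius \<open>r1\<close> inside the open balls
    of radius \<open>d\<close> and \<open>r0\<close>.\<close>
  define r1 where "r1 = min d r0 / 2"
  have r1: "r1 > 0" "r1 < r0" "r1 < d" using d(1) r0 by (auto simp: r1_def)
  have est: "norm (f y - f z - (y - z)) \<le> 1/2 * norm (y - z)" if "y \<in> cball x0 r1" "z \<in> cball x0 r1" for y z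
    using that r1 r0 by (intro d(2)) auto
  show ?thesis
  proof (rule that[OF r1(1,2)])
    fix y z assume "y \<in> cball x0 r1" "z \<in> cball x0 r1"
    from est[OF this] show "norm (y - z) \<le> 2 * norm (f y - f z)"
      using norm_triangle_ineq3[of "f y - f z" "y - z"] by linarith
  next
    fix r w assume r: "0 < r" "r \<le> r1" and w: "w \<in> cball (f x0) (r / 2)"
    have sub: "cball x0 r \<subseteq> cball x0 r1" using r by auto
    define T where "T y = y - f y + w" for y
    have Tc: "dist (T y) (T z) \<le> 1/2 * dist y z" if "y \<in> cball x0 r" "z \<in> cball x0 r" for y z
      
    proof -
      have "T y - T z = - (f y - f z - (y - z))" by (simp add: T_def)
      then have "norm (T y - T z) = norm (f y - f z - (y - z))" by (metis norm_minus_cancel)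
      moreover have "y \<in> cball x0 r1" "z \<in> cball x0 r1" using that sub by blast+
      ultimately show ?thesis using est[of y z] by (simp add: dist_norm)
    qed
    have "\<exists>!x\<in>cball x0 r. T x = x"
    proof (rule Banach_fix[where c = "1/2"])
      show "complete (cball x0 r)" using complete_closed_subset[OF closed_cball _ cpl] by blast
      show "T ` cball x0 r \<subseteq> cball x0 r"
      proof
        fix v assume "v \<in> T ` cball x0 r"
        then obtain y where y: "y \<in> cball x0 r" "v = T y" by blast
        have "dist x0 v \<le> dist x0 (T x0) + dist (T x0) (T y)" using y dist_triangle by blast
        also have "dist x0 (T x0) \<le> r / 2" using w by (simp add: T_def dist_norm norm_minus_commute)
        also have "dist (T x0) (T y) \<le> 1/2 * dist x0 y" using Tc[of x0 y] y r by simp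
        finally show "v \<in> cball x0 r" using y by simp
      qed
    qed (use r Tc in auto)
    then obtain y where "y \<in> cball x0 r" "T y = y" by blast
    then show "\<exists>y\<in>cball x0 r. f y = w" by (intro bexI[of _ y]) (auto simp: T_def)
  qed
qed

text \<open>The second difference of \<open>f\<close> over the parallelogram with sides
  \<open>t *\<^sub>R u\<close> and \<open>t *\<^sub>R v\<close> is symmetric in \<open>u\<close> and
  \<open>v\<close>; divided by \<open>t * t\<close> it tends to either mixed derivative, by
  \<open>key\<close> applied in both orders.\<close>

lemma symmetric_second_derivative:
  fixes f :: "'a::real_normed_vector \<Rightarrow> 'b::real_normed_vector"
  assumes fd: "fin_dim TYPE('a)" and U: "open U" "p \<in> U" and f: "smooth_on U f"
  shows "frechet_derivative (\<lambda>x. frechet_derivative f (at x) v) (at p) u =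
         frechet_derivative (\<lambda>x. frechet_derivative f (at x) u) (at p) v"
proof -
  let ?D = "\<lambda>v x. frechet_derivative f (at x) v"
  let ?DD = "\<lambda>u v. frechet_derivative (?D u) (at p) v"
  have key: "\<exists>d>0. \<forall>t. 0 < t \<and> t < d \<longrightarrow>
      norm (f (p + t *\<^sub>R u + t *\<^sub>R v) - f (p + t *\<^sub>R u) - f (p + t *\<^sub>R v) + f p - (t * t) *\<^sub>R ?DD u v) \<le> e * t * t"
    if e: "e > 0" for e u v
  proof -
    obtain r where r: "r > 0" "ball p r \<subseteq> U" using U open_contains_ball by blast
    define e1 where "e1 = e / (norm v + 1)"
    have e1: "e1 > 0" using e by (simp add: e1_def add_nonneg_pos)
    obtain d where d: "d > 0" "\<And>y z. y \<in> U \<Longrightarrow> z \<in> U \<Longrightarrow> dist p y < d \<Longrightarrow> dist p z < d \<Longrightarrow>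
      norm (?D u y - ?D u z - ?DD u (y - z)) \<le> e1 * norm (y - z)"
      using strict_derivD[OF smooth_on_strict_deriv[OF fd U smooth_on_derivative[OF f]] e1] by blast
    define d0 where "d0 = min d r / (norm u + norm v + 1)"
    have nuv: "norm u + norm v + 1 > 0" by (simp add: add_nonneg_pos)
    have d0: "d0 > 0" using d(1) r(1) nuv by (simp add: d0_def)
    have lin: "linear (?DD u)"
      using smooth_on_differentiable[OF smooth_on_derivative[OF f] U(2)] by (simp add: linear_frechet_derivative)
    show ?thesis
    proof (intro exI[of _ d0] conjI allI impI d0)
      fix t assume t: "0 < t \<and> t < d0"
      have near: "dist p (p + s *\<^sub>R u + s' *\<^sub>R v) < min d r" if "s \<in> {0..t}" "s' \<in> {0..t}" for s s'
      proof -
        have "norm (s *\<^sub>R u + s' *\<^sub>R v) \<le> s * norm u + s' * norm v"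
          using norm_triangle_ineq[of "s *\<^sub>R u" "s' *\<^sub>R v"] that by simp
        also have "\<dots> \<le> t * norm u + t * norm v" using that by (intro add_mono mult_right_mono) auto
        also have "\<dots> \<le> t * (norm u + norm v + 1)" using t by (simp add: algebra_simps)
        also have "\<dots> < min d r" using t nuv by (simp add: d0_def pos_less_divide_eq)
        finally show ?thesis by (simp add: dist_norm norm_minus_commute add.assoc add.commute)
      qed
      then have inU: "p + s *\<^sub>R u + s' *\<^sub>R v \<in> U" if "s \<in> {0..t}" "s' \<in> {0..t}" for s s'
        using that r(2) by (meson in_mono mem_ball min_less_iff_conj)
      have hd: "(f has_derivative frechet_derivative f (at x)) (at x)" if "x \<in> U" for x
        using smooth_on_differentiable[OF f that] frechet_derivative_works by blast
      have fl: "frechet_derivative f (at x) (h *\<^sub>R u) = h *\<^sub>R ?D u x" if "x \<in> U" for x h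
        using linear_frechet_derivative[OF smooth_on_differentiable[OF f that]] by (simp add: linear_scale)
      \<comment> \<open>\<open>\<phi> t - \<phi> 0\<close> is the second difference minus its
        expected value. The derivative of \<open>\<phi>\<close> compares \<open>?D u\<close> at two
        points that differ by \<open>t *\<^sub>R v\<close>, so strict differentiability of
        \<open>?D u\<close> bounds it by \<open>e * t\<close>.\<close>
      define \<phi> where "\<phi> s = f (p + s *\<^sub>R u + t *\<^sub>R v) - f (p + s *\<^sub>R u) - (s * t) *\<^sub>R ?DD u v" for s
      have "norm (\<phi> t - \<phi> 0) \<le> (e * t) * norm (t - 0)"
      proof (rule differentiable_bound[of "{0..t}"])
        fix s assume s: "s \<in> {0..t}"
        let ?\<phi>' = "?D u (p + s *\<^sub>R u + t *\<^sub>R v) - ?D u (p + s *\<^sub>R u) - t *\<^sub>R ?DD u v"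
        have m: "p + s *\<^sub>R u + t *\<^sub>R v \<in> U" "p + s *\<^sub>R u \<in> U"
          using inU[OF s, of t] inU[OF s, of 0] t by auto
        have "((\<lambda>s. f (p + s *\<^sub>R u + t *\<^sub>R v)) has_derivative (\<lambda>h. frechet_derivative f (at (p + s *\<^sub>R u + t *\<^sub>R v)) (h *\<^sub>R u))) (at s within {0..t})"
          by (rule has_derivative_compose[where g = f and f = "\<lambda>s. p + s *\<^sub>R u + t *\<^sub>R v", OF _ hd[OF m(1)]]) (auto intro!: derivative_eq_intros)
        moreover have "((\<lambda>s. f (p + s *\<^sub>R u)) has_derivative (\<lambda>h. frechet_derivative f (at (p + s *\<^sub>R u)) (h *\<^sub>R u))) (at s within {0..t})"
          by (rule has_derivative_compose[where g = f and f = "\<lambda>s. p + s *\<^sub>R u", OF _ hd[OF m(2)]]) (auto intro!: derivative_eq_intros)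
        moreover have "((\<lambda>s. (s * t) *\<^sub>R ?DD u v) has_derivative (\<lambda>h. (h * t) *\<^sub>R ?DD u v)) (at s within {0..t})"
          by (auto intro!: derivative_eq_intros)
        ultimately have "(\<phi> has_derivative (\<lambda>h. h *\<^sub>R ?\<phi>')) (at s within {0..t})"
          unfolding \<phi>_def using fl[OF m(1)] fl[OF m(2)]
          by (auto intro!: derivative_eq_intros simp: algebra_simps)
        then show "(\<phi> has_derivative (\<lambda>h. h *\<^sub>R ?\<phi>')) (at s within {0..t})" .
        have "norm (?D u (p + s *\<^sub>R u + t *\<^sub>R v) - ?D u (p + s *\<^sub>R u) - ?DD u ((p + s *\<^sub>R u + t *\<^sub>R v) - (p + s *\<^sub>R u)))
          \<le> e1 * norm ((p + s *\<^sub>R u + t *\<^sub>R v) - (p + s *\<^sub>R u))"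
          using near[OF s, of t] near[OF s, of 0] t by (intro d(2) m) auto
        then have "norm ?\<phi>' \<le> e1 * norm (t *\<^sub>R v)"
          using linear_scale[OF lin, of t v] by (simp add: algebra_simps)
        also have "\<dots> = t * (e1 * norm v)" using t by simp
        also have "\<dots> \<le> t * e" using t e 
            by (intro mult_left_mono) (auto simp: e1_def pos_divide_le_eq add_nonneg_pos mult_left_mono)
        finally have b: "norm ?\<phi>' \<le> e * t" by (simp add: mult.commute)
        show "onorm (\<lambda>h. h *\<^sub>R ?\<phi>') \<le> e * t"
          using b e t by (intro onorm_bound) (auto simp: mult.commute[of "e * t"] intro!: mult_left_mono)
      qed (use t in auto)
      then show "norm (f (p + t *\<^sub>R u + t *\<^sub>R v) - f (p + t *\<^sub>R u) - f (p + t *\<^sub>R v) + f p - (t * t) *\<^sub>R ?DD u v) \<le> e * t * t"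
        using t by (simp add: \<phi>_def algebra_simps)
    qed
  qed
  have "norm (?DD u v - ?DD v u) \<le> e" if e: "e > 0" for e
  proof -
    obtain d1 where d1: "d1 > 0" "\<And>t. 0 < t \<and> t < d1 \<Longrightarrow>
      norm (f (p + t *\<^sub>R u + t *\<^sub>R v) - f (p + t *\<^sub>R u) - f (p + t *\<^sub>R v) + f p - (t * t) *\<^sub>R ?DD u v) \<le> e / 2 * t * t"
      using key[of "e/2" u v] e by auto
    obtain d2 where d2: "d2 > 0" "\<And>t. 0 < t \<and> t < d2 \<Longrightarrow>
      norm (f (p + t *\<^sub>R v + t *\<^sub>R u) - f (p + t *\<^sub>R v) - f (p + t *\<^sub>R u) + f p - (t * t) *\<^sub>R ?DD v u) \<le> e / 2 * t * t"
      using key[of "e/2" v u] e by auto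
    define t where "t = min d1 d2 / 2"
    have t: "0 < t" "t < d1" "t < d2" using d1(1) d2(1) by (auto simp: t_def)
    let ?\<Delta> = "f (p + t *\<^sub>R u + t *\<^sub>R v) - f (p + t *\<^sub>R u) - f (p + t *\<^sub>R v) + f p"
    have eq: "f (p + t *\<^sub>R v + t *\<^sub>R u) - f (p + t *\<^sub>R v) - f (p + t *\<^sub>R u) + f p = ?\<Delta>"
      by (simp add: algebra_simps)
    have "norm ((t * t) *\<^sub>R (?DD u v - ?DD v u)) =
      norm ((?\<Delta> - (t * t) *\<^sub>R ?DD v u) - (?\<Delta> - (t * t) *\<^sub>R ?DD u v))" by (simp add: scaleR_diff_right)
    also have "\<dots> \<le> e / 2 * t * t + e / 2 * t * t"
    proof (rule order_trans[OF norm_triangle_ineq4], rule add_mono)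
      show "norm (?\<Delta> - (t * t) *\<^sub>R ?DD v u) \<le> e / 2 * t * t" using d2(2)[of t] t unfolding eq by simp
      show "norm (?\<Delta> - (t * t) *\<^sub>R ?DD u v) \<le> e / 2 * t * t" using d1(2)[of t] t by simp
    qed
    finally have "t * t * norm (?DD u v - ?DD v u) \<le> t * t * e"
      unfolding norm_scaleR using t by (simp add: abs_mult mult.assoc mult.commute[of e])
    then show ?thesis using t by simp
  qed
  then have "norm (?DD u v - ?DD v u) \<le> 0" by (rule field_le_epsilon) simp
  then show ?thesis by simp
qed

section \<open>Derivatives of maps between manifolds\<close>

text \<open>The fragment of \<open>smooth_manifold\<close> on which the pointwise calculus rests.
  Derivatives are always taken in the preferred charts, and the fragment passes directly to products
  and vector spaces.\<close>

definition charted :: "('m, 'e::real_normed_vector) manifold \<Rightarrow> bool" where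
  "charted M \<longleftrightarrow>
     (\<forall>C\<in>atlas M. openin (mtop M) (fst C) \<and> open (snd C ` fst C) \<and>
        homeomorphic_map (subtopology (mtop M) (fst C)) (top_of_set (snd C ` fst C)) (snd C)) \<and>
     (\<forall>p\<in>pts M. chart_at M p \<in> atlas M \<and> p \<in> fst (chart_at M p))"

abbreviation "cdom M p \<equiv> fst (chart_at M p)"
abbreviation "cmap M p \<equiv> snd (chart_at M p)"
abbreviation "cinv M p \<equiv> chart_inv (chart_at M p)"

lemma smooth_manifold_charted: "smooth_manifold M \<Longrightarrow> charted M"
  by (simp add: smooth_manifold_def charted_def)

lemma charted_chart_at: "charted M \<Longrightarrow> p \<in> pts M \<Longrightarrow> chart_at M p \<in> atlas M"
  by (simp add: charted_def)

lemma charted_mem: "charted M \<Longrightarrow> p \<in> pts M \<Longrightarrow> p \<in> cdom M p"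
  by (simp add: charted_def)

lemma charted_inj: "charted M \<Longrightarrow> C \<in> atlas M \<Longrightarrow> inj_on (snd C) (fst C)"
proof -
  assume a: "charted M" "C \<in> atlas M"
  then have "homeomorphic_map (subtopology (mtop M) (fst C)) (top_of_set (snd C ` fst C)) (snd C)"
    "fst C \<subseteq> pts M"
    by (auto simp: charted_def openin_subset)
  then show ?thesis
    using homeomorphic_imp_injective_map topspace_subtopology_subset by metis
qed

lemma chart_inv_eq: "charted M \<Longrightarrow> C \<in> atlas M \<Longrightarrow> x \<in> fst C \<Longrightarrow> chart_inv C (snd C x) = x"
  by (simp add: chart_inv_def charted_inj)

lemma chart_image_open:
  assumes "charted M" "C \<in> atlas M" "openin (mtop M) W"
  shows "open (snd C ` (fst C \<inter> W))"
proof -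
  have h: "homeomorphic_map (subtopology (mtop M) (fst C)) (top_of_set (snd C ` fst C)) (snd C)"
    "open (snd C ` fst C)" "openin (mtop M) (fst C)"
    using assms by (auto simp: charted_def)
  have "openin (subtopology (mtop M) (fst C)) (fst C \<inter> W)"
    using assms(3) h(3) by (simp add: openin_open_subtopology openin_Int)
  then have "openin (top_of_set (snd C ` fst C)) (snd C ` (fst C \<inter> W))"
    using homeomorphic_imp_open_map[OF h(1)] unfolding open_map_def by blast
  then show ?thesis using h(2) by (simp add: openin_open_eq)
qed

lemma chart_preimage_open:
  assumes "charted M" "C \<in> atlas M" "open V"
  shows "openin (mtop M) {x \<in> fst C. snd C x \<in> V}"
proof -
  have h: "homeomorphic_map (subtopology (mtop M) (fst C)) (top_of_set (snd C ` fst C)) (snd C)"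
    "openin (mtop M) (fst C)"
    using assms by (auto simp: charted_def)
  have "continuous_map (subtopology (mtop M) (fst C)) (top_of_set (snd C ` fst C)) (snd C)"
    using h by (simp add: homeomorphic_imp_continuous_map)
  then have "openin (subtopology (mtop M) (fst C)) {x \<in> topspace (subtopology (mtop M) (fst C)). snd C x \<in> snd C ` fst C \<inter> V}"
    using assms(3) by (intro openin_continuous_map_preimage) (auto simp: openin_open)
  moreover have "{x \<in> topspace (subtopology (mtop M) (fst C)). snd C x \<in> snd C ` fst C \<inter> V} = {x \<in> fst C. snd C x \<in> V}"
    using openin_subset[OF h(2)] by auto
  ultimately show ?thesis using h(2) by (simp add: openin_open_subtopology)
qed

lemma chart_near:
  assumes "charted M" "p \<in> pts M" "openin (mtop M) W" "p \<in> W"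
  obtains r where "r > 0" "\<And>y. dist (cmap M p p) y < r \<Longrightarrow>
    y \<in> cmap M p ` (cdom M p \<inter> W) \<and> cinv M p y \<in> cdom M p \<inter> W \<and> cmap M p (cinv M p y) = y"
proof -
  note c = charted_chart_at[OF assms(1,2)]
  have "open (cmap M p ` (cdom M p \<inter> W))" by (rule chart_image_open[OF assms(1) c assms(3)])
  moreover have "cmap M p p \<in> cmap M p ` (cdom M p \<inter> W)"
    using assms(4) charted_mem[OF assms(1,2)] by blast
  ultimately obtain r where r: "r > 0" "ball (cmap M p p) r \<subseteq> cmap M p ` (cdom M p \<inter> W)"
    using open_contains_ball by blast
  show ?thesis
  proof (rule that[OF r(1)])
    fix y assume "dist (cmap M p p) y < r"
    then have y: "y \<in> cmap M p ` (cdom M p \<inter> W)" using r(2) by auto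
    then obtain x where "x \<in> cdom M p \<inter> W" "y = cmap M p x" by blast
    then show "y \<in> cmap M p ` (cdom M p \<inter> W) \<and> cinv M p y \<in> cdom M p \<inter> W \<and> cmap M p (cinv M p y) = y"
      using chart_inv_eq[OF assms(1) c] y by auto
  qed
qed

text \<open>The clause on \<open>W\<close> carries the continuity: outside the chart domain the
  coordinate expression is the junk value of a total function and says nothing about
  \<open>f\<close>. \<open>D\<close> is an argument of a relation because on a proper subset
  \<open>A\<close> it need be determined only along velocities in \<open>A\<close>.\<close>

definition mderiv ::
  "('m, 'e::real_normed_vector) manifold \<Rightarrow> 'm set \<Rightarrow> ('n, 'f::real_normed_vector) manifold
    \<Rightarrow> ('m \<Rightarrow> 'n) \<Rightarrow> 'm \<Rightarrow> ('e \<Rightarrow> 'f) \<Rightarrow> bool" where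
  "mderiv M A N f p D \<longleftrightarrow> p \<in> A \<and> p \<in> pts M \<and> f p \<in> pts N \<and>
     (\<exists>W. openin (mtop M) W \<and> p \<in> W \<and> f ` (A \<inter> W) \<subseteq> cdom N (f p)) \<and>
     strict_deriv (cmap N (f p) \<circ> f \<circ> cinv M p) D (cmap M p p) (cmap M p ` (A \<inter> cdom M p))"

lemma mderiv_mem: "mderiv M A N f p D \<Longrightarrow> p \<in> A" "mderiv M A N f p D \<Longrightarrow> p \<in> pts M"
  "mderiv M A N f p D \<Longrightarrow> f p \<in> pts N"
  by (auto simp: mderiv_def)

lemma mderiv_linear: "mderiv M A N f p D \<Longrightarrow> bounded_linear D"
  by (auto simp: mderiv_def strict_deriv_linear)

lemma mderiv_transform:
  assumes M: "charted M" and f: "mderiv M A N f p D" and W: "openin (mtop M) W" "p \<in> W" "p \<in> B"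
    and eq: "\<And>x. x \<in> B \<Longrightarrow> x \<in> W \<Longrightarrow> x \<in> A \<and> g x = f x"
  shows "mderiv M B N g p D"
proof -
  have p: "p \<in> pts M" "p \<in> A" "f p \<in> pts N" and gp: "g p = f p"
    using f W eq by (auto simp: mderiv_def)
  note c = charted_chart_at[OF M p(1)]
  obtain V where V: "openin (mtop M) V" "p \<in> V" "f ` (A \<inter> V) \<subseteq> cdom N (f p)"
    using f by (auto simp: mderiv_def)
  obtain r where r: "r > 0" "\<And>y. dist (cmap M p p) y < r \<Longrightarrow>
    y \<in> cmap M p ` (cdom M p \<inter> W) \<and> cinv M p y \<in> cdom M p \<inter> W \<and> cmap M p (cinv M p y) = y"
    using chart_near[OF M p(1) W(1,2)] by blast
  have "strict_deriv (cmap N (f p) \<circ> g \<circ> cinv M p) D (cmap M p p) (cmap M p ` (B \<inter> cdom M p))"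
  proof (rule strict_deriv_transform[OF _ r(1)])
    show "strict_deriv (cmap N (f p) \<circ> f \<circ> cinv M p) D (cmap M p p) (cmap M p ` (A \<inter> cdom M p))"
      using f by (simp add: mderiv_def)
    fix y assume y: "y \<in> cmap M p ` (B \<inter> cdom M p)" "dist (cmap M p p) y < r"
    then obtain x where x: "x \<in> B" "x \<in> cdom M p" "y = cmap M p x" by blast
    have "x \<in> W" using r(2)[OF y(2)] x chart_inv_eq[OF M c] by auto
    then have "x \<in> A" "g x = f x" using eq x by auto
    then show "y \<in> cmap M p ` (A \<inter> cdom M p) \<and> (cmap N (f p) \<circ> g \<circ> cinv M p) y = (cmap N (f p) \<circ> f \<circ> cinv M p) y"
      using x chart_inv_eq[OF M c] by auto
  qed
  moreover have "openin (mtop M) (V \<inter> W) \<and> p \<in> V \<inter> W \<and> g ` (B \<inter> (V \<inter> W)) \<subseteq> cdom N (f p)"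
  proof -
    have "g x \<in> cdom N (f p)" if "x \<in> B" "x \<in> V" "x \<in> W" for x
      using eq[OF that(1,3)] V(3) that by auto
    then show ?thesis using V W by (auto intro: openin_Int)
  qed
  ultimately show ?thesis unfolding mderiv_def gp using W p by blast
qed

lemma mderiv_subset: "charted M \<Longrightarrow> mderiv M A N f p D \<Longrightarrow> p \<in> B \<Longrightarrow> B \<subseteq> A \<Longrightarrow> mderiv M B N f p D"
  by (rule mderiv_transform[of M A N f p D "pts M"]) (auto dest: mderiv_mem)

lemma mderiv_cong: "charted M \<Longrightarrow> mderiv M A N f p D \<Longrightarrow> (\<And>x. x \<in> A \<Longrightarrow> g x = f x) \<Longrightarrow> mderiv M A N g p D"
  by (rule mderiv_transform[of M A N f p D "pts M"]) (auto dest: mderiv_mem)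

text \<open>In charts a strict derivative gives a Lipschitz bound; the clause on \<open>W0\<close>
  in \<open>mderiv\<close> is what allows the bound to be read back in the topology of the
  target.\<close>

lemma mderiv_continuous:
  assumes M: "charted M" and N: "charted N" and f: "mderiv M A N f p D"
    and V: "openin (mtop N) V" "f p \<in> V"
  obtains W where "openin (mtop M) W" "p \<in> W" "\<And>x. x \<in> A \<Longrightarrow> x \<in> W \<Longrightarrow> f x \<in> V"
proof -
  have p: "p \<in> pts M" "f p \<in> pts N" "p \<in> A" using f by (auto simp: mderiv_def)
  note c = charted_chart_at[OF M p(1)] charted_chart_at[OF N p(2)]
  obtain W0 where W0: "openin (mtop M) W0" "p \<in> W0" "f ` (A \<inter> W0) \<subseteq> cdom N (f p)"
    using f by (auto simp: mderiv_def)
  obtain r where r: "r > 0" "\<And>y. dist (cmap N (f p) (f p)) y < r \<Longrightarrow>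
    y \<in> cmap N (f p) ` (cdom N (f p) \<inter> V) \<and> cinv N (f p) y \<in> cdom N (f p) \<inter> V \<and> cmap N (f p) (cinv N (f p) y) = y"
    using chart_near[OF N p(2) V] by blast
  let ?f = "cmap N (f p) \<circ> f \<circ> cinv M p"
  let ?S = "cmap M p ` (A \<inter> cdom M p)"
  have sd: "strict_deriv ?f D (cmap M p p) ?S" using f by (simp add: mderiv_def)
  obtain K d where K: "K > 0" "d > 0" "\<And>y z. y \<in> ?S \<Longrightarrow> z \<in> ?S \<Longrightarrow> dist (cmap M p p) y < d \<Longrightarrow>
    dist (cmap M p p) z < d \<Longrightarrow> norm (?f y - ?f z) \<le> K * norm (y - z)"
    using strict_deriv_lipschitz[OF sd] by blast
  let ?W = "W0 \<inter> {x \<in> cdom M p. cmap M p x \<in> ball (cmap M p p) (min d (r / K))}"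
  show ?thesis
  proof (rule that[of ?W])
    show "openin (mtop M) ?W" using W0 by (intro openin_Int chart_preimage_open[OF M c(1)]) auto
    show "p \<in> ?W" using W0 charted_mem[OF M p(1)] K r by simp
    fix x assume x: "x \<in> A" "x \<in> ?W"
    have px: "cmap M p p \<in> ?S" "cmap M p x \<in> ?S" using x p charted_mem[OF M p(1)] by auto
    have "norm (?f (cmap M p p) - ?f (cmap M p x)) \<le> K * norm (cmap M p p - cmap M p x)"
      using px x K by (intro K(3)) auto
    also have "\<dots> < r" using x K(1) by (simp add: dist_norm pos_less_divide_eq mult.commute)
    finally have "dist (cmap N (f p) (f p)) (cmap N (f p) (f x)) < r"
      using x chart_inv_eq[OF M c(1)] charted_mem[OF M p(1)] by (simp add: dist_norm)
    from r(2)[OF this] have "cinv N (f p) (cmap N (f p) (f x)) \<in> V" by blast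
    moreover have "f x \<in> cdom N (f p)" using W0 x by blast
    ultimately show "f x \<in> V" using chart_inv_eq[OF N c(2)] by simp
  qed
qed

lemma mderiv_compose:
  assumes M: "charted M" and N: "charted N" and P: "charted P"
    and f: "mderiv M A N f p D" and g: "mderiv N B P g (f p) E"
    and W: "openin (mtop M) W" "p \<in> W" "\<And>x. x \<in> A \<Longrightarrow> x \<in> W \<Longrightarrow> f x \<in> B"
  shows "mderiv M A P (\<lambda>x. g (f x)) p (\<lambda>v. E (D v))"
proof -
  have p: "p \<in> pts M" "f p \<in> pts N" "p \<in> A" "g (f p) \<in> pts P" "f p \<in> B" using f g by (auto simp: mderiv_def)
  note c = charted_chart_at[OF M p(1)] charted_chart_at[OF N p(2)]
  obtain V where V: "openin (mtop N) V" "f p \<in> V" "g ` (B \<inter> V) \<subseteq> cdom P (g (f p))"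
    using g by (auto simp: mderiv_def)
  obtain W1 where W1: "openin (mtop M) W1" "p \<in> W1" "f ` (A \<inter> W1) \<subseteq> cdom N (f p)"
    using f by (auto simp: mderiv_def)
  obtain W2 where W2: "openin (mtop M) W2" "p \<in> W2" "\<And>x. x \<in> A \<Longrightarrow> x \<in> W2 \<Longrightarrow> f x \<in> V"
    using mderiv_continuous[OF M N f V(1,2)] by blast
  let ?W = "W \<inter> W1 \<inter> W2"
  have oW: "openin (mtop M) ?W" "p \<in> ?W" using W W1 W2 by auto
  have sub: "g (f x) \<in> cdom P (g (f p))" if "x \<in> A" "x \<in> ?W" for x
    using that W(3)[of x] W2(3)[of x] V(3) by auto
  obtain r where r: "r > 0" "\<And>y. dist (cmap M p p) y < r \<Longrightarrow>
    y \<in> cmap M p ` (cdom M p \<inter> ?W) \<and> cinv M p y \<in> cdom M p \<inter> ?W \<and> cmap M p (cinv M p y) = y"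
    using chart_near[OF M p(1) oW] by blast
  let ?f = "cmap N (f p) \<circ> f \<circ> cinv M p"
  let ?g = "cmap P (g (f p)) \<circ> g \<circ> cinv N (f p)"
  let ?S = "cmap M p ` (A \<inter> cdom M p)"
  let ?T = "cmap N (f p) ` (B \<inter> cdom N (f p))"
  have fp: "?f (cmap M p p) = cmap N (f p) (f p)"
    using chart_inv_eq[OF M c(1) charted_mem[OF M p(1)]] by simp
  have inA: "cinv M p y \<in> A \<and> cinv M p y \<in> ?W \<and> cinv M p y \<in> cdom M p" if "y \<in> ?S" "dist (cmap M p p) y < r" for y
  proof -
    obtain x where "x \<in> A \<inter> cdom M p" "y = cmap M p x" using \<open>y \<in> ?S\<close> by blast
    then show ?thesis using r(2)[OF that(2)] chart_inv_eq[OF M c(1)] by auto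
  qed
  have "strict_deriv (\<lambda>x. ?g (?f x)) (\<lambda>v. E (D v)) (cmap M p p) ?S"
  proof (rule strict_deriv_compose[where f = ?f and g = ?g and T = ?T, OF _ _ _ r(1)])
    show "strict_deriv ?f D (cmap M p p) ?S" using f by (simp add: mderiv_def)
    show "strict_deriv ?g E (?f (cmap M p p)) ?T" using g unfolding fp by (simp add: mderiv_def)
    show "cmap M p p \<in> ?S" using p charted_mem[OF M p(1)] by blast
    fix y assume "y \<in> ?S" "dist (cmap M p p) y < r"
    from inA[OF this] have "f (cinv M p y) \<in> B \<inter> cdom N (f p)" using W(3) W1(3) by auto
    then show "?f y \<in> ?T" by auto
  qed
  then have "strict_deriv (cmap P (g (f p)) \<circ> (\<lambda>x. g (f x)) \<circ> cinv M p) (\<lambda>v. E (D v)) (cmap M p p) ?S"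
  proof (rule strict_deriv_transform[OF _ r(1)])
    fix y assume y: "y \<in> ?S" "dist (cmap M p p) y < r"
    from inA[OF y] have "f (cinv M p y) \<in> cdom N (f p)" using W1(3) by auto
    then show "y \<in> ?S \<and> (cmap P (g (f p)) \<circ> (\<lambda>x. g (f x)) \<circ> cinv M p) y = ?g (?f y)"
      using y(1) chart_inv_eq[OF N c(2)] by simp
  qed
  moreover have "(\<lambda>x. g (f x)) ` (A \<inter> ?W) \<subseteq> cdom P (g (f p))" using sub by blast
  ultimately show ?thesis unfolding mderiv_def using p oW by blast
qed

lemma mderiv_compose_simple:
  assumes "charted M" "charted N" "charted P"
    and "mderiv M A N f p D" "mderiv N B P g (f p) E" "\<And>x. x \<in> A \<Longrightarrow> f x \<in> B"
  shows "mderiv M A P (\<lambda>x. g (f x)) p (\<lambda>v. E (D v))"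
  using assms mderiv_mem(2)[OF assms(4)] by (intro mderiv_compose[of M N P A f p D B g E "pts M"]) auto

text \<open>A local smooth extension \<open>F\<close> agrees with \<open>f\<close> on
  \<open>A\<close> near \<open>p\<close>, and the strict derivative of its chart expression
  restricts to the chart image of \<open>A\<close>.\<close>

lemma smooth_map_mderiv:
  fixes M :: "('m, 'e::real_normed_vector) manifold" and N :: "('n, 'f::real_normed_vector) manifold"
  assumes M: "charted M" and N: "charted N" and fd: "fin_dim TYPE('e)"
    and f: "smooth_map M A N f" and p: "p \<in> A"
  obtains D where "mderiv M A N f p D"
proof -
  obtain W F where W: "openin (mtop M) W" "p \<in> W" and F: "smooth_on_open M W N F"
    and eq: "\<And>x. x \<in> A \<inter> W \<Longrightarrow> F x = f x" using f p unfolding smooth_map_def by blast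
  have pM: "p \<in> pts M" using f p by (auto simp: smooth_map_def)
  have Fp: "F p = f p" using eq p W by blast
  have Wp: "W \<subseteq> pts M" using W openin_subset by blast
  have cm: "continuous_map (subtopology (mtop M) W) (mtop N) F" using F by (simp add: smooth_on_open_def)
  have pN: "f p \<in> pts N" using cm W Fp Wp by (force simp: continuous_map_def)
  note c = charted_chart_at[OF M pM] charted_chart_at[OF N pN]
  have oD: "openin (mtop N) (cdom N (f p))" using N c(2) by (simp add: charted_def)
  let ?V = "{x \<in> W. F x \<in> cdom N (f p)}"
  have "openin (subtopology (mtop M) W) {x \<in> topspace (subtopology (mtop M) W). F x \<in> cdom N (f p)}"
    by (rule openin_continuous_map_preimage[OF cm oD])
  moreover have "{x \<in> topspace (subtopology (mtop M) W). F x \<in> cdom N (f p)} = ?V" using Wp by auto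
  ultimately have V: "openin (mtop M) ?V" using W by (simp add: openin_open_subtopology)
  have pV: "p \<in> ?V" using W Fp charted_mem[OF N pN] by simp
  let ?U = "cmap M p ` {x \<in> cdom M p \<inter> W. F x \<in> cdom N (f p)}"
  have sm: "smooth_on ?U (cmap N (f p) \<circ> F \<circ> cinv M p)"
    using F c unfolding smooth_on_open_def by blast
  have Ueq: "{x \<in> cdom M p \<inter> W. F x \<in> cdom N (f p)} = cdom M p \<inter> ?V" by auto
  have U: "open ?U" "cmap M p p \<in> ?U"
    using chart_image_open[OF M c(1) V] pV charted_mem[OF M pM] unfolding Ueq by auto
  obtain r where r: "r > 0" "\<And>y. dist (cmap M p p) y < r \<Longrightarrow>
    y \<in> cmap M p ` (cdom M p \<inter> ?V) \<and> cinv M p y \<in> cdom M p \<inter> ?V \<and> cmap M p (cinv M p y) = y"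
    using chart_near[OF M pM V pV] by blast
  have "strict_deriv (cmap N (f p) \<circ> f \<circ> cinv M p) (frechet_derivative (cmap N (f p) \<circ> F \<circ> cinv M p) (at (cmap M p p)))
     (cmap M p p) (cmap M p ` (A \<inter> cdom M p))"
  proof (rule strict_deriv_transform[OF smooth_on_strict_deriv[OF fd U sm] r(1)])
    fix y assume y: "y \<in> cmap M p ` (A \<inter> cdom M p)" "dist (cmap M p p) y < r"
    then have "cinv M p y \<in> A" using chart_inv_eq[OF M c(1)] by auto
    with r(2)[OF y(2)] eq show "y \<in> ?U \<and> (cmap N (f p) \<circ> f \<circ> cinv M p) y = (cmap N (f p) \<circ> F \<circ> cinv M p) y"
      unfolding Ueq by auto
  qed
  moreover have "f ` (A \<inter> ?V) \<subseteq> cdom N (f p)" using eq by auto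
  ultimately have "mderiv M A N f p (frechet_derivative (cmap N (f p) \<circ> F \<circ> cinv M p) (at (cmap M p p)))"
    unfolding mderiv_def using p pM pN V pV by blast
  then show ?thesis by (rule that)
qed

lemma mderiv_has_derivative:
  assumes "charted M" "mderiv M A N f p D"
  shows "(cmap N (f p) \<circ> f \<circ> cinv M p has_derivative D) (at (cmap M p p) within cmap M p ` (A \<inter> cdom M p))"
proof (rule strict_deriv_has_derivative)
  show "cmap M p p \<in> cmap M p ` (A \<inter> cdom M p)"
    using charted_mem[of M p] assms by (auto simp: mderiv_def)
qed (use assms in \<open>simp add: mderiv_def\<close>)

subsection \<open>Vector spaces and products\<close>

lemma chart_at_vec_mfd [simp]: "chart_at vec_mfd p = (UNIV, id)"
  unfolding vec_mfd_def by simp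

lemma mtop_vec_mfd [simp]: "mtop vec_mfd = euclidean"
  unfolding vec_mfd_def by simp

lemma chart_inv_id [simp]: "chart_inv (UNIV, id) = id"
  unfolding chart_inv_def fst_conv snd_conv by (metis inv_id)

lemma charted_vec_mfd: "charted vec_mfd"
  unfolding charted_def by (simp add: vec_mfd_def)

lemma mderiv_vec_vec: "mderiv vec_mfd A vec_mfd f p D \<longleftrightarrow> p \<in> A \<and> strict_deriv f D p A"
  by (auto simp: mderiv_def intro!: exI[of _ UNIV])

lemma mderiv_to_vec: "mderiv M A vec_mfd f p D \<longleftrightarrow> p \<in> A \<and> p \<in> pts M \<and>
   strict_deriv (f \<circ> cinv M p) D (cmap M p p) (cmap M p ` (A \<inter> cdom M p))"
  by (auto simp: mderiv_def intro!: exI[of _ "pts M"])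

lemma mderiv_ident: "charted M \<Longrightarrow> p \<in> A \<Longrightarrow> p \<in> pts M \<Longrightarrow> mderiv M A M (\<lambda>x. x) p (\<lambda>v. v)"
  unfolding mderiv_def
proof (intro conjI)
  assume a: "charted M" "p \<in> A" "p \<in> pts M"
  note c = charted_chart_at[OF a(1,3)]
  show "\<exists>W. openin (mtop M) W \<and> p \<in> W \<and> (\<lambda>x. x) ` (A \<inter> W) \<subseteq> cdom M p"
    using a c charted_mem[OF a(1,3)] by (intro exI[of _ "cdom M p"]) (auto simp: charted_def)
  show "strict_deriv (cmap M p \<circ> (\<lambda>x. x) \<circ> cinv M p) (\<lambda>v. v) (cmap M p p) (cmap M p ` (A \<inter> cdom M p))"
    by (rule strict_deriv_transform[OF strict_deriv_bounded_linear[OF bounded_linear_ident, where S = UNIV] zero_less_one])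
      (auto simp: chart_inv_eq[OF a(1) c])
qed auto

lemma mderiv_const: "charted N \<Longrightarrow> p \<in> A \<Longrightarrow> p \<in> pts M \<Longrightarrow> q \<in> pts N \<Longrightarrow> mderiv M A N (\<lambda>_. q) p (\<lambda>_. 0)"
  unfolding mderiv_def
  by (auto simp: charted_mem o_def intro!: strict_deriv_const exI[of _ "pts M"])

lemma chart_at_prod [simp]: "chart_at (prod_mfd M N) (p, q) = prod_chart (chart_at M p) (chart_at N q)"
  "mtop (prod_mfd M N) = prod_topology (mtop M) (mtop N)"
  by (auto simp: prod_mfd_def)

lemma prod_chart_sel [simp]: "fst (prod_chart C D) = fst C \<times> fst D" "snd (prod_chart C D) = map_prod (snd C) (snd D)"
  by (auto simp: prod_chart_def)

lemma image_map_prod_Times: "map_prod f g ` (A \<times> B) = (f ` A) \<times> (g ` B)"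
  by auto

lemma charted_prod:
  assumes M: "charted M" and N: "charted N"
  shows "charted (prod_mfd M N)"
  unfolding charted_def
proof (intro conjI ballI)
  fix E assume "E \<in> atlas (prod_mfd M N)"
  then obtain C D where E: "E = prod_chart C D" "C \<in> atlas M" "D \<in> atlas N" by (auto simp: prod_mfd_def)
  have C: "openin (mtop M) (fst C)" "open (snd C ` fst C)"
    "homeomorphic_map (subtopology (mtop M) (fst C)) (top_of_set (snd C ` fst C)) (snd C)"
    using M E by (auto simp: charted_def)
  have D: "openin (mtop N) (fst D)" "open (snd D ` fst D)"
    "homeomorphic_map (subtopology (mtop N) (fst D)) (top_of_set (snd D ` fst D)) (snd D)"
    using N E by (auto simp: charted_def)
  show "openin (mtop (prod_mfd M N)) (fst E)" using C D by (simp add: E openin_prod_Times_iff)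
  show "open (snd E ` fst E)" using C D by (simp add: E image_map_prod_Times open_Times)
  have "homeomorphic_map (prod_topology (subtopology (mtop M) (fst C)) (subtopology (mtop N) (fst D)))
    (prod_topology (top_of_set (snd C ` fst C)) (top_of_set (snd D ` fst D))) (\<lambda>(x, y). (snd C x, snd D y))"
    using C(3) D(3) homeomorphic_maps_prod unfolding homeomorphic_map_maps by metis
  then show "homeomorphic_map (subtopology (mtop (prod_mfd M N)) (fst E)) (top_of_set (snd E ` fst E)) (snd E)"
    by (simp add: E image_map_prod_Times subtopology_Times) (simp add: map_prod_def)
next
  fix z assume "z \<in> pts (prod_mfd M N)"
  then obtain p q where z: "z = (p, q)" "p \<in> pts M" "q \<in> pts N" by auto
  show "chart_at (prod_mfd M N) z \<in> atlas (prod_mfd M N)"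
    using z charted_chart_at[OF M z(2)] charted_chart_at[OF N z(3)]
    unfolding z chart_at_prod by (simp add: prod_mfd_def) (metis prod.collapse)
  show "z \<in> cdom (prod_mfd M N) z" using z charted_mem[OF M z(2)] charted_mem[OF N z(3)] by auto
qed

lemma mderiv_Pair:
  assumes "charted X" and M: "charted M" and N: "charted N"
    and f: "mderiv X A M f p D" and g: "mderiv X A N g p E"
  shows "mderiv X A (prod_mfd M N) (\<lambda>x. (f x, g x)) p (\<lambda>v. (D v, E v))"
proof -
  obtain V where V: "openin (mtop X) V" "p \<in> V" "f ` (A \<inter> V) \<subseteq> cdom M (f p)"
    using f by (auto simp: mderiv_def)
  obtain W where W: "openin (mtop X) W" "p \<in> W" "g ` (A \<inter> W) \<subseteq> cdom N (g p)"
    using g by (auto simp: mderiv_def)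
  have "(\<lambda>x. (f x, g x)) ` (A \<inter> (V \<inter> W)) \<subseteq> cdom (prod_mfd M N) (f p, g p)" using V W by auto
  moreover have "strict_deriv (cmap (prod_mfd M N) (f p, g p) \<circ> (\<lambda>x. (f x, g x)) \<circ> cinv X p) (\<lambda>v. (D v, E v))
      (cmap X p p) (cmap X p ` (A \<inter> cdom X p))"
    using strict_deriv_Pair[of "cmap M (f p) \<circ> f \<circ> cinv X p" D _ _ "cmap N (g p) \<circ> g \<circ> cinv X p" E] f g
    by (simp add: mderiv_def o_def)
  ultimately show ?thesis using f g V W unfolding mderiv_def
    by (intro conjI exI[of _ "V \<inter> W"]) auto
qed

lemma mderiv_fst:
  assumes M: "charted M" and N: "charted N" and p: "p \<in> A" "p \<in> pts (prod_mfd M N)"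
  shows "mderiv (prod_mfd M N) A M fst p fst"
proof -
  obtain x y where [simp]: "p = (x, y)" by force
  have xy: "x \<in> pts M" "y \<in> pts N" using p by auto
  note ch = charted_prod[OF M N] 
  note c = charted_chart_at[OF ch p(2)]
  have o: "openin (mtop M) (cdom M x)" using M charted_chart_at[OF M xy(1)] by (simp add: charted_def)
  have "openin (mtop (prod_mfd M N)) (cdom M x \<times> pts N)" using o by (simp add: openin_prod_Times_iff)
  moreover have "strict_deriv (cmap M x \<circ> fst \<circ> cinv (prod_mfd M N) p) fst (cmap (prod_mfd M N) p p)
     (cmap (prod_mfd M N) p ` (A \<inter> cdom (prod_mfd M N) p))"
  proof (rule strict_deriv_transform[OF strict_deriv_bounded_linear[OF bounded_linear_fst, where S = UNIV] zero_less_one])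
    fix z assume "z \<in> cmap (prod_mfd M N) p ` (A \<inter> cdom (prod_mfd M N) p)"
    then show "z \<in> UNIV \<and> (cmap M x \<circ> fst \<circ> cinv (prod_mfd M N) p) z = fst z"
      using chart_inv_eq[OF ch c] by (auto simp: prod_mfd_def)
  qed
  ultimately show ?thesis using p xy charted_mem[OF M xy(1)] unfolding mderiv_def
    by (intro conjI exI[of _ "cdom M x \<times> pts N"]) auto
qed

lemma mderiv_snd:
  assumes M: "charted M" and N: "charted N" and p: "p \<in> A" "p \<in> pts (prod_mfd M N)"
  shows "mderiv (prod_mfd M N) A N snd p snd"
proof -
  obtain x y where [simp]: "p = (x, y)" by force
  have xy: "x \<in> pts M" "y \<in> pts N" using p by auto
  note ch = charted_prod[OF M N] 
  note c = charted_chart_at[OF ch p(2)]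
  have o: "openin (mtop N) (cdom N y)" using N charted_chart_at[OF N xy(2)] by (simp add: charted_def)
  have "openin (mtop (prod_mfd M N)) (pts M \<times> cdom N y)" using o by (simp add: openin_prod_Times_iff)
  moreover have "strict_deriv (cmap N y \<circ> snd \<circ> cinv (prod_mfd M N) p) snd (cmap (prod_mfd M N) p p)
     (cmap (prod_mfd M N) p ` (A \<inter> cdom (prod_mfd M N) p))"
  proof (rule strict_deriv_transform[OF strict_deriv_bounded_linear[OF bounded_linear_snd, where S = UNIV] zero_less_one])
    fix z assume "z \<in> cmap (prod_mfd M N) p ` (A \<inter> cdom (prod_mfd M N) p)"
    then show "z \<in> UNIV \<and> (cmap N y \<circ> snd \<circ> cinv (prod_mfd M N) p) z = snd z"
      using chart_inv_eq[OF ch c] by (auto simp: prod_mfd_def)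
  qed
  ultimately show ?thesis using p xy charted_mem[OF N xy(2)] unfolding mderiv_def
    by (intro conjI exI[of _ "pts M \<times> cdom N y"]) auto
qed

subsection \<open>Velocities\<close>

text \<open>More permissive than \<open>tangent_space\<close>: the curve need only be defined near 0
  and be strictly differentiable at 0. Such vectors still determine derivatives, and they can be
  exhibited by straight lines in a chart.\<close>

definition velocity :: "('m, 'e::real_normed_vector) manifold \<Rightarrow> 'm set \<Rightarrow> 'm \<Rightarrow> 'e \<Rightarrow> bool" where
  "velocity M A p v \<longleftrightarrow> (\<exists>c T. open T \<and> (0::real) \<in> T \<and> c ` T \<subseteq> A \<and> c 0 = p \<and>
     mderiv vec_mfd T M c 0 (\<lambda>t. t *\<^sub>R v))"

lemma has_derivative_along_velocity:
  assumes M: "charted M" and c: "open T" "(0::real) \<in> T" "c ` T \<subseteq> A" "c 0 = p" "mderiv vec_mfd T M c 0 (\<lambda>t. t *\<^sub>R v)"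
    and f: "(f \<circ> cinv M p has_derivative D) (at (cmap M p p) within cmap M p ` (A \<inter> cdom M p))"
  shows "((\<lambda>t. f (c t)) has_derivative (\<lambda>t. t *\<^sub>R D v)) (at 0)"
proof -
  have p: "p \<in> pts M" using c by (auto dest: mderiv_mem)
  note ch = charted_chart_at[OF M p]
  obtain W where W: "open W" "0 \<in> W" "c ` (T \<inter> W) \<subseteq> cdom M p"
    using c(4,5) by (auto simp: mderiv_def)
  have "((\<lambda>t. cmap M p (c t)) has_derivative (\<lambda>t. t *\<^sub>R v)) (at 0 within T)"
    using mderiv_has_derivative[OF charted_vec_mfd c(5)] c(4) by (simp add: o_def)
  then have 1: "((\<lambda>t. cmap M p (c t)) has_derivative (\<lambda>t. t *\<^sub>R v)) (at 0 within T \<inter> W)"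
    by (rule has_derivative_subset) auto
  have "(f \<circ> cinv M p has_derivative D) (at (cmap M p (c 0)) within (\<lambda>t. cmap M p (c t)) ` (T \<inter> W))"
    by (rule has_derivative_subset) (use f c W in auto)
  from has_derivative_in_compose[OF 1 this]
  have "((\<lambda>t. (f \<circ> cinv M p) (cmap M p (c t))) has_derivative (\<lambda>t. D (t *\<^sub>R v))) (at 0 within T \<inter> W)" .
  then have "((\<lambda>t. (f \<circ> cinv M p) (cmap M p (c t))) has_derivative (\<lambda>t. t *\<^sub>R D v)) (at 0 within T \<inter> W)"
    using has_derivative_bounded_linear[OF f] by (simp add: bounded_linear.linear linear_scale)
  then have "((\<lambda>t. f (c t)) has_derivative (\<lambda>t. t *\<^sub>R D v)) (at 0 within T \<inter> W)"
    by (rule has_derivative_transform[rotated 2]) (use c W chart_inv_eq[OF M ch] in auto)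
  moreover have "at 0 within T \<inter> W = at (0::real)" using c W by (intro at_within_open) auto
  ultimately show ?thesis by simp
qed

text \<open>\<open>tmap\<close> chooses some derivative within the chart image of \<open>A\<close>.
  Composed with a curve, it and \<open>D\<close> both become derivatives of the same function of one
  real variable at 0, where derivatives are unique.\<close>

lemma tmap_eq_mderiv:
  assumes M: "charted M" and f: "mderiv M A N f p D" and v: "velocity M A p v"
  shows "tmap M A N f p v = D v"
proof -
  obtain c T where c: "open T" "(0::real) \<in> T" "c ` T \<subseteq> A" "c 0 = p" "mderiv vec_mfd T M c 0 (\<lambda>t. t *\<^sub>R v)"
    using v unfolding velocity_def by blast
  let ?S = "cmap M p ` (A \<inter> cdom M p)"
  have D: "(cmap N (f p) \<circ> f \<circ> cinv M p has_derivative D) (at (cmap M p p) within ?S)"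
    by (rule mderiv_has_derivative[OF M f])
  then have "(cmap N (f p) \<circ> f \<circ> cinv M p) differentiable (at (cmap M p p) within ?S)"
    unfolding differentiable_def by blast
  then have T: "(cmap N (f p) \<circ> f \<circ> cinv M p has_derivative tmap M A N f p) (at (cmap M p p) within ?S)"
    unfolding tmap_def by (simp add: frechet_derivative_works)
  have "((\<lambda>t. (cmap N (f p) \<circ> f) (c t)) has_derivative (\<lambda>t. t *\<^sub>R D v)) (at 0)"
    by (rule has_derivative_along_velocity[OF M c D])
  moreover have "((\<lambda>t. (cmap N (f p) \<circ> f) (c t)) has_derivative (\<lambda>t. t *\<^sub>R tmap M A N f p v)) (at 0)"
    by (rule has_derivative_along_velocity[OF M c T])
  ultimately have "(\<lambda>t. t *\<^sub>R D v) = (\<lambda>t. t *\<^sub>R tmap M A N f p v)" by (rule has_derivative_unique)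
  from fun_cong[OF this, of 1] show ?thesis by simp
qed

lemma mderiv_unique:
  assumes "charted M" "mderiv M A N f p D" "mderiv M A N f p E" "velocity M A p v"
  shows "D v = E v"
  using tmap_eq_mderiv[OF assms(1,2,4)] tmap_eq_mderiv[OF assms(1,3,4)] by simp

lemma velocity_open:
  assumes M: "charted M" and W: "openin (mtop M) W" "p \<in> W" "W \<subseteq> A"
  shows "velocity M A p v"
proof -
  have p: "p \<in> pts M" using W openin_subset by blast
  note ch = charted_chart_at[OF M p]
  let ?O = "cmap M p ` (cdom M p \<inter> W)"
  have O: "open ?O" by (rule chart_image_open[OF M ch W(1)])
  define c where "c t = cinv M p (cmap M p p + t *\<^sub>R v)" for t :: real
  let ?T = "{t. cmap M p p + t *\<^sub>R v \<in> ?O}"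
  have "?T = (\<lambda>t. cmap M p p + t *\<^sub>R v) -` ?O" by auto
  then have T: "open ?T" using O by (auto intro!: continuous_open_vimage continuous_intros)
  have c0: "c 0 = p" by (simp add: c_def chart_inv_eq[OF M ch charted_mem[OF M p]])
  have cin: "c t \<in> W \<and> c t \<in> cdom M p \<and> cmap M p (c t) = cmap M p p + t *\<^sub>R v" if "t \<in> ?T" for t
  proof -
    from that have "cmap M p p + t *\<^sub>R v \<in> ?O" by simp
    then obtain x where "x \<in> cdom M p \<inter> W" "cmap M p p + t *\<^sub>R v = cmap M p x" by (elim imageE) simp
    then show ?thesis unfolding c_def using chart_inv_eq[OF M ch] by auto
  qed
  have "strict_deriv (\<lambda>t. cmap M p p + t *\<^sub>R v) (\<lambda>t. 0 + t *\<^sub>R v) 0 UNIV"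
    by (intro strict_deriv_add strict_deriv_const strict_deriv_bounded_linear bounded_linear_scaleR_left) auto
  then have "strict_deriv (\<lambda>t. cmap M p p + t *\<^sub>R v) (\<lambda>t. t *\<^sub>R v) 0 UNIV" by simp
  then have sd: "strict_deriv (\<lambda>t. cmap M p (c t)) (\<lambda>t. t *\<^sub>R v) 0 ?T"
  proof (rule strict_deriv_transform[OF _ zero_less_one])
    fix t assume "t \<in> ?T"
    from cin[OF this] show "t \<in> UNIV \<and> cmap M p (c t) = cmap M p p + t *\<^sub>R v" by blast
  qed
  have 0: "0 \<in> ?T" using W charted_mem[OF M p] by simp
  have "c ` (?T \<inter> UNIV) \<subseteq> cdom M p" using cin by blast
  then have "mderiv vec_mfd ?T M c 0 (\<lambda>t. t *\<^sub>R v)"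
    unfolding mderiv_def c0 using p 0 sd
    by (intro conjI exI[of _ UNIV]) (simp_all add: o_def)
  moreover note 0
  ultimately show ?thesis unfolding velocity_def using T c0 cin W by blast
qed

lemma velocity_pts: "charted M \<Longrightarrow> p \<in> pts M \<Longrightarrow> velocity M (pts M) p v"
  by (rule velocity_open[of M "pts M"]) auto

lemma velocity_Pair:
  assumes M: "charted M" and N: "charted N" and v: "velocity M A p v" and w: "velocity N B q w"
  shows "velocity (prod_mfd M N) (A \<times> B) (p, q) (v, w)"
proof -
  obtain c T where c: "open T" "(0::real) \<in> T" "c ` T \<subseteq> A" "c 0 = p" "mderiv vec_mfd T M c 0 (\<lambda>t. t *\<^sub>R v)"
    using v unfolding velocity_def by blast
  obtain d R where d: "open R" "(0::real) \<in> R" "d ` R \<subseteq> B" "d 0 = q" "mderiv vec_mfd R N d 0 (\<lambda>t. t *\<^sub>R w)"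
    using w unfolding velocity_def by blast
  have "mderiv vec_mfd (T \<inter> R) (prod_mfd M N) (\<lambda>t. (c t, d t)) 0 (\<lambda>t. (t *\<^sub>R v, t *\<^sub>R w))"
    by (intro mderiv_Pair charted_vec_mfd M N mderiv_subset[OF charted_vec_mfd c(5)] mderiv_subset[OF charted_vec_mfd d(5)])
      (use c d in auto)
  then show ?thesis unfolding velocity_def using c d
    by (intro exI[of _ "\<lambda>t. (c t, d t)"] exI[of _ "T \<inter> R"]) auto
qed

lemma velocity_rel_open:
  assumes "subspace V" "openin (top_of_set V) U" "y \<in> U" "v \<in> V"
  shows "velocity vec_mfd U y v"
proof -
  obtain O' where O: "open O'" "U = V \<inter> O'" using assms(2) by (auto simp: openin_open)
  let ?T = "(\<lambda>t::real. y + t *\<^sub>R v) -` O'"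
  have "strict_deriv (\<lambda>t. y + t *\<^sub>R v) (\<lambda>t. 0 + t *\<^sub>R v) 0 ?T"
    using assms(3) O by (intro strict_deriv_add strict_deriv_const strict_deriv_bounded_linear bounded_linear_scaleR_left) auto
  then have "mderiv vec_mfd ?T vec_mfd (\<lambda>t. y + t *\<^sub>R v) 0 (\<lambda>t. t *\<^sub>R v)"
    using assms(3) O by (simp add: mderiv_vec_vec)
  moreover have "open ?T" by (intro continuous_open_vimage O) (auto intro!: continuous_intros)
  ultimately show ?thesis unfolding velocity_def using assms O
    by (intro exI[of _ "\<lambda>t. y + t *\<^sub>R v"] exI[of _ ?T]) (auto simp: subspace_add subspace_scale)
qed

lemma velocity_vec: "velocity vec_mfd UNIV y v"
  by (rule velocity_rel_open[of UNIV]) auto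

lemma tangent_space_velocity:
  assumes M: "charted M" and v: "v \<in> tangent_space M A p"
  shows "velocity M A p v"
proof -
  obtain c where c: "v = tmap vec_mfd UNIV M c (0::real) 1" "smooth_map vec_mfd UNIV M c" "range c \<subseteq> A" "c 0 = p"
    using v unfolding tangent_space_def by blast
  obtain D where D: "mderiv vec_mfd UNIV M c 0 D"
    using smooth_map_mderiv[OF charted_vec_mfd M fin_dim_real c(2)] by blast
  have "v = D 1" using tmap_eq_mderiv[OF charted_vec_mfd D velocity_vec] c by simp
  then have "D t = t *\<^sub>R v" for t
    using linear_scale[OF bounded_linear.linear[OF mderiv_linear[OF D]], of t 1] by simp
  then have "D = (\<lambda>t. t *\<^sub>R v)" by (rule ext)
  then show ?thesis using D c unfolding velocity_def by (intro exI[of _ c] exI[of _ UNIV]) auto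
qed

section \<open>Lie groups\<close>

lemma mderiv_tmap:
  assumes M: "charted M" and f: "mderiv M A N f p D" and v: "\<And>v. velocity M A p v"
  shows "mderiv M A N f p (tmap M A N f p)" "tmap M A N f p = D"
proof -
  show 1: "tmap M A N f p = D" using tmap_eq_mderiv[OF M f v] by blast
  show "mderiv M A N f p (tmap M A N f p)" using f unfolding 1 .
qed

text \<open>The total derivative, known to exist, is identified by restricting it to each of the two
  factors and adding.\<close>

lemma smooth_on_derivative_strict_deriv_eq:
  fixes f :: "'a::real_normed_vector \<Rightarrow> 'b::real_normed_vector"
  assumes fd: "fin_dim TYPE('a)" and U: "open U" "x \<in> U" and f: "smooth_on U f"
  shows "strict_deriv (\<lambda>z. frechet_derivative f (at (fst z)) (snd z))
    (\<lambda>h. frechet_derivative (\<lambda>y. frechet_derivative f (at y) w) (at x) (fst h) + frechet_derivative f (at x) (snd h))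
    (x, w) (U \<times> UNIV)"
proof -
  let ?D = "\<lambda>y. frechet_derivative f (at y)"
  obtain D where D: "strict_deriv (\<lambda>z. ?D (fst z) (snd z)) D (x, w) (U \<times> UNIV)"
    using smooth_on_derivative_strict_deriv[OF assms] by blast
  have lD: "linear D" using strict_deriv_linear[OF D] bounded_linear.linear by blast
  have l: "linear (?D x)" using smooth_on_differentiable[OF f U(2)] by (simp add: linear_frechet_derivative)
  have 1: "frechet_derivative (\<lambda>y. ?D y w) (at x) = (\<lambda>h. D (h, 0))"
  proof -
    have "strict_deriv (\<lambda>y. (y, w)) (\<lambda>h. (h, 0)) x U"
      by (intro strict_deriv_Pair strict_deriv_const strict_deriv_bounded_linear bounded_linear_ident)
    from strict_deriv_compose[OF this D U(2) zero_less_one]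
    have "strict_deriv (\<lambda>y. ?D y w) (\<lambda>h. D (h, 0)) x U" by simp
    from strict_deriv_has_derivative[OF this U(2)]
    have "((\<lambda>y. ?D y w) has_derivative (\<lambda>h. D (h, 0))) (at x)"
      unfolding at_within_open[OF U(2,1)] .
    then show ?thesis by (rule frechet_derivative_at[symmetric])
  qed
  have 2: "?D x = (\<lambda>k. D (0, k))"
  proof -
    have "strict_deriv (\<lambda>k. (x, k)) (\<lambda>k. (0, k)) w UNIV"
      by (intro strict_deriv_Pair strict_deriv_const strict_deriv_bounded_linear bounded_linear_ident)
    from strict_deriv_compose[OF this D UNIV_I zero_less_one]
    have "strict_deriv (\<lambda>k. ?D x k) (\<lambda>k. D (0, k)) w UNIV" using U by simp
    from strict_deriv_has_derivative[OF this UNIV_I]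
    have "(?D x has_derivative (\<lambda>k. D (0, k))) (at w)" by simp
    moreover have "(?D x has_derivative ?D x) (at w)"
      by (rule bounded_linear_imp_has_derivative[OF fin_dim_bounded_linear[OF fd l]])
    ultimately show ?thesis by (metis has_derivative_unique)
  qed
  have "D = (\<lambda>h. D (fst h, 0) + D (0, snd h))"
  proof
    fix h show "D h = D (fst h, 0) + D (0, snd h)" by (simp flip: linear_add[OF lD])
  qed
  with D show ?thesis unfolding 1 2 by simp
qed

text \<open>Supplies the bound on \<open>H\<close>-orbits in the linear representations, which later
  excludes elements of \<open>H\<close> acting as dilations.\<close>

lemma mderiv_bounded_on_compact:
  assumes M: "charted M" and K: "compactin (mtop M) K" "K \<subseteq> A"
    and f: "\<And>h. h \<in> K \<Longrightarrow> \<exists>D. mderiv M A vec_mfd f h D"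
  shows "\<exists>b. \<forall>h\<in>K. norm (f h) \<le> b"
proof -
  have "\<exists>W. openin (mtop M) W \<and> h \<in> W \<and> (\<forall>x\<in>A \<inter> W. norm (f x) \<le> norm (f h) + 1)" if h: "h \<in> K" for h
  proof -
    obtain D where D: "mderiv M A vec_mfd f h D" using f[OF h] by blast
    obtain W where W: "openin (mtop M) W" "h \<in> W" "\<And>x. x \<in> A \<Longrightarrow> x \<in> W \<Longrightarrow> f x \<in> ball (f h) 1"
      using mderiv_continuous[OF M charted_vec_mfd D, of "ball (f h) 1"] by auto
    have "norm (f x) \<le> norm (f h) + 1" if "x \<in> A" "x \<in> W" for x
      using W(3)[OF that] norm_triangle_ineq2[of "f x" "f h"] by (simp add: dist_norm norm_minus_commute)
    with W show ?thesis by auto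
  qed
  then obtain W where W: "\<And>h. h \<in> K \<Longrightarrow> openin (mtop M) (W h) \<and> h \<in> W h \<and> (\<forall>x\<in>A \<inter> W h. norm (f x) \<le> norm (f h) + 1)"
    by metis
  have "\<exists>\<F>. finite \<F> \<and> \<F> \<subseteq> W ` K \<and> K \<subseteq> \<Union>\<F>"
    using K(1) unfolding compactin_def
    by (elim conjE allE[of _ "W ` K"]) (use W in blast)
  then obtain I where I: "finite I" "I \<subseteq> K" "K \<subseteq> \<Union>(W ` I)" by (metis finite_subset_image)
  show ?thesis
  proof (intro exI ballI)
    fix h assume h: "h \<in> K"
    then obtain i where i: "i \<in> I" "h \<in> W i" using I by blast
    then have "norm (f h) \<le> norm (f i) + 1" using W[of i] I K h by blast
    also have "\<dots> \<le> (\<Sum>i\<in>I. norm (f i) + 1)" using I(1) i by (intro member_le_sum) auto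
    finally show "norm (f h) \<le> (\<Sum>i\<in>I. norm (f i) + 1)" .
  qed
qed

section \<open>Calculus on a Lie group: translations, inversion and the adjoint action\<close>

locale lie_gp =
  fixes G :: "('a, 'g::real_normed_vector) lie_grp" (structure)
  assumes lie: "lie_group G"
begin

sublocale group G using lie by (simp add: lie_group_def)

abbreviation "M \<equiv> mfd G"
abbreviation "C \<equiv> carrier G"

lemma manM: "smooth_manifold M" using lie by (simp add: lie_group_def)
lemma chM: "charted M" using manM smooth_manifold_charted by blast
lemma fd: "fin_dim TYPE('g)" using manM by (simp add: smooth_manifold_def)
lemma ptsM: "pts M = C" using lie by (simp add: lie_group_def)
lemma fdd: "fin_dim TYPE('g dual)" by (rule fin_dim_dual[OF fd])

lemmas chV = charted_vec_mfd
lemmas chMM = charted_prod[OF chM chM]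
lemmas chMV = charted_prod[OF chM chV]

lemma openC: "openin (mtop M) C" using ptsM openin_topspace by metis

lemma velC: "g \<in> C \<Longrightarrow> velocity M C g v" using velocity_pts[OF chM] ptsM by metis

lemma linear_fd: "linear f \<Longrightarrow> bounded_linear f" for f :: "'g \<Rightarrow> 'b::real_normed_vector"
  by (rule fin_dim_bounded_linear[OF fd])

lemma velCC: "g \<in> C \<Longrightarrow> h \<in> C \<Longrightarrow> velocity (prod_mfd M M) (C \<times> C) (g, h) v"
  using velocity_Pair[OF chM chM velC velC, of g h "fst v" "snd v"] by simp

definition dmult :: "'a \<Rightarrow> 'a \<Rightarrow> 'g \<times> 'g \<Rightarrow> 'g" where
  "dmult g h = tmap (prod_mfd M M) (C \<times> C) M (\<lambda>(g, h). g \<otimes> h) (g, h)"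

lemma mult_mderiv:
  assumes "g \<in> C" "h \<in> C"
  shows "mderiv (prod_mfd M M) (C \<times> C) M (\<lambda>(g, h). g \<otimes> h) (g, h) (dmult g h)"
proof -
  have "smooth_map (prod_mfd M M) (C \<times> C) M (\<lambda>(g, h). g \<otimes> h)" using lie by (simp add: lie_group_def)
  from smooth_map_mderiv[OF chMM chM fin_dim_prod[OF fd fd] this, of "(g, h)"] assms
  obtain D where D: "mderiv (prod_mfd M M) (C \<times> C) M (\<lambda>(g, h). g \<otimes> h) (g, h) D" by blast
  show ?thesis unfolding dmult_def by (rule mderiv_tmap(1)[OF chMM D]) (use assms velCC in auto)
qed

lemma dmult_linear: "g \<in> C \<Longrightarrow> h \<in> C \<Longrightarrow> linear (dmult g h)"
  by (rule bounded_linear.linear[OF mderiv_linear[OF mult_mderiv]])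

lemma mderiv_mult:
  assumes X: "charted X" and f: "mderiv X A M f p D" and f': "mderiv X A M f' p D'"
    and A: "\<And>x. x \<in> A \<Longrightarrow> f x \<in> C" "\<And>x. x \<in> A \<Longrightarrow> f' x \<in> C"
  shows "mderiv X A M (\<lambda>x. f x \<otimes> f' x) p (\<lambda>v. dmult (f p) (f' p) (D v, D' v))"
proof -
  have p: "p \<in> A" using f by (auto dest: mderiv_mem)
  have "mderiv X A M (\<lambda>x. (\<lambda>(g, h). g \<otimes> h) (f x, f' x)) p (\<lambda>v. dmult (f p) (f' p) (D v, D' v))"
    by (rule mderiv_compose_simple[OF X chMM chM mderiv_Pair[OF X chM chM f f'] mult_mderiv])
      (use A p in auto)
  then show ?thesis by simp
qed

lemma idM: "g \<in> C \<Longrightarrow> mderiv M C M (\<lambda>x. x) g (\<lambda>v. v)"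
  by (rule mderiv_ident[OF chM]) (simp_all add: ptsM)

lemma constM: "g \<in> C \<Longrightarrow> k \<in> C \<Longrightarrow> mderiv M C M (\<lambda>x. k) g (\<lambda>v. 0)"
  by (rule mderiv_const[OF chM]) (simp_all add: ptsM)

lemma left_mderiv: "g \<in> C \<Longrightarrow> h \<in> C \<Longrightarrow> mderiv M C M (\<lambda>x. g \<otimes> x) h (\<lambda>v. dmult g h (0, v))"
  by (rule mderiv_mult[OF chM constM idM]) simp_all

lemma right_mderiv: "g \<in> C \<Longrightarrow> h \<in> C \<Longrightarrow> mderiv M C M (\<lambda>x. x \<otimes> g) h (\<lambda>v. dmult h g (v, 0))"
  by (rule mderiv_mult[OF chM idM constM]) simp_all

lemma from_left_mderiv: "g \<in> C \<Longrightarrow> mderiv M C M (\<lambda>x. g \<otimes> x) \<one> (from_left G g)"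
  unfolding from_left_def by (rule mderiv_tmap(1)[OF chM left_mderiv]) (auto intro: velC)

lemma to_left_mderiv: "g \<in> C \<Longrightarrow> mderiv M C M (\<lambda>x. inv g \<otimes> x) g (to_left G g)"
  unfolding to_left_def by (rule mderiv_tmap(1)[OF chM left_mderiv]) (auto intro: velC)

lemma Ad_mderiv:
  assumes g: "g \<in> C"
  shows "mderiv M C M (\<lambda>x. g \<otimes> x \<otimes> inv g) \<one> (Ad G g)"
proof -
  have "mderiv M C M (\<lambda>x. (g \<otimes> x) \<otimes> inv g) \<one> (\<lambda>v. dmult (g \<otimes> \<one>) (inv g) (dmult g \<one> (0, v), 0))"
    by (rule mderiv_mult[OF chM left_mderiv constM]) (use g in simp_all)
  then show ?thesis unfolding Ad_def by (rule mderiv_tmap(1)[OF chM]) (rule velC[OF one_closed])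
qed

lemma mderiv_uniqueM:
  assumes "mderiv M C N f g D" "mderiv M C N f g E"
  shows "D = E"
proof
  have "g \<in> C" using assms(1) by (rule mderiv_mem(1))
  then show "D v = E v" for v by (rule mderiv_unique[OF chM assms velC])
qed

lemma from_left_linear: "g \<in> C \<Longrightarrow> linear (from_left G g)"
  by (rule bounded_linear.linear[OF mderiv_linear[OF from_left_mderiv]])

lemma Ad_linear: "g \<in> C \<Longrightarrow> linear (Ad G g)"
  by (rule bounded_linear.linear[OF mderiv_linear[OF Ad_mderiv]])

lemma from_to_left:
  assumes g: "g \<in> C" shows "from_left G g (to_left G g v) = v" "to_left G g (from_left G g v) = v"
proof -
  have "mderiv M C M (\<lambda>x. g \<otimes> (inv g \<otimes> x)) g (\<lambda>v. from_left G g (to_left G g v))"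
    by (rule mderiv_compose_simple[OF chM chM chM to_left_mderiv]) (use g from_left_mderiv in auto)
  then have "mderiv M C M (\<lambda>x. x) g (\<lambda>v. from_left G g (to_left G g v))"
    by (rule mderiv_cong[OF chM]) (simp add: g flip: m_assoc)
  from fun_cong[OF mderiv_uniqueM[OF this idM[OF g]]] show "from_left G g (to_left G g v) = v" by simp
  have "mderiv M C M (\<lambda>x. inv g \<otimes> (g \<otimes> x)) \<one> (\<lambda>v. to_left G g (from_left G g v))"
    by (rule mderiv_compose_simple[OF chM chM chM from_left_mderiv]) (use g to_left_mderiv in auto)
  then have "mderiv M C M (\<lambda>x. x) \<one> (\<lambda>v. to_left G g (from_left G g v))"
    by (rule mderiv_cong[OF chM]) (simp add: g flip: m_assoc)
  from fun_cong[OF mderiv_uniqueM[OF this idM[OF one_closed]]] show "to_left G g (from_left G g v) = v" by simp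
qed

lemma from_left_one: "from_left G \<one> = (\<lambda>v. v)"
proof -
  have "mderiv M C M (\<lambda>x. x) \<one> (from_left G \<one>)"
    by (rule mderiv_cong[OF chM from_left_mderiv]) auto
  from mderiv_uniqueM[OF this idM[OF one_closed]] show ?thesis .
qed

lemma to_left_one: "to_left G \<one> = (\<lambda>v. v)"
  using from_to_left(2)[OF one_closed] from_left_one by auto

lemma Ad_one: "Ad G \<one> = (\<lambda>v. v)"
proof -
  have "mderiv M C M (\<lambda>x. x) \<one> (Ad G \<one>)"
    by (rule mderiv_cong[OF chM Ad_mderiv]) auto
  from mderiv_uniqueM[OF this idM[OF one_closed]] show ?thesis .
qed

lemma Ad_mult: 
  assumes "g \<in> C" "h \<in> C"
  shows "Ad G (g \<otimes> h) v = Ad G g (Ad G h v)"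
proof -
  have "mderiv M C M (\<lambda>x. g \<otimes> (h \<otimes> x \<otimes> inv h) \<otimes> inv g) \<one> (\<lambda>v. Ad G g (Ad G h v))"
    by (rule mderiv_compose_simple[OF chM chM chM Ad_mderiv]) (use assms Ad_mderiv in auto)
  then have "mderiv M C M (\<lambda>x. (g \<otimes> h) \<otimes> x \<otimes> inv (g \<otimes> h)) \<one> (\<lambda>v. Ad G g (Ad G h v))"
    by (rule mderiv_cong[OF chM]) (simp add: assms inv_mult_group m_assoc)
  from fun_cong[OF mderiv_uniqueM[OF this Ad_mderiv[OF m_closed[OF assms]]]] show ?thesis by simp
qed

lemma Ad_inv: "g \<in> C \<Longrightarrow> Ad G (inv g) (Ad G g v) = v" "g \<in> C \<Longrightarrow> Ad G g (Ad G (inv g) v) = v"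
  using Ad_mult[of "inv g" g v] Ad_mult[of g "inv g" v] Ad_one by auto

lemma dmult_one: "dmult \<one> \<one> (v, w) = v + w"
proof -
  have "mderiv M C M (\<lambda>x. x) \<one> (\<lambda>v. dmult \<one> \<one> (0, v))"
    by (rule mderiv_cong[OF chM left_mderiv]) auto
  from fun_cong[OF mderiv_uniqueM[OF this idM[OF one_closed]]] have 1: "dmult \<one> \<one> (0, w) = w" by simp
  have "mderiv M C M (\<lambda>x. x) \<one> (\<lambda>v. dmult \<one> \<one> (v, 0))"
    by (rule mderiv_cong[OF chM right_mderiv]) auto
  from fun_cong[OF mderiv_uniqueM[OF this idM[OF one_closed]]] have 2: "dmult \<one> \<one> (v, 0) = v" by simp
  show ?thesis using linear_add[OF dmult_linear[OF one_closed one_closed], of "(v, 0)" "(0, w)"] 1 2 by simp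
qed

lemma inv_smooth_mderiv: "g \<in> C \<Longrightarrow> \<exists>D. mderiv M C M (\<lambda>g. inv g) g D"
proof -
  have "smooth_map M C M (\<lambda>g. inv g)" using lie by (simp add: lie_group_def)
  then show "g \<in> C \<Longrightarrow> \<exists>D. mderiv M C M (\<lambda>g. inv g) g D"
    using smooth_map_mderiv[OF chM chM fd] by metis
qed

lemma inv_mderiv: "mderiv M C M (\<lambda>g. inv g) \<one> (\<lambda>v. - v)"
proof -
  obtain D where D: "mderiv M C M (\<lambda>g. inv g) \<one> D" using inv_smooth_mderiv by blast
  have "mderiv M C M (\<lambda>x. x \<otimes> inv x) \<one> (\<lambda>v. dmult \<one> (inv \<one>) (v, D v))"
    by (rule mderiv_mult[OF chM idM D]) auto
  then have "mderiv M C M (\<lambda>x. x \<otimes> inv x) \<one> (\<lambda>v. v + D v)" by (simp add: dmult_one)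
  then have "mderiv M C M (\<lambda>x. \<one>) \<one> (\<lambda>v. v + D v)"
    by (rule mderiv_cong[OF chM]) simp
  from mderiv_uniqueM[OF this constM[OF one_closed one_closed]] have "(\<lambda>v. v + D v) = (\<lambda>v. 0)" by simp
  then have "v + D v = 0" for v by (rule fun_cong)
  then have "D = (\<lambda>v. - v)" by (intro ext) (simp add: eq_neg_iff_add_eq_0 add.commute)
  with D show ?thesis by simp
qed

text \<open>In the chart at the identity, \<open>Ad g \<eta> = Dm(g, g\<inverse>)(Dm(g, 1)(0, \<eta>), 0)\<close> for the local
  expression \<open>m\<close> of the multiplication, so its derivative in \<open>g\<close> is a combination of second
  derivatives of \<open>m\<close>, which are symmetric.\<close>

lemma Ad_mderiv_one:
  "\<exists>D. mderiv M C vec_mfd (\<lambda>g. Ad G g \<eta>) \<one> D \<and> D \<eta> = 0"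
proof -
  let ?e = "\<one>"
  let ?P = "prod_mfd M M"
  define x0 where "x0 = cmap M ?e ?e"
  have "smooth_map ?P (C \<times> C) M (\<lambda>(g, h). g \<otimes> h)" using lie by (simp add: lie_group_def)
  then obtain W F where W: "openin (mtop ?P) W" "(?e, ?e) \<in> W" and F: "smooth_on_open ?P W M F"
    and eq: "\<And>x. x \<in> (C \<times> C) \<inter> W \<Longrightarrow> F x = (\<lambda>(g, h). g \<otimes> h) x"
    unfolding smooth_map_def using one_closed by (metis (no_types, lifting) SigmaI)
  have WC: "W \<subseteq> C \<times> C" using openin_subset[OF W(1)] ptsM by auto
  have eM: "?e \<in> pts M" "(?e, ?e) \<in> pts ?P" using ptsM by auto
  note c1 = charted_chart_at[OF chM eM(1)] and c2 = charted_chart_at[OF chMM eM(2)]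
  have F1: "F (g, h) = g \<otimes> h" if "(g, h) \<in> W" for g h using eq[of "(g, h)"] that WC by auto
  let ?U0 = "{x \<in> cdom ?P (?e, ?e) \<inter> W. F x \<in> cdom M ?e}"
  define U where "U = cmap ?P (?e, ?e) ` ?U0"
  define m where "m = cmap M ?e \<circ> F \<circ> cinv ?P (?e, ?e)"
  have smU: "smooth_on U m" using F c1 c2 unfolding smooth_on_open_def U_def m_def by blast
  have oU: "open U"
  proof -
    have cm: "continuous_map (subtopology (mtop ?P) W) (mtop M) F" using F by (simp add: smooth_on_open_def)
    have "openin (subtopology (mtop ?P) W) {x \<in> topspace (subtopology (mtop ?P) W). F x \<in> cdom M ?e}"
      using chM c1 by (intro openin_continuous_map_preimage[OF cm]) (simp add: charted_def)
    moreover have "{x \<in> topspace (subtopology (mtop ?P) W). F x \<in> cdom M ?e} = {x \<in> W. F x \<in> cdom M ?e}"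
      using openin_subset[OF W(1)] by auto
    ultimately have V: "openin (mtop ?P) {x \<in> W. F x \<in> cdom M ?e}"
      using W by (simp add: openin_open_subtopology)
    have "?U0 = cdom ?P (?e, ?e) \<inter> {x \<in> W. F x \<in> cdom M ?e}" by auto
    then show ?thesis unfolding U_def using chart_image_open[OF chMM c2 V] by simp
  qed
  have xU: "(x0, x0) \<in> U"
    unfolding U_def x0_def using W(2) charted_mem[OF chM eM(1)] F1[OF W(2)] by force
  have inU: "fst y \<in> cmap M ?e ` cdom M ?e \<and> snd y \<in> cmap M ?e ` cdom M ?e \<and>
     cinv M ?e (fst y) \<otimes> cinv M ?e (snd y) \<in> cdom M ?e \<and>
     m y = cmap M ?e (cinv M ?e (fst y) \<otimes> cinv M ?e (snd y))" if yU: "y \<in> U" for y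
  proof -
    obtain g h where gh: "y = (cmap M ?e g, cmap M ?e h)" "(g, h) \<in> W" "g \<in> cdom M ?e" "h \<in> cdom M ?e"
      "F (g, h) \<in> cdom M ?e" using yU unfolding U_def by auto
    have "cinv ?P (?e, ?e) y = (g, h)" using chart_inv_eq[OF chMM c2, of "(g, h)"] gh by simp
    then show ?thesis using gh F1[OF gh(2)] chart_inv_eq[OF chM c1] by (auto simp: m_def)
  qed
  have cinvx0: "cinv M ?e x0 = ?e" unfolding x0_def by (rule chart_inv_eq[OF chM c1 charted_mem[OF chM eM(1)]])
  let ?D = "\<lambda>y. frechet_derivative m (at y)"
  have hdm: "(m has_derivative ?D y) (at y)" if "y \<in> U" for y
    using smooth_on_differentiable[OF smU that] frechet_derivative_works by blast
  define ii where "ii = cmap M ?e \<circ> (\<lambda>g. inv g) \<circ> cinv M ?e"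
  let ?O = "cmap M ?e ` (C \<inter> cdom M ?e)"
  have sdi: "strict_deriv ii (\<lambda>v. - v) x0 ?O" using inv_mderiv by (simp add: mderiv_def ii_def x0_def)
  have x0O: "x0 \<in> ?O" using charted_mem[OF chM eM(1)] by (simp add: x0_def)
  have iix0: "ii x0 = x0" by (simp add: ii_def cinvx0 x0_def[symmetric])
  \<comment> \<open>In coordinates, \<open>S1 z\<close> is the image of \<open>\<eta>\<close> under
    the derivative of left translation by the point \<open>z\<close>, and \<open>S2 z\<close>
    applies right translation by its inverse, so near \<open>x0\<close> the value
    \<open>S2 z\<close> is \<open>Ad\<close> of that point on \<open>\<eta>\<close>.\<close>
  define S1 where "S1 z = ?D (z, x0) (0, \<eta>)" for z
  define S2 where "S2 z = ?D (z, ii z) (S1 z, 0)" for z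
  let ?d2 = "\<lambda>w h. frechet_derivative (\<lambda>y. ?D y w) (at (x0, x0)) h"
  obtain r1 where r1: "r1 > 0" "ball (x0, x0) r1 \<subseteq> U" using oU xU open_contains_ball by blast
  have dist1: "dist (x0, x0) (z, x0) = dist x0 z" for z by (simp add: dist_Pair_Pair)
  have fd2: "fin_dim TYPE('g \<times> 'g)" by (rule fin_dim_prod[OF fd fd])
  note SD = smooth_on_derivative_strict_deriv_eq[OF fd2 oU xU smU]
  have sS1: "strict_deriv S1 (\<lambda>h. ?d2 (0, \<eta>) (h, 0)) x0 ?O"
  proof -
    have a: "strict_deriv (\<lambda>z. ((z, x0), (0, \<eta>))) (\<lambda>h. ((h, 0), (0, 0))) x0 ?O"
      by (intro strict_deriv_Pair strict_deriv_const strict_deriv_bounded_linear bounded_linear_ident)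
    have "?D (x0, x0) (0, 0) = 0"
      using linear_frechet_derivative[OF smooth_on_differentiable[OF smU xU]] linear_0 by (simp flip: zero_prod_def)
    with strict_deriv_compose[OF a SD x0O r1(1)] show ?thesis
      using r1(2) by (auto simp: S1_def[abs_def] dist1 subset_eq)
  qed
  obtain r2 where r2: "r2 > 0" "\<And>z. z \<in> ?O \<Longrightarrow> dist x0 z < r2 \<Longrightarrow> (z, ii z) \<in> U"
  proof -
    obtain K d where K: "K > 0" "d > 0" "\<And>y z. y \<in> ?O \<Longrightarrow> z \<in> ?O \<Longrightarrow> dist x0 y < d \<Longrightarrow> dist x0 z < d \<Longrightarrow>
      norm (ii y - ii z) \<le> K * norm (y - z)" using strict_deriv_lipschitz[OF sdi] by blast
    have "(z, ii z) \<in> U" if z: "z \<in> ?O" "dist x0 z < min d (r1 / (1 + K))" for z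
    proof -
      have "dist x0 (ii z) \<le> K * dist x0 z" using K(3)[OF x0O z(1)] z K by (simp add: iix0 dist_norm)
      moreover have "dist x0 z * (1 + K) < r1" using z K by (simp add: pos_less_divide_eq)
      moreover have "dist (x0, x0) (z, ii z) \<le> dist x0 z + dist x0 (ii z)"
        unfolding dist_Pair_Pair by (rule sqrt_sum_squares_le_sum) auto
      ultimately have "dist (x0, x0) (z, ii z) < r1" by (simp add: algebra_simps)
      then show ?thesis using r1 by auto
    qed
    then show ?thesis using that[of "min d (r1 / (1 + K))"] K r1 by simp
  qed
  have S1x0: "S1 x0 = \<eta>" and D10: "\<And>z v. (z, x0) \<in> U \<Longrightarrow> ?D (z, x0) (v, 0) = v"
  proof -
    have "m (z, x0) = z" if "(z, x0) \<in> U" for z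
      using inU[OF that] chart_inv_eq[OF chM c1] openin_subset[of "mtop M" "cdom M ?e"] c1 chM ptsM
      by (auto simp: cinvx0 charted_def)
    note mz = this
    show "?D (z, x0) (v, 0) = v" if z: "(z, x0) \<in> U" for z v
    proof -
      obtain r where r: "r > 0" "ball (z, x0) r \<subseteq> U" using oU z open_contains_ball by blast
      have "((\<lambda>y. m (y, x0)) has_derivative (\<lambda>v. ?D (z, x0) (v, 0))) (at z)"
        by (rule has_derivative_compose[where f = "\<lambda>y. (y, x0)" and g = m, OF _ hdm[OF z]])
          (auto intro!: derivative_eq_intros)
      moreover have "((\<lambda>y. m (y, x0)) has_derivative (\<lambda>v. v)) (at z)"
      proof (rule has_derivative_transform_within_open[where f = "\<lambda>y. y" and s = "ball z r"])
        fix y assume "y \<in> ball z r"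
        then have "(y, x0) \<in> ball (z, x0) r" by (simp add: dist_Pair_Pair)
        then show "y = m (y, x0)" using r mz by auto
      qed (use r in auto)
      ultimately show ?thesis by (metis has_derivative_unique)
    qed
    have mz2: "m (x0, y) = y" if "(x0, y) \<in> U" for y
      using inU[OF that] chart_inv_eq[OF chM c1] openin_subset[of "mtop M" "cdom M ?e"] c1 chM ptsM
      by (auto simp: cinvx0 charted_def)
    have "((\<lambda>y. m (x0, y)) has_derivative (\<lambda>v. ?D (x0, x0) (0, v))) (at x0)"
      by (rule has_derivative_compose[where f = "\<lambda>y. (x0, y)" and g = m, OF _ hdm[OF xU]])
        (auto intro!: derivative_eq_intros)
    moreover have "((\<lambda>y. m (x0, y)) has_derivative (\<lambda>v. v)) (at x0)"
    proof (rule has_derivative_transform_within_open[where f = "\<lambda>y. y" and s = "ball x0 r1"])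
      fix y assume "y \<in> ball x0 r1"
      then have "(x0, y) \<in> ball (x0, x0) r1" by (simp add: dist_Pair_Pair)
      then show "y = m (x0, y)" using r1 mz2 by auto
    qed (use r1 in auto)
    ultimately show "S1 x0 = \<eta>" unfolding S1_def by (metis has_derivative_unique)
  qed
  \<comment> \<open>As \<open>m (z, x0) = z\<close>, the first partial derivative of
    \<open>m\<close> is constantly the identity along this slice.\<close>
  have d2z: "?d2 (v, 0) (h, 0) = 0" for v h
  proof -
    have "((\<lambda>y. ?D y (v, 0)) has_derivative ?d2 (v, 0)) (at (x0, x0))"
      using smooth_on_differentiable[OF smooth_on_derivative[OF smU] xU] frechet_derivative_works by blast
    then have "((\<lambda>z. ?D (z, x0) (v, 0)) has_derivative (\<lambda>h. ?d2 (v, 0) (h, 0))) (at x0)"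
      by (rule has_derivative_compose[where f = "\<lambda>y. (y, x0)" and g = "\<lambda>y. ?D y (v, 0)", rotated])
        (auto intro!: derivative_eq_intros)
    moreover have "((\<lambda>z. ?D (z, x0) (v, 0)) has_derivative (\<lambda>h. 0)) (at x0)"
    proof (rule has_derivative_transform_within_open[where f = "\<lambda>z. v" and s = "ball x0 r1"])
      fix y assume "y \<in> ball x0 r1"
      then have "(y, x0) \<in> ball (x0, x0) r1" by (simp add: dist_Pair_Pair)
      then show "v = ?D (y, x0) (v, 0)" using r1 D10 by auto
    qed (use r1 in auto)
    ultimately show ?thesis by (metis has_derivative_unique)
  qed
  obtain Wi where Wi: "openin (mtop M) Wi" "?e \<in> Wi" "(\<lambda>g. inv g) ` (C \<inter> Wi) \<subseteq> cdom M ?e"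
    using inv_mderiv by (auto simp: mderiv_def)
  obtain r3 where r3: "r3 > 0" "\<And>y. dist (cmap M ?e ?e) y < r3 \<Longrightarrow>
    y \<in> cmap M ?e ` (cdom M ?e \<inter> Wi) \<and> cinv M ?e y \<in> cdom M ?e \<inter> Wi \<and> cmap M ?e (cinv M ?e y) = y"
    using chart_near[OF chM eM(1) Wi(1,2)] by blast
  define DS where "DS h = ?d2 (\<eta>, 0) (h, - h) + ?D (x0, x0) (?d2 (0, \<eta>) (h, 0), 0)" for h
  have sS2: "strict_deriv S2 DS x0 ?O"
  proof -
    have a: "strict_deriv (\<lambda>z. ((z, ii z), (S1 z, 0))) (\<lambda>h. ((h, - h), (?d2 (0, \<eta>) (h, 0), 0))) x0 ?O"
      by (intro strict_deriv_Pair strict_deriv_const sdi sS1 strict_deriv_bounded_linear bounded_linear_ident)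
    have SD': "strict_deriv (\<lambda>z. ?D (fst z) (snd z)) (\<lambda>h. ?d2 (\<eta>, 0) (fst h) + ?D (x0, x0) (snd h))
       ((x0, ii x0), (S1 x0, 0)) (U \<times> UNIV)" using SD[of "(\<eta>, 0)"] by (simp add: iix0 S1x0)
    show ?thesis
      using strict_deriv_compose[OF a SD' x0O r2(1)] r2(2)
      by (simp add: S2_def[abs_def] DS_def[abs_def])
  qed
  have DSeq: "DS h = ?d2 (0, \<eta>) (h, 0) - ?d2 (\<eta>, 0) (0, h)" for h
  proof -
    have l: "linear (?d2 (\<eta>, 0))"
      using smooth_on_differentiable[OF smooth_on_derivative[OF smU] xU] by (simp add: linear_frechet_derivative)
    have "?d2 (\<eta>, 0) (h, - h) = ?d2 (\<eta>, 0) (h, 0) - ?d2 (\<eta>, 0) (0, h)"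
      by (simp flip: linear_diff[OF l])
    then show ?thesis by (simp add: DS_def D10[OF xU] d2z)
  qed
  \<comment> \<open>At \<open>h = \<eta>\<close> the two terms of \<open>DSeq\<close> are the mixed
    second derivatives of \<open>m\<close> in the same pair of directions, taken in opposite
    order.\<close>
  have "DS \<eta> = 0"
    using symmetric_second_derivative[OF fd2 oU xU smU, of "(0, \<eta>)" "(\<eta>, 0)"] by (simp add: DSeq)
  moreover have "mderiv M C vec_mfd (\<lambda>g. Ad G g \<eta>) ?e DS"
    unfolding mderiv_to_vec
  proof (intro conjI one_closed eM)
    show "strict_deriv ((\<lambda>g. Ad G g \<eta>) \<circ> cinv M ?e) DS (cmap M ?e ?e) ?O"
      unfolding x0_def[symmetric]
    proof (rule strict_deriv_transform[OF sS2])
      show "min (min r1 r2) r3 > 0" using r1 r2 r3 by simp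
      fix z assume z: "z \<in> ?O" "dist x0 z < min (min r1 r2) r3"
      obtain g where g: "g \<in> C" "g \<in> cdom M ?e" "z = cmap M ?e g" using z by blast
      have cg: "cinv M ?e z = g" using g chart_inv_eq[OF chM c1] by simp
      have zU: "(z, x0) \<in> U" using z r1 dist1 by auto
      have ziU: "(z, ii z) \<in> U" using z r2 by auto
      have ciz: "cinv M ?e (ii z) = inv g"
      proof -
        have "inv g \<in> cdom M ?e" using r3(2)[of z] z g cg Wi by (auto simp: x0_def)
        moreover have "ii z = cmap M ?e (inv g)" by (simp add: ii_def cg)
        ultimately show ?thesis using chart_inv_eq[OF chM c1] by simp
      qed
      have mz: "m (z, x0) = z"
      proof -
        have "m (z, x0) = cmap M ?e (cinv M ?e z \<otimes> ?e)" using inU[OF zU] by (simp add: cinvx0)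
        then show ?thesis unfolding cg using g by simp
      qed
      have h1: "((\<lambda>y. m (z, y)) has_derivative (\<lambda>v. ?D (z, x0) (0, v))) (at x0)"
        by (rule has_derivative_compose[where f = "\<lambda>y. (z, y)" and g = m, OF _ hdm[OF zU]])
          (auto intro!: derivative_eq_intros)
      have ziU': "(m (z, x0), ii z) \<in> U" using ziU mz by simp
      have h2: "((\<lambda>y. (m (z, y), ii z)) has_derivative (\<lambda>v. (?D (z, x0) (0, v), 0))) (at x0)"
        by (rule has_derivative_Pair[OF h1]) simp
      have h3: "((\<lambda>y. m (m (z, y), ii z)) has_derivative (\<lambda>v. ?D (z, ii z) (?D (z, x0) (0, v), 0))) (at x0)"
        using has_derivative_compose[where f = "\<lambda>y. (m (z, y), ii z)" and g = m, OF h2 hdm[OF ziU']] mz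
        by simp
      have h5: "((cmap M ?e \<circ> (\<lambda>x. g \<otimes> x \<otimes> inv g) \<circ> cinv M ?e) has_derivative Ad G g) (at x0 within ?O)"
        using mderiv_has_derivative[OF chM Ad_mderiv[OF g(1)]] g by (simp add: x0_def)
      have oO: "open ?O" using chart_image_open[OF chM c1 openC] by (simp add: Int_commute)
      have h4: "((cmap M ?e \<circ> (\<lambda>x. g \<otimes> x \<otimes> inv g) \<circ> cinv M ?e) has_derivative Ad G g) (at x0)"
        using h5 unfolding at_within_open[OF x0O oO] .
      have "\<forall>\<^sub>F y in nhds x0. (z, y) \<in> U \<and> (m (z, y), ii z) \<in> U"
      proof -
        have "isCont (\<lambda>y. m (z, y)) x0" using has_derivative_continuous[OF h1] .
        then have "isCont (\<lambda>y. (m (z, y), ii z)) x0" by (intro continuous_intros)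
        moreover have "isCont (\<lambda>y. (z, y)) x0" by (intro continuous_intros)
        ultimately show ?thesis using oU zU ziU'
          by (intro eventually_conj) (auto simp: continuous_at_open eventually_nhds)
      qed
      then obtain V where V: "open V" "x0 \<in> V" "\<And>y. y \<in> V \<Longrightarrow> (z, y) \<in> U \<and> (m (z, y), ii z) \<in> U"
        unfolding eventually_nhds by blast
      have "((cmap M ?e \<circ> (\<lambda>x. g \<otimes> x \<otimes> inv g) \<circ> cinv M ?e) has_derivative (\<lambda>v. ?D (z, ii z) (?D (z, x0) (0, v), 0))) (at x0)"
      proof (rule has_derivative_transform_within_open[OF h3 V(1,2)])
        fix y assume "y \<in> V"
        then have y: "(z, y) \<in> U" "(m (z, y), ii z) \<in> U" using V by auto
        show "m (m (z, y), ii z) = (cmap M ?e \<circ> (\<lambda>x. g \<otimes> x \<otimes> inv g) \<circ> cinv M ?e) y"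
          using inU[OF y(1)] inU[OF y(2)] chart_inv_eq[OF chM c1] by (auto simp: cg ciz)
      qed
      from has_derivative_unique[OF this h4]
      have "Ad G g \<eta> = S2 z" by (auto simp: S2_def S1_def dest: fun_cong[of _ _ \<eta>])
      then show "z \<in> ?O \<and> ((\<lambda>g. Ad G g \<eta>) \<circ> cinv M ?e) z = S2 z" using z cg by simp
    qed
  qed
  ultimately show ?thesis by blast
qed

lemma bracket_mderiv: "mderiv M C vec_mfd (\<lambda>g. Ad G g \<eta>) \<one> (\<lambda>\<xi>. bracket G \<xi> \<eta>)"
proof -
  obtain D where D: "mderiv M C vec_mfd (\<lambda>g. Ad G g \<eta>) \<one> D" using Ad_mderiv_one by metis
  have "mderiv M C vec_mfd (\<lambda>g. Ad G g \<eta>) \<one> (tmap M C vec_mfd (\<lambda>g. Ad G g \<eta>) \<one>)"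
    by (rule mderiv_tmap(1)[OF chM D]) (rule velC[OF one_closed])
  moreover have "tmap M C vec_mfd (\<lambda>g. Ad G g \<eta>) \<one> = (\<lambda>\<xi>. bracket G \<xi> \<eta>)"
    by (simp add: bracket_def[abs_def])
  ultimately show ?thesis by simp
qed

lemma bracket_self: "bracket G \<xi> \<xi> = 0"
proof -
  obtain D where D: "mderiv M C vec_mfd (\<lambda>g. Ad G g \<xi>) \<one> D" "D \<xi> = 0" using Ad_mderiv_one by metis
  from fun_cong[OF mderiv_uniqueM[OF D(1) bracket_mderiv], of \<xi>] D(2) show ?thesis by simp
qed

lemma bracket_linear_left: "linear (\<lambda>\<xi>. bracket G \<xi> \<eta>)"
  by (rule bounded_linear.linear[OF mderiv_linear[OF bracket_mderiv]])

lemma mderiv_vec_add: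
  assumes "charted X" "mderiv X A vec_mfd f p D" "mderiv X A vec_mfd f' p D'"
  shows "mderiv X A vec_mfd (\<lambda>x. f x + f' x) p (\<lambda>v. D v + D' v)"
proof -
  have "cmap X p p \<in> cmap X p ` (A \<inter> cdom X p)"
    using assms charted_mem[OF assms(1)] mderiv_mem[OF assms(2)] by blast
  then show ?thesis using assms(2,3) strict_deriv_add unfolding mderiv_to_vec o_def by blast
qed

lemma mderiv_vec_linear:
  assumes "charted X" "mderiv X A vec_mfd f p D" "bounded_linear L"
  shows "mderiv X A vec_mfd (\<lambda>x. L (f x)) p (\<lambda>v. L (D v))"
proof -
  have "cmap X p p \<in> cmap X p ` (A \<inter> cdom X p)"
    using assms charted_mem[OF assms(1)] mderiv_mem[OF assms(2)] by blast
  then show ?thesis using assms(2) strict_deriv_linear_comp[OF assms(3)] unfolding mderiv_to_vec o_def by blast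
qed

lemma bracket_linear_right: "linear (\<lambda>\<eta>. bracket G \<xi> \<eta>)"
proof (rule linearI)
  fix a b
  have "mderiv M C vec_mfd (\<lambda>g. Ad G g a + Ad G g b) \<one> (\<lambda>\<xi>. bracket G \<xi> a + bracket G \<xi> b)"
    by (rule mderiv_vec_add[OF chM bracket_mderiv bracket_mderiv])
  then have "mderiv M C vec_mfd (\<lambda>g. Ad G g (a + b)) \<one> (\<lambda>\<xi>. bracket G \<xi> a + bracket G \<xi> b)"
    by (rule mderiv_cong[OF chM]) (simp add: linear_add[OF Ad_linear])
  from fun_cong[OF mderiv_uniqueM[OF this bracket_mderiv], of \<xi>]
  show "bracket G \<xi> (a + b) = bracket G \<xi> a + bracket G \<xi> b" by simp
next
  fix r :: real and b
  have "mderiv M C vec_mfd (\<lambda>g. r *\<^sub>R Ad G g b) \<one> (\<lambda>\<xi>. r *\<^sub>R bracket G \<xi> b)"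
    by (rule mderiv_vec_linear[OF chM bracket_mderiv bounded_linear_scaleR_right])
  then have "mderiv M C vec_mfd (\<lambda>g. Ad G g (r *\<^sub>R b)) \<one> (\<lambda>\<xi>. r *\<^sub>R bracket G \<xi> b)"
    by (rule mderiv_cong[OF chM]) (simp add: linear_scale[OF Ad_linear])
  from fun_cong[OF mderiv_uniqueM[OF this bracket_mderiv], of \<xi>]
  show "bracket G \<xi> (r *\<^sub>R b) = r *\<^sub>R bracket G \<xi> b" by simp
qed

lemmas bracket_simps = linear_add[OF bracket_linear_left] linear_add[OF bracket_linear_right]
  linear_scale[OF bracket_linear_left] linear_scale[OF bracket_linear_right]
  linear_0[OF bracket_linear_left] linear_0[OF bracket_linear_right]
  linear_neg[OF bracket_linear_left] linear_neg[OF bracket_linear_right]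
  linear_diff[OF bracket_linear_left] linear_diff[OF bracket_linear_right]

lemma bracket_skew: "bracket G \<xi> \<eta> = - bracket G \<eta> \<xi>"
proof -
  have "0 = bracket G (\<xi> + \<eta>) (\<xi> + \<eta>)" by (rule bracket_self[symmetric])
  also have "\<dots> = (bracket G \<xi> \<xi> + bracket G \<eta> \<eta>) + (bracket G \<xi> \<eta> + bracket G \<eta> \<xi>)"
    by (simp only: bracket_simps ac_simps)
  finally have "bracket G \<xi> \<eta> + bracket G \<eta> \<xi> = 0" by (simp add: bracket_self)
  then show ?thesis by (simp add: eq_neg_iff_add_eq_0)
qed

section \<open>The coadjoint action and its derivative\<close>

lemma coAd_apply: "g \<in> C \<Longrightarrow> blinfun_apply (coAd G g \<nu>) \<eta> = \<nu> (Ad G g \<eta>)"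
proof -
  assume g: "g \<in> C"
  have "linear (\<lambda>\<eta>. \<nu> (Ad G g \<eta>))"
    using linear_compose[OF Ad_linear[OF g] bounded_linear.linear[OF blinfun.bounded_linear_right[of \<nu>]]]
    by (simp add: o_def)
  then show ?thesis unfolding coAd_def by (simp add: blinfun_apply_Blinfun_fin_dim[OF fd])
qed

lemma coad_apply: "blinfun_apply (coad G \<xi> \<nu>) \<eta> = \<nu> (bracket G \<xi> \<eta>)"
proof -
  have "linear (\<lambda>\<eta>. \<nu> (bracket G \<xi> \<eta>))"
    using linear_compose[OF bracket_linear_right bounded_linear.linear[OF blinfun.bounded_linear_right[of \<nu>]]]
    by (simp add: o_def)
  then show ?thesis unfolding coad_def by (simp add: blinfun_apply_Blinfun_fin_dim[OF fd])
qed

lemma coAd_mult: "g \<in> C \<Longrightarrow> h \<in> C \<Longrightarrow> coAd G (g \<otimes> h) \<nu> = coAd G h (coAd G g \<nu>)"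
  by (rule blinfun_eqI) (simp add: coAd_apply Ad_mult)

lemma coAd_one: "coAd G \<one> \<nu> = \<nu>"
  by (rule blinfun_eqI) (simp add: coAd_apply Ad_one)

lemma coAd_inv: "g \<in> C \<Longrightarrow> coAd G (inv g) (coAd G g \<nu>) = \<nu>" "g \<in> C \<Longrightarrow> coAd G g (coAd G (inv g) \<nu>) = \<nu>"
  using coAd_mult[of g "inv g" \<nu>] coAd_mult[of "inv g" g \<nu>] coAd_one by auto

lemma coAd_linear: "g \<in> C \<Longrightarrow> linear (coAd G g)"
  by (rule linearI; rule blinfun_eqI) (simp_all add: coAd_apply blinfun.add_left blinfun.scaleR_left)

lemma coAd_bounded_linear: "g \<in> C \<Longrightarrow> bounded_linear (coAd G g)"
  by (rule fin_dim_bounded_linear[OF fdd coAd_linear])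

lemma coad_linear: "linear (\<lambda>\<xi>. coad G \<xi> \<nu>)" "linear (coad G \<xi>)"
  by (rule linearI; rule blinfun_eqI; simp add: coad_apply bracket_simps blinfun.add_left blinfun.scaleR_left
    blinfun.add_right blinfun.scaleR_right)+

lemma coad_bounded_linear: "bounded_linear (\<lambda>\<xi>. coad G \<xi> \<nu>)"
  by (rule fin_dim_bounded_linear[OF fd coad_linear(1)])

lemma stab_iff: "g \<in> stab G \<mu> \<longleftrightarrow> g \<in> C \<and> coAd G g \<mu> = \<mu>"
  unfolding stab_def using coAd_inv by (metis (mono_tags, lifting) mem_Collect_eq)

lemma stab_alg_iff: "\<xi> \<in> stab_alg G \<mu> \<longleftrightarrow> (\<forall>\<eta>. \<mu> (bracket G \<xi> \<eta>) = 0)"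
proof
  assume "\<xi> \<in> stab_alg G \<mu>"
  then have "coad G \<xi> \<mu> = 0" by (simp add: stab_alg_def)
  then show "\<forall>\<eta>. \<mu> (bracket G \<xi> \<eta>) = 0" by (simp flip: coad_apply)
next
  assume "\<forall>\<eta>. \<mu> (bracket G \<xi> \<eta>) = 0"
  then have "coad G \<xi> \<mu> = 0" by (intro blinfun_eqI) (simp add: coad_apply)
  then show "\<xi> \<in> stab_alg G \<mu>" by (simp add: stab_alg_def)
qed

lemma subspace_stab_alg: "subspace (stab_alg G \<mu>)"
  unfolding subspace_def by (simp add: stab_alg_iff bracket_simps blinfun.add_right blinfun.scaleR_right)

lemma stab_mult: "g \<in> stab G \<mu> \<Longrightarrow> h \<in> stab G \<mu> \<Longrightarrow> g \<otimes> h \<in> stab G \<mu>"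
  by (simp add: stab_iff coAd_mult)

lemma stab_one: "\<one> \<in> stab G \<mu>" by (simp add: stab_iff coAd_one)

text \<open>Joint in both arguments, because along the tube the group element and the covector
  depend on the same parameter. Group elements away from the identity are handled by splitting off a
  constant factor.\<close>

lemma coAd_mderiv:
  "mderiv (prod_mfd M vec_mfd) (C \<times> UNIV) vec_mfd (\<lambda>z. coAd G (fst z) (snd z)) (\<one>, \<mu>)
    (\<lambda>v. snd v + coad G (fst v) \<mu>)"
  unfolding mderiv_to_vec
proof (intro conjI)
  let ?P = "prod_mfd M (vec_mfd :: ('g dual, 'g dual) manifold)"
  show mem: "(\<one>, \<mu>) \<in> C \<times> UNIV" "(\<one>, \<mu>) \<in> pts ?P" using ptsM by auto
  note c2 = charted_chart_at[OF chMV mem(2)]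
  have e: "\<one> \<in> pts M" using ptsM by simp
  note c1 = charted_chart_at[OF chM e]
  let ?x = "cmap ?P (\<one>, \<mu>) (\<one>, \<mu>)"
  let ?S = "cmap ?P (\<one>, \<mu>) ` (C \<times> UNIV \<inter> cdom ?P (\<one>, \<mu>))"
  have xS: "?x \<in> ?S" using mem charted_mem[OF chMV mem(2)] by blast
  have inS: "fst z \<in> cmap M \<one> ` (C \<inter> cdom M \<one>)" "cinv ?P (\<one>, \<mu>) z = (cinv M \<one> (fst z), snd z)" if zS: "z \<in> ?S" for z
  proof -
    obtain w where w: "w \<in> C \<times> UNIV \<inter> cdom ?P (\<one>, \<mu>)" "z = cmap ?P (\<one>, \<mu>) w" using zS by blast
    obtain g \<beta> where "w = (g, \<beta>)" by (cases w)
    with w have g: "g \<in> C" "g \<in> cdom M \<one>" "z = (cmap M \<one> g, \<beta>)" by simp_all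
    have "(g, \<beta>) \<in> cdom ?P (\<one>, \<mu>)" using g by simp
    from chart_inv_eq[OF chMV c2 this] have "cinv ?P (\<one>, \<mu>) z = (g, \<beta>)" using g by simp
    then show "fst z \<in> cmap M \<one> ` (C \<inter> cdom M \<one>)" "cinv ?P (\<one>, \<mu>) z = (cinv M \<one> (fst z), snd z)"
      using g chart_inv_eq[OF chM c1] by auto
  qed
  show "strict_deriv ((\<lambda>z. coAd G (fst z) (snd z)) \<circ> cinv ?P (\<one>, \<mu>)) (\<lambda>v. snd v + coad G (fst v) \<mu>) ?x ?S"
  proof (rule strict_deriv_blinfun[OF fd])
    show "bounded_linear (\<lambda>v. snd v + coad G (fst v) \<mu>)"
      by (intro bounded_linear_add bounded_linear_snd bounded_linear_compose[OF coad_bounded_linear bounded_linear_fst])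
    fix \<eta>
    have A: "strict_deriv ((\<lambda>g. Ad G g \<eta>) \<circ> cinv M \<one>) (\<lambda>\<xi>. bracket G \<xi> \<eta>) (cmap M \<one> \<one>) (cmap M \<one> ` (C \<inter> cdom M \<one>))"
      using bracket_mderiv unfolding mderiv_to_vec by blast
    have f: "strict_deriv fst fst ?x ?S" by (rule strict_deriv_bounded_linear[OF bounded_linear_fst])
    have A2: "strict_deriv (\<lambda>z. ((\<lambda>g. Ad G g \<eta>) \<circ> cinv M \<one>) (fst z)) (\<lambda>v. bracket G (fst v) \<eta>) ?x ?S"
    proof (rule strict_deriv_compose[OF f _ xS zero_less_one])
      show "strict_deriv ((\<lambda>g. Ad G g \<eta>) \<circ> cinv M \<one>) (\<lambda>\<xi>. bracket G \<xi> \<eta>) (fst ?x) (cmap M \<one> ` (C \<inter> cdom M \<one>))"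
        using A by simp
    qed (rule inS(1))
    have "strict_deriv (\<lambda>z. blinfun_apply (snd z) (((\<lambda>g. Ad G g \<eta>) \<circ> cinv M \<one>) (fst z)))
      (\<lambda>h. blinfun_apply (snd ?x) (bracket G (fst h) \<eta>) + blinfun_apply (snd h) (((\<lambda>g. Ad G g \<eta>) \<circ> cinv M \<one>) (fst ?x))) ?x ?S"
      by (rule strict_deriv_bilinear_comp[OF bounded_bilinear_blinfun_apply
        strict_deriv_bounded_linear[OF bounded_linear_snd] A2 xS])
    moreover have "(\<lambda>h. blinfun_apply (snd ?x) (bracket G (fst h) \<eta>) + blinfun_apply (snd h) (((\<lambda>g. Ad G g \<eta>) \<circ> cinv M \<one>) (fst ?x)))
      = (\<lambda>h. blinfun_apply (snd h + coad G (fst h) \<mu>) \<eta>)"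
      using chart_inv_eq[OF chM c1 charted_mem[OF chM e]]
      by (simp add: blinfun.add_left coad_apply Ad_one add.commute)
    ultimately have "strict_deriv (\<lambda>z. blinfun_apply (snd z) (((\<lambda>g. Ad G g \<eta>) \<circ> cinv M \<one>) (fst z)))
      (\<lambda>h. blinfun_apply (snd h + coad G (fst h) \<mu>) \<eta>) ?x ?S" by simp
    then show "strict_deriv (\<lambda>z. blinfun_apply (((\<lambda>z. coAd G (fst z) (snd z)) \<circ> cinv ?P (\<one>, \<mu>)) z) \<eta>)
      (\<lambda>h. blinfun_apply (snd h + coad G (fst h) \<mu>) \<eta>) ?x ?S"
    proof (rule strict_deriv_transform[OF _ zero_less_one])
      fix z assume z: "z \<in> ?S"
      then have "cinv M \<one> (fst z) \<in> C" using inS(1)[OF z] chart_inv_eq[OF chM c1] by auto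
      then show "z \<in> ?S \<and> blinfun_apply (((\<lambda>z. coAd G (fst z) (snd z)) \<circ> cinv ?P (\<one>, \<mu>)) z) \<eta> =
        blinfun_apply (snd z) (((\<lambda>g. Ad G g \<eta>) \<circ> cinv M \<one>) (fst z))"
        using z inS(2)[OF z] by (simp add: coAd_apply)
    qed
  qed
qed

lemma mderiv_coAd:
  assumes X: "charted X" and f: "mderiv X A M f p D" and b: "mderiv X A vec_mfd b p E"
    and A: "\<And>x. x \<in> A \<Longrightarrow> f x \<in> C" and fp: "f p = \<one>"
  shows "mderiv X A vec_mfd (\<lambda>x. coAd G (f x) (b x)) p (\<lambda>v. E v + coad G (D v) (b p))"
proof -
  have "mderiv X A vec_mfd (\<lambda>x. (\<lambda>z. coAd G (fst z) (snd z)) (f x, b x)) p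
    (\<lambda>v. snd (D v, E v) + coad G (fst (D v, E v)) (b p))"
  proof (rule mderiv_compose_simple[OF X chMV chV mderiv_Pair[OF X chM chV f b]])
    show "mderiv (prod_mfd M vec_mfd) (C \<times> UNIV) vec_mfd (\<lambda>z. coAd G (fst z) (snd z)) (f p, b p)
      (\<lambda>v. snd v + coad G (fst v) (b p))" unfolding fp by (rule coAd_mderiv)
  qed (use A in auto)
  then show ?thesis by simp
qed

lemma mderiv_inv:
  assumes X: "charted X" and f: "mderiv X A M f p D"
    and A: "\<And>x. x \<in> A \<Longrightarrow> f x \<in> C" and fp: "f p = \<one>"
  shows "mderiv X A M (\<lambda>x. inv (f x)) p (\<lambda>v. - D v)"
  by (rule mderiv_compose_simple[OF X chM chM f, of C "\<lambda>g. inv g" "\<lambda>v. - v"])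
    (use A inv_mderiv fp in auto)

lemma coAd_mderiv_const: "mderiv M C vec_mfd (\<lambda>g. coAd G g \<mu>) \<one> (\<lambda>\<xi>. coad G \<xi> \<mu>)"
proof -
  have "mderiv M C vec_mfd (\<lambda>g. \<mu>) \<one> (\<lambda>v. 0)"
    by (rule mderiv_const[OF chV]) (auto simp: ptsM)
  from mderiv_coAd[OF chM idM[OF one_closed] this] show ?thesis by simp
qed

lemma Ad_mderiv_at: "h \<in> C \<Longrightarrow> \<exists>D. mderiv M C vec_mfd (\<lambda>g. Ad G g \<eta>) h D"
proof -
  assume h: "h \<in> C"
  have "mderiv M C vec_mfd (\<lambda>g. Ad G (inv h \<otimes> g) \<eta>) h (\<lambda>v. bracket G (dmult (inv h) h (0, v)) \<eta>)"
    by (rule mderiv_compose_simple[OF chM chM chV left_mderiv[OF inv_closed[OF h] h]])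
      (use h bracket_mderiv in auto)
  then have "mderiv M C vec_mfd (\<lambda>g. Ad G h (Ad G (inv h \<otimes> g) \<eta>)) h (\<lambda>v. Ad G h (bracket G (dmult (inv h) h (0, v)) \<eta>))"
    by (rule mderiv_vec_linear[OF chM _ linear_fd[OF Ad_linear[OF h]]])
  then have "mderiv M C vec_mfd (\<lambda>g. Ad G g \<eta>) h (\<lambda>v. Ad G h (bracket G (dmult (inv h) h (0, v)) \<eta>))"
    by (rule mderiv_cong[OF chM]) (simp add: h flip: Ad_mult m_assoc)
  then show ?thesis by blast
qed

lemma Ad_bounded_on_compact:
  assumes "compactin (mtop M) K"
  shows "\<exists>b. \<forall>h\<in>K. norm (Ad G h \<eta>) \<le> b"
proof -
  have "K \<subseteq> C" using assms ptsM by (simp add: compactin_def)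
  then show ?thesis by (intro mderiv_bounded_on_compact[OF chM assms, of C]) (use Ad_mderiv_at in auto)
qed

lemma mult_near_one:
  assumes "openin (mtop M) N" "\<one> \<in> N"
  obtains V where "openin (mtop M) V" "\<one> \<in> V" "V \<subseteq> C" "\<And>g h. g \<in> V \<Longrightarrow> h \<in> V \<Longrightarrow> g \<otimes> h \<in> N"
proof -
  obtain W where W: "openin (mtop (prod_mfd M M)) W" "(\<one>, \<one>) \<in> W"
    "\<And>x. x \<in> C \<times> C \<Longrightarrow> x \<in> W \<Longrightarrow> (\<lambda>(g, h). g \<otimes> h) x \<in> N"
    using mderiv_continuous[OF chMM chM mult_mderiv[OF one_closed one_closed] assms(1)] assms(2) by auto
  have "\<exists>V1 V2. openin (mtop M) V1 \<and> openin (mtop M) V2 \<and> \<one> \<in> V1 \<and> \<one> \<in> V2 \<and> V1 \<times> V2 \<subseteq> W"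
    using W(1,2) unfolding chart_at_prod openin_prod_topology_alt by simp
  then obtain V1 V2 where V: "openin (mtop M) V1" "openin (mtop M) V2" "\<one> \<in> V1" "\<one> \<in> V2" "V1 \<times> V2 \<subseteq> W"
    by (elim exE conjE)
  have sub: "V1 \<inter> V2 \<subseteq> C" using openin_subset[OF V(1)] ptsM by auto
  show ?thesis
  proof (rule that[of "V1 \<inter> V2"])
    fix g h assume gh: "g \<in> V1 \<inter> V2" "h \<in> V1 \<inter> V2"
    then have "(g, h) \<in> W" using V(5) by auto
    moreover have "(g, h) \<in> C \<times> C" using gh sub by auto
    ultimately show "g \<otimes> h \<in> N" using W(3)[of "(g, h)"] by simp
  qed (use V sub in auto)
qed

lemma left_translate_open:
  assumes "k \<in> C" "openin (mtop M) W"
  shows "openin (mtop M) ((\<lambda>g. k \<otimes> g) ` W)"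
proof (subst openin_subopen, intro ballI)
  have WC: "W \<subseteq> C" using openin_subset[OF assms(2)] ptsM by simp
  fix x assume "x \<in> (\<lambda>g. k \<otimes> g) ` W"
  then obtain g where g: "g \<in> W" "x = k \<otimes> g" by blast
  have xC: "x \<in> C" using g WC assms(1) by auto
  have gx: "inv k \<otimes> x \<in> W" using g subsetD[OF WC g(1)] assms(1) by (simp add: m_assoc[symmetric])
  obtain V where V: "openin (mtop M) V" "x \<in> V" "\<And>y. y \<in> C \<Longrightarrow> y \<in> V \<Longrightarrow> inv k \<otimes> y \<in> W"
    using mderiv_continuous[OF chM chM left_mderiv[OF inv_closed[OF assms(1)] xC] assms(2) gx] by metis
  have "V \<subseteq> (\<lambda>g. k \<otimes> g) ` W"
  proof
    fix y assume y: "y \<in> V"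
    then have "y \<in> C" using openin_subset[OF V(1)] ptsM by auto
    then have "inv k \<otimes> y \<in> W" "y = k \<otimes> (inv k \<otimes> y)" using V(3) y assms(1) by (simp_all add: m_assoc[symmetric])
    then show "y \<in> (\<lambda>g. k \<otimes> g) ` W" by blast
  qed
  then show "\<exists>T. openin (mtop M) T \<and> x \<in> T \<and> T \<subseteq> (\<lambda>g. k \<otimes> g) ` W" using V by blast
qed

section \<open>Estimates near the identity and the local slice for the coadjoint orbit\<close>

abbreviation "x1 \<equiv> cmap M \<one> \<one>"
abbreviation "O1 \<equiv> cmap M \<one> ` (C \<inter> cdom M \<one>)"

lemma one_pts: "\<one> \<in> pts M" using ptsM by simp
lemma chart_one: "chart_at M \<one> \<in> atlas M" by (rule charted_chart_at[OF chM one_pts])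
lemma cinv_cmap_one: "g \<in> cdom M \<one> \<Longrightarrow> cinv M \<one> (cmap M \<one> g) = g" by (rule chart_inv_eq[OF chM chart_one])
lemma one_cdom: "\<one> \<in> cdom M \<one>" by (rule charted_mem[OF chM one_pts])
lemma cdom_C: "cdom M \<one> \<subseteq> C" using chM chart_one openin_subset ptsM unfolding charted_def by metis
lemma openO1: "open O1" using chart_image_open[OF chM chart_one openC] by (simp add: Int_commute)
lemma x1_O1: "x1 \<in> O1" using one_cdom by blast
lemma cinvO1: "z \<in> O1 \<Longrightarrow> cinv M \<one> z \<in> cdom M \<one> \<and> cinv M \<one> z \<in> C \<and> cmap M \<one> (cinv M \<one> z) = z"
  using cinv_cmap_one by auto

text \<open>The derivative of \<open>coAd\<close> at \<open>(\<one>, 0)\<close> is just the covector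
  component. Strictness, applied to the points \<open>(z, \<beta>)\<close> and
  \<open>(z, 0)\<close>, therefore gives the estimate for small \<open>\<beta>\<close>, and
  homogeneity extends it to all \<open>\<beta>\<close> on the same neighbourhood of
  \<open>x1\<close>.\<close>

lemma coAd_near_one:
  assumes "e > 0"
  obtains r where "r > 0" "\<And>z \<beta>. z \<in> O1 \<Longrightarrow> dist x1 z < r \<Longrightarrow> norm (coAd G (cinv M \<one> z) \<beta> - \<beta>) \<le> e * norm \<beta>"
proof -
  let ?P = "prod_mfd M (vec_mfd :: ('g dual, 'g dual) manifold)"
  let ?f = "(\<lambda>z. coAd G (fst z) (snd z)) \<circ> cinv ?P (\<one>, 0)"
  let ?S = "cmap ?P (\<one>, 0) ` (C \<times> UNIV \<inter> cdom ?P (\<one>, 0))"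
  have sd: "strict_deriv ?f (\<lambda>v. snd v + coad G (fst v) 0) (cmap ?P (\<one>, 0) (\<one>, 0)) ?S"
    using coAd_mderiv[of 0] unfolding mderiv_to_vec by blast
  have c0: "coad G \<xi> 0 = 0" for \<xi> using linear_0[OF coad_linear(2)] .
  obtain d where d: "d > 0" "\<And>y z. y \<in> ?S \<Longrightarrow> z \<in> ?S \<Longrightarrow> dist (x1, 0) y < d \<Longrightarrow> dist (x1, 0) z < d \<Longrightarrow>
    norm (?f y - ?f z - (snd (y - z) + coad G (fst (y - z)) 0)) \<le> e * norm (y - z)"
    using strict_derivD[OF sd assms] by auto
  have mem: "(\<one>, 0 :: 'g dual) \<in> pts ?P" using one_pts by simp
  have inS: "(z, \<beta>) \<in> ?S" "?f (z, \<beta>) = coAd G (cinv M \<one> z) \<beta>" if z: "z \<in> O1" for z \<beta>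
  proof -
    have w: "(cinv M \<one> z, \<beta>) \<in> C \<times> UNIV \<inter> cdom ?P (\<one>, 0)" "cmap ?P (\<one>, 0) (cinv M \<one> z, \<beta>) = (z, \<beta>)"
      using cinvO1[OF z] by auto
    then show "(z, \<beta>) \<in> ?S" by (metis imageI)
    have "cinv ?P (\<one>, 0) (z, \<beta>) = (cinv M \<one> z, \<beta>)"
      using chart_inv_eq[OF chMV charted_chart_at[OF chMV mem], of "(cinv M \<one> z, \<beta>)"] w by auto
    then show "?f (z, \<beta>) = coAd G (cinv M \<one> z) \<beta>" by simp
  qed
  show ?thesis
  proof (rule that[of "d / 2"])
    fix z \<beta> assume z: "z \<in> O1" "dist x1 z < d / 2"
    have gC: "cinv M \<one> z \<in> C" using cinvO1[OF z(1)] by blast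
    have small: "norm (coAd G (cinv M \<one> z) \<beta> - \<beta>) \<le> e * norm \<beta>" if b: "norm \<beta> < d / 2" for \<beta>
    proof -
      have "dist (x1, 0) (z, \<beta>) \<le> dist x1 z + norm \<beta>"
        unfolding dist_Pair_Pair using sqrt_sum_squares_le_sum[of "dist x1 z" "dist 0 \<beta>"] by simp
      then have "dist (x1, 0) (z, \<beta>) < d" using z b by simp
      moreover have "dist (x1, 0 :: 'g dual) (z, 0) < d" using z d(1) by (simp add: dist_Pair_Pair)
      ultimately have "norm (?f (z, \<beta>) - ?f (z, 0) - (snd ((z, \<beta>) - (z, 0)) + coad G (fst ((z, \<beta>) - (z, 0))) 0))
        \<le> e * norm ((z, \<beta>) - (z, 0))" by (intro d(2) inS(1)[OF z(1)])
      then show ?thesis unfolding inS(2)[OF z(1)] using linear_0[OF coAd_linear[OF gC]] by (simp add: c0 norm_Pair)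
    qed
    show "norm (coAd G (cinv M \<one> z) \<beta> - \<beta>) \<le> e * norm \<beta>"
    proof (cases "\<beta> = 0")
      case True then show ?thesis using linear_0[OF coAd_linear[OF gC]] by simp
    next
      case False
      define t where "t = d / (4 * norm \<beta>)"
      have t: "t > 0" "norm (t *\<^sub>R \<beta>) < d / 2" using d(1) False by (auto simp: t_def)
      have "norm (coAd G (cinv M \<one> z) (t *\<^sub>R \<beta>) - t *\<^sub>R \<beta>) \<le> e * norm (t *\<^sub>R \<beta>)" by (rule small[OF t(2)])
      then have "t * norm (coAd G (cinv M \<one> z) \<beta> - \<beta>) \<le> t * (e * norm \<beta>)"
        using t(1) unfolding linear_scale[OF coAd_linear[OF gC]] by (simp flip: scaleR_diff_right)
      then show ?thesis using t(1) by simp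
    qed
  qed (use d in simp)
qed

text \<open>Comparing \<open>(y, z)\<close> with \<open>(z, z)\<close>, where the quotient is the
  identity, bounds the quotient by the distance of \<open>y\<close> and \<open>z\<close> themselves
  rather than by their distances to \<open>x1\<close>. The derivative along a path needs exactly
  this.\<close>

lemma quotient_lipschitz:
  obtains K r where "K > 0" "r > 0"
    "\<And>y z. y \<in> O1 \<Longrightarrow> z \<in> O1 \<Longrightarrow> dist x1 y < r \<Longrightarrow> dist x1 z < r \<Longrightarrow>
      cinv M \<one> y \<otimes> inv (cinv M \<one> z) \<in> cdom M \<one> \<and>
      norm (cmap M \<one> (cinv M \<one> y \<otimes> inv (cinv M \<one> z)) - x1) \<le> K * norm (y - z)"
proof -
  let ?P = "prod_mfd M M"
  have mem: "(\<one>, \<one>) \<in> pts ?P" using one_pts by simp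
  note c2 = charted_chart_at[OF chMM mem]
  have i: "mderiv ?P (C \<times> C) M (\<lambda>z. inv (snd z)) (\<one>, \<one>) (\<lambda>v. - snd v)"
    by (rule mderiv_inv[OF chMM mderiv_snd[OF chM chM]]) (use mem in auto)
  have q: "mderiv ?P (C \<times> C) M (\<lambda>z. fst z \<otimes> inv (snd z)) (\<one>, \<one>)
    (\<lambda>v. dmult (fst (\<one>, \<one>)) (inv (snd (\<one>, \<one>))) (fst v, - snd v))"
    by (rule mderiv_mult[OF chMM mderiv_fst[OF chM chM] i]) (use mem in auto)
  let ?f = "cmap M \<one> \<circ> (\<lambda>z. fst z \<otimes> inv (snd z)) \<circ> cinv ?P (\<one>, \<one>)"
  let ?S = "cmap ?P (\<one>, \<one>) ` (C \<times> C \<inter> cdom ?P (\<one>, \<one>))"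
  obtain D where sd: "strict_deriv ?f D (cmap ?P (\<one>, \<one>) (\<one>, \<one>)) ?S"
    using q unfolding mderiv_def by auto
  obtain K d where K: "K > 0" "d > 0" "\<And>y z. y \<in> ?S \<Longrightarrow> z \<in> ?S \<Longrightarrow> dist (x1, x1) y < d \<Longrightarrow> dist (x1, x1) z < d \<Longrightarrow>
    norm (?f y - ?f z) \<le> K * norm (y - z)" using strict_deriv_lipschitz[OF sd] by auto
  have inS: "(y, z) \<in> ?S" "?f (y, z) = cmap M \<one> (cinv M \<one> y \<otimes> inv (cinv M \<one> z))" if y: "y \<in> O1" and z: "z \<in> O1" for y z
  proof -
    have w: "(cinv M \<one> y, cinv M \<one> z) \<in> C \<times> C \<inter> cdom ?P (\<one>, \<one>)" "cmap ?P (\<one>, \<one>) (cinv M \<one> y, cinv M \<one> z) = (y, z)"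
      using cinvO1[OF y] cinvO1[OF z] by auto
    then show "(y, z) \<in> ?S" by (metis imageI)
    have "cinv ?P (\<one>, \<one>) (y, z) = (cinv M \<one> y, cinv M \<one> z)"
      using chart_inv_eq[OF chMM c2, of "(cinv M \<one> y, cinv M \<one> z)"] w by auto
    then show "?f (y, z) = cmap M \<one> (cinv M \<one> y \<otimes> inv (cinv M \<one> z))" by simp
  qed
  have oc: "openin (mtop M) (cdom M \<one>)" using chM chart_one by (simp add: charted_def)
  obtain W where W: "openin (mtop ?P) W" "(\<one>, \<one>) \<in> W" "\<And>x. x \<in> C \<times> C \<Longrightarrow> x \<in> W \<Longrightarrow> fst x \<otimes> inv (snd x) \<in> cdom M \<one>"
    using mderiv_continuous[OF chMM chM q oc] one_cdom by auto
  obtain r where r: "r > 0" "\<And>y. dist (cmap ?P (\<one>, \<one>) (\<one>, \<one>)) y < r \<Longrightarrow>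
    y \<in> cmap ?P (\<one>, \<one>) ` (cdom ?P (\<one>, \<one>) \<inter> W) \<and> cinv ?P (\<one>, \<one>) y \<in> cdom ?P (\<one>, \<one>) \<inter> W \<and> cmap ?P (\<one>, \<one>) (cinv ?P (\<one>, \<one>) y) = y"
    using chart_near[OF chMM mem W(1,2)] by blast
  show ?thesis
  proof (rule that[of K "min d r / 2"])
    fix y z assume yz: "y \<in> O1" "z \<in> O1" "dist x1 y < min d r / 2" "dist x1 z < min d r / 2"
    have "dist (x1, x1) (y, z) \<le> dist x1 y + dist x1 z"
      unfolding dist_Pair_Pair by (rule sqrt_sum_squares_le_sum) auto
    then have d1: "dist (x1, x1) (y, z) < min d r" using yz(3,4) by linarith
    have "dist (x1, x1) (z, z) \<le> dist x1 z + dist x1 z"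
      unfolding dist_Pair_Pair by (rule sqrt_sum_squares_le_sum) auto
    then have d2: "dist (x1, x1) (z, z) < min d r" using yz(4) by linarith
    have "norm (?f (y, z) - ?f (z, z)) \<le> K * norm ((y, z) - (z, z))"
      by (intro K(3) inS(1) yz(1,2)) (use d1 d2 in auto)
    then have 1: "norm (cmap M \<one> (cinv M \<one> y \<otimes> inv (cinv M \<one> z)) - x1) \<le> K * norm (y - z)"
      unfolding inS(2)[OF yz(1,2)] inS(2)[OF yz(2,2)] using cinvO1[OF yz(2)] by (simp add: norm_Pair)
    have w: "(cinv M \<one> y, cinv M \<one> z) \<in> C \<times> C \<inter> cdom ?P (\<one>, \<one>)" "cmap ?P (\<one>, \<one>) (cinv M \<one> y, cinv M \<one> z) = (y, z)"
      using cinvO1[OF yz(1)] cinvO1[OF yz(2)] by auto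
    have "cinv ?P (\<one>, \<one>) (y, z) = (cinv M \<one> y, cinv M \<one> z)"
      using chart_inv_eq[OF chMM c2, of "(cinv M \<one> y, cinv M \<one> z)"] w by auto
    moreover have "cinv ?P (\<one>, \<one>) (y, z) \<in> W" using r(2)[of "(y, z)"] d1 by simp
    ultimately have "cinv M \<one> y \<otimes> inv (cinv M \<one> z) \<in> cdom M \<one>" using W(3)[of "(cinv M \<one> y, cinv M \<one> z)"] w(1) by auto
    with 1 show "cinv M \<one> y \<otimes> inv (cinv M \<one> z) \<in> cdom M \<one> \<and>
      norm (cmap M \<one> (cinv M \<one> y \<otimes> inv (cinv M \<one> z)) - x1) \<le> K * norm (y - z)" by blast
  qed (use K r in auto)
qed

text \<open>The coadjoint orbit of \<open>\<mu>\<close> is tangent to \<open>{coad \<xi> \<mu>}\<close>, which is complementary to the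
  annihilator of \<open>V\<close>. The level set through \<open>\<mu>\<close> of the component of \<open>g \<mapsto> coAd g \<mu>\<close> along the
  orbit is connected near the identity by Lipschitz paths, and along these paths the derivative of
  the orbit map vanishes since its rank is constant.\<close>

lemma orbit_meets_slice_once:
  fixes \<mu> :: "'g dual"
  assumes P: "linear P" "\<And>x. P x \<in> V" "\<And>x. x \<in> V \<Longrightarrow> P x = x" "\<And>x. x - P x \<in> stab_alg G \<mu>"
    and P0: "\<And>x. x \<in> stab_alg G \<mu> \<Longrightarrow> P x = 0" and V: "subspace V"
  obtains N where "openin (mtop M) N" "\<one> \<in> N" "N \<subseteq> C"
    "\<And>g. g \<in> N \<Longrightarrow> coAd G g \<mu> - \<mu> \<in> annih V \<Longrightarrow> coAd G g \<mu> = \<mu>"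
proof -
  define \<omega> where "\<omega> x y = \<mu> (bracket G x y)" for x y
  have \<omega>lin: "bilinear \<omega>"
    unfolding bilinear_def \<omega>_def
    by (intro conjI allI linearI) (auto simp: bracket_simps blinfun.add_right blinfun.scaleR_right)
  have \<omega>skew: "\<omega> x y = - \<omega> y x" for x y
    unfolding \<omega>_def by (subst bracket_skew) (simp add: blinfun.minus_right)
  have \<omega>stab: "\<omega> x y = 0" "\<omega> y x = 0" if "x \<in> stab_alg G \<mu>" for x y
    using that \<omega>skew[of y x] by (auto simp: \<omega>_def stab_alg_iff)
  have \<omega>P: "\<omega> (P x) y = \<omega> x y" for x y
  proof -
    have "\<omega> (x - P x) y = 0" by (rule \<omega>stab(1)[OF P(4)])
    then show ?thesis using \<omega>lin by (simp add: bilinear_lsub)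
  qed
  have nd: "y = 0" if y: "y \<in> V" "\<And>x. x \<in> V \<Longrightarrow> \<omega> x y = 0" for y
  proof -
    have "\<omega> x y = 0" for x using y(2)[OF P(2)[of x]] \<omega>P by simp
    then have "\<omega> y x = 0" for x by (subst \<omega>skew) simp
    then have "y \<in> stab_alg G \<mu>" by (simp add: stab_alg_iff \<omega>_def)
    then show ?thesis using P0 P(3)[OF y(1)] by simp
  qed
  have "\<exists>x\<in>V. \<forall>y\<in>V. \<omega> x y = \<beta> y" for \<beta> :: "'g dual"
    by (rule represent_functional[OF fd V P(1,2,3) \<omega>lin nd bounded_linear.linear[OF blinfun.bounded_linear_right]])
  \<comment> \<open>\<open>J\<close> is a left inverse, modulo the stabilizer algebra, of
    \<open>\<lambda>\<xi>. coad G \<xi> \<mu>\<close>: it satisfies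
    \<open>J (coad G x \<mu>) = P x\<close> and kills the annihilator of \<open>V\<close>.\<close>
  then obtain J where J: "\<And>\<beta> :: 'g dual. J \<beta> \<in> V" "\<And>(\<beta> :: 'g dual) y. y \<in> V \<Longrightarrow> \<omega> (J \<beta>) y = \<beta> y" by metis
  have Juniq: "J \<beta> = x" if x: "x \<in> V" "\<And>y. y \<in> V \<Longrightarrow> \<omega> x y = \<beta> y" for \<beta> :: "'g dual" and x
  proof -
    have "J \<beta> - x = 0"
    proof (rule nd)
      show "J \<beta> - x \<in> V" using J x V by (simp add: subspace_diff)
      fix y assume y: "y \<in> V"
      have "\<omega> (J \<beta> - x) y = 0" using J(2)[OF y] x(2)[OF y] \<omega>lin by (simp add: bilinear_lsub)
      then show "\<omega> y (J \<beta> - x) = 0" by (subst \<omega>skew) simp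
    qed
    then show ?thesis by simp
  qed
  have lJ: "linear J"
  proof (rule linearI)
    show "J (a + b) = J a + J b" for a b
      by (rule Juniq) (use J V \<omega>lin in \<open>auto simp: subspace_add bilinear_ladd blinfun.add_left\<close>)
    show "J (r *\<^sub>R b) = r *\<^sub>R J b" for r b
      by (rule Juniq) (use J V \<omega>lin in \<open>auto simp: subspace_scale bilinear_lmul blinfun.scaleR_left\<close>)
  qed
  have bJ: "bounded_linear J" by (rule fin_dim_bounded_linear[OF fdd lJ])
  have Jcoad: "J (coad G x \<mu>) = P x" for x
    by (rule Juniq) (auto simp: P(2) \<omega>P, simp add: coad_apply \<omega>_def)
  have Jann: "J \<beta> = 0" if "\<beta> \<in> annih V" for \<beta>
    by (rule Juniq) (use that V \<omega>lin in \<open>auto simp: annih_def subspace_0 bilinear_lzero\<close>)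
  have bP: "bounded_linear P" by (rule linear_fd[OF P(1)])
  obtain KJ where KJ: "KJ > 0" "\<And>\<beta>. norm (J \<beta>) \<le> norm \<beta> * KJ" using bounded_linear.pos_bounded[OF bJ] by blast
  obtain KX where KX: "KX > 0" "\<And>x. norm (coad G x \<mu>) \<le> norm x * KX"
    using bounded_linear.pos_bounded[OF coad_bounded_linear[of \<mu>]] by blast
  have coadP: "coad G (P x) \<mu> = coad G x \<mu>" for x
    by (rule blinfun_eqI) (use \<omega>P[of x] in \<open>simp add: coad_apply \<omega>_def\<close>)
  have KXJ: "norm (coad G x \<mu>) \<le> KX * norm (J (coad G x \<mu>))" for x
    using KX(2)[of "P x"] by (simp add: Jcoad coadP mult.commute)
  define f where "f z = coAd G (cinv M \<one> z) \<mu>" for z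
  have sf: "strict_deriv f (\<lambda>\<xi>. coad G \<xi> \<mu>) x1 O1"
    using coAd_mderiv_const[of \<mu>] unfolding mderiv_to_vec f_def[abs_def] o_def by blast
  have fx1: "f x1 = \<mu>" using cinv_cmap_one[OF one_cdom] by (simp add: f_def coAd_one)
  \<comment> \<open>Adapted coordinates: the stabilizer part is taken from the chart and the
    \<open>V\<close> part from the orbit map. The derivative at \<open>x1\<close> is
    \<open>v - P v + P v = v\<close>.\<close>
  define \<Xi> where "\<Xi> z = (z - x1) - P (z - x1) + J (f z - \<mu>)" for z
  have s\<Xi>: "strict_deriv \<Xi> (\<lambda>v. v) x1 O1"
  proof -
    have a: "strict_deriv (\<lambda>z. z - x1) (\<lambda>v. v - 0) x1 O1"
      by (intro strict_deriv_diff strict_deriv_const strict_deriv_bounded_linear bounded_linear_ident x1_O1)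
    then have a: "strict_deriv (\<lambda>z. z - x1) (\<lambda>v. v) x1 O1" by simp
    have b: "strict_deriv (\<lambda>z. J (f z - \<mu>)) (\<lambda>v. J (coad G v \<mu> - 0)) x1 O1"
      by (intro strict_deriv_linear_comp[OF bJ] strict_deriv_diff strict_deriv_const sf x1_O1)
    have "strict_deriv (\<lambda>z. ((z - x1) - P (z - x1)) + J (f z - \<mu>)) (\<lambda>v. (v - P v) + J (coad G v \<mu> - 0)) x1 O1"
      by (intro strict_deriv_add strict_deriv_diff strict_deriv_linear_comp[OF bP] a b x1_O1)
    then show ?thesis unfolding \<Xi>_def[abs_def] by (simp add: Jcoad)
  qed
  have \<Xi>x1: "\<Xi> x1 = 0" by (simp add: \<Xi>_def fx1 linear_0[OF lJ] linear_0[OF P(1)])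
  \<comment> \<open>Small enough for the term \<open>KX * KJ * e0 * norm w\<close> to be absorbed in
    \<open>norm w\<close>; the bound 1 gives
    \<open>norm (coAd G ?g \<beta>) \<le> 2 * norm \<beta>\<close>.\<close>
  define e0 where "e0 = min 1 (1 / (2 * KX * KJ))"
  have e0: "e0 > 0" "e0 \<le> 1" "KX * KJ * e0 \<le> 1 / 2"
  proof -
    show "e0 > 0" "e0 \<le> 1" using KX KJ by (auto simp: e0_def)
    have "KX * KJ * e0 \<le> KX * KJ * (1 / (2 * KX * KJ))" using KX(1) KJ(1) by (intro mult_left_mono) (auto simp: e0_def)
    then show "KX * KJ * e0 \<le> 1 / 2" using KX(1) KJ(1) by simp
  qed
  obtain ra where ra: "ra > 0" "\<And>z \<beta>. z \<in> O1 \<Longrightarrow> dist x1 z < ra \<Longrightarrow> norm (coAd G (cinv M \<one> z) \<beta> - \<beta>) \<le> e0 * norm \<beta>"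
    using coAd_near_one[OF e0(1)] by blast
  obtain Kq rq where q: "Kq > 0" "rq > 0"
    "\<And>y z. y \<in> O1 \<Longrightarrow> z \<in> O1 \<Longrightarrow> dist x1 y < rq \<Longrightarrow> dist x1 z < rq \<Longrightarrow>
      cinv M \<one> y \<otimes> inv (cinv M \<one> z) \<in> cdom M \<one> \<and>
      norm (cmap M \<one> (cinv M \<one> y \<otimes> inv (cinv M \<one> z)) - x1) \<le> Kq * norm (y - z)"
    using quotient_lipschitz by blast
  obtain rO where rO: "rO > 0" "ball x1 rO \<subseteq> O1" using openO1 x1_O1 open_contains_ball by blast
  define r0 where "r0 = min (min ra rq) rO"
  have r0: "r0 > 0" "r0 \<le> ra" "r0 \<le> rq" "ball x1 r0 \<subseteq> O1" using ra q rO by (auto simp: r0_def)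
  obtain r1 where r1: "r1 > 0" "r1 < r0"
    "\<And>y z. y \<in> cball x1 r1 \<Longrightarrow> z \<in> cball x1 r1 \<Longrightarrow> norm (y - z) \<le> 2 * norm (\<Xi> y - \<Xi> z)"
    "\<And>r w. 0 < r \<Longrightarrow> r \<le> r1 \<Longrightarrow> w \<in> cball (\<Xi> x1) (r / 2) \<Longrightarrow> \<exists>y\<in>cball x1 r. \<Xi> y = w"
    using strict_inverse[OF fin_dim_complete[OF fd] s\<Xi> r0(1,4)] by metis
  obtain Kx dx where Kx: "Kx > 0" "dx > 0" "\<And>y z. y \<in> O1 \<Longrightarrow> z \<in> O1 \<Longrightarrow> dist x1 y < dx \<Longrightarrow> dist x1 z < dx \<Longrightarrow>
    norm (\<Xi> y - \<Xi> z) \<le> Kx * norm (y - z)" using strict_deriv_lipschitz[OF s\<Xi>] by blast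
  \<comment> \<open>The last entry makes \<open>norm (\<Xi> z) \<le> r1 / 2\<close>, so that the
    whole segment from 0 to \<open>\<Xi> z\<close> lies in the range covered by
    \<open>strict_inverse\<close>.\<close>
  define r2 where "r2 = min (min r1 dx) (r1 / (2 * Kx))"
  have r2: "r2 > 0" using r1 Kx by (simp add: r2_def)
  let ?N = "{g \<in> cdom M \<one>. cmap M \<one> g \<in> ball x1 r2}"
  \<comment> \<open>Translation by \<open>?g\<close> moves the increment to the identity:
    \<open>f y - f z = coAd G ?g (w + \<rho>)\<close> with linear part \<open>w\<close> and
    remainder \<open>\<rho>\<close>. As \<open>J\<close> kills the increment and
    \<open>coAd G ?g\<close> is close to the identity, \<open>w\<close> is at most
    \<open>4 * KX * KJ\<close> times \<open>\<rho>\<close>, so the whole increment is of remainder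
    size. The constant in \<open>near\<close> collects this factor, the 2 from \<open>A2\<close> and
    the \<open>Kq\<close> from the quotient.\<close>
  have step: "norm (f y - f z) \<le> e * norm (y - z)"
    if yz: "y \<in> ball x1 r0" "z \<in> ball x1 r0" "J (f y - f z) = 0" and e: "e > 0"
      and near: "\<And>\<zeta>. \<zeta> \<in> O1 \<Longrightarrow> norm (\<zeta> - x1) \<le> Kq * norm (y - z) \<Longrightarrow>
        norm (f \<zeta> - \<mu> - coad G (\<zeta> - x1) \<mu>) \<le> e / (Kq * (2 * (4 * KX * KJ + 1))) * norm (\<zeta> - x1)" for y z e
  proof -
    have O: "y \<in> O1" "z \<in> O1" using yz r0 by auto
    let ?u = "cinv M \<one> y \<otimes> inv (cinv M \<one> z)"
    let ?g = "cinv M \<one> z"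
    have u: "?u \<in> cdom M \<one>" "norm (cmap M \<one> ?u - x1) \<le> Kq * norm (y - z)"
      using q(3)[OF O] yz r0 by auto
    have gC: "?g \<in> C" "cinv M \<one> y \<in> C" "?u \<in> C" using cinvO1 O by auto
    define \<zeta> where "\<zeta> = cmap M \<one> ?u"
    have \<zeta>: "\<zeta> \<in> O1" "f \<zeta> = coAd G ?u \<mu>" using u gC by (auto simp: \<zeta>_def f_def cinv_cmap_one)
    define \<rho> where "\<rho> = f \<zeta> - \<mu> - coad G (\<zeta> - x1) \<mu>"
    define w where "w = coad G (\<zeta> - x1) \<mu>"
    have n\<rho>: "norm \<rho> \<le> e / (Kq * (2 * (4 * KX * KJ + 1))) * norm (\<zeta> - x1)"
      unfolding \<rho>_def by (rule near[OF \<zeta>(1)]) (use u(2) in \<open>simp add: \<zeta>_def\<close>)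
    have yeq: "cinv M \<one> y = ?u \<otimes> ?g" using gC by (simp add: m_assoc)
    have "f y = coAd G ?g (coAd G ?u \<mu>)" unfolding f_def by (subst yeq) (rule coAd_mult[OF gC(3,1)])
    then have fyz: "f y - f z = coAd G ?g (w + \<rho>)"
      using \<zeta>(2) linear_diff[OF coAd_linear[OF gC(1)], of "f \<zeta>" \<mu>] by (simp add: w_def \<rho>_def f_def)
    have A: "norm (coAd G ?g \<beta> - \<beta>) \<le> e0 * norm \<beta>" for \<beta> using ra(2)[OF O(2)] yz r0 by auto
    have A2: "norm (coAd G ?g \<beta>) \<le> 2 * norm \<beta>" for \<beta>
    proof -
      have "norm (coAd G ?g \<beta>) \<le> norm (coAd G ?g \<beta> - \<beta>) + norm \<beta>" by (metis norm_triangle_sub add.commute)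
      also have "\<dots> \<le> 1 * norm \<beta> + norm \<beta>" using A[of \<beta>] e0(2) mult_right_mono[of e0 1 "norm \<beta>"] by simp
      finally show ?thesis by simp
    qed
    have "J (coAd G ?g w) + J (coAd G ?g \<rho>) = 0"
      using yz(3) unfolding fyz linear_add[OF coAd_linear[OF gC(1)]] linear_add[OF lJ] .
    then have Jw: "J w = - J (coAd G ?g w - w) - J (coAd G ?g \<rho>)"
      by (simp add: linear_diff[OF lJ] add_eq_0_iff2)
    have "norm (J w) \<le> norm (J (coAd G ?g w - w)) + norm (J (coAd G ?g \<rho>))"
      unfolding Jw by (metis norm_triangle_ineq4 norm_minus_cancel)
    also have "\<dots> \<le> (e0 * norm w) * KJ + (2 * norm \<rho>) * KJ"
      by (intro add_mono order_trans[OF KJ(2)] mult_right_mono A A2) (use KJ in auto)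
    finally have Jwn: "norm (J w) \<le> (e0 * norm w) * KJ + (2 * norm \<rho>) * KJ" .
    have "norm w \<le> KX * norm (J w)" unfolding w_def by (rule KXJ)
    also have "\<dots> \<le> KX * ((e0 * norm w) * KJ + (2 * norm \<rho>) * KJ)" using Jwn KX(1) by simp
    also have "\<dots> = (KX * KJ * e0) * norm w + 2 * KX * KJ * norm \<rho>" by (simp add: algebra_simps)
    also have "\<dots> \<le> 1 / 2 * norm w + 2 * KX * KJ * norm \<rho>"
      using e0(3) mult_right_mono[of "KX * KJ * e0" "1/2" "norm w"] by simp
    finally have nw: "norm w \<le> 4 * KX * KJ * norm \<rho>" by simp
    have "norm (f y - f z) \<le> 2 * norm (w + \<rho>)" unfolding fyz by (rule A2)
    also have "\<dots> \<le> 2 * (norm w + norm \<rho>)" using norm_triangle_ineq[of w \<rho>] by simp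
    also have "\<dots> \<le> 2 * (4 * KX * KJ + 1) * norm \<rho>" using nw by (simp add: algebra_simps)
    also have "\<dots> \<le> 2 * (4 * KX * KJ + 1) * (e / (Kq * (2 * (4 * KX * KJ + 1))) * norm (\<zeta> - x1))"
      using n\<rho> KX KJ by (intro mult_left_mono) auto
    also have "\<dots> = e / Kq * norm (\<zeta> - x1)"
    proof -
      have "L * (e / (Kq * L) * n) = e / Kq * n" if "L > 0" for L n :: real
        using that by simp
      moreover have "2 * (4 * KX * KJ + 1) > 0" using KX(1) KJ(1) by (simp add: add_pos_pos)
      ultimately show ?thesis .
    qed
    also have "\<dots> \<le> e / Kq * (Kq * norm (y - z))" using u(2) e q(1) by (intro mult_left_mono) (auto simp: \<zeta>_def)
    finally show ?thesis using q(1) by simp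
  qed
  show ?thesis
  proof (rule that[of ?N])
    show "openin (mtop M) ?N" by (rule chart_preimage_open[OF chM chart_one]) simp
    show "\<one> \<in> ?N" using one_cdom r2 by simp
    show "?N \<subseteq> C" using cdom_C by blast
    fix g assume g: "g \<in> ?N" and ann: "coAd G g \<mu> - \<mu> \<in> annih V"
    define z where "z = cmap M \<one> g"
    have zr: "dist x1 z < r2" "cinv M \<one> z = g" using g by (auto simp: z_def cinv_cmap_one)
    have fz: "f z = coAd G g \<mu>" by (simp add: f_def zr)
    \<comment> \<open>\<open>J\<close> kills \<open>coAd G g \<mu> - \<mu>\<close>, so the adapted
      coordinate of \<open>z\<close> is this stabilizer component alone.\<close>
    define \<zeta> where "\<zeta> = (z - x1) - P (z - x1)"
    have \<Xi>z: "\<Xi> z = \<zeta>" using Jann[OF ann] by (simp add: \<Xi>_def \<zeta>_def fz)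
    have zO: "z \<in> O1" using g cdom_C by (auto simp: z_def)
    have "norm (\<Xi> z - \<Xi> x1) \<le> Kx * norm (z - x1)"
      using zr Kx zO x1_O1 by (intro Kx(3)) (auto simp: r2_def)
    also have "\<dots> \<le> r1 / 2"
    proof -
      have "norm (z - x1) < r1 / (2 * Kx)" using zr by (simp add: r2_def dist_norm norm_minus_commute)
      then show ?thesis using Kx(1) by (simp add: field_simps)
    qed
    finally have n\<zeta>: "norm \<zeta> \<le> r1 / 2" by (simp add: \<Xi>z \<Xi>x1)
    \<comment> \<open>The path \<open>c\<close> lifts the segment from 0 to \<open>\<zeta>\<close>;
      it joins \<open>x1\<close> to \<open>z\<close> inside the set where the orbit map has no
      component along \<open>V\<close>.\<close>
    have "\<exists>y\<in>cball x1 r1. \<Xi> y = s *\<^sub>R \<zeta>" if s: "s \<in> {0..1}" for s :: real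
    proof (rule r1(4)[OF r1(1) order_refl])
      have "norm (s *\<^sub>R \<zeta>) \<le> 1 * norm \<zeta>" using s by (simp add: mult_left_le_one_le)
      then show "s *\<^sub>R \<zeta> \<in> cball (\<Xi> x1) (r1 / 2)" using n\<zeta> by (simp add: \<Xi>x1)
    qed
    then obtain c where c: "\<And>s :: real. s \<in> {0..1} \<Longrightarrow> c s \<in> cball x1 r1 \<and> \<Xi> (c s) = s *\<^sub>R \<zeta>" by metis
    have P\<zeta>: "P \<zeta> = 0" unfolding \<zeta>_def by (rule P0[OF P(4)])
    have Jc: "J (f (c s) - \<mu>) = 0" if s: "s \<in> {0..1}" for s
    proof -
      have "P (s *\<^sub>R \<zeta>) = 0" using P\<zeta> by (simp add: linear_scale[OF P(1)])
      then have "P (\<Xi> (c s)) = 0" using c[OF s] by simp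
      moreover have "P (\<Xi> (c s)) = P ((c s - x1) - P (c s - x1)) + P (J (f (c s) - \<mu>))"
        unfolding \<Xi>_def by (rule linear_add[OF P(1)])
      moreover have "P ((c s - x1) - P (c s - x1)) = 0" by (rule P0[OF P(4)])
      ultimately show ?thesis using P(3)[OF J(1)] by simp
    qed
    have clip: "norm (c s - c t) \<le> 2 * norm \<zeta> * \<bar>s - t\<bar>" if "s \<in> {0..1}" "t \<in> {0..1}" for s t
    proof -
      have "norm (c s - c t) \<le> 2 * norm (\<Xi> (c s) - \<Xi> (c t))" using c that by (intro r1(3)) auto
      also have "\<Xi> (c s) - \<Xi> (c t) = (s - t) *\<^sub>R \<zeta>" using c that by (simp add: scaleR_diff_left)
      finally show ?thesis by (simp add: mult.commute mult.left_commute)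
    qed
    \<comment> \<open>\<open>step\<close> with arbitrarily small constant, together with the
      Lipschitz bound \<open>clip\<close>, makes the derivative of the orbit map along
      \<open>c\<close> zero.\<close>
    have "\<exists>k. \<forall>s\<in>{0..1}. f (c s) = k"
    proof (rule has_derivative_zero_constant)
      fix s :: real assume s: "s \<in> {0..1}"
      show "((\<lambda>s. f (c s)) has_derivative (\<lambda>h. 0)) (at s within {0..1})"
        unfolding has_derivative_within_alt
      proof (intro conjI allI impI)
        fix e :: real assume e: "e > 0"
        define e' where "e' = e / (2 * norm \<zeta> + 1)"
        have e': "e' > 0" using e by (simp add: e'_def add_nonneg_pos)
        define e'' where "e'' = e' / (Kq * (2 * (4 * KX * KJ + 1)))"
        have e'': "e'' > 0" unfolding e''_def using e' q KX KJ by (intro divide_pos_pos mult_pos_pos add_pos_pos) auto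
        obtain d where d: "d > 0" "\<And>y z. y \<in> O1 \<Longrightarrow> z \<in> O1 \<Longrightarrow> dist x1 y < d \<Longrightarrow> dist x1 z < d \<Longrightarrow>
          norm (f y - f z - coad G (y - z) \<mu>) \<le> e'' * norm (y - z)" using strict_derivD[OF sf e''] by blast
        define d' where "d' = d / (Kq * (2 * norm \<zeta> + 1))"
        have pos: "2 * norm \<zeta> + 1 > 0" by (simp add: add_nonneg_pos)
        have d': "d' > 0" unfolding d'_def using d(1) q(1) pos by simp
        show "\<exists>d>0. \<forall>t\<in>{0..1}. norm (t - s) < d \<longrightarrow> norm (f (c t) - f (c s) - 0) \<le> e * norm (t - s)"
        proof (intro exI[of _ d'] conjI ballI impI d')
          fix t :: real assume t: "t \<in> {0..1}" "norm (t - s) < d'"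
          have b: "norm (c t - c s) \<le> (2 * norm \<zeta> + 1) * \<bar>t - s\<bar>" using clip[OF t(1) s] by (simp add: algebra_simps)
          have "norm (f (c t) - f (c s)) \<le> e' * norm (c t - c s)"
          proof (rule step[OF _ _ _ e'])
            show "c t \<in> ball x1 r0" "c s \<in> ball x1 r0" using c[OF s] c[OF t(1)] r1(2) by auto
            show "J (f (c t) - f (c s)) = 0"
              using linear_diff[OF lJ, of "f (c t) - \<mu>" "f (c s) - \<mu>"] Jc[OF s] Jc[OF t(1)] by simp
            fix x assume x: "x \<in> O1" "norm (x - x1) \<le> Kq * norm (c t - c s)"
            have "norm (x - x1) \<le> Kq * ((2 * norm \<zeta> + 1) * \<bar>t - s\<bar>)"
              by (rule order_trans[OF x(2) mult_left_mono[OF b]]) (use q(1) in simp)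
            also have "\<dots> < d" using t(2) q(1) pos by (simp add: d'_def pos_less_divide_eq mult.assoc mult.commute mult.left_commute)
            finally have "dist x1 x < d" by (simp add: dist_norm norm_minus_commute)
            then show "norm (f x - \<mu> - coad G (x - x1) \<mu>) \<le> e' / (Kq * (2 * (4 * KX * KJ + 1))) * norm (x - x1)"
              using d(2)[OF x(1) x1_O1] d(1) by (simp add: fx1 e''_def)
          qed
          also have "\<dots> \<le> e' * ((2 * norm \<zeta> + 1) * \<bar>t - s\<bar>)" using b e' by (intro mult_left_mono) auto
          also have "\<dots> = e * \<bar>t - s\<bar>" using pos by (simp add: e'_def)
          finally show "norm (f (c t) - f (c s) - 0) \<le> e * norm (t - s)" by simp
        qed
      qed simp
    qed simp
    then have "f (c 1) = f (c 0)" by force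
    moreover have "c 1 = z"
    proof -
      have "norm (c 1 - z) \<le> 2 * norm (\<Xi> (c 1) - \<Xi> z)"
        using c[of 1] zr by (intro r1(3)) (auto simp: r2_def)
      then show ?thesis using c[of 1] by (simp add: \<Xi>z)
    qed
    moreover have "c 0 = x1"
    proof -
      have "norm (c 0 - x1) \<le> 2 * norm (\<Xi> (c 0) - \<Xi> x1)" using c[of 0] r1(1) by (intro r1(3)) auto
      then show ?thesis using c[of 0] by (simp add: \<Xi>x1)
    qed
    ultimately show "coAd G g \<mu> = \<mu>" using fz fx1 by simp
  qed
qed

end

section \<open>Splittings and their projections\<close>

lemma direct_sum_pair:
  assumes "direct_sum V [A, B]"
  shows "subspace A" "subspace B" "V = {a + b | a b. a \<in> A \<and> b \<in> B}"
    "\<And>a b a' b'. a \<in> A \<Longrightarrow> b \<in> B \<Longrightarrow> a' \<in> A \<Longrightarrow> b' \<in> B \<Longrightarrow> a + b = a' + b' \<Longrightarrow> a = a' \<and> b = b'"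
proof -
  show "subspace A" "subspace B" using assms by (auto simp: direct_sum_def)
  have bij: "bij_betw sum_list (listset [A, B]) V" using assms by (simp add: direct_sum_def)
  have ls: "listset [A, B] = {[a, b] | a b. a \<in> A \<and> b \<in> B}" by (auto simp: set_Cons_def)
  have "V = sum_list ` listset [A, B]" using bij by (simp add: bij_betw_def)
  then show "V = {a + b | a b. a \<in> A \<and> b \<in> B}" unfolding ls by force
  fix a b a' b' assume "a \<in> A" "b \<in> B" "a' \<in> A" "b' \<in> B" "a + b = a' + b'"
  then have "[a, b] = [a', b']"
    using bij_betw_imp_inj_on[OF bij] unfolding ls by (intro inj_onD[of sum_list]) auto
  then show "a = a' \<and> b = b'" by simp
qed

lemma direct_sum_pair_split: "direct_sum V [A, B] \<Longrightarrow> x \<in> V \<Longrightarrow> \<exists>a\<in>A. \<exists>b\<in>B. x = a + b"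
  using direct_sum_pair(3)[of V A B] by blast

lemma direct_sum_pair_add: "direct_sum V [A, B] \<Longrightarrow> a \<in> A \<Longrightarrow> b \<in> B \<Longrightarrow> a + b \<in> V"
  using direct_sum_pair(3)[of V A B] by blast

lemma direct_sum_quad:
  assumes "direct_sum V [A, B, D, E]"
  shows "subspace A" "subspace B" "subspace D" "subspace E"
    "V = {a + b + c + d | a b c d. a \<in> A \<and> b \<in> B \<and> c \<in> D \<and> d \<in> E}"
    "\<And>a b c d a' b' c' d'. a \<in> A \<Longrightarrow> b \<in> B \<Longrightarrow> c \<in> D \<Longrightarrow> d \<in> E \<Longrightarrow>
      a' \<in> A \<Longrightarrow> b' \<in> B \<Longrightarrow> c' \<in> D \<Longrightarrow> d' \<in> E \<Longrightarrow> a + b + c + d = a' + b' + c' + d' \<Longrightarrow>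
      a = a' \<and> b = b' \<and> c = c' \<and> d = d'"
proof -
  show "subspace A" "subspace B" "subspace D" "subspace E" using assms by (auto simp: direct_sum_def)
  have bij: "bij_betw sum_list (listset [A, B, D, E]) V" using assms by (simp add: direct_sum_def)
  have ls: "listset [A, B, D, E] = {[a, b, c, d] | a b c d. a \<in> A \<and> b \<in> B \<and> c \<in> D \<and> d \<in> E}"
    by (auto simp: set_Cons_def)
  have "V = sum_list ` listset [A, B, D, E]" using bij by (simp add: bij_betw_def)
  also have "\<dots> = {a + b + c + d | a b c d. a \<in> A \<and> b \<in> B \<and> c \<in> D \<and> d \<in> E}"
  proof (intro equalityI subsetI)
    fix x assume "x \<in> sum_list ` listset [A, B, D, E]"
    then obtain a b c d where "a \<in> A" "b \<in> B" "c \<in> D" "d \<in> E" "x = sum_list [a, b, c, d]"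
      unfolding ls by blast
    moreover from this have "x = a + b + c + d" by (simp add: add.assoc)
    ultimately show "x \<in> {a + b + c + d | a b c d. a \<in> A \<and> b \<in> B \<and> c \<in> D \<and> d \<in> E}" by blast
  next
    fix x assume "x \<in> {a + b + c + d | a b c d. a \<in> A \<and> b \<in> B \<and> c \<in> D \<and> d \<in> E}"
    then obtain a b c d where x: "a \<in> A" "b \<in> B" "c \<in> D" "d \<in> E" "x = a + b + c + d" by blast
    have "x = sum_list [a, b, c, d]" using x(5) by (simp add: add.assoc)
    moreover have "[a, b, c, d] \<in> listset [A, B, D, E]" using x(1-4) unfolding ls by blast
    ultimately show "x \<in> sum_list ` listset [A, B, D, E]" by (rule image_eqI)
  qed
  finally show "V = {a + b + c + d | a b c d. a \<in> A \<and> b \<in> B \<and> c \<in> D \<and> d \<in> E}" .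
  fix a b c d a' b' c' d' assume *: "a \<in> A" "b \<in> B" "c \<in> D" "d \<in> E"
      "a' \<in> A" "b' \<in> B" "c' \<in> D" "d' \<in> E" "a + b + c + d = a' + b' + c' + d'"
  have "[a, b, c, d] = [a', b', c', d']"
    by (rule inj_onD[OF bij_betw_imp_inj_on[OF bij]]) (use * in \<open>auto simp: set_Cons_def add.assoc\<close>)
  then show "a = a' \<and> b = b' \<and> c = c' \<and> d = d'" by simp
qed

lemma subspace_annih: "subspace (annih A)"
  unfolding subspace_def annih_def by (auto simp: blinfun.add_left blinfun.scaleR_left)

lemma annih_span: "\<beta> \<in> annih A \<Longrightarrow> x \<in> span A \<Longrightarrow> blinfun_apply \<beta> x = 0"
  using linear_eq_0_on_span[OF bounded_linear.linear[OF blinfun.bounded_linear_right[of \<beta>]]]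
  by (auto simp: annih_def)

text \<open>A projection onto \<open>k\<close> along the span of \<open>c\<close> shows that exactly
  one functional meets the description in \<open>dual_ext\<close>, namely \<open>f\<close> composed
  with \<open>P\<close>.\<close>

lemma dual_ext_proj:
  fixes f :: "'v::real_normed_vector \<Rightarrow> real"
  assumes fd: "fin_dim TYPE('v)" and P: "linear P" "\<And>x. P x \<in> k" "\<And>x. x \<in> k \<Longrightarrow> P x = x"
    "\<And>x. x \<in> c \<Longrightarrow> P x = 0" "\<And>x. x - P x \<in> span c" and f: "linear (\<lambda>x. f (P x))"
  shows "blinfun_apply (dual_ext k c f) x = f (P x)" "dual_ext k c f \<in> annih c"
proof -
  define \<beta> where "\<beta> = Blinfun (\<lambda>x. f (P x))"
  have ap: "blinfun_apply \<beta> x = f (P x)" for x unfolding \<beta>_def by (simp add: blinfun_apply_Blinfun_fin_dim[OF fd f])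
  have f0: "f 0 = 0" using linear_0[OF f] linear_0[OF P(1)] by simp
  have mem: "\<beta> \<in> annih c" using P(4) f0 by (simp add: annih_def ap)
  have "dual_ext k c f = \<beta>"
    unfolding dual_ext_def
  proof (rule the_equality)
    show "\<beta> \<in> annih c \<and> (\<forall>\<eta>\<in>k. blinfun_apply \<beta> \<eta> = f \<eta>)" using mem P(3) by (simp add: ap)
    fix \<gamma> :: "'v dual" assume \<gamma>: "\<gamma> \<in> annih c \<and> (\<forall>\<eta>\<in>k. blinfun_apply \<gamma> \<eta> = f \<eta>)"
    show "\<gamma> = \<beta>"
    proof (rule blinfun_eqI)
      fix x
      have "blinfun_apply \<gamma> (x - P x) = 0" using annih_span \<gamma> P(5) by blast
      then have "blinfun_apply \<gamma> x = blinfun_apply \<gamma> (P x)" by (simp add: blinfun.diff_right)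
      then show "blinfun_apply \<gamma> x = blinfun_apply \<beta> x" using \<gamma> P(2) by (simp add: ap)
    qed
  qed
  then show "blinfun_apply (dual_ext k c f) x = f (P x)" "dual_ext k c f \<in> annih c" using ap mem by auto
qed

locale tube_data = lie_gp G
  for G :: "('a, 'g::real_normed_vector) lie_grp" (structure) +
  fixes H :: "'a set"
    and \<rho> :: "'a \<Rightarrow> 's::real_normed_vector \<Rightarrow> 's"
    and \<mu> :: "'g dual"
    and \<pp> \<oo> \<ll> \<nn> :: "'g set"
    and U :: "('g dual \<times> 'g \<times> 'g dual) set"
    and \<Phi> :: "'a \<times> 'g dual \<times> 'g \<times> 'g dual \<Rightarrow> 'a \<times> 'g dual"
  assumes subH: "subgroup H G" and compH: "compactin (mtop (mfd G)) H"
    and fdS: "fin_dim TYPE('s)" and rep: "lie_representation G H \<rho>"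
    and \<mu>h: "\<forall>\<eta>\<in>sub_alg G H. blinfun_apply \<mu> \<eta> = 0"
    and splitting: "adapted_splitting G H \<mu> \<oo> \<ll> \<nn>"
    and psum: "direct_sum (stab_alg G \<mu>) [sub_alg G H \<inter> stab_alg G \<mu>, \<pp>]"
    and tube: "restricted_tube G H \<mu> \<oo> \<ll> \<nn> U \<Phi>"
begin

abbreviation "\<hh> \<equiv> sub_alg G H"
abbreviation "\<hh>\<mu> \<equiv> sub_alg G H \<inter> stab_alg G \<mu>"
abbreviation "\<gg>\<mu> \<equiv> stab_alg G \<mu>"
abbreviation "MV \<equiv> prod_mfd (mfd G) (vec_mfd :: ('g dual \<times> 'g \<times> 'g dual, 'g dual \<times> 'g \<times> 'g dual) manifold)"
abbreviation "MD \<equiv> prod_mfd (mfd G) (vec_mfd :: ('g dual, 'g dual) manifold)"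
abbreviation "TM \<equiv> tube_model G \<mu> \<oo> \<ll> \<nn>"

lemma stab_splitting: "direct_sum UNIV [\<gg>\<mu>, \<oo>, \<ll>, \<nn>]" using splitting by (simp add: adapted_splitting_def)
lemma h_splitting: "direct_sum \<hh> [\<hh>\<mu>, \<ll>]" using splitting by (simp add: adapted_splitting_def)

lemmas sub_spaces = direct_sum_pair(1,2)[OF psum] direct_sum_quad(1-4)[OF stab_splitting]

lemma subspace_h: "subspace \<hh>"
  by (subst direct_sum_pair(3)[OF h_splitting]) (rule subspace_sums[OF sub_spaces(1,5)])

lemma decomp: "\<exists>t. fst t \<in> \<hh>\<mu> \<and> fst (snd t) \<in> \<pp> \<and> fst (snd (snd t)) \<in> \<oo> \<and> fst (snd (snd (snd t))) \<in> \<ll> \<and>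
    snd (snd (snd (snd t))) \<in> \<nn> \<and>
    x = fst t + fst (snd t) + fst (snd (snd t)) + fst (snd (snd (snd t))) + snd (snd (snd (snd t)))"
proof -
  have "x \<in> {a + b + c + d | a b c d. a \<in> \<gg>\<mu> \<and> b \<in> \<oo> \<and> c \<in> \<ll> \<and> d \<in> \<nn>}"
    using direct_sum_quad(5)[OF stab_splitting] by auto
  then obtain s b c d where x: "x = s + b + c + d" "s \<in> \<gg>\<mu>" "b \<in> \<oo>" "c \<in> \<ll>" "d \<in> \<nn>" by blast
  moreover obtain k p where "s = k + p" "k \<in> \<hh>\<mu>" "p \<in> \<pp>"
    using direct_sum_pair_split[OF psum x(2)] by blast
  ultimately show ?thesis by (intro exI[of _ "(k, p, b, c, d)"]) simp
qed

definition "dec x = (SOME t. fst t \<in> \<hh>\<mu> \<and> fst (snd t) \<in> \<pp> \<and> fst (snd (snd t)) \<in> \<oo> \<and> fst (snd (snd (snd t))) \<in> \<ll> \<and>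
    snd (snd (snd (snd t))) \<in> \<nn> \<and>
    x = fst t + fst (snd t) + fst (snd (snd t)) + fst (snd (snd (snd t))) + snd (snd (snd (snd t))))"

text \<open>The letters follow the summands, with \<open>k\<close> standing for
  \<open>\<hh>\<mu>\<close>; the choice in \<open>dec\<close> is harmless by
  \<open>P_unique\<close>.\<close>

definition "Pk x = fst (dec x)"
definition "Pp x = fst (snd (dec x))"
definition "Po x = fst (snd (snd (dec x)))"
definition "Pl x = fst (snd (snd (snd (dec x))))"
definition "Pn x = snd (snd (snd (snd (dec x))))"

lemma P_mem: "Pk x \<in> \<hh>" "Pk x \<in> \<gg>\<mu>" "Pp x \<in> \<pp>" "Po x \<in> \<oo>" "Pl x \<in> \<ll>" "Pn x \<in> \<nn>"
  and P_sum: "x = Pk x + Pp x + Po x + Pl x + Pn x"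
  using someI_ex[OF decomp[of x]] by (auto simp: dec_def Pk_def Pp_def Po_def Pl_def Pn_def)

lemma pp_stab: "x \<in> \<pp> \<Longrightarrow> x \<in> \<gg>\<mu>"
proof -
  assume x: "x \<in> \<pp>"
  have "0 + x \<in> \<gg>\<mu>" by (rule direct_sum_pair_add[OF psum subspace_0[OF sub_spaces(1)] x])
  then show ?thesis by simp
qed

lemma P_unique:
  assumes "a \<in> \<hh>" "a \<in> \<gg>\<mu>" "b \<in> \<pp>" "c \<in> \<oo>" "d \<in> \<ll>" "e \<in> \<nn>"
  shows "Pk (a + b + c + d + e) = a" "Pp (a + b + c + d + e) = b" "Po (a + b + c + d + e) = c"
    "Pl (a + b + c + d + e) = d" "Pn (a + b + c + d + e) = e"
proof -
  let ?x = "a + b + c + d + e"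
  have s: "Pk ?x + Pp ?x \<in> \<gg>\<mu>" "a + b \<in> \<gg>\<mu>"
    using P_mem pp_stab assms subspace_add[OF subspace_stab_alg] by auto
  have "(Pk ?x + Pp ?x) + Po ?x + Pl ?x + Pn ?x = (a + b) + c + d + e" using P_sum[of ?x] by simp
  from direct_sum_quad(6)[OF stab_splitting s(1) P_mem(4-6) s(2) assms(4-6) this]
  have 1: "Pk ?x + Pp ?x = a + b" and 2: "Po ?x = c" "Pl ?x = d" "Pn ?x = e" by auto
  from direct_sum_pair(4)[OF psum _ P_mem(3) _ assms(3) 1] P_mem assms 
  show "Pk ?x = a" "Pp ?x = b" by auto
  show "Po ?x = c" "Pl ?x = d" "Pn ?x = e" by (fact 2)+
qed

lemma P_linear: "linear Pk" "linear Pp" "linear Po" "linear Pl" "linear Pn"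
proof -
  note sa = subspace_add[OF subspace_h] subspace_add[OF sub_spaces(2)] subspace_add[OF sub_spaces(3)]
    subspace_add[OF sub_spaces(4)] subspace_add[OF sub_spaces(5)] subspace_add[OF sub_spaces(6)]
  note ss = subspace_scale[OF subspace_h] subspace_scale[OF sub_spaces(2)] subspace_scale[OF sub_spaces(3)]
    subspace_scale[OF sub_spaces(4)] subspace_scale[OF sub_spaces(5)] subspace_scale[OF sub_spaces(6)]
  have add: "Pk (x + y) = Pk x + Pk y \<and> Pp (x + y) = Pp x + Pp y \<and> Po (x + y) = Po x + Po y \<and>
    Pl (x + y) = Pl x + Pl y \<and> Pn (x + y) = Pn x + Pn y" for x y
  proof -
    have "x + y = (Pk x + Pk y) + (Pp x + Pp y) + (Po x + Po y) + (Pl x + Pl y) + (Pn x + Pn y)"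
      by (subst P_sum[of x], subst P_sum[of y]) (simp add: algebra_simps)
    then show ?thesis
      using P_unique[of "Pk x + Pk y" "Pp x + Pp y" "Po x + Po y" "Pl x + Pl y" "Pn x + Pn y"] sa P_mem
      by metis
  qed
  have scale: "Pk (r *\<^sub>R x) = r *\<^sub>R Pk x \<and> Pp (r *\<^sub>R x) = r *\<^sub>R Pp x \<and> Po (r *\<^sub>R x) = r *\<^sub>R Po x \<and>
    Pl (r *\<^sub>R x) = r *\<^sub>R Pl x \<and> Pn (r *\<^sub>R x) = r *\<^sub>R Pn x" for r x
  proof -
    have "r *\<^sub>R x = r *\<^sub>R Pk x + r *\<^sub>R Pp x + r *\<^sub>R Po x + r *\<^sub>R Pl x + r *\<^sub>R Pn x"
      by (subst P_sum[of x]) (simp add: scaleR_add_right)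
    then show ?thesis
      using P_unique[of "r *\<^sub>R Pk x" "r *\<^sub>R Pp x" "r *\<^sub>R Po x" "r *\<^sub>R Pl x" "r *\<^sub>R Pn x"] ss P_mem
      by metis
  qed
  show "linear Pk" "linear Pp" "linear Po" "linear Pl" "linear Pn" 
    by (rule linearI; use add scale in blast)+
qed

lemma zero_mem: "0 \<in> \<hh>" "0 \<in> \<gg>\<mu>" "0 \<in> \<pp>" "0 \<in> \<oo>" "0 \<in> \<ll>" "0 \<in> \<nn>"
  using subspace_0[OF subspace_h] sub_spaces subspace_0 by blast+

lemma P_hm: "x \<in> \<hh> \<Longrightarrow> x \<in> \<gg>\<mu> \<Longrightarrow> Pk x = x \<and> Pp x = 0 \<and> Po x = 0 \<and> Pl x = 0 \<and> Pn x = 0"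
  using P_unique[of x 0 0 0 0] zero_mem by simp
lemma P_p: "x \<in> \<pp> \<Longrightarrow> Pk x = 0 \<and> Pp x = x \<and> Po x = 0 \<and> Pl x = 0 \<and> Pn x = 0"
  using P_unique[of 0 x 0 0 0] zero_mem by simp
lemma P_o: "x \<in> \<oo> \<Longrightarrow> Pk x = 0 \<and> Pp x = 0 \<and> Po x = x \<and> Pl x = 0 \<and> Pn x = 0"
  using P_unique[of 0 0 x 0 0] zero_mem by simp
lemma P_l: "x \<in> \<ll> \<Longrightarrow> Pk x = 0 \<and> Pp x = 0 \<and> Po x = 0 \<and> Pl x = x \<and> Pn x = 0"
  using P_unique[of 0 0 0 x 0] zero_mem by simp
lemma P_n: "x \<in> \<nn> \<Longrightarrow> Pk x = 0 \<and> Pp x = 0 \<and> Po x = 0 \<and> Pl x = 0 \<and> Pn x = x"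
  using P_unique[of 0 0 0 0 x] zero_mem by simp

lemma ll_h: "x \<in> \<ll> \<Longrightarrow> x \<in> \<hh>"
proof -
  assume x: "x \<in> \<ll>"
  have "0 + x \<in> \<hh>" by (rule direct_sum_pair_add[OF h_splitting subspace_0[OF sub_spaces(1)] x])
  then show ?thesis by simp
qed

lemma P_h: "x \<in> \<hh> \<Longrightarrow> Pk x + Pl x = x"
proof -
  assume "x \<in> \<hh>"
  then obtain a b where "x = a + b" "a \<in> \<hh>\<mu>" "b \<in> \<ll>" using direct_sum_pair_split[OF h_splitting] by blast
  then show ?thesis using P_unique[of a 0 0 b 0] zero_mem by simp
qed

lemma P_stab: "x \<in> \<gg>\<mu> \<Longrightarrow> Pk x + Pp x = x \<and> Po x = 0 \<and> Pl x = 0 \<and> Pn x = 0"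
proof -
  assume "x \<in> \<gg>\<mu>"
  then obtain a b where "x = a + b" "a \<in> \<hh>\<mu>" "b \<in> \<pp>" using direct_sum_pair_split[OF psum] by blast
  then show ?thesis using P_unique[of a b 0 0 0] zero_mem by simp
qed

lemma mu_stab: "x \<in> \<gg>\<mu> \<Longrightarrow> \<mu> (bracket G x y) = 0" "x \<in> \<gg>\<mu> \<Longrightarrow> \<mu> (bracket G y x) = 0"
proof -
  assume "x \<in> \<gg>\<mu>"
  then have a: "\<mu> (bracket G x y) = 0" for y by (simp add: stab_alg_iff)
  then show "\<mu> (bracket G x y) = 0" .
  show "\<mu> (bracket G y x) = 0" by (subst bracket_skew) (simp add: a blinfun.minus_right)
qed

lemma mu_skew: "\<mu> (bracket G x y) = - \<mu> (bracket G y x)"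
  by (subst bracket_skew) (simp add: blinfun.minus_right)

lemma dual_ext_h:
  assumes "linear (\<lambda>x. f (Pk x + Pl x))"
  shows "blinfun_apply (dual_ext \<hh> (\<pp> \<union> \<oo> \<union> \<nn>) f) x = f (Pk x + Pl x)" "dual_ext \<hh> (\<pp> \<union> \<oo> \<union> \<nn>) f \<in> annih (\<pp> \<union> \<oo> \<union> \<nn>)"
proof -
  have a: "linear (\<lambda>x. Pk x + Pl x)" by (rule linear_compose_add[OF P_linear(1,4)])
  have b: "Pk x + Pl x \<in> \<hh>" for x using P_mem ll_h subspace_add[OF subspace_h] by blast
  have c: "x - (Pk x + Pl x) \<in> span (\<pp> \<union> \<oo> \<union> \<nn>)" for x
  proof -
    have "x - (Pk x + Pl x) = Pp x + Po x + Pn x" by (subst P_sum[of x]) simp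
    also have "\<dots> \<in> span (\<pp> \<union> \<oo> \<union> \<nn>)" by (intro span_add span_base) (use P_mem in auto)
    finally show ?thesis .
  qed
  have d: "Pk x + Pl x = 0" if "x \<in> \<pp> \<union> \<oo> \<union> \<nn>" for x using that P_p P_o P_n by force
  show "blinfun_apply (dual_ext \<hh> (\<pp> \<union> \<oo> \<union> \<nn>) f) x = f (Pk x + Pl x)"
    by (rule dual_ext_proj(1)[OF fd a b P_h d c assms])
  show "dual_ext \<hh> (\<pp> \<union> \<oo> \<union> \<nn>) f \<in> annih (\<pp> \<union> \<oo> \<union> \<nn>)"
    by (rule dual_ext_proj(2)[OF fd a b P_h d c assms])
qed

lemma dual_ext_hm:
  assumes "linear (\<lambda>x. f (Pk x))"
  shows "blinfun_apply (dual_ext \<hh>\<mu> (\<pp> \<union> \<oo> \<union> \<ll> \<union> \<nn>) f) x = f (Pk x)"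
    "dual_ext \<hh>\<mu> (\<pp> \<union> \<oo> \<union> \<ll> \<union> \<nn>) f \<in> annih (\<pp> \<union> \<oo> \<union> \<ll> \<union> \<nn>)"
proof -
  have c: "x - Pk x \<in> span (\<pp> \<union> \<oo> \<union> \<ll> \<union> \<nn>)" for x
  proof -
    have "x - Pk x = Pp x + Po x + Pl x + Pn x" by (subst P_sum[of x]) simp
    also have "\<dots> \<in> span (\<pp> \<union> \<oo> \<union> \<ll> \<union> \<nn>)" by (intro span_add span_base) (use P_mem in auto)
    finally show ?thesis .
  qed
  have b: "Pk x \<in> \<hh>\<mu>" for x using P_mem by blast
  have e: "Pk x = x" if "x \<in> \<hh>\<mu>" for x using that P_hm by blast
  have d: "Pk x = 0" if "x \<in> \<pp> \<union> \<oo> \<union> \<ll> \<union> \<nn>" for x using that P_p P_o P_n P_l by blast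
  show "blinfun_apply (dual_ext \<hh>\<mu> (\<pp> \<union> \<oo> \<union> \<ll> \<union> \<nn>) f) x = f (Pk x)"
    by (rule dual_ext_proj(1)[OF fd P_linear(1) b e d c assms])
  show "dual_ext \<hh>\<mu> (\<pp> \<union> \<oo> \<union> \<ll> \<union> \<nn>) f \<in> annih (\<pp> \<union> \<oo> \<union> \<ll> \<union> \<nn>)"
    by (rule dual_ext_proj(2)[OF fd P_linear(1) b e d c assms])
qed

lemma dual_ext_l:
  assumes "linear (\<lambda>x. f (Pl x))"
  shows "blinfun_apply (dual_ext \<ll> (\<gg>\<mu> \<union> \<oo> \<union> \<nn>) f) x = f (Pl x)" "dual_ext \<ll> (\<gg>\<mu> \<union> \<oo> \<union> \<nn>) f \<in> annih (\<gg>\<mu> \<union> \<oo> \<union> \<nn>)"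
proof -
  have c: "x - Pl x \<in> span (\<gg>\<mu> \<union> \<oo> \<union> \<nn>)" for x
  proof -
    have "x - Pl x = Pk x + Pp x + Po x + Pn x" by (subst P_sum[of x]) simp
    also have "\<dots> \<in> span (\<gg>\<mu> \<union> \<oo> \<union> \<nn>)" by (intro span_add span_base) (use P_mem pp_stab in auto)
    finally show ?thesis .
  qed
  have e: "Pl x = x" if "x \<in> \<ll>" for x using that P_l by blast
  have d: "Pl x = 0" if "x \<in> \<gg>\<mu> \<union> \<oo> \<union> \<nn>" for x using that P_stab P_o P_n by blast
  show "blinfun_apply (dual_ext \<ll> (\<gg>\<mu> \<union> \<oo> \<union> \<nn>) f) x = f (Pl x)"
    by (rule dual_ext_proj(1)[OF fd P_linear(4) P_mem(5) e d c assms])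
  show "dual_ext \<ll> (\<gg>\<mu> \<union> \<oo> \<union> \<nn>) f \<in> annih (\<gg>\<mu> \<union> \<oo> \<union> \<nn>)"
    by (rule dual_ext_proj(2)[OF fd P_linear(4) P_mem(5) e d c assms])
qed

section \<open>The representation of \<open>H\<close> and the diamond maps\<close>

lemma H_C: "h \<in> H \<Longrightarrow> h \<in> C" using subgroup.mem_carrier[OF subH] .
lemma H_one: "\<one> \<in> H" using subgroup.one_closed[OF subH] .
lemma H_mult: "h \<in> H \<Longrightarrow> k \<in> H \<Longrightarrow> h \<otimes> k \<in> H" using subgroup.m_closed[OF subH] .
lemma H_inv: "h \<in> H \<Longrightarrow> inv h \<in> H" using subgroup.m_inv_closed[OF subH] .

lemma sub_alg_velocity: "\<eta> \<in> \<hh> \<Longrightarrow> velocity M H \<one> \<eta>"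
  unfolding sub_alg_def by (rule tangent_space_velocity[OF chM])

lemma rho_linear: "h \<in> H \<Longrightarrow> linear (\<rho> h)" using rep by (simp add: lie_representation_def)
lemma rho_one: "\<rho> \<one> a = a" using rep by (simp add: lie_representation_def)
lemma rho_mult: "h \<in> H \<Longrightarrow> k \<in> H \<Longrightarrow> \<rho> (h \<otimes> k) a = \<rho> h (\<rho> k a)" using rep by (simp add: lie_representation_def)
lemma rho_inv: "h \<in> H \<Longrightarrow> \<rho> (inv h) (\<rho> h a) = a" "h \<in> H \<Longrightarrow> \<rho> h (\<rho> (inv h) a) = a"
  using rho_mult[of "inv h" h a] rho_mult[of h "inv h" a] rho_one H_inv H_C by auto

lemma rho_mderiv: "h \<in> H \<Longrightarrow> \<exists>D. mderiv (prod_mfd M vec_mfd) (H \<times> UNIV) vec_mfd (\<lambda>(h, a). \<rho> h a) (h, a) D"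
proof -
  assume h: "h \<in> H"
  have sm: "smooth_map (prod_mfd M vec_mfd) (H \<times> UNIV) vec_mfd (\<lambda>(h, a). \<rho> h a)"
    using rep by (simp add: lie_representation_def)
  show ?thesis
    using smooth_map_mderiv[OF chMV chV fin_dim_prod[OF fd fdS] sm, of "(h, a)"] h by (metis UNIV_I mem_Sigma_iff)
qed

lemma idH: "h \<in> H \<Longrightarrow> mderiv M H M (\<lambda>x. x) h (\<lambda>v. v)"
  by (rule mderiv_ident[OF chM]) (auto simp: ptsM H_C)

lemma rho_mderiv_fix: "h \<in> H \<Longrightarrow> \<exists>D. mderiv M H vec_mfd (\<lambda>h. \<rho> h a) h D"
proof -
  assume h: "h \<in> H"
  obtain D where D: "mderiv (prod_mfd M vec_mfd) (H \<times> UNIV) vec_mfd (\<lambda>(h, a). \<rho> h a) (h, a) D"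
    using rho_mderiv[OF h] by blast
  have c: "mderiv M H vec_mfd (\<lambda>_. a) h (\<lambda>_. 0)"
    by (rule mderiv_const[OF chV]) (auto simp: h ptsM H_C)
  have "mderiv M H vec_mfd (\<lambda>x. (\<lambda>(h, a). \<rho> h a) (x, a)) h (\<lambda>v. D (v, 0))"
    by (rule mderiv_compose_simple[OF chM chMV chV mderiv_Pair[OF chM chM chV idH[OF h] c] D]) auto
  then show ?thesis by (simp, blast)
qed

text \<open>\<open>inf_act\<close> is a \<open>tmap\<close> on the subset \<open>H\<close>, so only
  its values on \<open>\<hh>\<close> are determined by the action. A linear \<open>D\<close> that
  agrees with it there supplies the linearity required for the functionals in
  \<open>diamond\<close>.\<close>

lemma inf_act_linear:
  obtains D where "mderiv M H vec_mfd (\<lambda>h. \<rho> h a) \<one> D" "linear D" "\<And>\<eta>. \<eta> \<in> \<hh> \<Longrightarrow> inf_act G H \<rho> \<eta> a = D \<eta>"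
proof -
  obtain D where D: "mderiv M H vec_mfd (\<lambda>h. \<rho> h a) \<one> D" using rho_mderiv_fix[OF H_one] by blast
  show ?thesis
  proof (rule that[OF D])
    show "linear D" by (rule bounded_linear.linear[OF mderiv_linear[OF D]])
    show "inf_act G H \<rho> \<eta> a = D \<eta>" if "\<eta> \<in> \<hh>" for \<eta>
      unfolding inf_act_def by (rule tmap_eq_mderiv[OF chM D sub_alg_velocity[OF that]])
  qed
qed

lemma inf_act_compose_linear:
  assumes "linear P" "\<And>x. P x \<in> \<hh>"
  shows "linear (\<lambda>x. blinfun_apply b (inf_act G H \<rho> (P x) a))"
proof -
  obtain D where D: "linear D" "\<And>\<eta>. \<eta> \<in> \<hh> \<Longrightarrow> inf_act G H \<rho> \<eta> a = D \<eta>"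
    using inf_act_linear[of a] by metis
  have "linear (\<lambda>x. blinfun_apply b (D (P x)))"
    using linear_compose[OF linear_compose[OF assms(1) D(1)] bounded_linear.linear[OF blinfun.bounded_linear_right[of b]]]
    by (simp add: o_def)
  then show ?thesis using D(2) assms(2) by simp
qed

abbreviation "dia_h a b \<equiv> diamond \<hh> (\<pp> \<union> \<oo> \<union> \<nn>) (inf_act G H \<rho>) a b"
abbreviation "dia_l a b \<equiv> diamond \<ll> (\<gg>\<mu> \<union> \<oo> \<union> \<nn>) (inf_act G H \<rho>) a b"
abbreviation "JN \<equiv> J_N0 G H \<rho> \<mu> (\<pp> \<union> \<oo> \<union> \<ll> \<union> \<nn>)"

lemma Pkl_linear: "linear (\<lambda>x. Pk x + Pl x)" by (rule linear_compose_add[OF P_linear(1,4)])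
lemma Pkl_h: "Pk x + Pl x \<in> \<hh>" using P_mem ll_h subspace_add[OF subspace_h] by blast

lemma dia_h_apply: "blinfun_apply (dia_h a b) \<eta> = b (inf_act G H \<rho> (Pk \<eta> + Pl \<eta>) a)"
  and dia_h_annih: "dia_h a b \<in> annih (\<pp> \<union> \<oo> \<union> \<nn>)"
  unfolding diamond_def
  by (rule dual_ext_h[OF inf_act_compose_linear[OF Pkl_linear Pkl_h]])+

lemma dia_l_apply: "blinfun_apply (dia_l a b) \<eta> = b (inf_act G H \<rho> (Pl \<eta>) a)"
  and dia_l_annih: "dia_l a b \<in> annih (\<gg>\<mu> \<union> \<oo> \<union> \<nn>)"
  unfolding diamond_def
  by (rule dual_ext_l[OF inf_act_compose_linear[OF P_linear(4) ll_h[OF P_mem(5)]]])+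

lemma JN_apply: "blinfun_apply (JN (x, a, b)) \<eta> = (1/2) * \<mu> (bracket G x (bracket G (Pk \<eta>) x)) + b (inf_act G H \<rho> (Pk \<eta>) a)"
  and JN_annih: "JN (x, a, b) \<in> annih (\<pp> \<union> \<oo> \<union> \<ll> \<union> \<nn>)"
proof -
  have l: "linear (\<lambda>\<eta>. blinfun_apply (coad G x \<mu>) (bracket G (Pk \<eta>) x))"
    using linear_compose[OF linear_compose[OF P_linear(1) bracket_linear_left[of x]] bounded_linear.linear[OF blinfun.bounded_linear_right[of "coad G x \<mu>"]]]
    by (simp add: o_def)
  note 1 = dual_ext_hm[OF l] and 2 = dual_ext_hm[OF inf_act_compose_linear[OF P_linear(1) P_mem(1)]]
  show "blinfun_apply (JN (x, a, b)) \<eta> = (1/2) * \<mu> (bracket G x (bracket G (Pk \<eta>) x)) + b (inf_act G H \<rho> (Pk \<eta>) a)"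
    unfolding J_N0_def diamond_def prod.case
    using 1(1)[of \<eta>] 2(1)[of b a \<eta>] by (simp add: blinfun.add_left blinfun.scaleR_left coad_apply)
  show "JN (x, a, b) \<in> annih (\<pp> \<union> \<oo> \<union> \<ll> \<union> \<nn>)"
    unfolding J_N0_def diamond_def prod.case
    by (intro subspace_add[OF subspace_annih] subspace_scale[OF subspace_annih] 1(2) 2(2))
qed

section \<open>The restricted tube\<close>

definition "A y = fst (\<Phi> (\<one>, y))"
definition "B y = snd (\<Phi> (\<one>, y))"

lemma Phi_eq: "g \<in> C \<Longrightarrow> y \<in> U \<Longrightarrow> \<Phi> (g, y) = (g \<otimes> A y, B y)"
proof -
  assume g: "g \<in> C" and y: "y \<in> U"
  have "\<forall>g'\<in>C. \<forall>g\<in>C. \<forall>y\<in>U. \<Phi> (g' \<otimes> g, y) = (g' \<otimes> fst (\<Phi> (g, y)), snd (\<Phi> (g, y)))"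
    using tube unfolding restricted_tube_def by (elim conjE)
  then have "\<Phi> (g \<otimes> \<one>, y) = (g \<otimes> fst (\<Phi> (\<one>, y)), snd (\<Phi> (\<one>, y)))" using g y one_closed by blast
  then show ?thesis using g by (simp add: A_def B_def)
qed

lemma U_open: "openin (top_of_set TM) U" using tube by (simp add: restricted_tube_def)
lemma U_connected: "connected U" using tube by (simp add: restricted_tube_def)
lemma U_zero: "0 \<in> U" using tube by (simp add: restricted_tube_def)
lemma U_TM: "y \<in> U \<Longrightarrow> y \<in> TM" using openin_imp_subset[OF U_open] by blast
lemma AB_zero: "A 0 = \<one>" "B 0 = \<mu>" using tube by (simp_all add: restricted_tube_def A_def B_def zero_prod_def)
lemma TM_subspace: "subspace TM"
  unfolding tube_model_def by (intro subspace_Times subspace_annih sub_spaces(4))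
lemma U_velocity: "y \<in> U \<Longrightarrow> w \<in> TM \<Longrightarrow> velocity vec_mfd U y w"
  by (rule velocity_rel_open[OF TM_subspace U_open])

lemma tube_l: "y \<in> U \<Longrightarrow> \<eta> \<in> \<ll> \<Longrightarrow> blinfun_apply (B y) \<eta> = blinfun_apply (snd (snd y)) \<eta>"
proof -
  assume y: "y \<in> U" and \<eta>: "\<eta> \<in> \<ll>"
  have "\<forall>g\<in>C. \<forall>\<nu> x \<epsilon>. (\<nu>, x, \<epsilon>) \<in> U \<longrightarrow> (\<forall>\<eta>\<in>\<ll>. (- snd (\<Phi> (g, \<nu>, x, \<epsilon>))) \<eta> = - blinfun_apply \<epsilon> \<eta>)"
    using tube unfolding restricted_tube_def by (elim conjE)
  then have "(- snd (\<Phi> (\<one>, fst y, fst (snd y), snd (snd y)))) \<eta> = - blinfun_apply (snd (snd y)) \<eta>"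
    using y \<eta> one_closed by (metis prod.collapse)
  then show ?thesis by (simp add: B_def blinfun.minus_left)
qed

lemma fdT: "fin_dim TYPE('g dual \<times> 'g \<times> 'g dual)" by (intro fin_dim_prod fdd fd)

lemma Phi_mderiv:
  assumes "y \<in> U"
  obtains D where "mderiv MV (C \<times> U) MD \<Phi> (\<one>, y) D"
proof -
  have "smooth_map MV (C \<times> U) MD \<Phi>"
    using tube by (simp add: restricted_tube_def diffeo_onto_image_def TG_dual_def)
  from smooth_map_mderiv[OF chMV chMV fin_dim_prod[OF fd fdT] this, of "(\<one>, y)"] assms
  show ?thesis using that by blast
qed

lemma AB_mderiv:
  assumes y: "y \<in> U" and D: "mderiv MV (C \<times> U) MD \<Phi> (\<one>, y) D"
  shows "mderiv vec_mfd U M A y (\<lambda>w. fst (D (0, w)))" "mderiv vec_mfd U vec_mfd B y (\<lambda>w. snd (D (0, w)))"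
proof -
  have i: "mderiv vec_mfd U MV (\<lambda>y. (\<one>, y)) y (\<lambda>w. (0, w))"
    by (intro mderiv_Pair chV chM mderiv_const mderiv_ident) (use y ptsM in auto)
  have P: "mderiv vec_mfd U MD (\<lambda>y. \<Phi> (\<one>, y)) y (\<lambda>w. D (0, w))"
    by (rule mderiv_compose_simple[OF chV chMV chMV i D]) auto
  have m: "\<Phi> (\<one>, y) \<in> pts MD" using mderiv_mem(3)[OF P] .
  show "mderiv vec_mfd U M A y (\<lambda>w. fst (D (0, w)))"
    unfolding A_def[abs_def]
    by (rule mderiv_compose_simple[OF chV chMV chM P mderiv_fst[OF chM chV UNIV_I m]]) auto
  show "mderiv vec_mfd U vec_mfd B y (\<lambda>w. snd (D (0, w)))"
    unfolding B_def[abs_def]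
    by (rule mderiv_compose_simple[OF chV chMV chV P mderiv_snd[OF chM chV UNIV_I m]]) auto
qed

lemma A_C: "y \<in> U \<Longrightarrow> A y \<in> C"
  using Phi_mderiv[of y] AB_mderiv(1)[of y] mderiv_mem(3) ptsM by metis

text \<open>The form condition evaluated on \<open>(\<xi>, 0)\<close> and \<open>(0, w)\<close>. By
  left equivariance the image of the first vector is tangent to
  \<open>g \<mapsto> (g \<otimes> A y, B y)\<close>, and its left trivialization is
  \<open>Ad G (inv (A y)) \<xi>\<close> with no covector part.\<close>

lemma tube_form_identity:
  assumes y: "y \<in> U" and D: "mderiv MV (C \<times> U) MD \<Phi> (\<one>, y) D"
    and w: "w \<in> TM"
  shows "blinfun_apply (snd (D (0, w))) (Ad G (inv (A y)) \<xi>)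
    + blinfun_apply (B y) (bracket G (Ad G (inv (A y)) \<xi>) (to_left G (A y) (fst (D (0, w))))) = blinfun_apply (fst w) \<xi>"
proof -
  let ?T = "tmap MV (C \<times> U) (TG_dual G) \<Phi> (\<one>, y)"
  have TGD: "TG_dual G = MD" by (simp add: TG_dual_def)
  have AC: "A y \<in> C" by (rule A_C[OF y])
  have v: "velocity MV (C \<times> U) (\<one>, y) (\<xi>, w)" if "w \<in> TM" for \<xi> w
    by (rule velocity_Pair[OF chM chV velC[OF one_closed] U_velocity[OF y that]])
  have T: "?T (\<xi>, w) = D (\<xi>, w)" if "w \<in> TM" for \<xi> w
    unfolding TGD by (rule tmap_eq_mderiv[OF chMV D v[OF that]])
  have z: "0 \<in> TM" by (rule subspace_0[OF TM_subspace])
  have "\<forall>g\<in>C. \<forall>y\<in>U. \<forall>\<xi>1 \<xi>2. \<forall>y1\<in>TM. \<forall>y2\<in>TM.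
        TG_form G (\<Phi> (g, y))
          (tmap MV (C \<times> U) (TG_dual G) \<Phi> (g, y) (from_left G g \<xi>1, y1))
          (tmap MV (C \<times> U) (TG_dual G) \<Phi> (g, y) (from_left G g \<xi>2, y2))
        = tube_form G \<mu> (fst y) (\<xi>1, y1) (\<xi>2, y2)"
    using tube unfolding restricted_tube_def by (elim conjE)
  then have "TG_form G (\<Phi> (\<one>, y)) (?T (from_left G \<one> \<xi>, 0)) (?T (from_left G \<one> 0, w))
     = tube_form G \<mu> (fst y) (\<xi>, 0) (0, w)" using y z w one_closed by blast
  then have main: "TG_form G (A y, B y) (D (\<xi>, 0)) (D (0, w)) = tube_form G \<mu> (fst y) (\<xi>, 0) (0, w)"
    by (simp add: from_left_one T z w A_def B_def)
  have D1: "fst (D (\<xi>, 0)) = dmult \<one> (A y) (\<xi>, 0)" "snd (D (\<xi>, 0)) = 0" for \<xi>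
  proof -
    have i: "mderiv M C MV (\<lambda>g. (g, y)) \<one> (\<lambda>v. (v, 0))"
      by (intro mderiv_Pair chM chV idM one_closed mderiv_const) (use ptsM in auto)
    have "mderiv M C MD (\<lambda>g. \<Phi> (g, y)) \<one> (\<lambda>v. D (v, 0))"
      by (rule mderiv_compose_simple[OF chM chMV chMV i D]) (use y in auto)
    then have 1: "mderiv M C MD (\<lambda>g. (g \<otimes> A y, B y)) \<one> (\<lambda>v. D (v, 0))"
      by (rule mderiv_cong[OF chM]) (simp add: Phi_eq y)
    have 2: "mderiv M C MD (\<lambda>g. (g \<otimes> A y, B y)) \<one> (\<lambda>v. (dmult \<one> (A y) (v, 0), 0))"
      by (intro mderiv_Pair chM chV right_mderiv one_closed AC mderiv_const) (use ptsM in auto)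
    from fun_cong[OF mderiv_uniqueM[OF 1 2], of \<xi>]
    show "fst (D (\<xi>, 0)) = dmult \<one> (A y) (\<xi>, 0)" "snd (D (\<xi>, 0)) = 0" by auto
  qed
  have Ad1: "to_left G (A y) (dmult \<one> (A y) (\<xi>, 0)) = Ad G (inv (A y)) \<xi>"
  proof -
    have "mderiv M C M (\<lambda>g. inv (A y) \<otimes> (g \<otimes> A y)) \<one> (\<lambda>v. to_left G (A y) (dmult \<one> (A y) (v, 0)))"
      by (rule mderiv_compose_simple[OF chM chM chM right_mderiv[OF AC one_closed]])
        (use AC to_left_mderiv in auto)
    then have "mderiv M C M (\<lambda>g. inv (A y) \<otimes> g \<otimes> inv (inv (A y))) \<one> (\<lambda>v. to_left G (A y) (dmult \<one> (A y) (v, 0)))"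
      by (rule mderiv_cong[OF chM]) (simp add: AC m_assoc)
    from fun_cong[OF mderiv_uniqueM[OF this Ad_mderiv[OF inv_closed[OF AC]]], of \<xi>] show ?thesis .
  qed
  obtain w1 w2 w3 where [simp]: "w = (w1, w2, w3)" by (cases w)
  have Deq: "D (\<xi>, 0) = (dmult \<one> (A y) (\<xi>, 0), 0)" using D1[of \<xi>] by (simp add: prod_eq_iff)
  show ?thesis
    using main unfolding Deq TG_form_def tube_form_def
    by (simp add: case_prod_beta Let_def Ad1 bracket_simps zero_prod_def)
qed

text \<open>After applying \<open>coAd G (inv (A y))\<close>, the identity from the form says that
  the left momentum has the same derivative as \<open>fst\<close>. The conclusion is restricted to
  \<open>TM\<close> because \<open>U\<close> is open only relative to that subspace.\<close>

lemma left_momentum_tube_derivative: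
  assumes y: "y \<in> U"
  obtains E where "strict_deriv (\<lambda>y. coAd G (inv (A y)) (B y) - fst y) E y U" "\<And>w. w \<in> TM \<Longrightarrow> E w = 0"
proof -
  obtain D where D: "mderiv MV (C \<times> U) MD \<Phi> (\<one>, y) D" using Phi_mderiv[OF y] by blast
  note AB = AB_mderiv[OF y D]
  have AC: "A y \<in> C" by (rule A_C[OF y])
  \<comment> \<open>\<open>mderiv_coAd\<close> requires the group element to be the identity at the
    base point, so the constant factor \<open>inv (A y)\<close> is split off.\<close>
  let ?c = "\<lambda>y'. inv (A y) \<otimes> A y'"
  have c: "mderiv vec_mfd U M ?c y (\<lambda>w. to_left G (A y) (fst (D (0, w))))"
    by (rule mderiv_compose_simple[OF chV chM chM AB(1) to_left_mderiv[OF AC]]) (rule A_C)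
  have cy: "?c y = \<one>" using AC by simp
  have ci: "mderiv vec_mfd U M (\<lambda>y'. inv (?c y')) y (\<lambda>w. - to_left G (A y) (fst (D (0, w))))"
    by (rule mderiv_inv[OF chV c]) (use A_C AC cy in auto)
  have k: "mderiv vec_mfd U vec_mfd (\<lambda>y'. coAd G (inv (?c y')) (B y')) y
    (\<lambda>w. snd (D (0, w)) + coad G (- to_left G (A y) (fst (D (0, w)))) (B y))"
    by (rule mderiv_coAd[OF chV ci AB(2)]) (use A_C AC cy in auto)
  have "mderiv vec_mfd U vec_mfd (\<lambda>y'. coAd G (inv (A y)) (coAd G (inv (?c y')) (B y'))) y
    (\<lambda>w. coAd G (inv (A y)) (snd (D (0, w)) + coad G (- to_left G (A y) (fst (D (0, w)))) (B y)))"
    by (rule mderiv_vec_linear[OF chV k coAd_bounded_linear[OF inv_closed[OF AC]]])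
  then have "mderiv vec_mfd U vec_mfd (\<lambda>y'. coAd G (inv (A y')) (B y')) y
    (\<lambda>w. coAd G (inv (A y)) (snd (D (0, w)) + coad G (- to_left G (A y) (fst (D (0, w)))) (B y)))"
  proof (rule mderiv_cong[OF chV])
    fix x assume "x \<in> U"
    then have "A x \<in> C" by (rule A_C)
    then have "inv (A x) = inv (?c x) \<otimes> inv (A y)" using AC by (simp add: inv_mult_group m_assoc)
    then show "coAd G (inv (A x)) (B x) = coAd G (inv (A y)) (coAd G (inv (?c x)) (B x))"
      using \<open>A x \<in> C\<close> AC by (simp add: coAd_mult)
  qed
  then have sd: "strict_deriv (\<lambda>y'. coAd G (inv (A y')) (B y'))
     (\<lambda>w. coAd G (inv (A y)) (snd (D (0, w)) + coad G (- to_left G (A y) (fst (D (0, w)))) (B y))) y U"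
    by (simp add: mderiv_vec_vec)
  show ?thesis
  proof (rule that)
    show "strict_deriv (\<lambda>y'. coAd G (inv (A y')) (B y') - fst y')
     (\<lambda>w. coAd G (inv (A y)) (snd (D (0, w)) + coad G (- to_left G (A y) (fst (D (0, w)))) (B y)) - fst w) y U"
      by (rule strict_deriv_diff[OF sd strict_deriv_bounded_linear[OF bounded_linear_fst] y])
    fix w assume w: "w \<in> TM"
    show "coAd G (inv (A y)) (snd (D (0, w)) + coad G (- to_left G (A y) (fst (D (0, w)))) (B y)) - fst w = 0"
    proof (rule blinfun_eqI)
      fix \<xi>
      let ?\<zeta> = "Ad G (inv (A y)) \<xi>" and ?v = "to_left G (A y) (fst (D (0, w)))"
      have "blinfun_apply (B y) (bracket G (- ?v) ?\<zeta>) = blinfun_apply (B y) (bracket G ?\<zeta> ?v)"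
        by (subst bracket_skew[of ?\<zeta>]) (simp add: bracket_simps)
      then show "blinfun_apply (coAd G (inv (A y)) (snd (D (0, w)) + coad G (- ?v) (B y)) - fst w) \<xi> = blinfun_apply 0 \<xi>"
        using tube_form_identity[OF y D w, of \<xi>] AC
        by (simp add: coAd_apply coad_apply blinfun.diff_left blinfun.add_left)
    qed
  qed
qed

lemma left_momentum_tube:
  assumes y: "y \<in> U"
  shows "coAd G (inv (A y)) (B y) = fst y + \<mu>"
proof -
  let ?f = "\<lambda>y. coAd G (inv (A y)) (B y) - fst y"
  have "?f y = ?f 0"
  proof (rule connected_local_const[OF U_connected y U_zero], intro ballI)
    fix a assume a: "a \<in> U"
    obtain T where T: "open T" "U = TM \<inter> T" using U_open by (auto simp: openin_open)
    then obtain r where r: "r > 0" "ball a r \<subseteq> T" using a open_contains_ball by blast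
    \<comment> \<open>A convex piece of \<open>U\<close>: zero derivative makes the difference
      constant on it, and connectedness of \<open>U\<close> joins the pieces.\<close>
    let ?S = "TM \<inter> ball a r"
    have SU: "?S \<subseteq> U" using T r by blast
    have "\<exists>c. \<forall>x\<in>?S. ?f x = c"
    proof (rule has_derivative_zero_constant)
      show "convex ?S" by (intro convex_Int subspace_imp_convex TM_subspace convex_ball)
      fix x assume x: "x \<in> ?S"
      then have xU: "x \<in> U" using SU by blast
      obtain E where E: "strict_deriv ?f E x U" "\<And>w. w \<in> TM \<Longrightarrow> E w = 0" using left_momentum_tube_derivative[OF xU] by blast
      have E0: "E (z - x) = 0" if "z \<in> ?S" for z
        using E(2) that x subspace_diff[OF TM_subspace] by blast
      show "(?f has_derivative (\<lambda>h. 0)) (at x within ?S)"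
        unfolding has_derivative_within_alt
      proof (intro conjI allI impI)
        fix e :: real assume "e > 0"
        then obtain d where d: "d > 0" "\<And>y z. y \<in> U \<Longrightarrow> z \<in> U \<Longrightarrow> dist x y < d \<Longrightarrow> dist x z < d \<Longrightarrow>
          norm (?f y - ?f z - E (y - z)) \<le> e * norm (y - z)" using strict_derivD[OF E(1)] by metis
        show "\<exists>d>0. \<forall>z\<in>?S. norm (z - x) < d \<longrightarrow> norm (?f z - ?f x - 0) \<le> e * norm (z - x)"
        proof (intro exI[of _ d] conjI ballI impI d(1))
          fix z assume z: "z \<in> ?S" "norm (z - x) < d"
          have "norm (?f z - ?f x - E (z - x)) \<le> e * norm (z - x)"
            by (rule d(2)) (use z xU SU d(1) in \<open>auto simp: dist_norm norm_minus_commute\<close>)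
          then show "norm (?f z - ?f x - 0) \<le> e * norm (z - x)" unfolding E0[OF z(1)] .
        qed
      qed simp
    qed
    then obtain c where c: "\<And>x. x \<in> ?S \<Longrightarrow> ?f x = c" by blast
    have "?f a = ?f b" if "b \<in> U" "dist b a < r" for b
      using c[of a] c[of b] that a U_TM r(1) by (auto simp: dist_commute)
    then show "\<forall>\<^sub>F b in at a within U. ?f a = ?f b"
      unfolding eventually_at using r(1) by (intro exI[of _ r]) simp
  qed
  then show ?thesis by (simp add: AB_zero coAd_one algebra_simps)
qed

end

lemma fin_dim_inj_surj:
  fixes f :: "'v::real_normed_vector \<Rightarrow> 'v"
  assumes "fin_dim TYPE('v)" "linear f" "inj f"
  shows "surj f"
proof -
  obtain S :: "'v set" where S: "finite S" "span S = UNIV" using assms(1) unfolding fin_dim_def by blast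
  obtain B where B: "B \<subseteq> S" "independent B" "S \<subseteq> span B" using maximal_independent_subset by blast
  have fB: "finite B" using B S finite_subset by blast
  have sB: "span B = UNIV" using B S by (metis span_eq_iff span_mono span_span top.extremum_uniqueI)
  have "finite_dimensional_vector_space (scaleR :: real \<Rightarrow> 'v \<Rightarrow> 'v) B"
    by unfold_locales
      (use fB B(2)[unfolded dependent_raw_def] sB[unfolded span_raw_def] in auto)
  then show ?thesis
    by (rule finite_dimensional_vector_space.linear_inj_imp_surj) (use assms in \<open>auto simp: linear_def\<close>)
qed

section \<open>The tube linearized at the origin\<close>

context tube_data
begin

lemma nondeg_o: "x \<in> \<oo> \<Longrightarrow> (\<And>y. y \<in> \<oo> \<Longrightarrow> \<mu> (bracket G x y) = 0) \<Longrightarrow> x = 0"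
  using splitting by (simp add: adapted_splitting_def nondeg_on_def \<Omega>\<mu>_def)

lemma iso_l: "x \<in> \<ll> \<Longrightarrow> y \<in> \<ll> \<Longrightarrow> \<mu> (bracket G x y) = 0"
  using splitting by (simp add: adapted_splitting_def \<Omega>\<mu>_def)

lemma iso_n: "x \<in> \<nn> \<Longrightarrow> y \<in> \<nn> \<Longrightarrow> \<mu> (bracket G x y) = 0"
  using splitting by (simp add: adapted_splitting_def \<Omega>\<mu>_def)

lemma orth_o: 
  assumes "x \<in> \<oo>" "y \<in> \<ll> \<or> y \<in> \<nn>"
  shows "\<mu> (bracket G x y) = 0" "\<mu> (bracket G y x) = 0"
proof -
  have "y \<in> span (\<ll> \<union> \<nn>)" using assms(2) by (auto intro: span_base)
  then show 1: "\<mu> (bracket G x y) = 0" using assms(1) splitting by (simp add: adapted_splitting_def \<Omega>\<mu>_def)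
  show "\<mu> (bracket G y x) = 0" using 1 by (subst mu_skew) simp
qed

lemma \<mu>_bilinear: "bilinear (\<lambda>x y. \<mu> (bracket G x y))"
  unfolding bilinear_def
  by (intro conjI allI linearI) (auto simp: bracket_simps blinfun.add_right blinfun.scaleR_right)

text \<open>Since \<open>\<nn>\<close> is isotropic, an element of it orthogonal to
  \<open>\<ll>\<close> is orthogonal to all of \<open>\<ll> \<oplus> \<nn>\<close>.\<close>

lemma nondeg_n:
  assumes x: "x \<in> \<nn>" and "\<And>y. y \<in> \<ll> \<Longrightarrow> \<mu> (bracket G y x) = 0"
  shows "x = 0"
proof -
  have z: "\<mu> (bracket G x y) = 0" if "y \<in> \<ll> \<union> \<nn>" for y
  proof (cases "y \<in> \<ll>")
    case True
    then have "\<mu> (bracket G y x) = 0" by (rule assms(2))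
    then show ?thesis by (subst mu_skew) simp
  next
    case False
    then show ?thesis using that iso_n[OF x] by blast
  qed
  have l: "linear (\<lambda>y. \<mu> (bracket G x y))" using \<mu>_bilinear by (simp add: bilinear_def)
  have "\<mu> (bracket G x y) = 0" if "y \<in> span (\<ll> \<union> \<nn>)" for y
    by (rule linear_eq_0_on_span[OF l z that])
  moreover have "x \<in> span (\<ll> \<union> \<nn>)" using x by (auto intro: span_base)
  ultimately show ?thesis using splitting by (simp add: adapted_splitting_def nondeg_on_def \<Omega>\<mu>_def)
qed

lemma mu_expand:
  "\<mu> (bracket G x y) = \<mu> (bracket G (Po x + Pl x + Pn x) y)"
  "\<mu> (bracket G y x) = \<mu> (bracket G y (Po x + Pl x + Pn x))"
proof -
  have s: "Pk x + Pp x \<in> \<gg>\<mu>" using P_mem pp_stab subspace_add[OF subspace_stab_alg] by blast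
  have x: "x = (Pk x + Pp x) + (Po x + Pl x + Pn x)" by (subst P_sum[of x]) (simp add: add.assoc)
  have "\<mu> (bracket G x y) = \<mu> (bracket G (Pk x + Pp x) y) + \<mu> (bracket G (Po x + Pl x + Pn x) y)"
    by (subst x) (simp only: bracket_simps(1) blinfun.add_right)
  then show "\<mu> (bracket G x y) = \<mu> (bracket G (Po x + Pl x + Pn x) y)" using mu_stab(1)[OF s] by simp
  have "\<mu> (bracket G y x) = \<mu> (bracket G y (Pk x + Pp x)) + \<mu> (bracket G y (Po x + Pl x + Pn x))"
    by (subst x) (simp only: bracket_simps(2) blinfun.add_right)
  then show "\<mu> (bracket G y x) = \<mu> (bracket G y (Po x + Pl x + Pn x))" using mu_stab(2)[OF s] by simp
qed

lemma mu_on_l: "y \<in> \<ll> \<Longrightarrow> \<mu> (bracket G x y) = \<mu> (bracket G (Pn x) y)"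
  by (subst mu_expand(1)) (simp add: bracket_simps blinfun.add_right orth_o(1)[OF P_mem(4)] iso_l[OF P_mem(5)])

lemma mu_on_o: "y \<in> \<oo> \<Longrightarrow> \<mu> (bracket G x y) = \<mu> (bracket G (Po x) y)"
  by (subst mu_expand(1)) (simp add: bracket_simps blinfun.add_right orth_o(2) P_mem)

context
  fixes D
  assumes D: "mderiv MV (C \<times> U) MD \<Phi> (\<one>, 0) D"
begin

abbreviation "dA w \<equiv> fst (D (0, w))"
abbreviation "dB w \<equiv> snd (D (0, w))"

lemma D_linear: "linear D" by (rule bounded_linear.linear[OF mderiv_linear[OF D]])
lemma dA_linear: "linear (\<lambda>w. dA w)" and dB_linear: "linear (\<lambda>w. dB w)"
proof -
  have l: "linear (\<lambda>w. D (0, w))"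
    using linear_compose[OF bounded_linear.linear[OF bounded_linear_Pair[OF bounded_linear_zero bounded_linear_ident]] D_linear]
    by (simp add: o_def)
  show "linear (\<lambda>w. dA w)" using linear_compose[OF l linear_fst] by (simp add: o_def)
  show "linear (\<lambda>w. dB w)" using linear_compose[OF l linear_snd] by (simp add: o_def)
qed

lemma dB_eq:
  assumes "w \<in> TM" shows "blinfun_apply (dB w) \<xi> = blinfun_apply (fst w) \<xi> + \<mu> (bracket G (dA w) \<xi>)"
  using tube_form_identity[OF U_zero D assms, of \<xi>]
  by (simp add: AB_zero Ad_one to_left_one mu_skew[of "dA w"])

text \<open>On \<open>\<ll>\<close> the momentum condition makes \<open>B\<close> equal to the
  linear coordinate \<open>snd (snd y)\<close>, whose derivative is itself.\<close>

lemma dB_l: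
  assumes w: "w \<in> TM" and \<eta>: "\<eta> \<in> \<ll>"
  shows "blinfun_apply (dB w) \<eta> = blinfun_apply (snd (snd w)) \<eta>"
proof -
  have e: "bounded_linear (\<lambda>\<beta> :: 'g dual. blinfun_apply \<beta> \<eta>)" by (rule blinfun.bounded_linear_left)
  have 1: "mderiv vec_mfd U vec_mfd (\<lambda>y. blinfun_apply (B y) \<eta>) 0 (\<lambda>w. blinfun_apply (dB w) \<eta>)"
    by (rule mderiv_vec_linear[OF chV AB_mderiv(2)[OF U_zero D] e])
  have "bounded_linear (\<lambda>y :: 'g dual \<times> 'g \<times> 'g dual. blinfun_apply (snd (snd y)) \<eta>)"
    by (rule bounded_linear_compose[OF e bounded_linear_compose[OF bounded_linear_snd bounded_linear_snd]])
  then have "mderiv vec_mfd U vec_mfd (\<lambda>y. blinfun_apply (snd (snd y)) \<eta>) 0 (\<lambda>y. blinfun_apply (snd (snd y)) \<eta>)"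
    by (simp add: mderiv_vec_vec U_zero strict_deriv_bounded_linear)
  then have "mderiv vec_mfd U vec_mfd (\<lambda>y. blinfun_apply (B y) \<eta>) 0 (\<lambda>y. blinfun_apply (snd (snd y)) \<eta>)"
    by (rule mderiv_cong[OF chV]) (rule tube_l[OF _ \<eta>])
  from mderiv_unique[OF chV 1 this U_velocity[OF U_zero w]] show ?thesis .
qed

text \<open>With \<open>dB\<close> expressed through \<open>dA\<close> by \<open>dB_eq\<close>, the
  three terms of the form on the target reduce to minus one pairing of \<open>dA w1\<close> with
  \<open>dA w2\<close>.\<close>

lemma tube_symplectic_o:
  assumes "w1 \<in> TM" "w2 \<in> TM" "fst w1 = 0" "fst w2 = 0"
  shows "\<mu> (bracket G (dA w1) (dA w2)) = \<mu> (bracket G (fst (snd w1)) (fst (snd w2)))"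
proof -
  let ?T = "tmap MV (C \<times> U) (TG_dual G) \<Phi> (\<one>, 0)"
  have T: "?T (0, w) = D (0, w)" if "w \<in> TM" for w
    unfolding TG_dual_def
    by (rule tmap_eq_mderiv[OF chMV D velocity_Pair[OF chM chV velC[OF one_closed] U_velocity[OF U_zero that]]])
  have "\<forall>g\<in>C. \<forall>y\<in>U. \<forall>\<xi>1 \<xi>2. \<forall>y1\<in>TM. \<forall>y2\<in>TM.
        TG_form G (\<Phi> (g, y))
          (tmap MV (C \<times> U) (TG_dual G) \<Phi> (g, y) (from_left G g \<xi>1, y1))
          (tmap MV (C \<times> U) (TG_dual G) \<Phi> (g, y) (from_left G g \<xi>2, y2))
        = tube_form G \<mu> (fst y) (\<xi>1, y1) (\<xi>2, y2)"
    using tube unfolding restricted_tube_def by (elim conjE)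
  then have "TG_form G (\<Phi> (\<one>, 0)) (?T (from_left G \<one> 0, w1)) (?T (from_left G \<one> 0, w2))
     = tube_form G \<mu> (fst (0 :: 'g dual \<times> 'g \<times> 'g dual)) (0, w1) (0, w2)" using assms U_zero one_closed by blast
  moreover have "\<Phi> (\<one>, 0) = (\<one>, \<mu>)" using Phi_eq[OF one_closed U_zero] by (simp add: AB_zero)
  ultimately have "TG_form G (\<one>, \<mu>) (D (0, w1)) (D (0, w2)) = tube_form G \<mu> 0 (0, w1) (0, w2)"
    by (simp add: from_left_one T assms)
  then have "dB w2 (dA w1) - dB w1 (dA w2) + \<mu> (bracket G (dA w1) (dA w2))
     = - \<mu> (bracket G (fst (snd w1)) (fst (snd w2)))"
    by (simp add: TG_form_def tube_form_def case_prod_beta Let_def to_left_one bracket_simps)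
  moreover have "blinfun_apply (dB w2) (dA w1) = \<mu> (bracket G (dA w2) (dA w1))" using dB_eq[OF assms(2)] assms(4) by simp
  moreover have "blinfun_apply (dB w1) (dA w2) = \<mu> (bracket G (dA w1) (dA w2))" using dB_eq[OF assms(1)] assms(3) by simp
  ultimately show ?thesis using mu_skew[of "dA w2" "dA w1"] by simp
qed

lemma TM_iff: "(\<nu>, x, \<epsilon>) \<in> TM \<longleftrightarrow> \<nu> \<in> annih (\<oo> \<union> \<ll> \<union> \<nn>) \<and> x \<in> \<oo> \<and> \<epsilon> \<in> annih (\<gg>\<mu> \<union> \<oo> \<union> \<nn>)"
  by (simp add: tube_model_def)

lemma zero_annih: "0 \<in> annih S" by (rule subspace_0[OF subspace_annih])

text \<open>Along \<open>(0, x, 0)\<close> both descriptions of \<open>dB\<close> on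
  \<open>\<ll>\<close> are available: \<open>dB_l\<close> gives 0 and \<open>dB_eq\<close> gives the
  pairing with \<open>dA\<close>, which on \<open>\<ll>\<close> sees only the \<open>\<nn>\<close>
  component.\<close>

lemma dA_o_n: "x \<in> \<oo> \<Longrightarrow> Pn (dA (0, x, 0)) = 0"
proof (rule nondeg_n[OF P_mem(6)])
  assume x: "x \<in> \<oo>"
  have w: "(0, x, 0) \<in> TM" using x by (simp add: TM_iff zero_annih)
  fix y assume y: "y \<in> \<ll>"
  have "\<mu> (bracket G (dA (0, x, 0)) y) = 0" using dB_eq[OF w, of y] dB_l[OF w y] by simp
  then have "\<mu> (bracket G (Pn (dA (0, x, 0))) y) = 0" using mu_on_l[OF y] by simp
  then show "\<mu> (bracket G y (Pn (dA (0, x, 0)))) = 0" by (subst mu_skew) simp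
qed

text \<open>The \<open>\<nn>\<close> components vanish, \<open>\<ll>\<close> is isotropic and
  orthogonal to \<open>\<oo>\<close>, so the symplectic identity survives the projection to
  \<open>\<oo>\<close>. A map preserving a nondegenerate form is injective, which gives the
  surjectivity below.\<close>

lemma dA_o_iso:
  assumes "x \<in> \<oo>" "y \<in> \<oo>"
  shows "\<mu> (bracket G (Po (dA (0, x, 0))) (Po (dA (0, y, 0)))) = \<mu> (bracket G x y)"
proof -
  have w: "(0, x, 0) \<in> TM" "(0, y, 0) \<in> TM" using assms by (auto simp: TM_iff zero_annih)
  have "\<mu> (bracket G (dA (0, x, 0)) (dA (0, y, 0))) = \<mu> (bracket G x y)"
    using tube_symplectic_o[OF w] by simp
  moreover have "\<mu> (bracket G (dA (0, x, 0)) (dA (0, y, 0))) = \<mu> (bracket G (Po (dA (0, x, 0))) (Po (dA (0, y, 0))))"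
    by (subst mu_expand(1), subst mu_expand(2))
      (simp add: dA_o_n assms bracket_simps blinfun.add_right orth_o P_mem iso_l)
  ultimately show ?thesis by simp
qed

lemma dA_o_surj: 
  assumes z: "z \<in> \<oo>" shows "\<exists>x\<in>\<oo>. Po (dA (0, x, 0)) = z"
proof -
  let ?i = "\<lambda>x :: 'g. (0 :: 'g dual, x, 0 :: 'g dual)"
  have li: "linear ?i" by (rule linearI) auto
  have lT: "linear (\<lambda>x. Po (dA (?i (Po x))))"
    using linear_compose[OF linear_compose[OF linear_compose[OF P_linear(3) li] dA_linear] P_linear(3)] by (simp add: o_def)
  \<comment> \<open>\<open>Po\<close> after \<open>dA\<close> on \<open>\<oo>\<close>, extended by
    the identity on the complement, so that the statement on injective endomorphisms of the whole
    space applies.\<close>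
  define T where "T x = Po (dA (?i (Po x))) + (x - Po x)" for x
  have lT': "linear T" unfolding T_def
    by (intro linear_compose_add lT linear_compose_sub linear_ident P_linear(3))
  have PoT: "Po (T x) = Po (dA (?i (Po x)))" for x
    unfolding T_def using P_o[OF P_mem(4)] by (simp add: linear_add[OF P_linear(3)] linear_diff[OF P_linear(3)])
  have "inj T"
    unfolding linear_injective_0[OF lT']
  proof (intro allI impI)
    fix x assume T0: "T x = 0"
    then have d0: "Po (dA (?i (Po x))) = 0" using PoT[of x] linear_0[OF P_linear(3)] by simp
    have "Po x = 0"
    proof (rule nondeg_o[OF P_mem(4)])
      fix y assume "y \<in> \<oo>"
      from dA_o_iso[OF P_mem(4) this, of x] show "\<mu> (bracket G (Po x) y) = 0" by (simp add: d0 bracket_simps)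
    qed
    then show "x = 0" using T0 d0 by (simp add: T_def)
  qed
  from fin_dim_inj_surj[OF fd lT' this] obtain x where "T x = z" by (metis surjD)
  then have "Po (dA (?i (Po x))) = z" using PoT[of x] P_o[OF z] by simp
  then show ?thesis using P_mem(4) by blast
qed

text \<open>The tube and the infinitesimal twisting by \<open>\<ll>\<close> span the dual of the Lie algebra: \<open>\<nu>\<close>
  accounts for the dual of the stabilizer algebra, \<open>\<epsilon>\<close> for that of \<open>\<ll>\<close>, \<open>\<oo>\<close> for its own dual and
  \<open>\<ll>\<close> for that of \<open>\<nn>\<close>.\<close>

lemma twist_surj: "\<exists>\<eta>\<in>\<ll>. \<exists>w\<in>TM. dB w - coad G \<eta> \<mu> = \<gamma>"
proof -
  define \<nu> where "\<nu> = Blinfun (\<lambda>\<xi>. blinfun_apply \<gamma> (Pk \<xi> + Pp \<xi>))"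
  define \<epsilon> where "\<epsilon> = Blinfun (\<lambda>\<xi>. blinfun_apply \<gamma> (Pl \<xi>))"
  have l\<gamma>: "linear (blinfun_apply \<gamma>)" by (rule bounded_linear.linear[OF blinfun.bounded_linear_right])
  have \<nu>: "blinfun_apply \<nu> = (\<lambda>\<xi>. \<gamma> (Pk \<xi> + Pp \<xi>))"
    unfolding \<nu>_def by (rule blinfun_apply_Blinfun_fin_dim[OF fd])
      (use linear_compose[OF linear_compose_add[OF P_linear(1,2)] l\<gamma>] in \<open>simp add: o_def\<close>)
  have \<epsilon>: "blinfun_apply \<epsilon> = (\<lambda>\<xi>. \<gamma> (Pl \<xi>))"
    unfolding \<epsilon>_def by (rule blinfun_apply_Blinfun_fin_dim[OF fd])
      (use linear_compose[OF P_linear(4) l\<gamma>] in \<open>simp add: o_def\<close>)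
  have m\<nu>: "\<nu> \<in> annih (\<oo> \<union> \<ll> \<union> \<nn>)" using P_o P_l P_n by (auto simp: annih_def \<nu>)
  have m\<epsilon>: "\<epsilon> \<in> annih (\<gg>\<mu> \<union> \<oo> \<union> \<nn>)" using P_stab P_o P_n by (auto simp: annih_def \<epsilon>)
  let ?wz = "(\<nu>, 0 :: 'g, \<epsilon>)"
  have Po_id: "\<And>x. x \<in> \<oo> \<Longrightarrow> Po x = x" and Pn_id: "\<And>x. x \<in> \<nn> \<Longrightarrow> Pn x = x" using P_o P_n by blast+
  \<comment> \<open>The vector \<open>?wz\<close> already contributes to the \<open>\<oo>\<close>
    part through its \<open>dA\<close>; \<open>z\<close> represents only what is still missing
    there.\<close>
  have "\<exists>z\<in>\<oo>. \<forall>y\<in>\<oo>. \<mu> (bracket G z y) = blinfun_apply (\<gamma> - coad G (dA ?wz) \<mu>) y"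
  proof (rule represent_functional[OF fd sub_spaces(4) P_linear(3) P_mem(4) Po_id \<mu>_bilinear])
    fix y assume y: "y \<in> \<oo>" "\<And>x. x \<in> \<oo> \<Longrightarrow> \<mu> (bracket G x y) = 0"
    show "y = 0"
    proof (rule nondeg_o[OF y(1)])
      fix x assume "x \<in> \<oo>"
      from y(2)[OF this] show "\<mu> (bracket G y x) = 0" by (subst mu_skew) simp
    qed
  qed (assumption, rule bounded_linear.linear[OF blinfun.bounded_linear_right])
  then obtain z where z: "z \<in> \<oo>" "\<And>y. y \<in> \<oo> \<Longrightarrow> \<mu> (bracket G z y) = \<gamma> y - \<mu> (bracket G (dA ?wz) y)"
    by (auto simp: blinfun.diff_left coad_apply)
  obtain x where x: "x \<in> \<oo>" "Po (dA (0, x, 0)) = z" using dA_o_surj[OF z(1)] by blast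
  let ?w = "(\<nu>, x, \<epsilon>)"
  have w: "?w \<in> TM" using m\<nu> m\<epsilon> x by (simp add: TM_iff)
  have "?w = ?wz + (0, x, 0)" by simp
  then have dAw: "dA ?w = dA ?wz + dA (0, x, 0)" by (simp only: linear_add[OF dA_linear])
  \<comment> \<open>Chosen last: \<open>coad G \<eta> \<mu>\<close> with \<open>\<eta>\<close> in
    \<open>\<ll>\<close> vanishes on the stabilizer algebra, on \<open>\<oo>\<close> and on
    \<open>\<ll>\<close>, so it corrects the \<open>\<nn>\<close> part without disturbing the
    others.\<close>
  have "\<exists>\<eta>\<in>\<ll>. \<forall>y\<in>\<nn>. \<mu> (bracket G \<eta> y) = blinfun_apply (dB ?w - \<gamma>) y"
    by (rule represent_functional[OF fd sub_spaces(5) P_linear(5) P_mem(6) Pn_id \<mu>_bilinear nondeg_n])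
      (auto intro: bounded_linear.linear[OF blinfun.bounded_linear_right])
  then obtain \<eta> where \<eta>: "\<eta> \<in> \<ll>" "\<And>y. y \<in> \<nn> \<Longrightarrow> \<mu> (bracket G \<eta> y) = dB ?w y - \<gamma> y"
    by (auto simp: blinfun.diff_left)
  have "dB ?w - coad G \<eta> \<mu> = \<gamma>"
  proof (rule blinfun_eqI)
    fix \<xi>
    let ?E = "\<lambda>\<xi>. blinfun_apply (dB ?w - coad G \<eta> \<mu> - \<gamma>) \<xi>"
    have s: "Pk \<xi> + Pp \<xi> \<in> \<gg>\<mu>" using P_mem pp_stab subspace_add[OF subspace_stab_alg] by blast
    have 1: "?E (Pk \<xi> + Pp \<xi>) = 0"
      using dB_eq[OF w, of "Pk \<xi> + Pp \<xi>"] mu_stab(2)[OF s] P_stab[OF s]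
      by (simp add: blinfun.diff_left coad_apply \<nu>)
    have 2: "?E (Po \<xi>) = 0"
    proof -
      have "\<mu> (bracket G (dA ?w) (Po \<xi>)) = \<mu> (bracket G (dA ?wz) (Po \<xi>)) + \<mu> (bracket G z (Po \<xi>))"
        using mu_on_o[OF P_mem(4), of "dA (0, x, 0)"] by (simp add: dAw bracket_simps blinfun.add_right x)
      also have "\<dots> = \<gamma> (Po \<xi>)" using z(2)[OF P_mem(4)] by simp
      finally have "\<mu> (bracket G (dA ?w) (Po \<xi>)) = \<gamma> (Po \<xi>)" .
      moreover have "blinfun_apply \<nu> (Po \<xi>) = 0" using m\<nu> P_mem(4) by (simp add: annih_def)
      ultimately show ?thesis using dB_eq[OF w, of "Po \<xi>"] orth_o(2)[OF P_mem(4), of \<eta> \<xi>] \<eta>(1)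
        by (simp add: blinfun.diff_left coad_apply)
    qed
    have 3: "?E (Pl \<xi>) = 0"
      using dB_l[OF w P_mem(5)] iso_l[OF \<eta>(1) P_mem(5)] P_l[OF P_mem(5)]
      by (simp add: blinfun.diff_left coad_apply \<epsilon>)
    have 4: "?E (Pn \<xi>) = 0" using \<eta>(2)[OF P_mem(6)] by (simp add: blinfun.diff_left coad_apply)
    have "?E \<xi> = ?E ((Pk \<xi> + Pp \<xi>) + Po \<xi> + Pl \<xi> + Pn \<xi>)" by (rule arg_cong[OF P_sum])
    also have "\<dots> = ?E (Pk \<xi> + Pp \<xi>) + ?E (Po \<xi>) + ?E (Pl \<xi>) + ?E (Pn \<xi>)"
      by (simp only: blinfun.add_right)
    finally have "?E \<xi> = ?E (Pk \<xi> + Pp \<xi>) + ?E (Po \<xi>) + ?E (Pl \<xi>) + ?E (Pn \<xi>)" .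
    then show "blinfun_apply (dB ?w - coad G \<eta> \<mu>) \<xi> = \<gamma> \<xi>" using 1 2 3 4 by (simp add: blinfun.diff_left)
  qed
  then show ?thesis using \<eta>(1) w by blast
qed

end

section \<open>Moving covectors near \<open>\<mu>\<close> into the tube by twisting\<close>

text \<open>For each basis vector \<open>b\<close> of the Lie algebra take a curve in
  \<open>H\<close> with velocity \<open>Pl b\<close>, evaluate it at the coordinate
  \<open>c b x\<close>, and multiply. The derivative of the product at 0 is the sum of the
  velocities, which is \<open>Pl\<close>.\<close>

lemma H_local_parametrization:
  "\<exists>S h. open S \<and> (0 :: 'g) \<in> S \<and> h ` S \<subseteq> H \<and> h 0 = \<one> \<and> mderiv vec_mfd S M h 0 Pl"
proof -
  obtain E :: "'g set" and c :: "'g \<Rightarrow> 'g \<Rightarrow> real" where E: "finite E" "\<And>b. bounded_linear (c b)"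
    "\<And>x. x = (\<Sum>b\<in>E. c b x *\<^sub>R b)" using fin_dim_basis[OF fd] by blast
  have "\<exists>S h. open S \<and> (0 :: 'g) \<in> S \<and> h ` S \<subseteq> H \<and> h 0 = \<one> \<and> mderiv vec_mfd S M h 0 (\<lambda>x. \<Sum>b\<in>F. c b x *\<^sub>R Pl b)"
    if "finite F" for F
    using that
  proof (induction F)
    case empty
    have "mderiv vec_mfd UNIV M (\<lambda>x :: 'g. \<one>) 0 (\<lambda>x. 0)" by (rule mderiv_const[OF chM]) (auto simp: ptsM)
    then show ?case by (intro exI[of _ UNIV] exI[of _ "\<lambda>x. \<one>"]) (auto simp: H_one)
  next
    case (insert b F)
    then obtain S h where h: "open S" "(0 :: 'g) \<in> S" "h ` S \<subseteq> H" "h 0 = \<one>"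
      "mderiv vec_mfd S M h 0 (\<lambda>x. \<Sum>b\<in>F. c b x *\<^sub>R Pl b)" by blast
    obtain k T where k: "open T" "(0::real) \<in> T" "k ` T \<subseteq> H" "k 0 = \<one>" "mderiv vec_mfd T M k 0 (\<lambda>t. t *\<^sub>R Pl b)"
      using sub_alg_velocity[OF ll_h[OF P_mem(5)[of b]]] unfolding velocity_def by blast
    have cb0: "c b 0 = 0" using linear_0[OF bounded_linear.linear[OF E(2)]] .
    let ?S = "S \<inter> c b -` T"
    have "open (c b -` T)" using k(1) E(2) by (intro continuous_open_vimage) (auto intro: linear_continuous_at)
    then have oS: "open ?S" using h by blast
    have 0: "0 \<in> ?S" using h k cb0 by simp
    have m1: "mderiv vec_mfd ?S vec_mfd (c b) 0 (c b)" using 0 E(2) by (simp add: mderiv_vec_vec strict_deriv_bounded_linear)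
    have "mderiv vec_mfd T M k (c b 0) (\<lambda>t. t *\<^sub>R Pl b)" using k(5) cb0 by simp
    from mderiv_compose_simple[OF chV chV chM m1 this]
    have m2: "mderiv vec_mfd ?S M (\<lambda>x. k (c b x)) 0 (\<lambda>x. c b x *\<^sub>R Pl b)" by simp
    have m3: "mderiv vec_mfd ?S M h 0 (\<lambda>x. \<Sum>b\<in>F. c b x *\<^sub>R Pl b)"
      by (rule mderiv_subset[OF chV h(5) 0]) simp
    have inC: "k (c b x) \<in> H" "h x \<in> H" if "x \<in> ?S" for x using that h k by auto
    have "mderiv vec_mfd ?S M (\<lambda>x. k (c b x) \<otimes> h x) 0
      (\<lambda>x. dmult (k (c b 0)) (h 0) (c b x *\<^sub>R Pl b, \<Sum>b\<in>F. c b x *\<^sub>R Pl b))"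
      by (rule mderiv_mult[OF chV m2 m3]) (use inC H_C in auto)
    then have "mderiv vec_mfd ?S M (\<lambda>x. k (c b x) \<otimes> h x) 0 (\<lambda>x. \<Sum>b\<in>insert b F. c b x *\<^sub>R Pl b)"
      using insert.hyps by (simp add: cb0 k(4) h(4) dmult_one)
    moreover have "(\<lambda>x. k (c b x) \<otimes> h x) ` ?S \<subseteq> H" using inC H_mult by blast
    moreover have "k (c b 0) \<otimes> h 0 = \<one>" by (simp add: cb0 k(4) h(4))
    ultimately show ?case using oS 0 by (intro exI[of _ ?S] exI[of _ "\<lambda>x. k (c b x) \<otimes> h x"]) simp
  qed
  from this[OF E(1)] obtain S h where h: "open S" "(0 :: 'g) \<in> S" "h ` S \<subseteq> H" "h 0 = \<one>"
      "mderiv vec_mfd S M h 0 (\<lambda>x. \<Sum>b\<in>E. c b x *\<^sub>R Pl b)" by blast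
  have "(\<lambda>x. \<Sum>b\<in>E. c b x *\<^sub>R Pl b) = Pl"
  proof
    fix x
    have "Pl x = Pl (\<Sum>b\<in>E. c b x *\<^sub>R b)" using E(3) by metis
    then show "(\<Sum>b\<in>E. c b x *\<^sub>R Pl b) = Pl x"
      by (simp add: linear_sum[OF P_linear(4)] linear_scale[OF P_linear(4)])
  qed
  with h show ?thesis by auto
qed

lemma U_near_zero:
  obtains r where "r > 0" "\<And>y. y \<in> TM \<Longrightarrow> norm y < r \<Longrightarrow> y \<in> U"
proof -
  obtain T where T: "open T" "U = TM \<inter> T" using U_open by (auto simp: openin_open)
  then obtain r where "r > 0" "ball 0 r \<subseteq> T" using U_zero open_contains_ball by blast
  then show ?thesis using T that[of r] by (auto simp: subset_iff)
qed

text \<open>By \<open>twist_surj\<close> the map taking \<open>(\<eta>, y)\<close> to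
  \<open>B y\<close> twisted back by a group element with velocity \<open>\<eta>\<close> is a
  submersion at the origin; it is inverted locally and applied to \<open>coAd G g \<mu>\<close>.
  Continuity of the solution keeps \<open>h\<close> and \<open>A y\<close>, hence also
  \<open>g \<otimes> h \<otimes> inv (A y)\<close>, near the identity.\<close>

lemma coAd_orbit_in_tube:
  assumes N: "openin (mtop M) N" "\<one> \<in> N" and r: "r > 0"
  obtains V where "openin (mtop M) V" "\<one> \<in> V" "V \<subseteq> C"
    "\<And>g. g \<in> V \<Longrightarrow> \<exists>h\<in>H. \<exists>y\<in>U. norm y < r \<and> B y = coAd G (g \<otimes> h) \<mu> \<and> g \<otimes> h \<otimes> inv (A y) \<in> N"
proof -
  obtain D where D: "mderiv MV (C \<times> U) MD \<Phi> (\<one>, 0) D" using Phi_mderiv[OF U_zero] by blast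
  obtain S h where h: "open S" "(0 :: 'g) \<in> S" "h ` S \<subseteq> H" "h 0 = \<one>" "mderiv vec_mfd S M h 0 Pl"
    using H_local_parametrization by blast
  obtain rU where rU: "rU > 0" "\<And>y. y \<in> TM \<Longrightarrow> norm y < rU \<Longrightarrow> y \<in> U" using U_near_zero by blast
  define L where "L z = snd (D (0, snd z)) - coad G (fst z) \<mu>" for z :: "'g \<times> 'g dual \<times> 'g \<times> 'g dual"
  have lL: "linear L"
    unfolding L_def[abs_def]
    using linear_compose_sub[OF linear_compose[OF linear_snd dB_linear[OF D]] linear_compose[OF linear_fst coad_linear(1)[of \<mu>]]]
    by (simp add: o_def)
  have sub: "subspace (\<ll> \<times> TM)" by (rule subspace_Times[OF sub_spaces(5) TM_subspace])
  have surj: "L ` (\<ll> \<times> TM) = UNIV"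
  proof (intro equalityI subset_UNIV subsetI)
    fix \<gamma> :: "'g dual"
    obtain \<eta> w where "\<eta> \<in> \<ll>" "w \<in> TM" "snd (D (0, w)) - coad G \<eta> \<mu> = \<gamma>" using twist_surj[OF D] by blast
    then show "\<gamma> \<in> L ` (\<ll> \<times> TM)" by (intro image_eqI[of _ _ "(\<eta>, w)"]) (auto simp: L_def)
  qed
  \<comment> \<open>A right inverse of \<open>L\<close> with values in
    \<open>\<ll> \<times> TM\<close> parametrizes twists and tube points by the covector to be
    reached, so that \<open>\<Psi>\<close> below has identity derivative.\<close>
  obtain R where R: "range R \<subseteq> \<ll> \<times> TM" "linear R" "\<forall>\<gamma>\<in>L ` (\<ll> \<times> TM). L (R \<gamma>) = \<gamma>"
    using linear_exists_right_inverse_on[OF lL sub] by blast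
  have LR: "L (R \<gamma>) = \<gamma>" for \<gamma> using R(3) surj by blast
  have R1: "fst (R \<gamma>) \<in> \<ll>" "snd (R \<gamma>) \<in> TM" for \<gamma> using R(1) by (auto simp: image_subset_iff mem_Times_iff)
  have R0: "R 0 = 0" by (rule linear_0[OF R(2)])
  have bR: "bounded_linear R" by (rule fin_dim_bounded_linear[OF fdd R(2)])
  have bR1: "bounded_linear (\<lambda>\<gamma>. fst (R \<gamma>))" "bounded_linear (\<lambda>\<gamma>. snd (R \<gamma>))"
    by (rule bounded_linear_compose[OF bounded_linear_fst bR] bounded_linear_compose[OF bounded_linear_snd bR])+
  \<comment> \<open>Both \<open>snd (R \<gamma>) \<in> U\<close> and the bound
    \<open>norm y < r\<close> are built into this domain.\<close>
  let ?S = "(\<lambda>\<gamma>. fst (R \<gamma>)) -` S \<inter> {\<gamma>. norm (snd (R \<gamma>)) < min rU r}"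
  have oS: "open ?S"
  proof (rule open_Int)
    show "open ((\<lambda>\<gamma>. fst (R \<gamma>)) -` S)"
      using h(1) linear_continuous_at[OF bR1(1)] by (intro continuous_open_vimage) auto
    have "continuous_on UNIV (\<lambda>\<gamma>. norm (snd (R \<gamma>)))"
      by (intro continuous_on_norm linear_continuous_on bR1)
    then show "open {\<gamma>. norm (snd (R \<gamma>)) < min rU r}" by (intro open_Collect_less continuous_on_const)
  qed
  have S0: "0 \<in> ?S" using h rU r by (simp add: R0)
  have SU: "snd (R \<gamma>) \<in> U" "h (fst (R \<gamma>)) \<in> H" if "\<gamma> \<in> ?S" for \<gamma> using that rU(2)[OF R1(2)] h(3) by auto
  have ma: "mderiv vec_mfd ?S vec_mfd (\<lambda>\<gamma>. fst (R \<gamma>)) 0 (\<lambda>\<gamma>. fst (R \<gamma>))"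
    and mb: "mderiv vec_mfd ?S vec_mfd (\<lambda>\<gamma>. snd (R \<gamma>)) 0 (\<lambda>\<gamma>. snd (R \<gamma>))"
    unfolding mderiv_vec_vec using S0 bR1 strict_deriv_bounded_linear by blast+
  have "mderiv vec_mfd S M h (fst (R 0)) Pl" using h(5) by (simp add: R0)
  from mderiv_compose_simple[OF chV chV chM ma this]
  have mh: "mderiv vec_mfd ?S M (\<lambda>\<gamma>. h (fst (R \<gamma>))) 0 (\<lambda>\<gamma>. Pl (fst (R \<gamma>)))" by simp
  have mhi: "mderiv vec_mfd ?S M (\<lambda>\<gamma>. inv (h (fst (R \<gamma>)))) 0 (\<lambda>\<gamma>. - Pl (fst (R \<gamma>)))"
    by (rule mderiv_inv[OF chV mh]) (use SU H_C h in \<open>auto simp: R0\<close>)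
  note AB = AB_mderiv[OF U_zero D]
  have AB': "mderiv vec_mfd U M A (snd (R 0)) (\<lambda>w. fst (D (0, w)))" "mderiv vec_mfd U vec_mfd B (snd (R 0)) (\<lambda>w. snd (D (0, w)))"
    using AB by (auto simp: R0)
  have mB: "mderiv vec_mfd ?S vec_mfd (\<lambda>\<gamma>. B (snd (R \<gamma>))) 0 (\<lambda>\<gamma>. snd (D (0, snd (R \<gamma>))))"
    by (rule mderiv_compose_simple[OF chV chV chV mb AB'(2)]) (rule SU)
  have mA: "mderiv vec_mfd ?S M (\<lambda>\<gamma>. A (snd (R \<gamma>))) 0 (\<lambda>\<gamma>. fst (D (0, snd (R \<gamma>))))"
    by (rule mderiv_compose_simple[OF chV chV chM mb AB'(1)]) (rule SU)
  define \<Psi> where "\<Psi> \<gamma> = coAd G (inv (h (fst (R \<gamma>)))) (B (snd (R \<gamma>)))" for \<gamma>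
  have "mderiv vec_mfd ?S vec_mfd \<Psi> 0 (\<lambda>\<gamma>. snd (D (0, snd (R \<gamma>))) + coad G (- Pl (fst (R \<gamma>))) (B (snd (R 0))))"
    unfolding \<Psi>_def[abs_def] by (rule mderiv_coAd[OF chV mhi mB]) (use SU H_C h in \<open>auto simp: R0\<close>)
  moreover have "snd (D (0, snd (R \<gamma>))) + coad G (- Pl (fst (R \<gamma>))) (B (snd (R 0))) = \<gamma>" for \<gamma>
    using LR[of \<gamma>] P_l[OF R1(1)[of \<gamma>]] linear_neg[OF coad_linear(1)[of \<mu>]] by (simp add: L_def R0 AB_zero)
  ultimately have s\<Psi>: "strict_deriv \<Psi> (\<lambda>\<gamma>. \<gamma>) 0 ?S" by (simp add: mderiv_vec_vec)
  have \<Psi>0: "\<Psi> 0 = \<mu>" by (simp add: \<Psi>_def R0 h(4) AB_zero coAd_one)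
  obtain V where V: "openin (mtop M) V" "\<one> \<in> V" "V \<subseteq> C" "\<And>g h. g \<in> V \<Longrightarrow> h \<in> V \<Longrightarrow> g \<otimes> h \<in> N"
    using mult_near_one[OF N] by blast
  have mAi: "mderiv vec_mfd ?S M (\<lambda>\<gamma>. inv (A (snd (R \<gamma>)))) 0 (\<lambda>\<gamma>. - fst (D (0, snd (R \<gamma>))))"
    by (rule mderiv_inv[OF chV mA]) (use SU A_C in \<open>auto simp: R0 AB_zero\<close>)
  have mk: "mderiv vec_mfd ?S M (\<lambda>\<gamma>. h (fst (R \<gamma>)) \<otimes> inv (A (snd (R \<gamma>)))) 0
     (\<lambda>\<gamma>. dmult (h (fst (R 0))) (inv (A (snd (R 0)))) (Pl (fst (R \<gamma>)), - fst (D (0, snd (R \<gamma>)))))"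
    by (rule mderiv_mult[OF chV mh mAi]) (use SU A_C H_C in auto)
  obtain W where W: "openin (mtop (vec_mfd :: ('g dual, 'g dual) manifold)) W" "0 \<in> W"
    "\<And>\<gamma>. \<gamma> \<in> ?S \<Longrightarrow> \<gamma> \<in> W \<Longrightarrow> h (fst (R \<gamma>)) \<otimes> inv (A (snd (R \<gamma>))) \<in> V"
    using mderiv_continuous[OF chV chM mk V(1)] V(2) by (auto simp: R0 h(4) AB_zero)
  have "open (?S \<inter> W)" "0 \<in> ?S \<inter> W" using oS W S0 by auto
  then obtain r0 where r0: "r0 > 0" "ball 0 r0 \<subseteq> ?S \<inter> W" using open_contains_ball by blast
  have r0S: "ball 0 r0 \<subseteq> ?S" using r0(2) by blast
  obtain r1 where r1: "r1 > 0" "r1 < r0"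
    "\<And>r w. 0 < r \<Longrightarrow> r \<le> r1 \<Longrightarrow> w \<in> cball (\<Psi> 0) (r / 2) \<Longrightarrow> \<exists>y\<in>cball 0 r. \<Psi> y = w"
    using strict_inverse[OF complete_UNIV s\<Psi> r0(1) r0S] by metis
  have "openin (mtop (vec_mfd :: ('g dual, 'g dual) manifold)) (ball \<mu> (r1 / 2))" by simp
  moreover have "coAd G \<one> \<mu> \<in> ball \<mu> (r1 / 2)" using r1 by (simp add: coAd_one)
  ultimately obtain V2 where V2: "openin (mtop M) V2" "\<one> \<in> V2" "\<And>g. g \<in> C \<Longrightarrow> g \<in> V2 \<Longrightarrow> coAd G g \<mu> \<in> ball \<mu> (r1 / 2)"
    using mderiv_continuous[OF chM chV coAd_mderiv_const[of \<mu>]] by metis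
  show ?thesis
  proof (rule that[of "V \<inter> V2"])
    show "openin (mtop M) (V \<inter> V2)" "\<one> \<in> V \<inter> V2" "V \<inter> V2 \<subseteq> C" using V V2 by auto
    fix g assume g: "g \<in> V \<inter> V2"
    then have gC: "g \<in> C" using V by blast
    have "coAd G g \<mu> \<in> cball (\<Psi> 0) (r1 / 2)" using V2(3)[OF gC] g by (simp add: \<Psi>0 less_imp_le)
    from r1(3)[OF r1(1) order_refl this] obtain \<gamma> where \<gamma>: "\<gamma> \<in> cball 0 r1" "\<Psi> \<gamma> = coAd G g \<mu>" by blast
    then have "\<gamma> \<in> ball 0 r0" using r1(2) by simp
    from subsetD[OF r0(2) this] have \<gamma>S: "\<gamma> \<in> ?S" "\<gamma> \<in> W" by blast+
    let ?h = "h (fst (R \<gamma>))" and ?y = "snd (R \<gamma>)"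
    have hH: "?h \<in> H" "?h \<in> C" "?y \<in> U" using SU[OF \<gamma>S(1)] H_C by auto
    have "B ?y = coAd G ?h (coAd G (inv ?h) (B ?y))" using coAd_inv(2)[OF hH(2)] by simp
    also have "\<dots> = coAd G (g \<otimes> ?h) \<mu>" using \<gamma>(2) by (simp add: \<Psi>_def coAd_mult gC hH)
    finally have 1: "B ?y = coAd G (g \<otimes> ?h) \<mu>" .
    have 2: "g \<otimes> ?h \<otimes> inv (A ?y) \<in> N"
      using V(4)[OF _ W(3)[OF \<gamma>S], of g] g gC hH A_C by (simp add: m_assoc)
    have "norm ?y < r" using \<gamma>S(1) by simp
    with 1 2 hH show "\<exists>h\<in>H. \<exists>y\<in>U. norm y < r \<and> B y = coAd G (g \<otimes> h) \<mu> \<and> g \<otimes> h \<otimes> inv (A y) \<in> N" by blast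
  qed
qed

end

text \<open>A right inverse \<open>R\<close> of \<open>D\<close> gives an affine slice through the
  chart point of \<open>p\<close> on which \<open>f\<close> has identity derivative in charts, so
  \<open>strict_inverse\<close> covers a neighbourhood of \<open>f p\<close>.\<close>

lemma mderiv_surj_open:
  fixes N :: "('n, 'f::real_normed_vector) manifold" and D :: "'e::real_normed_vector \<Rightarrow> 'f"
  assumes M: "charted M" and N: "charted N" and fdN: "fin_dim TYPE('f)"
    and f: "mderiv M A N f p D" and A: "openin (mtop M) A" and D: "surj D"
  shows "\<exists>V. openin (mtop N) V \<and> f p \<in> V \<and> V \<subseteq> f ` A"
proof -
  have p: "p \<in> pts M" "f p \<in> pts N" "p \<in> A" using f by (auto simp: mderiv_def)
  note c = charted_chart_at[OF M p(1)] charted_chart_at[OF N p(2)]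
  obtain W where W: "openin (mtop M) W" "p \<in> W" "f ` (A \<inter> W) \<subseteq> cdom N (f p)"
    using f by (auto simp: mderiv_def)
  have lD: "linear D" by (rule bounded_linear.linear[OF mderiv_linear[OF f]])
  obtain R where R: "linear R" "\<And>v. D (R v) = v"
    using linear_surjective_right_inverse[OF lD D] by (auto simp: o_def fun_eq_iff)
  have bR: "bounded_linear R" by (rule fin_dim_bounded_linear[OF fdN R(1)])
  obtain KR where KR: "KR > 0" "\<And>z. norm (R z) \<le> norm z * KR" using bounded_linear.pos_bounded[OF bR] by blast
  obtain r where r: "r > 0" "\<And>y. dist (cmap M p p) y < r \<Longrightarrow>
    y \<in> cmap M p ` (cdom M p \<inter> (A \<inter> W)) \<and> cinv M p y \<in> cdom M p \<inter> (A \<inter> W) \<and> cmap M p (cinv M p y) = y"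
    using chart_near[OF M p(1) openin_Int[OF A W(1)]] p W(2) by (metis IntI)
  let ?f = "cmap N (f p) \<circ> f \<circ> cinv M p"
  define g where "g z = ?f (cmap M p p + R z)" for z
  have near: "dist (cmap M p p) (cmap M p p + R z) < r" if "z \<in> ball 0 (r / KR)" for z
  proof -
    have "norm (R z) \<le> norm z * KR" by (rule KR)
    also have "\<dots> < r" using that KR(1) by (simp add: pos_less_divide_eq)
    finally show ?thesis by (simp add: dist_norm)
  qed
  have 0: "0 \<in> ball 0 (r / KR)" using r KR by simp
  have "strict_deriv (\<lambda>z. cmap M p p + R z) (\<lambda>z. 0 + R z) 0 (ball 0 (r / KR))"
    by (intro strict_deriv_add strict_deriv_const strict_deriv_bounded_linear bR 0)
  then have a: "strict_deriv (\<lambda>z. cmap M p p + R z) R 0 (ball 0 (r / KR))" by simp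
  have "strict_deriv ?f D (cmap M p p + R 0) (cmap M p ` (A \<inter> cdom M p))"
    using f linear_0[OF R(1)] by (simp add: mderiv_def)
  from strict_deriv_compose[OF a this 0 zero_less_one]
  have sg: "strict_deriv g (\<lambda>z. z) 0 (ball 0 (r / KR))"
    using r(2)[OF near] unfolding g_def[abs_def] R(2) by blast
  have rKR: "r / KR > 0" using r KR by simp
  obtain r1 where r1: "r1 > 0" "r1 < r / KR"
    "\<And>r w. 0 < r \<Longrightarrow> r \<le> r1 \<Longrightarrow> w \<in> cball (g 0) (r / 2) \<Longrightarrow> \<exists>y\<in>cball 0 r. g y = w"
    using strict_inverse[OF fin_dim_complete[OF fdN] sg rKR order_refl] by metis
  let ?V = "{q \<in> cdom N (f p). cmap N (f p) q \<in> ball (g 0) (r1 / 2)}"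
  have g0: "g 0 = cmap N (f p) (f p)"
    using chart_inv_eq[OF M c(1) charted_mem[OF M p(1)]] linear_0[OF R(1)] by (simp add: g_def)
  show ?thesis
  proof (intro exI conjI)
    show "openin (mtop N) ?V" by (rule chart_preimage_open[OF N c(2)]) simp
    show "f p \<in> ?V" using charted_mem[OF N p(2)] r1(1) by (simp add: g0)
    show "?V \<subseteq> f ` A"
    proof
      fix q assume q: "q \<in> ?V"
      then have "cmap N (f p) q \<in> cball (g 0) (r1 / 2)" by simp
      from r1(3)[OF r1(1) order_refl this] obtain z where z: "z \<in> cball 0 r1" "g z = cmap N (f p) q" by blast
      have "z \<in> ball 0 (r / KR)" using z(1) r1(2) by simp
      from r(2)[OF near[OF this]] have x: "cinv M p (cmap M p p + R z) \<in> A \<inter> W" by blast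
      then have fx: "f (cinv M p (cmap M p p + R z)) \<in> cdom N (f p)" using W(3) by blast
      have "cmap N (f p) (f (cinv M p (cmap M p p + R z))) = cmap N (f p) q" using z(2) by (simp add: g_def)
      then have "f (cinv M p (cmap M p p + R z)) = q"
        using inj_onD[OF charted_inj[OF N c(2)]] fx q by blast
      then show "q \<in> f ` A" using x by blast
    qed
  qed
qed

lemma relative_open_near_zero:
  assumes "openin (top_of_set T) S" "(0 :: 'v::real_normed_vector) \<in> S"
  obtains r where "r > 0" "\<And>x. x \<in> T \<Longrightarrow> norm x < r \<Longrightarrow> x \<in> S"
proof -
  obtain O' where O: "open O'" "S = T \<inter> O'" using assms by (auto simp: openin_open)
  then obtain r where "r > 0" "ball 0 r \<subseteq> O'" using assms(2) open_contains_ball by blast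
  then show ?thesis using O that[of r] by (auto simp: subset_iff)
qed

section \<open>Covectors on the twisted product\<close>

locale tube_setting = tube_data G H \<rho> \<mu> \<pp> \<oo> \<ll> \<nn> U \<Phi>
  for G :: "('a, 'g::real_normed_vector) lie_grp" (structure)
    and H and \<rho> :: "'a \<Rightarrow> 's::real_normed_vector \<Rightarrow> 's" and \<mu> \<pp> \<oo> \<ll> \<nn> U \<Phi> +
  fixes Q :: "(('a \<times> 's) set, 'q::real_normed_vector) manifold"
    and \<pp>r \<hh>r :: "'g dual set" and \<oo>r :: "'g set"
    and T0 :: "('a \<times> 'g dual \<times> 'g \<times> 's \<times> 's dual) set \<Rightarrow> ('a \<times> 's) set \<times> 'q dual"
  assumes Q: "tw_product G H \<rho> UNIV Q"
    and \<pp>r: "openin (top_of_set (annih ((sub_alg G H \<inter> stab_alg G \<mu>) \<union> \<oo> \<union> \<ll> \<union> \<nn>))) \<pp>r" "0 \<in> \<pp>r"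
    and \<oo>r: "openin (top_of_set \<oo>) \<oo>r" "0 \<in> \<oo>r"
    and \<hh>r: "openin (top_of_set (annih (\<pp> \<union> \<oo> \<union> \<nn>))) \<hh>r" "0 \<in> \<hh>r"
    and T0: "\<forall>g\<in>carrier G. \<forall>\<nu>\<in>\<pp>r. \<forall>x\<in>\<oo>r. \<forall>a b.
         diamond (sub_alg G H) (\<pp> \<union> \<oo> \<union> \<nn>) (inf_act G H \<rho>) a b \<in> \<hh>r \<longrightarrow>
         (let y = (\<nu> + J_N0 G H \<rho> \<mu> (\<pp> \<union> \<oo> \<union> \<ll> \<union> \<nn>) (x, a, b), x,
                   diamond \<ll> (stab_alg G \<mu> \<union> \<oo> \<union> \<nn>) (inf_act G H \<rho>) a b)
          in y \<in> U \<and>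
             T0 (Y_class G H \<rho> \<mu> (g, \<nu>, x, a, b)) =
               \<phi> G H \<rho> Q (fst (\<Phi> (g, y)), snd (\<Phi> (g, y)), a, b))"
    and T0_inj: "inj_on T0 {Y_class G H \<rho> \<mu> (g, \<nu>, x, a, b) | g \<nu> x a b.
            g \<in> carrier G \<and> \<nu> \<in> \<pp>r \<and> x \<in> \<oo>r \<and>
            diamond (sub_alg G H) (\<pp> \<union> \<oo> \<union> \<nn>) (inf_act G H \<rho>) a b \<in> \<hh>r}"
    and T0_open: "openin (mtop (cotangent Q)) (T0 ` {Y_class G H \<rho> \<mu> (g, \<nu>, x, a, b) | g \<nu> x a b.
            g \<in> carrier G \<and> \<nu> \<in> \<pp>r \<and> x \<in> \<oo>r \<and>
            diamond (sub_alg G H) (\<pp> \<union> \<oo> \<union> \<nn>) (inf_act G H \<rho>) a b \<in> \<hh>r})"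
begin

abbreviation "MGS \<equiv> prod_mfd (mfd G) (vec_mfd :: ('s, 's) manifold)"
abbreviation "\<pi> \<equiv> tw_class G H \<rho>"

lemma manQ: "smooth_manifold Q" using Q by (simp add: tw_product_def)
lemma chQ: "charted Q" by (rule smooth_manifold_charted[OF manQ])
lemma fdQ: "fin_dim TYPE('q)" using manQ by (simp add: smooth_manifold_def)
lemma fdMS: "fin_dim TYPE('g \<times> 's)" by (rule fin_dim_prod[OF fd fdS])

definition "dpi g a = tmap MGS (carrier G \<times> UNIV) Q \<pi> (g, a)"

lemma velMS: "g \<in> C \<Longrightarrow> velocity MGS (C \<times> UNIV) (g, a) v"
  by (cases v) (simp add: velocity_Pair[OF chM chV velC velocity_vec])

lemma pi_mderiv: "g \<in> C \<Longrightarrow> mderiv MGS (C \<times> UNIV) Q \<pi> (g, a) (dpi g a)"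
proof -
  assume g: "g \<in> C"
  have "smooth_map MGS (C \<times> UNIV) Q \<pi>" using Q by (simp add: tw_product_def)
  from smooth_map_mderiv[OF chMV chQ fdMS this, of "(g, a)"] g
  obtain D where D: "mderiv MGS (C \<times> UNIV) Q \<pi> (g, a) D" by blast
  show ?thesis unfolding dpi_def by (rule mderiv_tmap(1)[OF chMV D velMS[OF g]])
qed

lemma dpi_linear: "g \<in> C \<Longrightarrow> linear (dpi g a)"
  by (rule bounded_linear.linear[OF mderiv_linear[OF pi_mderiv]])

lemma dpi_surj: "g \<in> C \<Longrightarrow> surj (dpi g a)"
proof -
  assume g: "g \<in> C"
  have "dpi g a ` tangent_space MGS (C \<times> UNIV) (g, a) = UNIV" using Q g by (simp add: tw_product_def dpi_def)
  then show ?thesis by blast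
qed

definition "Tpi g a v = dpi g a (from_left G g (fst v), snd v)"

lemma Tpi_linear: "g \<in> C \<Longrightarrow> linear (Tpi g a)"
proof -
  assume g: "g \<in> C"
  have "linear (\<lambda>v. (from_left G g (fst v), snd v))"
    by (rule linearI) (auto simp: linear_add[OF from_left_linear[OF g]] linear_scale[OF from_left_linear[OF g]])
  from linear_compose[OF this dpi_linear[OF g]] show ?thesis by (simp add: Tpi_def[abs_def] o_def)
qed

lemma Tpi_surj: "g \<in> C \<Longrightarrow> surj (Tpi g a)"
proof -
  assume g: "g \<in> C"
  have "\<exists>v. w = Tpi g a v" for w
  proof -
    obtain u where "w = dpi g a u" using surjD[OF dpi_surj[OF g]] by blast
    then have "w = Tpi g a (to_left G g (fst u), snd u)" by (simp add: Tpi_def from_to_left[OF g])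
    then show ?thesis ..
  qed
  then show ?thesis unfolding surj_def by blast
qed

text \<open>The relation inside the definite description of \<open>\<phi>\<close>. It is kept as a
  relation because existence of \<open>\<alpha>\<close> is the zero level condition and must be
  established separately for points of the tube.\<close>

definition "good g \<beta> a b \<alpha> \<longleftrightarrow> (\<forall>\<xi> v. blinfun_apply \<alpha> (Tpi g a (\<xi>, v)) = blinfun_apply \<beta> \<xi> + blinfun_apply b v)"

lemma good_unique:
  assumes g: "g \<in> C" and "good g \<beta> a b \<alpha>" "good g \<beta> a b \<alpha>'"
  shows "\<alpha> = \<alpha>'"
proof (rule blinfun_eqI)
  fix w
  obtain v where "w = Tpi g a v" using surjD[OF Tpi_surj[OF g]] by blast
  then have "w = Tpi g a (fst v, snd v)" by simp
  then show "blinfun_apply \<alpha> w = blinfun_apply \<alpha>' w" using assms(2,3) by (metis good_def)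
qed

lemma phi_The: "\<phi> G H \<rho> Q (g, \<beta>, a, b) = (\<pi> (g, a), THE \<alpha>. good g \<beta> a b \<alpha>)"
  by (simp add: \<phi>_def good_def Tpi_def dpi_def)

lemma phi_good:
  assumes "g \<in> C" "good g \<beta> a b \<alpha>" shows "\<phi> G H \<rho> Q (g, \<beta>, a, b) = (\<pi> (g, a), \<alpha>)"
proof -
  have "(THE \<alpha>. good g \<beta> a b \<alpha>) = \<alpha>"
    by (rule the_equality) (use assms good_unique[OF assms(1) _ assms(2)] in blast)+
  then show ?thesis by (simp add: phi_The)
qed

text \<open>All points without a functional over one base point share the same value of
  \<open>\<phi>\<close>; this is what collides with injectivity of \<open>T0\<close>.\<close>

lemma phi_bad: "\<nexists>\<alpha>. good g \<beta> a b \<alpha> \<Longrightarrow> \<phi> G H \<rho> Q (g, \<beta>, a, b) = (\<pi> (g, a), THE \<alpha>. False)"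
  by (simp add: phi_The)

text \<open>A functional on the product descends through the surjection \<open>Tpi g a\<close>
  exactly when it vanishes on the kernel; a right inverse of \<open>Tpi g a\<close> defines the
  descended functional.\<close>

lemma good_iff:
  assumes g: "g \<in> C"
  shows "(\<exists>\<alpha>. good g \<beta> a b \<alpha>) \<longleftrightarrow> (\<forall>v. Tpi g a v = 0 \<longrightarrow> blinfun_apply \<beta> (fst v) + blinfun_apply b (snd v) = 0)"
proof
  assume "\<exists>\<alpha>. good g \<beta> a b \<alpha>"
  then obtain \<alpha> where \<alpha>: "good g \<beta> a b \<alpha>" by blast
  show "\<forall>v. Tpi g a v = 0 \<longrightarrow> blinfun_apply \<beta> (fst v) + blinfun_apply b (snd v) = 0"
  proof (intro allI impI)
    fix v assume "Tpi g a v = 0"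
    then show "blinfun_apply \<beta> (fst v) + blinfun_apply b (snd v) = 0"
      using \<alpha>[unfolded good_def, rule_format, of "fst v" "snd v"] by (simp add: blinfun.zero_right)
  qed
next
  assume k: "\<forall>v. Tpi g a v = 0 \<longrightarrow> blinfun_apply \<beta> (fst v) + blinfun_apply b (snd v) = 0"
  obtain R where R: "linear R" "\<And>w. Tpi g a (R w) = w"
    using linear_surjective_right_inverse[OF Tpi_linear[OF g] Tpi_surj[OF g]] by (auto simp: o_def fun_eq_iff)
  let ?f = "\<lambda>v. blinfun_apply \<beta> (fst v) + blinfun_apply b (snd v)"
  have lf: "linear ?f" by (rule linearI) (auto simp: blinfun.add_right blinfun.scaleR_right algebra_simps)
  have lR: "linear (\<lambda>w. ?f (R w))" using linear_compose[OF R(1) lf] by (simp add: o_def)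
  define \<alpha> where "\<alpha> = Blinfun (\<lambda>w. ?f (R w))"
  have \<alpha>: "blinfun_apply \<alpha> = (\<lambda>w. ?f (R w))" unfolding \<alpha>_def by (rule blinfun_apply_Blinfun_fin_dim[OF fdQ lR])
  have "good g \<beta> a b \<alpha>"
    unfolding good_def
  proof (intro allI)
    fix \<xi> v
    let ?u = "R (Tpi g a (\<xi>, v)) - (\<xi>, v)"
    have "Tpi g a ?u = 0" by (simp add: linear_diff[OF Tpi_linear[OF g]] R(2))
    then have "?f ?u = 0" using k by blast
    then have "?f (R (Tpi g a (\<xi>, v))) = ?f (\<xi>, v)" by (simp add: blinfun.diff_right algebra_simps)
    then show "blinfun_apply \<alpha> (Tpi g a (\<xi>, v)) = blinfun_apply \<beta> \<xi> + blinfun_apply b v" by (simp add: \<alpha>)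
  qed
  then show "\<exists>\<alpha>. good g \<beta> a b \<alpha>" ..
qed

lemma good_exists_pullback:
  assumes g: "g \<in> C"
  shows "\<exists>\<beta> b. good g \<beta> a b \<alpha>"
proof -
  have l: "linear (\<lambda>v. blinfun_apply \<alpha> (Tpi g a v))"
    using linear_compose[OF Tpi_linear[OF g] bounded_linear.linear[OF blinfun.bounded_linear_right[of \<alpha>]]] by (simp add: o_def)
  have l1: "linear (\<lambda>\<xi> :: 'g. (\<xi>, 0 :: 's))" and l2: "linear (\<lambda>v :: 's. (0 :: 'g, v))" by (auto intro!: linearI)
  have 1: "blinfun_apply (Blinfun (\<lambda>\<xi>. \<alpha> (Tpi g a (\<xi>, 0)))) = (\<lambda>\<xi>. \<alpha> (Tpi g a (\<xi>, 0)))"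
    by (rule blinfun_apply_Blinfun_fin_dim[OF fd]) (use linear_compose[OF l1 l] in \<open>simp add: o_def\<close>)
  have 2: "blinfun_apply (Blinfun (\<lambda>v. \<alpha> (Tpi g a (0, v)))) = (\<lambda>v. \<alpha> (Tpi g a (0, v)))"
    by (rule blinfun_apply_Blinfun_fin_dim[OF fdS]) (use linear_compose[OF l2 l] in \<open>simp add: o_def\<close>)
  have "good g (Blinfun (\<lambda>\<xi>. \<alpha> (Tpi g a (\<xi>, 0)))) a (Blinfun (\<lambda>v. \<alpha> (Tpi g a (0, v)))) \<alpha>"
    unfolding good_def 1 2 using linear_add[OF l] by (simp flip: linear_add[OF l])
  then show ?thesis by blast
qed

lemma pi_twist: 
  assumes "g \<in> C" "h \<in> H" shows "\<pi> (g \<otimes> h, \<rho> (inv h) a) = \<pi> (g, a)"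
proof -
  have sub: "\<pi> (g \<otimes> h, \<rho> (inv h) a) \<subseteq> \<pi> (g, a)" if gh: "g \<in> C" "h \<in> H" for g h a
  proof
    fix z assume "z \<in> \<pi> (g \<otimes> h, \<rho> (inv h) a)"
    then obtain k where k: "k \<in> H" "z = (g \<otimes> h \<otimes> inv k, \<rho> k (\<rho> (inv h) a))" by (auto simp: tw_class_def)
    have "z = (g \<otimes> inv (k \<otimes> inv h), \<rho> (k \<otimes> inv h) a)"
      using k gh H_C H_inv by (simp add: rho_mult inv_mult_group m_assoc)
    moreover have "k \<otimes> inv h \<in> H" using k gh H_mult H_inv by blast
    ultimately show "z \<in> \<pi> (g, a)" by (auto simp: tw_class_def)
  qed
  have "\<pi> (g \<otimes> h \<otimes> inv h, \<rho> (inv (inv h)) (\<rho> (inv h) a)) \<subseteq> \<pi> (g \<otimes> h, \<rho> (inv h) a)"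
    by (rule sub) (use assms H_C H_inv in auto)
  moreover have "g \<otimes> h \<otimes> inv h = g" "\<rho> (inv (inv h)) (\<rho> (inv h) a) = a"
    using assms H_C rho_inv by (simp_all add: m_assoc)
  ultimately show ?thesis using sub[OF assms] by auto
qed

lemma tw_left_class:
  assumes "g' \<in> C" "g \<in> C" shows "tw_left G g' (\<pi> (g, a)) = \<pi> (g' \<otimes> g, a)"
proof -
  have "g' \<otimes> (g \<otimes> inv k) = g' \<otimes> g \<otimes> inv k" if "k \<in> H" for k
    using assms that H_C by (simp add: m_assoc)
  then show ?thesis unfolding tw_left_def tw_class_def by (force simp: image_iff)
qed

text \<open>The curve of twists of \<open>(g, a)\<close> by \<open>H\<close> is constant in
  \<open>Q\<close>; its derivative shows that \<open>(- \<eta>, D \<eta>)\<close> lies in the kernel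
  of \<open>Tpi g a\<close>, where the functional vanishes.\<close>

lemma good_h:
  assumes g: "g \<in> C" and good: "good g \<beta> a b \<alpha>" and \<eta>: "\<eta> \<in> \<hh>"
  shows "blinfun_apply \<beta> \<eta> = b (inf_act G H \<rho> \<eta> a)"
proof -
  obtain D where D: "mderiv M H vec_mfd (\<lambda>h. \<rho> h a) \<one> D" "\<And>\<eta>. \<eta> \<in> \<hh> \<Longrightarrow> inf_act G H \<rho> \<eta> a = D \<eta>"
    using inf_act_linear[of a] by metis
  have i: "mderiv M H M (\<lambda>h. inv h) \<one> (\<lambda>v. - v)"
    by (rule mderiv_inv[OF chM idH[OF H_one]]) (auto simp: H_C)
  have gi: "mderiv M H M (\<lambda>h. g \<otimes> inv h) \<one> (\<lambda>v. from_left G g (- v))"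
    by (rule mderiv_compose_simple[OF chM chM chM i, of C "\<lambda>x. g \<otimes> x"]) (use from_left_mderiv[OF g] H_C in auto)
  have m: "mderiv M H Q (\<lambda>h. \<pi> (g \<otimes> inv h, \<rho> h a)) \<one> (\<lambda>v. dpi g a (from_left G g (- v), D v))"
    by (rule mderiv_compose_simple[OF chM chMV chQ mderiv_Pair[OF chM chM chV gi D(1)], of "C \<times> UNIV" \<pi>])
      (use pi_mderiv[OF g] g H_C in \<open>auto simp: rho_one\<close>)
  have "mderiv M H Q (\<lambda>h. \<pi> (g, a)) \<one> (\<lambda>v. dpi g a (from_left G g (- v), D v))"
  proof (rule mderiv_cong[OF chM m])
    fix h assume h: "h \<in> H"
    show "\<pi> (g, a) = \<pi> (g \<otimes> inv h, \<rho> h a)" using pi_twist[OF g H_inv[OF h], of a] h H_C by simp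
  qed
  moreover have "mderiv M H Q (\<lambda>h. \<pi> (g, a)) \<one> (\<lambda>v. 0)"
    by (rule mderiv_const[OF chQ H_one]) (use ptsM mderiv_mem(3)[OF pi_mderiv[OF g]] in auto)
  ultimately have "dpi g a (from_left G g (- \<eta>), D \<eta>) = 0"
    by (rule mderiv_unique[OF chM _ _ sub_alg_velocity[OF \<eta>]])
  then have "Tpi g a (- \<eta>, D \<eta>) = 0" by (simp add: Tpi_def)
  then have "blinfun_apply \<beta> (- \<eta>) + blinfun_apply b (D \<eta>) = 0"
    using good[unfolded good_def, rule_format, of "- \<eta>" "D \<eta>"] by (simp add: blinfun.zero_right)
  then show ?thesis using D(2)[OF \<eta>] by (simp add: blinfun.minus_right)
qed

text \<open>Left multiplication moves \<open>[g, a]\<close> as right translation by \<open>g\<close>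
  moves the group factor, and
  \<open>x \<otimes> g = g \<otimes> (inv g \<otimes> x \<otimes> g)\<close>. Hence the generator of
  \<open>\<xi>\<close> is \<open>Tpi g a (Ad G (inv g) \<xi>, 0)\<close>.\<close>

lemma good_momentum:
  assumes g: "g \<in> C" and good: "good g \<beta> a b \<alpha>"
  shows "momentum G Q (\<pi> (g, a), \<alpha>) = coAd G (inv g) \<beta>"
proof -
  have r: "dmult \<one> g (\<xi>, 0) = from_left G g (Ad G (inv g) \<xi>)" for \<xi>
  proof -
    have "mderiv M C M (\<lambda>x. g \<otimes> (inv g \<otimes> x \<otimes> inv (inv g))) \<one> (\<lambda>v. from_left G g (Ad G (inv g) v))"
      by (rule mderiv_compose_simple[OF chM chM chM Ad_mderiv[OF inv_closed[OF g]], of C "\<lambda>x. g \<otimes> x"])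
        (use from_left_mderiv[OF g] g in auto)
    then have "mderiv M C M (\<lambda>x. x \<otimes> g) \<one> (\<lambda>v. from_left G g (Ad G (inv g) v))"
      by (rule mderiv_cong[OF chM]) (simp add: g m_assoc[symmetric])
    from fun_cong[OF mderiv_uniqueM[OF right_mderiv[OF g one_closed] this], of \<xi>] show ?thesis .
  qed
  have rg: "mderiv M C M (\<lambda>x. x \<otimes> g) \<one> (\<lambda>v. dmult \<one> g (v, 0))" by (rule right_mderiv[OF g one_closed])
  have ca: "mderiv M C vec_mfd (\<lambda>_. a) \<one> (\<lambda>_. 0)" by (rule mderiv_const[OF chV]) (auto simp: ptsM)
  have "mderiv M C Q (\<lambda>x. \<pi> (x \<otimes> g, a)) \<one> (\<lambda>v. dpi g a (dmult \<one> g (v, 0), 0))"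
    by (rule mderiv_compose_simple[OF chM chMV chQ mderiv_Pair[OF chM chM chV rg ca], of "C \<times> UNIV" \<pi>])
      (use pi_mderiv[OF g] g in auto)
  then have "mderiv M C Q (\<lambda>x. \<pi> (x \<otimes> g, a)) \<one> (\<lambda>v. Tpi g a (Ad G (inv g) v, 0))"
    by (simp add: r Tpi_def)
  then have m: "mderiv M C Q (\<lambda>x. tw_left G x (\<pi> (g, a))) \<one> (\<lambda>v. Tpi g a (Ad G (inv g) v, 0))"
    by (rule mderiv_cong[OF chM]) (simp add: tw_left_class g)
  have "tmap M C Q (\<lambda>x. tw_left G x (\<pi> (g, a))) \<one> = (\<lambda>v. Tpi g a (Ad G (inv g) v, 0))"
    by (rule mderiv_tmap(2)[OF chM m velC[OF one_closed]])
  then show ?thesis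
    using good by (simp add: momentum_def coAd_def good_def blinfun.zero_right)
qed

text \<open>One map into \<open>Q\<close> near \<open>(\<one>, 0)\<close> is written with base
  representative \<open>(g \<otimes> h, \<rho> (inv h) a)\<close> and, by \<open>pi_twist\<close>,
  with \<open>(g, a)\<close>; uniqueness of derivatives gives the identity.\<close>

lemma Tpi_twist:
  assumes g: "g \<in> C" and h: "h \<in> H"
  shows "Tpi (g \<otimes> h) (\<rho> (inv h) a) (\<xi>, v) = Tpi g a (Ad G h \<xi>, \<rho> h v)"
proof -
  have hC: "h \<in> C" "g \<otimes> h \<in> C" using g h H_C by auto
  let ?a = "\<rho> (inv h) a"
  have mem: "(\<one>, 0 :: 's) \<in> C \<times> UNIV" "(\<one>, 0 :: 's) \<in> pts MGS" using ptsM by auto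
  note F = mderiv_fst[OF chM chV mem] and S = mderiv_snd[OF chM chV mem]
  have tr: "mderiv vec_mfd UNIV vec_mfd (\<lambda>v. c + L v) 0 L" if "bounded_linear L" for c and L :: "'s \<Rightarrow> 's"
  proof -
    have "strict_deriv (\<lambda>v. c + L v) (\<lambda>v. 0 + L v) 0 UNIV"
      by (intro strict_deriv_add strict_deriv_const strict_deriv_bounded_linear that) auto
    then show ?thesis by (simp add: mderiv_vec_vec)
  qed
  have bl: "bounded_linear (\<rho> h)" by (rule fin_dim_bounded_linear[OF fdS rho_linear[OF h]])
  have "mderiv MGS (C \<times> UNIV) M (\<lambda>z. (g \<otimes> h) \<otimes> fst z) (\<one>, 0) (\<lambda>v. from_left G (g \<otimes> h) (fst v))"
    by (rule mderiv_compose_simple[OF chMV chM chM F, of C "\<lambda>x. (g \<otimes> h) \<otimes> x"]) (use from_left_mderiv[OF hC(2)] in auto)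
  moreover have "mderiv MGS (C \<times> UNIV) vec_mfd (\<lambda>z. ?a + snd z) (\<one>, 0) (\<lambda>v. snd v)"
    by (rule mderiv_compose_simple[OF chMV chV chV S, of UNIV "\<lambda>v. ?a + v" "\<lambda>v. v"])
      (use tr[OF bounded_linear_ident] in auto)
  ultimately have 1: "mderiv MGS (C \<times> UNIV) MGS (\<lambda>z. ((g \<otimes> h) \<otimes> fst z, ?a + snd z)) (\<one>, 0)
    (\<lambda>v. (from_left G (g \<otimes> h) (fst v), snd v))" by (rule mderiv_Pair[OF chMV chM chV])
  have 2: "mderiv MGS (C \<times> UNIV) Q (\<lambda>z. \<pi> ((g \<otimes> h) \<otimes> fst z, ?a + snd z)) (\<one>, 0)
    (\<lambda>v. dpi (g \<otimes> h) ?a (from_left G (g \<otimes> h) (fst v), snd v))"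
    by (rule mderiv_compose_simple[OF chMV chMV chQ 1, of "C \<times> UNIV" \<pi>]) (use pi_mderiv[OF hC(2)] hC in auto)
  have "mderiv MGS (C \<times> UNIV) M (\<lambda>z. h \<otimes> fst z \<otimes> inv h) (\<one>, 0) (\<lambda>v. Ad G h (fst v))"
    by (rule mderiv_compose_simple[OF chMV chM chM F, of C "\<lambda>x. h \<otimes> x \<otimes> inv h"]) (use Ad_mderiv[OF hC(1)] in auto)
  from mderiv_compose_simple[OF chMV chM chM this, of C "\<lambda>x. g \<otimes> x" "from_left G g"]
  have "mderiv MGS (C \<times> UNIV) M (\<lambda>z. g \<otimes> (h \<otimes> fst z \<otimes> inv h)) (\<one>, 0) (\<lambda>v. from_left G g (Ad G h (fst v)))"
    using from_left_mderiv[OF g] hC by auto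
  moreover have "mderiv MGS (C \<times> UNIV) vec_mfd (\<lambda>z. a + \<rho> h (snd z)) (\<one>, 0) (\<lambda>v. \<rho> h (snd v))"
    by (rule mderiv_compose_simple[OF chMV chV chV S, of UNIV "\<lambda>v. a + \<rho> h v" "\<rho> h"]) (use tr[OF bl] in auto)
  ultimately have 3: "mderiv MGS (C \<times> UNIV) MGS (\<lambda>z. (g \<otimes> (h \<otimes> fst z \<otimes> inv h), a + \<rho> h (snd z))) (\<one>, 0)
    (\<lambda>v. (from_left G g (Ad G h (fst v)), \<rho> h (snd v)))" by (rule mderiv_Pair[OF chMV chM chV])
  have "mderiv MGS (C \<times> UNIV) Q (\<lambda>z. \<pi> (g \<otimes> (h \<otimes> fst z \<otimes> inv h), a + \<rho> h (snd z))) (\<one>, 0)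
    (\<lambda>v. dpi g a (from_left G g (Ad G h (fst v)), \<rho> h (snd v)))"
    by (rule mderiv_compose_simple[OF chMV chMV chQ 3, of "C \<times> UNIV" \<pi>])
      (use pi_mderiv[OF g] g hC linear_0[OF rho_linear[OF h]] in auto)
  then have 4: "mderiv MGS (C \<times> UNIV) Q (\<lambda>z. \<pi> ((g \<otimes> h) \<otimes> fst z, ?a + snd z)) (\<one>, 0)
    (\<lambda>v. dpi g a (from_left G g (Ad G h (fst v)), \<rho> h (snd v)))"
  proof (rule mderiv_cong[OF chMV])
    fix z :: "'a \<times> 's" assume "z \<in> C \<times> UNIV"
    then have z: "fst z \<in> C" by auto
    let ?g' = "g \<otimes> (h \<otimes> fst z \<otimes> inv h)" and ?a' = "a + \<rho> h (snd z)"
    have "?g' \<otimes> h = (g \<otimes> h) \<otimes> fst z" using g hC z by (simp add: m_assoc)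
    moreover have "\<rho> (inv h) ?a' = ?a + snd z"
      using rho_inv(1)[OF h] by (simp add: linear_add[OF rho_linear[OF H_inv[OF h]]])
    moreover have "?g' \<in> C" using g hC z by simp
    ultimately show "\<pi> ((g \<otimes> h) \<otimes> fst z, ?a + snd z) = \<pi> (?g', ?a')" using pi_twist[of ?g' h ?a'] h by simp
  qed
  from mderiv_unique[OF chMV 2 4 velMS[OF one_closed], of "(\<xi>, v)"]
  show ?thesis by (simp add: Tpi_def)
qed

definition "comp_rho h b = Blinfun (\<lambda>v. blinfun_apply b (\<rho> h v))"

lemma comp_rho_apply: "h \<in> H \<Longrightarrow> blinfun_apply (comp_rho h b) v = b (\<rho> h v)"
proof -
  assume h: "h \<in> H"
  have "linear (\<lambda>v. blinfun_apply b (\<rho> h v))"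
    using linear_compose[OF rho_linear[OF h] bounded_linear.linear[OF blinfun.bounded_linear_right[of b]]] by (simp add: o_def)
  then show ?thesis by (simp add: comp_rho_def blinfun_apply_Blinfun_fin_dim[OF fdS])
qed

lemma good_twist:
  assumes "g \<in> C" "h \<in> H" "good g \<beta> a b \<alpha>"
  shows "good (g \<otimes> h) (coAd G h \<beta>) (\<rho> (inv h) a) (comp_rho h b) \<alpha>"
  using assms H_C unfolding good_def by (simp add: Tpi_twist coAd_apply comp_rho_apply)

text \<open>The topology of \<open>Q\<close> is not defined as a quotient topology; openness comes
  from the projection being a submersion.\<close>

lemma pi_open:
  assumes W: "openin (mtop M) W"
  shows "openin (mtop Q) (\<pi> ` (W \<times> UNIV))"
proof (subst openin_subopen, intro ballI)
  have WC: "W \<subseteq> C" using openin_subset[OF W] ptsM by simp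
  fix q assume "q \<in> \<pi> ` (W \<times> UNIV)"
  then obtain g a where q: "q = \<pi> (g, a)" "g \<in> W" by auto
  then have g: "g \<in> C" using WC by blast
  have m: "mderiv MGS (W \<times> UNIV) Q \<pi> (g, a) (dpi g a)"
    by (rule mderiv_subset[OF chMV pi_mderiv[OF g]]) (use q WC in auto)
  have "openin (mtop MGS) (W \<times> UNIV)" using W by (simp add: openin_prod_Times_iff)
  from mderiv_surj_open[OF chMV chQ fdQ m this dpi_surj[OF g]]
  show "\<exists>T. openin (mtop Q) T \<and> q \<in> T \<and> T \<subseteq> \<pi> ` (W \<times> UNIV)" unfolding q(1) .
qed

subsection \<open>Functionals in the image of the tube\<close>

abbreviation "Ycl \<equiv> Y_class G H \<rho> \<mu>"
abbreviation "\<pp>dual \<equiv> annih (\<hh>\<mu> \<union> \<oo> \<union> \<ll> \<union> \<nn>)"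

definition "in_dom g \<nu> x a b \<longleftrightarrow> g \<in> C \<and> \<nu> \<in> \<pp>r \<and> x \<in> \<oo>r \<and> dia_h a b \<in> \<hh>r"
definition "yv \<nu> x a b = (\<nu> + JN (x, a, b), x, dia_l a b)"

lemma T0_form:
  assumes "in_dom g \<nu> x a b"
  shows "yv \<nu> x a b \<in> U" "T0 (Ycl (g, \<nu>, x, a, b)) = \<phi> G H \<rho> Q (g \<otimes> A (yv \<nu> x a b), B (yv \<nu> x a b), a, b)"
proof -
  have g: "g \<in> C" using assms by (simp add: in_dom_def)
  have *: "yv \<nu> x a b \<in> U \<and> T0 (Ycl (g, \<nu>, x, a, b)) =
      \<phi> G H \<rho> Q (fst (\<Phi> (g, yv \<nu> x a b)), snd (\<Phi> (g, yv \<nu> x a b)), a, b)"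
    using T0 assms unfolding in_dom_def yv_def Let_def by blast
  then show "yv \<nu> x a b \<in> U" by blast
  with * show "T0 (Ycl (g, \<nu>, x, a, b)) = \<phi> G H \<rho> Q (g \<otimes> A (yv \<nu> x a b), B (yv \<nu> x a b), a, b)"
    by (simp add: Phi_eq[OF g])
qed

lemma T0_injD:
  assumes "in_dom g \<nu> x a b" "in_dom g' \<nu>' x' a' b'" "T0 (Ycl (g, \<nu>, x, a, b)) = T0 (Ycl (g', \<nu>', x', a', b'))"
  shows "\<exists>k\<in>H \<inter> stab G \<mu>. g' = g \<otimes> inv k \<and> \<nu>' = coAd G (inv k) \<nu> \<and> x' = Ad G k x \<and> a' = \<rho> k a \<and> b' = dual_act G \<rho> k b"
proof -
  have eq: "Ycl (g, \<nu>, x, a, b) = Ycl (g', \<nu>', x', a', b')"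
    by (rule inj_onD[OF T0_inj assms(3)]) (use assms(1,2)[unfolded in_dom_def] in blast)+
  have d1: "dual_act G \<rho> \<one> b' = b'"
  proof (rule blinfun_eqI)
    fix v show "blinfun_apply (dual_act G \<rho> \<one> b') v = b' v"
      by (simp add: dual_act_def rho_one blinfun_apply_inverse)
  qed
  have g': "g' \<in> C" using assms(2) by (simp add: in_dom_def)
  have "(g', \<nu>', x', a', b') \<in> Ycl (g', \<nu>', x', a', b')"
  proof -
    have "(g', \<nu>', x', a', b') = (g' \<otimes> inv \<one>, Y_act G \<rho> \<one> (\<nu>', x', a', b'))"
      by (simp add: Y_act_def g' coAd_one Ad_one rho_one d1)
    moreover have "\<one> \<in> H \<inter> stab G \<mu>" using H_one stab_one by blast
    ultimately show ?thesis unfolding Y_class_def tw_class_def by blast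
  qed
  then have "(g', \<nu>', x', a', b') \<in> Ycl (g, \<nu>, x, a, b)" by (simp add: eq)
  then show ?thesis unfolding Y_class_def tw_class_def Y_act_def by auto
qed

lemma dual_act_apply: "k \<in> H \<Longrightarrow> blinfun_apply (dual_act G \<rho> k b) v = b (\<rho> (inv k) v)"
  using comp_rho_apply[of "inv k" b v] H_inv by (simp add: dual_act_def comp_rho_def)

lemma H_pow: "k \<in> H \<Longrightarrow> k [^] (n :: nat) \<in> H"
  by (induction n) (auto simp: H_one H_mult)

lemma bounded_power_zero:
  fixes c r :: real
  assumes "r > 1" "\<And>n :: nat. \<bar>r ^ n * c\<bar> \<le> K"
  shows "c = 0"
proof (rule ccontr)
  assume c: "c \<noteq> 0"
  obtain n where "K / \<bar>c\<bar> < r ^ n" using real_arch_pow[OF assms(1)] by blast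
  then have "K < \<bar>r ^ n * c\<bar>" using c assms(1) by (simp add: abs_mult pos_divide_less_eq)
  with assms(2)[of n] show False by simp
qed

text \<open>If \<open>k\<close> multiplied a nonzero vector or covector by \<open>r > 1\<close>, its
  powers would be unbounded on it, against compactness of \<open>H\<close>.\<close>

lemma no_dilation:
  assumes k: "k \<in> H" and r: "r > 1"
  shows "r *\<^sub>R \<nu> = coAd G (inv k) \<nu> \<Longrightarrow> \<nu> = 0" "r *\<^sub>R x = Ad G k x \<Longrightarrow> x = 0" "r *\<^sub>R b = dual_act G \<rho> k b \<Longrightarrow> b = 0"
proof -
  have kC: "k \<in> C" using k H_C by blast
  show "x = 0" if e: "r *\<^sub>R x = Ad G k x"
  proof -
    have pw: "Ad G (k [^] n) x = r ^ n *\<^sub>R x" for n :: nat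
    proof (induction n)
      case 0 show ?case by (simp add: Ad_one)
    next
      case (Suc n)
      have "Ad G (k [^] Suc n) x = Ad G (k [^] n) (r *\<^sub>R x)" using kC by (simp add: Ad_mult e)
      also have "\<dots> = r ^ Suc n *\<^sub>R x" using Suc kC by (simp add: linear_scale[OF Ad_linear])
      finally show ?case .
    qed
    obtain K where K: "\<And>h. h \<in> H \<Longrightarrow> norm (Ad G h x) \<le> K" using Ad_bounded_on_compact[OF compH] by blast
    have "norm x = 0"
    proof (rule bounded_power_zero[OF r])
      fix n :: nat
      show "\<bar>r ^ n * norm x\<bar> \<le> K" using K[OF H_pow[OF k, of n]] r by (simp add: pw)
    qed
    then show ?thesis by simp
  qed
  show "\<nu> = 0" if e: "r *\<^sub>R \<nu> = coAd G (inv k) \<nu>"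
  proof (rule blinfun_eqI)
    fix \<eta>
    have ik: "inv k \<in> H" "inv k \<in> C" using k H_inv kC by auto
    have e': "blinfun_apply \<nu> (Ad G (inv k) \<eta>) = r * \<nu> \<eta>" for \<eta>
      using arg_cong[OF e, of "\<lambda>\<nu>. blinfun_apply \<nu> \<eta>"] ik by (simp add: coAd_apply blinfun.scaleR_left)
    have pw: "blinfun_apply \<nu> (Ad G (inv k [^] n) \<eta>) = r ^ n * \<nu> \<eta>" for n :: nat
    proof (induction n arbitrary: \<eta>)
      case 0 show ?case by (simp add: Ad_one)
    next
      case (Suc n)
      then show ?case using ik by (simp add: Ad_mult e')
    qed
    obtain K where K: "\<And>h. h \<in> H \<Longrightarrow> norm (Ad G h \<eta>) \<le> K" using Ad_bounded_on_compact[OF compH] by blast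
    have "blinfun_apply \<nu> \<eta> = 0"
    proof (rule bounded_power_zero[OF r])
      fix n :: nat
      have "norm (blinfun_apply \<nu> (Ad G (inv k [^] n) \<eta>)) \<le> norm \<nu> * K"
        by (rule order_trans[OF norm_blinfun mult_left_mono[OF K[OF H_pow[OF ik(1)]]]]) simp
      then show "\<bar>r ^ n * \<nu> \<eta>\<bar> \<le> norm \<nu> * K" unfolding pw by simp
    qed
    then show "blinfun_apply \<nu> \<eta> = blinfun_apply 0 \<eta>" by simp
  qed
  show "b = 0" if e: "r *\<^sub>R b = dual_act G \<rho> k b"
  proof (rule blinfun_eqI)
    fix v
    have ik: "inv k \<in> H" using k H_inv by auto
    have e': "blinfun_apply b (\<rho> (inv k) v) = r * b v" for v
      using arg_cong[OF e, of "\<lambda>b. blinfun_apply b v"] k by (simp add: dual_act_apply blinfun.scaleR_left)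
    have pw: "blinfun_apply b (\<rho> (inv k [^] n) v) = r ^ n * b v" for n :: nat
    proof (induction n arbitrary: v)
      case 0 show ?case by (simp add: rho_one)
    next
      case (Suc n)
      then show ?case using ik H_pow[OF ik] by (simp add: rho_mult e')
    qed
    have "\<exists>K. \<forall>h\<in>H. norm (\<rho> h v) \<le> K"
      by (rule mderiv_bounded_on_compact[OF chM compH order_refl]) (rule rho_mderiv_fix)
    then obtain K where K: "\<And>h. h \<in> H \<Longrightarrow> norm (\<rho> h v) \<le> K" by blast
    have "blinfun_apply b v = 0"
    proof (rule bounded_power_zero[OF r])
      fix n :: nat
      have "norm (blinfun_apply b (\<rho> (inv k [^] n) v)) \<le> norm b * K"
        by (rule order_trans[OF norm_blinfun mult_left_mono[OF K[OF H_pow[OF ik]]]]) simp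
      then show "\<bar>r ^ n * b v\<bar> \<le> norm b * K" unfolding pw by simp
    qed
    then show "blinfun_apply b v = blinfun_apply 0 v" by simp
  qed
qed

end

lemma tendsto_blinfun_fin_dim:
  fixes F :: "'x \<Rightarrow> ('v::real_normed_vector) dual"
  assumes fd: "fin_dim TYPE('v)" and pw: "\<And>\<eta>. ((\<lambda>x. blinfun_apply (F x) \<eta>) \<longlongrightarrow> blinfun_apply L \<eta>) net"
  shows "(F \<longlongrightarrow> L) net"
proof -
  obtain E :: "'v set" and K where E: "finite E" "K > 0"
    "\<And>\<beta> :: 'v dual. norm \<beta> \<le> K * (\<Sum>b\<in>E. \<bar>blinfun_apply \<beta> b\<bar>)" using fin_dim_dual_norm_le[OF fd] by blast
  have "((\<lambda>x. K * (\<Sum>b\<in>E. \<bar>blinfun_apply (F x) b - blinfun_apply L b\<bar>)) \<longlongrightarrow> K * (\<Sum>b\<in>E. \<bar>blinfun_apply L b - blinfun_apply L b\<bar>)) net"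
    by (intro tendsto_intros pw)
  then have 0: "((\<lambda>x. K * (\<Sum>b\<in>E. \<bar>blinfun_apply (F x) b - blinfun_apply L b\<bar>)) \<longlongrightarrow> 0) net" by simp
  have "((\<lambda>x. F x - L) \<longlongrightarrow> 0) net"
    by (rule Lim_null_comparison[OF _ 0]) (use E(3) in \<open>auto simp flip: blinfun.diff_left\<close>)
  then show ?thesis by (simp add: Lim_null[symmetric])
qed

context lie_gp
begin

lemma bracket_bounded_bilinear: "bounded_bilinear (bracket G)"
proof
  show "bracket G (a + a') b = bracket G a b + bracket G a' b" "bracket G a (b + b') = bracket G a b + bracket G a b'"
    "bracket G (r *\<^sub>R a) b = r *\<^sub>R bracket G a b" "bracket G a (r *\<^sub>R b) = r *\<^sub>R bracket G a b" for a a' b b' r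
    by (simp_all add: bracket_simps)
  obtain E :: "'g set" and c :: "'g \<Rightarrow> 'g \<Rightarrow> real" where E: "finite E" "\<And>b. bounded_linear (c b)"
    "\<And>x. x = (\<Sum>b\<in>E. c b x *\<^sub>R b)" using fin_dim_basis[OF fd] by blast
  have bl: "bounded_linear (bracket G b)" for b by (rule linear_fd[OF bracket_linear_right])
  have "norm (bracket G x y) \<le> norm x * norm y * (\<Sum>b\<in>E. onorm (c b) * onorm (bracket G b))" for x y
  proof -
    have "bracket G x y = bracket G (\<Sum>b\<in>E. c b x *\<^sub>R b) y" using E(3) by metis
    also have "\<dots> = (\<Sum>b\<in>E. c b x *\<^sub>R bracket G b y)"
      by (simp add: linear_sum[OF bracket_linear_left] bracket_simps)
    finally have "norm (bracket G x y) \<le> (\<Sum>b\<in>E. norm (c b x *\<^sub>R bracket G b y))" by (metis norm_sum)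
    also have "\<dots> \<le> (\<Sum>b\<in>E. (onorm (c b) * norm x) * (onorm (bracket G b) * norm y))"
    proof (rule sum_mono)
      fix b assume "b \<in> E"
      have "\<bar>c b x\<bar> \<le> onorm (c b) * norm x" using onorm[OF E(2), of b x] by simp
      then show "norm (c b x *\<^sub>R bracket G b y) \<le> (onorm (c b) * norm x) * (onorm (bracket G b) * norm y)"
        unfolding norm_scaleR by (intro mult_mono onorm[OF bl]) (auto intro: mult_nonneg_nonneg onorm_pos_le[OF E(2)])
    qed
    also have "\<dots> = norm x * norm y * (\<Sum>b\<in>E. onorm (c b) * onorm (bracket G b))"
      by (simp add: sum_distrib_left algebra_simps)
    finally show ?thesis .
  qed
  then show "\<exists>K. \<forall>a b. norm (bracket G a b) \<le> norm a * norm b * K" by blast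
qed

end

context tube_setting
begin

text \<open>Failure of the zero level condition is open: a kernel vector of \<open>Tpi\<close> on
  which the functional is nonzero still detects it after a small change of the fibre coordinates. If
  the base point in \<open>Q\<close> is held fixed, \<open>T0\<close> keeps its value.\<close>

lemma bad_ray:
  assumes dom: "in_dom g \<nu> x a b"
    and bad: "\<nexists>\<alpha>. good (g \<otimes> A (yv \<nu> x a b)) (B (yv \<nu> x a b)) a b \<alpha>"
    and dir: "\<nu>' \<in> \<pp>dual" "x' \<in> \<oo>"
  shows "\<exists>s>0. \<exists>g'. in_dom g' (\<nu> + s *\<^sub>R \<nu>') (x + s *\<^sub>R x') a (b + s *\<^sub>R b') \<and>
    T0 (Ycl (g', \<nu> + s *\<^sub>R \<nu>', x + s *\<^sub>R x', a, b + s *\<^sub>R b')) = T0 (Ycl (g, \<nu>, x, a, b))"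
proof -
  define y where "y = yv \<nu> x a b"
  define g1 where "g1 = g \<otimes> A y"
  have yU: "y \<in> U" unfolding y_def by (rule T0_form(1)[OF dom])
  have gC: "g \<in> C" "g1 \<in> C" using dom A_C[OF yU] by (auto simp: in_dom_def g1_def)
  obtain u where u: "Tpi g1 a u = 0" "blinfun_apply (B y) (fst u) + blinfun_apply b (snd u) \<noteq> 0"
    using bad good_iff[OF gC(2)] unfolding y_def[symmetric] g1_def[symmetric] by blast
  let ?F = "at_right (0::real)"
  have s0: "((\<lambda>s. s) \<longlongrightarrow> 0) ?F" by (rule tendsto_ident_at)
  have lin: "((\<lambda>s. p + s *\<^sub>R q) \<longlongrightarrow> p) ?F" for p q :: "'z::real_normed_vector"
    using tendsto_add[OF tendsto_const[of p] tendsto_scaleR[OF s0 tendsto_const[of q]]] by simp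
  have l\<nu>: "((\<lambda>s. \<nu> + s *\<^sub>R \<nu>') \<longlongrightarrow> \<nu>) ?F" and lx: "((\<lambda>s. x + s *\<^sub>R x') \<longlongrightarrow> x) ?F"
    and lb: "((\<lambda>s. b + s *\<^sub>R b') \<longlongrightarrow> b) ?F" by (rule lin)+
  have lb': "((\<lambda>s. blinfun_apply (b + s *\<^sub>R b') v) \<longlongrightarrow> blinfun_apply b v) ?F" for v
    by (rule bounded_linear.tendsto[OF blinfun.bounded_linear_left lb])
  have lh: "((\<lambda>s. dia_h a (b + s *\<^sub>R b')) \<longlongrightarrow> dia_h a b) ?F"
    by (rule tendsto_blinfun_fin_dim[OF fd]) (simp only: dia_h_apply lb')
  have ll: "((\<lambda>s. dia_l a (b + s *\<^sub>R b')) \<longlongrightarrow> dia_l a b) ?F"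
    by (rule tendsto_blinfun_fin_dim[OF fd]) (simp only: dia_l_apply lb')
  have lJ: "((\<lambda>s. JN (x + s *\<^sub>R x', a, b + s *\<^sub>R b')) \<longlongrightarrow> JN (x, a, b)) ?F"
  proof (rule tendsto_blinfun_fin_dim[OF fd])
    fix \<eta>
    note bt = bounded_bilinear.tendsto[OF bracket_bounded_bilinear]
    show "((\<lambda>s. blinfun_apply (JN (x + s *\<^sub>R x', a, b + s *\<^sub>R b')) \<eta>) \<longlongrightarrow> blinfun_apply (JN (x, a, b)) \<eta>) ?F"
      unfolding JN_apply
      by (intro tendsto_add tendsto_mult tendsto_const lb' bounded_linear.tendsto[OF blinfun.bounded_linear_right] bt lx)
  qed
  define c where "c s = yv (\<nu> + s *\<^sub>R \<nu>') (x + s *\<^sub>R x') a (b + s *\<^sub>R b')" for s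
  have lc: "(c \<longlongrightarrow> y) ?F"
    unfolding c_def[abs_def] y_def yv_def by (intro tendsto_Pair tendsto_add l\<nu> lJ lx ll)
  have ev: "eventually (\<lambda>s. f s \<in> S) ?F"
    if op: "openin (top_of_set T) S" and "L \<in> S" "(f \<longlongrightarrow> L) ?F" "\<And>s. f s \<in> T"
    for T S and L :: "'z::real_normed_vector" and f
  proof -
    obtain O' where O: "open O'" "S = T \<inter> O'" using op by (auto simp: openin_open)
    have "eventually (\<lambda>s. f s \<in> O') ?F" by (rule topological_tendstoD[OF that(3) O(1)]) (use that O in auto)
    then show ?thesis using that(4) O(2) by simp
  qed
  have mem: "\<nu> \<in> \<pp>r" "x \<in> \<oo>r" "dia_h a b \<in> \<hh>r" using dom by (auto simp: in_dom_def)
  have mem': "\<nu> \<in> \<pp>dual" "x \<in> \<oo>" using mem openin_imp_subset[OF \<pp>r(1)] openin_imp_subset[OF \<oo>r(1)] by blast+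
  have e1: "eventually (\<lambda>s. \<nu> + s *\<^sub>R \<nu>' \<in> \<pp>r) ?F"
    by (rule ev[OF \<pp>r(1) mem(1) l\<nu>]) (intro subspace_add subspace_scale subspace_annih mem' dir)
  have e2: "eventually (\<lambda>s. x + s *\<^sub>R x' \<in> \<oo>r) ?F"
    by (rule ev[OF \<oo>r(1) mem(2) lx]) (intro subspace_add subspace_scale sub_spaces(4) mem' dir)
  have e3: "eventually (\<lambda>s. dia_h a (b + s *\<^sub>R b') \<in> \<hh>r) ?F"
    by (rule ev[OF \<hh>r(1) mem(3) lh dia_h_annih])
  have e4: "eventually (\<lambda>s. in_dom \<one> (\<nu> + s *\<^sub>R \<nu>') (x + s *\<^sub>R x') a (b + s *\<^sub>R b')) ?F"
    using e1 e2 e3 by eventually_elim (simp add: in_dom_def)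
  then have eU: "eventually (\<lambda>s. c s \<in> U) ?F"
    by (rule eventually_mono) (simp add: c_def T0_form(1))
  obtain D where D: "mderiv MV (C \<times> U) MD \<Phi> (\<one>, y) D" using Phi_mderiv[OF yU] by blast
  have "(B has_derivative (\<lambda>w. snd (D (0, w)))) (at y within U)"
    by (rule strict_deriv_has_derivative) (use AB_mderiv(2)[OF yU D] in \<open>auto simp: mderiv_vec_vec\<close>)
  then have "continuous (at y within U) B" by (rule has_derivative_continuous)
  then have lB: "((\<lambda>s. B (c s)) \<longlongrightarrow> B y) ?F" by (rule continuous_within_tendsto_compose[OF _ eU lc])
  have "((\<lambda>s. blinfun_apply (B (c s)) (fst u) + blinfun_apply (b + s *\<^sub>R b') (snd u)) \<longlongrightarrow> blinfun_apply (B y) (fst u) + blinfun_apply b (snd u)) ?F"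
    by (intro tendsto_add lb' bounded_linear.tendsto[OF blinfun.bounded_linear_left lB])
  then have e5: "eventually (\<lambda>s. blinfun_apply (B (c s)) (fst u) + blinfun_apply (b + s *\<^sub>R b') (snd u) \<noteq> 0) ?F"
    by (rule tendsto_imp_eventually_ne[OF _ u(2)])
  have e6: "eventually (\<lambda>s. s > 0) ?F" by (simp add: eventually_at_right_less)
  have "eventually (\<lambda>s. s > 0 \<and> in_dom \<one> (\<nu> + s *\<^sub>R \<nu>') (x + s *\<^sub>R x') a (b + s *\<^sub>R b') \<and>
    blinfun_apply (B (c s)) (fst u) + blinfun_apply (b + s *\<^sub>R b') (snd u) \<noteq> 0) ?F"
    using e4 e5 e6 by eventually_elim simp
  then obtain s where s: "s > 0" "in_dom \<one> (\<nu> + s *\<^sub>R \<nu>') (x + s *\<^sub>R x') a (b + s *\<^sub>R b')"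
    "blinfun_apply (B (c s)) (fst u) + blinfun_apply (b + s *\<^sub>R b') (snd u) \<noteq> 0"
    using eventually_happens'[OF trivial_limit_at_right_real] by (metis (mono_tags, lifting))
  have cU: "c s \<in> U" unfolding c_def by (rule T0_form(1)[OF s(2)])
  \<comment> \<open>Compensates the change of \<open>A\<close> along the ray, so that
    \<open>g' \<otimes> A (c s)\<close> remains \<open>g1\<close> and the base point is the
    same.\<close>
  define g' where "g' = g1 \<otimes> inv (A (c s))"
  have g': "in_dom g' (\<nu> + s *\<^sub>R \<nu>') (x + s *\<^sub>R x') a (b + s *\<^sub>R b')" "g' \<otimes> A (c s) = g1"
    using s(2) gC A_C[OF cU] by (auto simp: in_dom_def g'_def m_assoc)
  have "\<nexists>\<alpha>. good g1 (B (c s)) a (b + s *\<^sub>R b') \<alpha>" using good_iff[OF gC(2)] u(1) s(3) by blast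
  then have "T0 (Ycl (g', \<nu> + s *\<^sub>R \<nu>', x + s *\<^sub>R x', a, b + s *\<^sub>R b')) = (\<pi> (g1, a), THE \<alpha>. False)"
    using T0_form(2)[OF g'(1)] phi_bad g'(2) unfolding c_def by simp
  also have "\<dots> = T0 (Ycl (g, \<nu>, x, a, b))"
    using T0_form(2)[OF dom] phi_bad[OF bad] by (simp add: y_def g1_def)
  finally show ?thesis using s(1) g'(1) by blast
qed

lemma stab_alg_of_curve:
  assumes c: "open T" "(0::real) \<in> T" "c ` T \<subseteq> H" "c 0 = \<one>" "mderiv vec_mfd T M c 0 (\<lambda>t. t *\<^sub>R \<eta>)"
    and W: "open W" "0 \<in> W" "\<And>t. t \<in> T \<inter> W \<Longrightarrow> coAd G (c t) \<mu> = \<mu>"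
  shows "\<eta> \<in> \<gg>\<mu>"
proof -
  have cm: "mderiv vec_mfd T vec_mfd (\<lambda>t. \<mu>) 0 (\<lambda>t. 0)" by (rule mderiv_const[OF chV]) (use c in auto)
  have inC: "c t \<in> C" if "t \<in> T" for t using that c H_C by blast
  have 1: "mderiv vec_mfd T vec_mfd (\<lambda>t. coAd G (c t) \<mu>) 0 (\<lambda>t. 0 + coAd G \<one> (coad G (t *\<^sub>R \<eta>) \<mu>))"
    using mderiv_coAd[OF chV c(5) cm inC c(4)] by (simp add: coAd_one)
  have 2: "mderiv vec_mfd (T \<inter> W) vec_mfd (\<lambda>t. \<mu>) 0 (\<lambda>t. 0 + coAd G \<one> (coad G (t *\<^sub>R \<eta>) \<mu>))"
    by (rule mderiv_transform[OF chV 1, of UNIV]) (use c W in auto)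
  have 3: "mderiv vec_mfd (T \<inter> W) vec_mfd (\<lambda>t. \<mu>) 0 (\<lambda>t. 0)" by (rule mderiv_const[OF chV]) (use c W in auto)
  have "velocity vec_mfd (T \<inter> W) (0 :: real) 1"
    by (rule velocity_open[OF chV, of "T \<inter> W"]) (use c W in auto)
  from mderiv_unique[OF chV 2 3 this] have "coad G \<eta> \<mu> = 0" by (simp add: coAd_one)
  then show ?thesis by (simp add: stab_alg_def)
qed

lemma fin_dim_dual_separates:
  assumes fd: "fin_dim TYPE('v::real_normed_vector)" and "\<And>\<beta> :: ('v::real_normed_vector) dual. blinfun_apply \<beta> v = 0"
  shows "v = 0"
proof -
  obtain E :: "'v set" and c :: "'v \<Rightarrow> 'v \<Rightarrow> real" where E: "finite E" "\<And>b. bounded_linear (c b)"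
    "\<And>x. x = (\<Sum>b\<in>E. c b x *\<^sub>R b)" using fin_dim_basis[OF fd] by blast
  have "c b v = 0" for b using assms(2)[of "Blinfun (c b)"] by (simp add: bounded_linear_Blinfun_apply[OF E(2)])
  then show ?thesis using E(3)[of v] by simp
qed

text \<open>If the image under the tube of a point of \<open>Y\<close> were not a genuine functional, its value would
  depend on the base point in \<open>Q\<close> only, and so the tube would fail to be injective on the points
  obtained by dilating the fibre coordinates while keeping that base point.\<close>

lemma tube_functional_exists:
  assumes dom: "in_dom g \<nu> x a b"
  shows "\<exists>\<alpha>. good (g \<otimes> A (yv \<nu> x a b)) (B (yv \<nu> x a b)) a b \<alpha>"
proof (rule ccontr)
  assume bad: "\<nexists>\<alpha>. good (g \<otimes> A (yv \<nu> x a b)) (B (yv \<nu> x a b)) a b \<alpha>"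
  have mem: "\<nu> \<in> \<pp>dual" "x \<in> \<oo>" "g \<in> C" 
    using dom openin_imp_subset[OF \<pp>r(1)] openin_imp_subset[OF \<oo>r(1)] by (auto simp: in_dom_def)
  obtain s g' where s: "s > 0" "in_dom g' (\<nu> + s *\<^sub>R \<nu>) (x + s *\<^sub>R x) a (b + s *\<^sub>R b)"
    "T0 (Ycl (g', \<nu> + s *\<^sub>R \<nu>, x + s *\<^sub>R x, a, b + s *\<^sub>R b)) = T0 (Ycl (g, \<nu>, x, a, b))"
    using bad_ray[OF dom bad mem(1,2)] by metis
  obtain k where k: "k \<in> H" "\<nu> + s *\<^sub>R \<nu> = coAd G (inv k) \<nu>" "x + s *\<^sub>R x = Ad G k x" "b + s *\<^sub>R b = dual_act G \<rho> k b"
    using T0_injD[OF dom s(2) s(3)[symmetric]] by blast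
  have r: "1 + s > 1" using s(1) by simp
  \<comment> \<open>The ray through the fibre point itself scales it by \<open>1 + s\<close>, so
    injectivity would make \<open>k\<close> a dilation.\<close>
  have z: "\<nu> = 0" "x = 0" "b = 0"
    by (rule no_dilation(1)[OF k(1) r] no_dilation(2)[OF k(1) r] no_dilation(3)[OF k(1) r],
        use k in \<open>simp add: scaleR_add_left\<close>)+
  \<comment> \<open>Now the fibre point is zero and fixed by every twist, so injectivity forces
    every admissible direction to vanish: \<open>\<oo>\<close>, \<open>S\<close> and
    \<open>\<pp>dual\<close> are all trivial.\<close>
  have triv: "\<nu>' = 0 \<and> x' = 0 \<and> b' = 0" if dir: "\<nu>' \<in> \<pp>dual" "x' \<in> \<oo>" for \<nu>' x' and b' :: "'s dual"
  proof -
    obtain s g' where s: "s > 0" "in_dom g' (\<nu> + s *\<^sub>R \<nu>') (x + s *\<^sub>R x') a (b + s *\<^sub>R b')"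
      "T0 (Ycl (g', \<nu> + s *\<^sub>R \<nu>', x + s *\<^sub>R x', a, b + s *\<^sub>R b')) = T0 (Ycl (g, \<nu>, x, a, b))"
      using bad_ray[OF dom bad dir, of b'] by blast
    obtain k where k: "k \<in> H" "\<nu> + s *\<^sub>R \<nu>' = coAd G (inv k) \<nu>" "x + s *\<^sub>R x' = Ad G k x" "b + s *\<^sub>R b' = dual_act G \<rho> k b"
      using T0_injD[OF dom s(2) s(3)[symmetric]] by blast
    have ikC: "inv k \<in> C" "k \<in> C" using k(1) H_C by auto
    have "dual_act G \<rho> k (0 :: 's dual) = 0" by (rule blinfun_eqI) (simp add: dual_act_apply k(1))
    then show ?thesis using k s(1) z linear_0[OF coAd_linear[OF ikC(1)]] linear_0[OF Ad_linear[OF ikC(2)]] by simp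
  qed
  have S0: "v = 0" for v :: 's
  proof (rule fin_dim_dual_separates[OF fdS])
    fix \<beta> :: "'s dual"
    have "\<beta> = 0" using triv[OF mem(1,2), of \<beta>] by blast
    then show "blinfun_apply \<beta> v = 0" by simp
  qed
  have o0: "x' = 0" if "x' \<in> \<oo>" for x' using triv[OF mem(1) that] by blast
  have p0: "\<nu>' = 0" if "\<nu>' \<in> \<pp>dual" for \<nu>' using triv[OF that mem(2)] by blast
  have a0: "a = 0" by (rule S0)
  have y0: "yv 0 0 a 0 = 0"
  proof -
    have "JN (0, a, 0) = 0" by (rule blinfun_eqI) (simp add: JN_apply bracket_simps blinfun.zero_right)
    moreover have "dia_l a 0 = 0" by (rule blinfun_eqI) (simp add: dia_l_apply)
    ultimately show ?thesis by (simp add: yv_def zero_prod_def)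
  qed
  have bad0: "\<nexists>\<alpha>. good g \<mu> a 0 \<alpha>" using bad mem(3) by (simp add: z y0 AB_zero)
  then have "\<not> (\<forall>v. Tpi g a v = 0 \<longrightarrow> blinfun_apply \<mu> (fst v) + blinfun_apply (0 :: 's dual) (snd v) = 0)"
    using good_iff[OF mem(3), of \<mu> a 0] by blast
  then obtain u where u: "Tpi g a u = 0" "blinfun_apply \<mu> (fst u) \<noteq> 0" by auto
  have dom0: "in_dom g' 0 0 a 0" if "g' \<in> C" for g' using dom that unfolding z in_dom_def by blast
  have T00: "T0 (Ycl (g', 0, 0, a, 0)) = \<phi> G H \<rho> Q (g', \<mu>, a, 0)" if "g' \<in> C" for g'
    using T0_form(2)[OF dom0[OF that]] that by (simp add: y0 AB_zero)
  \<comment> \<open>For such \<open>h\<close> the point over \<open>g \<otimes> h\<close> is bad as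
    well and has the same base point; injectivity then gives an element of
    \<open>H \<inter> stab G \<mu>\<close> relating the two, which is \<open>inv h\<close>.\<close>
  have hstab: "h \<in> stab G \<mu>" if h: "h \<in> H" "blinfun_apply \<mu> (Ad G (inv h) (fst u)) \<noteq> 0" for h
  proof -
    have hC: "h \<in> C" "g \<otimes> h \<in> C" using h H_C mem(3) by auto
    have "Tpi (g \<otimes> h) (\<rho> (inv h) a) (Ad G (inv h) (fst u), 0) = Tpi g a (fst u, \<rho> h 0)"
      using Tpi_twist[OF mem(3) h(1)] Ad_inv(2)[OF hC(1)] by simp
    moreover have "\<rho> (inv h) a = a" "(fst u, \<rho> h 0) = u" using S0[of "\<rho> (inv h) a"] a0 S0[of "\<rho> h 0"] S0[of "snd u"]
      by (auto simp: prod_eq_iff)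
    ultimately have "Tpi (g \<otimes> h) a (Ad G (inv h) (fst u), 0) = 0" using u(1) by simp
    then have "\<nexists>\<alpha>. good (g \<otimes> h) \<mu> a 0 \<alpha>" using good_iff[OF hC(2), of \<mu> a 0] h(2) by auto
    then have "T0 (Ycl (g \<otimes> h, 0, 0, a, 0)) = (\<pi> (g \<otimes> h, a), THE \<alpha>. False)"
      using T00[OF hC(2)] phi_bad by simp
    also have "\<pi> (g \<otimes> h, a) = \<pi> (g, a)" using pi_twist[OF mem(3) h(1), of a] \<open>\<rho> (inv h) a = a\<close> by simp
    also have "(\<pi> (g, a), THE \<alpha>. False) = T0 (Ycl (g, 0, 0, a, 0))" using T00[OF mem(3)] phi_bad[OF bad0] by simp
    finally obtain k where k: "k \<in> H \<inter> stab G \<mu>" "g \<otimes> h = g \<otimes> inv k"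
      using T0_injD[OF dom0[OF mem(3)] dom0[OF hC(2)]] by metis
    have kC: "k \<in> C" using k(1) H_C by blast
    have "h = inv k" using k(2) hC(1) mem(3) kC by simp
    then show ?thesis using k(1) kC coAd_inv(1)[OF kC, of \<mu>] by (auto simp: stab_iff)
  qed
  \<comment> \<open>The condition of \<open>hstab\<close> holds along a short curve in
    \<open>H\<close> from the identity, so the curve stays in the stabilizer and its velocity lies
    in the stabilizer algebra.\<close>
  have h_stab: "\<eta> \<in> \<gg>\<mu>" if \<eta>: "\<eta> \<in> \<hh>" for \<eta>
  proof -
    obtain c T where c: "open T" "(0::real) \<in> T" "c ` T \<subseteq> H" "c 0 = \<one>" "mderiv vec_mfd T M c 0 (\<lambda>t. t *\<^sub>R \<eta>)"
      using sub_alg_velocity[OF \<eta>] unfolding velocity_def by blast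
    have inC: "c t \<in> C" if "t \<in> T" for t using that c H_C by blast
    have ci: "mderiv vec_mfd T M (\<lambda>t. inv (c t)) 0 (\<lambda>t. - (t *\<^sub>R \<eta>))"
      by (rule mderiv_inv[OF chV c(5)]) (use inC c(4) in auto)
    have "mderiv M C vec_mfd (\<lambda>g. Ad G g (fst u)) (inv (c 0)) (\<lambda>\<xi>. bracket G \<xi> (fst u))"
      using bracket_mderiv c(4) by simp
    from mderiv_compose_simple[OF chV chM chV ci this]
    have "mderiv vec_mfd T vec_mfd (\<lambda>t. Ad G (inv (c t)) (fst u)) 0 (\<lambda>t. bracket G (- (t *\<^sub>R \<eta>)) (fst u))"
      using inC by simp
    then have m: "mderiv vec_mfd T vec_mfd (\<lambda>t. blinfun_apply \<mu> (Ad G (inv (c t)) (fst u))) 0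
       (\<lambda>t. blinfun_apply \<mu> (bracket G (- (t *\<^sub>R \<eta>)) (fst u)))"
      by (rule mderiv_vec_linear[OF chV _ blinfun.bounded_linear_right])
    have o: "openin (mtop (vec_mfd :: (real, real) manifold)) (- {0})" by (simp add: open_Compl)
    have "blinfun_apply \<mu> (Ad G (inv (c 0)) (fst u)) \<in> - {0}" using u(2) c(4) by (simp add: Ad_one)
    then obtain W where W: "openin (mtop (vec_mfd :: (real, real) manifold)) W" "0 \<in> W"
      "\<And>t. t \<in> T \<Longrightarrow> t \<in> W \<Longrightarrow> blinfun_apply \<mu> (Ad G (inv (c t)) (fst u)) \<in> - {0}"
      using mderiv_continuous[OF chV chV m o] by metis
    show ?thesis
    proof (rule stab_alg_of_curve[OF c, of W])
      show "open W" "0 \<in> W" using W by auto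
      fix t assume t: "t \<in> T \<inter> W"
      then have "c t \<in> stab G \<mu>" using c(3) W(3)[of t] by (intro hstab) auto
      then show "coAd G (c t) \<mu> = \<mu>" by (simp add: stab_iff)
    qed
  qed
  have l0: "\<eta> = 0" if "\<eta> \<in> \<ll>" for \<eta>
    using P_l[OF that] P_stab[OF h_stab[OF ll_h[OF that]]] by simp
  have n0: "\<eta> = 0" if "\<eta> \<in> \<nn>" for \<eta>
  proof (rule nondeg_n[OF that])
    fix y assume "y \<in> \<ll>"
    then have "y = 0" by (rule l0)
    then show "\<mu> (bracket G y \<eta>) = 0" by (simp add: bracket_simps blinfun.zero_right)
  qed
  have pp0: "Pp \<xi> = 0" for \<xi>
  proof (rule fin_dim_dual_separates[OF fd])
    fix \<beta> :: "'g dual"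
    have l: "linear (\<lambda>\<xi>. blinfun_apply \<beta> (Pp \<xi>))"
      using linear_compose[OF P_linear(2) bounded_linear.linear[OF blinfun.bounded_linear_right[of \<beta>]]] by (simp add: o_def)
    have ap: "blinfun_apply (Blinfun (\<lambda>\<xi>. \<beta> (Pp \<xi>))) = (\<lambda>\<xi>. \<beta> (Pp \<xi>))" by (rule blinfun_apply_Blinfun_fin_dim[OF fd l])
    have "Blinfun (\<lambda>\<xi>. \<beta> (Pp \<xi>)) \<in> \<pp>dual"
      using P_hm P_o P_l P_n by (auto simp: annih_def ap blinfun.zero_right)
    then have "Blinfun (\<lambda>\<xi>. blinfun_apply \<beta> (Pp \<xi>)) = 0" by (rule p0)
    then show "blinfun_apply \<beta> (Pp \<xi>) = 0" using fun_cong[OF ap, of \<xi>] by simp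
  qed
  \<comment> \<open>With \<open>\<ll>\<close> and its dual partner \<open>\<nn>\<close> also gone,
    the Lie algebra is \<open>\<hh>\<mu>\<close>, on which \<open>\<mu>\<close> vanishes; this
    contradicts the choice of \<open>u\<close>.\<close>
  have "fst u = Pk (fst u)"
    using P_sum[of "fst u"] pp0 o0[OF P_mem(4)] l0[OF P_mem(5)] n0[OF P_mem(6)] by simp
  then have "fst u \<in> \<hh>" using P_mem(1) by metis
  then show False using u(2) \<mu>h by blast
qed

text \<open>The zero level condition for tube points, recovered from the existence of the
  functional.\<close>

lemma tube_B_on_h:
  assumes dom: "in_dom g \<nu> x a b" and \<eta>: "\<eta> \<in> \<hh>"
  shows "blinfun_apply (B (yv \<nu> x a b)) \<eta> = b (inf_act G H \<rho> \<eta> a)"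
proof -
  obtain \<alpha> where \<alpha>: "good (g \<otimes> A (yv \<nu> x a b)) (B (yv \<nu> x a b)) a b \<alpha>" using tube_functional_exists[OF dom] by blast
  have "g \<otimes> A (yv \<nu> x a b) \<in> C" using dom A_C[OF T0_form(1)[OF dom]] by (simp add: in_dom_def)
  from good_h[OF this \<alpha> \<eta>] show ?thesis .
qed

end

section \<open>The momentum level near the base point\<close>

context tube_data
begin

text \<open>For an increment \<open>(J, 0, 0)\<close> the derivative of \<open>B\<close> restricted
  to \<open>\<hh>\<mu>\<close> is \<open>J\<close> itself, because \<open>coad\<close> of
  \<open>\<mu>\<close> vanishes on the stabilizer algebra. If \<open>B\<close> takes equal values on
  \<open>\<hh>\<close>, strict differentiability bounds \<open>J\<close> by half of itself.\<close>

lemma B_injective_on_hm: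
  obtains r where "r > 0" "\<And>J x \<epsilon>. J \<in> annih (\<pp> \<union> \<oo> \<union> \<ll> \<union> \<nn>) \<Longrightarrow> (0, x, \<epsilon>) \<in> U \<Longrightarrow> (J, x, \<epsilon>) \<in> U \<Longrightarrow>
    norm (0 :: 'g dual, x, \<epsilon>) < r \<Longrightarrow> norm (J, x, \<epsilon>) < r \<Longrightarrow>
    (\<And>\<eta>. \<eta> \<in> \<hh> \<Longrightarrow> blinfun_apply (B (J, x, \<epsilon>)) \<eta> = blinfun_apply (B (0, x, \<epsilon>)) \<eta>) \<Longrightarrow> J = 0"
proof -
  obtain D where D: "mderiv MV (C \<times> U) MD \<Phi> (\<one>, 0) D" using Phi_mderiv[OF U_zero] by blast
  have sB: "strict_deriv B (\<lambda>w. snd (D (0, w))) 0 U" using AB_mderiv(2)[OF U_zero D] by (simp add: mderiv_vec_vec)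
  obtain K where K: "K > 0" "\<And>\<xi>. norm (Pk \<xi>) \<le> norm \<xi> * K"
    using bounded_linear.pos_bounded[OF linear_fd[OF P_linear(1)]] by blast
  \<comment> \<open>\<open>K\<close> bounds the projection to \<open>\<hh>\<mu>\<close>; the
    precision \<open>1 / (2 * K)\<close> is what yields the factor 1/2.\<close>
  have "1 / (2 * K) > 0" using K by simp
  then obtain r where r: "r > 0" "\<And>y z. y \<in> U \<Longrightarrow> z \<in> U \<Longrightarrow> dist 0 y < r \<Longrightarrow> dist 0 z < r \<Longrightarrow>
    norm (B y - B z - snd (D (0, y - z))) \<le> 1 / (2 * K) * norm (y - z)" using strict_derivD[OF sB] by metis
  show ?thesis
  proof (rule that[OF r(1)])
    fix J x \<epsilon>
    assume J: "J \<in> annih (\<pp> \<union> \<oo> \<union> \<ll> \<union> \<nn>)" and U: "(0, x, \<epsilon>) \<in> U" "(J, x, \<epsilon>) \<in> U"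
      and n: "norm (0 :: 'g dual, x, \<epsilon>) < r" "norm (J, x, \<epsilon>) < r"
      and eq: "\<And>\<eta>. \<eta> \<in> \<hh> \<Longrightarrow> blinfun_apply (B (J, x, \<epsilon>)) \<eta> = blinfun_apply (B (0, x, \<epsilon>)) \<eta>"
    let ?w = "(J, 0 :: 'g, 0 :: 'g dual)"
    have w: "?w \<in> TM" using J zero_mem by (auto simp: tube_model_def annih_def)
    have "norm (B (J, x, \<epsilon>) - B (0, x, \<epsilon>) - snd (D (0, (J, x, \<epsilon>) - (0, x, \<epsilon>)))) \<le> 1 / (2 * K) * norm ((J, x, \<epsilon>) - (0, x, \<epsilon>))"
      using n by (intro r(2) U) auto
    then have est: "norm (B (J, x, \<epsilon>) - B (0, x, \<epsilon>) - snd (D (0, ?w))) \<le> 1 / (2 * K) * norm J"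
      by (simp add: norm_Pair zero_prod_def)
    have "norm J \<le> 1 / 2 * norm J"
    proof (rule norm_blinfun_bound)
      fix \<xi>
      have k: "Pk \<xi> \<in> \<hh>" "Pk \<xi> \<in> \<gg>\<mu>" by (rule P_mem)+
      have "blinfun_apply J \<xi> = blinfun_apply J (Pk \<xi>)"
      proof -
        have "blinfun_apply J \<xi> = blinfun_apply J (Pk \<xi> + Pp \<xi> + Po \<xi> + Pl \<xi> + Pn \<xi>)" by (rule arg_cong[OF P_sum])
        also have "\<dots> = blinfun_apply J (Pk \<xi>)" using J P_mem by (simp add: blinfun.add_right annih_def)
        finally show ?thesis .
      qed
      also have "\<dots> = - blinfun_apply (B (J, x, \<epsilon>) - B (0, x, \<epsilon>) - snd (D (0, ?w))) (Pk \<xi>)"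
        using dB_eq[OF D w, of "Pk \<xi>"] eq[OF k(1)] mu_stab(2)[OF k(2)] by (simp add: blinfun.diff_left)
      finally have "norm (blinfun_apply J \<xi>) \<le> norm (B (J, x, \<epsilon>) - B (0, x, \<epsilon>) - snd (D (0, ?w))) * norm (Pk \<xi>)"
        using norm_blinfun by (metis norm_minus_cancel)
      also have "\<dots> \<le> (1 / (2 * K) * norm J) * (norm \<xi> * K)"
        by (intro mult_mono est K) (use K in auto)
      also have "\<dots> = 1 / 2 * norm J * norm \<xi>" using K(1) by simp
      finally show "norm (blinfun_apply J \<xi>) \<le> 1 / 2 * norm J * norm \<xi>" .
    qed simp
    then show "J = 0" by simp
  qed
qed

end

context tube_setting
begin

lemma local_momentum_level:
  "\<exists>UQ. openin (mtop Q) UQ \<and> \<pi> (\<one>, 0) \<in> UQ \<and>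
     (\<forall>g\<in>stab G \<mu>. tw_left G g ` UQ \<subseteq> UQ) \<and>
     {z \<in> pts (cotangent Q). fst z \<in> UQ \<and> momentum G Q z = \<mu>} =
     T0 ` {Ycl (g, \<nu>, x, a, b) | g \<nu> x a b.
            g \<in> carrier G \<and> \<nu> \<in> \<pp>r \<and> x \<in> \<oo>r \<and> dia_h a b \<in> \<hh>r \<and>
            fst (T0 (Ycl (g, \<nu>, x, a, b))) \<in> UQ \<and>
            g \<in> stab G \<mu> \<and> \<nu> = 0 \<and> JN (x, a, b) = 0}"
proof -
  \<comment> \<open>The projection along the stabilizer algebra; its range \<open>V\<close> is
    \<open>\<oo> \<oplus> \<ll> \<oplus> \<nn>\<close>, the complement that defines the
    slice.\<close>
  define P where "P x = Po x + Pl x + Pn x" for x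
  have lP: "linear P" unfolding P_def[abs_def] by (intro linear_compose_add P_linear)
  define V where "V = {x. P x = x}"
  have Pid: "P (P x) = P x" for x
    using P_o[OF P_mem(4)[of x]] P_l[OF P_mem(5)[of x]] P_n[OF P_mem(6)[of x]]
    by (simp add: P_def linear_add[OF P_linear(3)] linear_add[OF P_linear(4)] linear_add[OF P_linear(5)])
  have sV: "subspace V"
    unfolding V_def by (rule subspaceI) (simp_all add: linear_0[OF lP] linear_add[OF lP] linear_scale[OF lP])
  have Pst: "x - P x \<in> \<gg>\<mu>" for x
  proof -
    have "x - P x = Pk x + Pp x" using P_sum[of x] by (simp add: P_def algebra_simps)
    then show ?thesis using P_mem(2,3) pp_stab subspace_add[OF subspace_stab_alg] by metis
  qed
  have P0: "P x = 0" if "x \<in> \<gg>\<mu>" for x using P_stab[OF that] by (simp add: P_def)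
  have PV: "P x \<in> V" "x \<in> V \<Longrightarrow> P x = x" for x using Pid by (auto simp: V_def)
  obtain N where N: "openin (mtop M) N" "\<one> \<in> N" "N \<subseteq> C"
    "\<And>g. g \<in> N \<Longrightarrow> coAd G g \<mu> - \<mu> \<in> annih V \<Longrightarrow> coAd G g \<mu> = \<mu>"
    using orbit_meets_slice_once[OF lP PV Pst P0 sV] by blast
  have annV: "\<nu> \<in> annih V" if "\<nu> \<in> annih (\<oo> \<union> \<ll> \<union> \<nn>)" for \<nu> :: "'g dual"
  proof -
    have "blinfun_apply \<nu> x = 0" if "x \<in> V" for x
    proof -
      have "blinfun_apply \<nu> x = blinfun_apply \<nu> (Po x + Pl x + Pn x)" using that by (simp add: V_def P_def)
      also have "\<dots> = 0" using \<open>\<nu> \<in> annih (\<oo> \<union> \<ll> \<union> \<nn>)\<close> P_mem by (simp add: annih_def blinfun.add_right)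
      finally show ?thesis .
    qed
    then show ?thesis by (simp add: annih_def)
  qed
  obtain rJ where rJ: "rJ > 0" "\<And>J x \<epsilon>. J \<in> annih (\<pp> \<union> \<oo> \<union> \<ll> \<union> \<nn>) \<Longrightarrow> (0, x, \<epsilon>) \<in> U \<Longrightarrow> (J, x, \<epsilon>) \<in> U \<Longrightarrow>
    norm (0 :: 'g dual, x, \<epsilon>) < rJ \<Longrightarrow> norm (J, x, \<epsilon>) < rJ \<Longrightarrow>
    (\<And>\<eta>. \<eta> \<in> \<hh> \<Longrightarrow> blinfun_apply (B (J, x, \<epsilon>)) \<eta> = blinfun_apply (B (0, x, \<epsilon>)) \<eta>) \<Longrightarrow> J = 0"
    using B_injective_on_hm by blast
  obtain ro where ro: "ro > 0" "\<And>x. x \<in> \<oo> \<Longrightarrow> norm x < ro \<Longrightarrow> x \<in> \<oo>r" using relative_open_near_zero[OF \<oo>r] by blast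
  obtain rh where rh: "rh > 0" "\<And>\<beta>. \<beta> \<in> annih (\<pp> \<union> \<oo> \<union> \<nn>) \<Longrightarrow> norm \<beta> < rh \<Longrightarrow> \<beta> \<in> \<hh>r"
    using relative_open_near_zero[OF \<hh>r] by blast
  obtain D where D: "mderiv MV (C \<times> U) MD \<Phi> (\<one>, 0) D" using Phi_mderiv[OF U_zero] by blast
  have sB: "strict_deriv B (\<lambda>w. snd (D (0, w))) 0 U" using AB_mderiv(2)[OF U_zero D] by (simp add: mderiv_vec_vec)
  obtain KB dB where KB: "KB > 0" "dB > 0" "\<And>y z. y \<in> U \<Longrightarrow> z \<in> U \<Longrightarrow> dist 0 y < dB \<Longrightarrow> dist 0 z < dB \<Longrightarrow>
    norm (B y - B z) \<le> KB * norm (y - z)" using strict_deriv_lipschitz[OF sB] by metis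
  obtain Kk where Kk: "Kk > 0" "\<And>\<xi>. norm (Pk \<xi>) \<le> norm \<xi> * Kk"
    using bounded_linear.pos_bounded[OF linear_fd[OF P_linear(1)]] by blast
  obtain Kh where Kh: "Kh > 0" "\<And>\<xi>. norm (Pk \<xi> + Pl \<xi>) \<le> norm \<xi> * Kh"
    using bounded_linear.pos_bounded[OF linear_fd[OF Pkl_linear]] by blast
  obtain Kb where Kb: "Kb > 0" "\<And>x y. norm (bracket G x y) \<le> norm x * norm y * Kb"
    using bounded_bilinear.pos_bounded[OF bracket_bounded_bilinear] by blast
  \<comment> \<open>Bounds \<open>norm J\<close> by a multiple of \<open>norm y\<close>: the first
    summand handles the quadratic term of \<open>JN\<close> once \<open>norm x \<le> 1\<close>, the
    second the diamond term through \<open>B y - \<mu>\<close>, and 1 keeps the constant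
    positive.\<close>
  define KJ where "KJ = norm \<mu> * Kb * Kb * Kk + KB * Kk + 1"
  have KJ: "KJ > 0" unfolding KJ_def using Kb(1) Kk(1) KB(1) by (simp add: add_nonneg_pos)
  \<comment> \<open>In order: 1 linearizes the quadratic term of \<open>JN\<close>,
    \<open>dB\<close> is the range of the Lipschitz bound for \<open>B\<close>, \<open>ro\<close>
    puts \<open>x\<close> into \<open>\<oo>r\<close>, the two entries with \<open>rJ\<close> bring
    \<open>(0, x, \<epsilon>)\<close> and \<open>(J, x, \<epsilon>)\<close> within reach of
    \<open>B_injective_on_hm\<close>, and the last puts the diamond into
    \<open>\<hh>r\<close>.\<close>
  define r where "r = Min {1, dB, ro, rJ / 2, rJ / (2 * KJ), rh / (KB * Kh)}"
  have r: "r > 0" "r \<le> 1" "r \<le> dB" "r \<le> ro" "r \<le> rJ / 2" "r \<le> rJ / (2 * KJ)" "r \<le> rh / (KB * Kh)"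
    unfolding r_def by (use KB(1,2) ro(1) rJ(1) rh(1) Kh(1) KJ in simp) (rule Min_le; simp)+
  obtain O1 where O1: "openin (mtop M) O1" "\<one> \<in> O1" "O1 \<subseteq> C"
    "\<And>g. g \<in> O1 \<Longrightarrow> \<exists>h\<in>H. \<exists>y\<in>U. norm y < r \<and> B y = coAd G (g \<otimes> h) \<mu> \<and> g \<otimes> h \<otimes> inv (A y) \<in> N"
    using coAd_orbit_in_tube[OF N(1,2) r(1)] by metis
  \<comment> \<open>Saturation by the stabilizer makes \<open>UQ\<close> invariant. Since
    \<open>UQ\<close> is the image of \<open>W \<times> UNIV\<close>, neither \<open>a\<close> nor
    \<open>b\<close> is restricted in size.\<close>
  define W where "W = (\<Union>k\<in>stab G \<mu>. (\<lambda>g. k \<otimes> g) ` O1)"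
  have oW: "openin (mtop M) W"
    unfolding W_def by (rule openin_Union) (auto simp: stab_iff left_translate_open O1)
  have WC: "W \<subseteq> C" using openin_subset[OF oW] ptsM by simp
  define UQ where "UQ = \<pi> ` (W \<times> UNIV)"
  have oneW: "\<one> \<in> W"
    unfolding W_def using stab_one O1(2) by (intro UN_I[of \<one>] image_eqI[of _ _ \<one>]) auto
  have Wst: "k \<otimes> g \<in> W" if k: "k \<in> stab G \<mu>" and g: "g \<in> W" for k g
  proof -
    obtain k' g' where "k' \<in> stab G \<mu>" "g' \<in> O1" "g = k' \<otimes> g'" using g by (auto simp: W_def)
    then have "k \<otimes> g = (k \<otimes> k') \<otimes> g'" "k \<otimes> k' \<in> stab G \<mu>"
      using k O1(3) stab_mult by (auto simp: m_assoc stab_iff subset_iff)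
    then show ?thesis using \<open>g' \<in> O1\<close> by (auto simp: W_def)
  qed
  have UQst: "tw_left G k ` UQ \<subseteq> UQ" if k: "k \<in> stab G \<mu>" for k
  proof
    fix q assume "q \<in> tw_left G k ` UQ"
    then obtain g a where "g \<in> W" "q = tw_left G k (\<pi> (g, a))" by (auto simp: UQ_def)
    moreover have "k \<in> C" "g \<in> C" using k calculation(1) WC by (auto simp: stab_iff)
    ultimately have "q = \<pi> (k \<otimes> g, a)" "k \<otimes> g \<in> W" using tw_left_class Wst[OF k] by auto
    then show "q \<in> UQ" by (auto simp: UQ_def)
  qed
  let ?L = "{z \<in> pts (cotangent Q). fst z \<in> UQ \<and> momentum G Q z = \<mu>}"
  let ?Z = "{Ycl (g, \<nu>, x, a, b) | g \<nu> x a b.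
            g \<in> carrier G \<and> \<nu> \<in> \<pp>r \<and> x \<in> \<oo>r \<and> dia_h a b \<in> \<hh>r \<and>
            fst (T0 (Ycl (g, \<nu>, x, a, b))) \<in> UQ \<and>
            g \<in> stab G \<mu> \<and> \<nu> = 0 \<and> JN (x, a, b) = 0}"
  have sup: "T0 ` ?Z \<subseteq> ?L"
  proof
    fix z assume "z \<in> T0 ` ?Z"
    then obtain p where p: "z = T0 p" "p \<in> ?Z" by (rule imageE)
    from p(2) obtain g \<nu> x a b where q: "p = Ycl (g, \<nu>, x, a, b)" "g \<in> C" "\<nu> \<in> \<pp>r" "x \<in> \<oo>r" "dia_h a b \<in> \<hh>r"
        "fst (T0 (Ycl (g, \<nu>, x, a, b))) \<in> UQ" "g \<in> stab G \<mu>" "\<nu> = 0" "JN (x, a, b) = 0"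
      by (elim CollectE exE conjE) (rule that; assumption)
    have z: "z = T0 (Ycl (g, 0, x, a, b))" "in_dom g 0 x a b" "fst z \<in> UQ" "g \<in> stab G \<mu>" "JN (x, a, b) = 0"
      using p(1) q by (simp_all add: in_dom_def)
    let ?y = "yv 0 x a b"
    have yU: "?y \<in> U" by (rule T0_form(1)[OF z(2)])
    have gC: "g \<in> C" "g \<otimes> A ?y \<in> C" using z(2) A_C[OF yU] by (auto simp: in_dom_def)
    obtain \<alpha> where \<alpha>: "good (g \<otimes> A ?y) (B ?y) a b \<alpha>" using tube_functional_exists[OF z(2)] by blast
    have zeq: "z = (\<pi> (g \<otimes> A ?y, a), \<alpha>)" using z(1) T0_form(2)[OF z(2)] phi_good[OF gC(2) \<alpha>] by simp
    have "momentum G Q z = coAd G (inv (g \<otimes> A ?y)) (B ?y)" unfolding zeq by (rule good_momentum[OF gC(2) \<alpha>])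
    also have "\<dots> = coAd G (inv g) (coAd G (inv (A ?y)) (B ?y))"
      using gC(1) A_C[OF yU] by (simp add: inv_mult_group coAd_mult)
    also have "\<dots> = coAd G (inv g) \<mu>" using left_momentum_tube[OF yU] z(5) by (simp add: yv_def)
    also have "\<dots> = \<mu>" using z(4) by (simp add: stab_def)
    finally have "momentum G Q z = \<mu>" .
    moreover have "z \<in> pts (cotangent Q)"
      using openin_subset[OF T0_open] z(1,2) unfolding in_dom_def by blast
    ultimately show "z \<in> ?L" using z(3) by blast
  qed
  have sub: "?L \<subseteq> T0 ` ?Z"
  proof
    fix z assume zL: "z \<in> ?L"
    then obtain g0 a where g0: "g0 \<in> W" "fst z = \<pi> (g0, a)" by (auto simp: UQ_def)
    obtain k g where kg: "k \<in> stab G \<mu>" "g \<in> O1" "g0 = k \<otimes> g" using g0(1) by (auto simp: W_def)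
    have C1: "k \<in> C" "g \<in> C" "g0 \<in> C" using kg O1(3) by (auto simp: stab_iff)
    define \<alpha> where "\<alpha> = snd z"
    have zeq: "z = (\<pi> (g0, a), \<alpha>)" using g0(2) by (simp add: \<alpha>_def prod_eq_iff)
    obtain \<beta> b where good: "good g0 \<beta> a b \<alpha>" using good_exists_pullback[OF C1(3)] by blast
    \<comment> \<open>The momentum determines the group part of the covector, and the factor
      \<open>k\<close> drops out because it fixes \<open>\<mu>\<close>.\<close>
    have "coAd G (inv g0) \<beta> = \<mu>" using zL good_momentum[OF C1(3) good] by (simp add: zeq)
    then have "\<beta> = coAd G g0 \<mu>" using coAd_inv(2)[OF C1(3), of \<beta>] by simp
    then have \<beta>: "\<beta> = coAd G g \<mu>" using kg C1 by (simp add: coAd_mult stab_iff)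
    obtain h y where hy: "h \<in> H" "y \<in> U" "norm y < r" "B y = coAd G (g \<otimes> h) \<mu>" "g \<otimes> h \<otimes> inv (A y) \<in> N"
      using O1(4)[OF kg(2)] by blast
    have hC: "h \<in> C" "A y \<in> C" using hy H_C A_C by auto
    define a' where "a' = \<rho> (inv h) a"
    define b' where "b' = comp_rho h b"
    have good': "good (g0 \<otimes> h) (B y) a' b' \<alpha>"
      using good_twist[OF C1(3) hy(1) good] by (simp add: a'_def b'_def \<beta> hy(4) coAd_mult C1 hC)
    have g0h: "g0 \<otimes> h \<in> C" using C1 hC by simp
    define g1 where "g1 = g \<otimes> h \<otimes> inv (A y)"
    have g1C: "g1 \<in> C" using C1 hC by (simp add: g1_def)
    have "coAd G g1 \<mu> = coAd G (inv (A y)) (B y)" using C1 hC by (simp add: g1_def hy(4) coAd_mult)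
    also have "\<dots> = fst y + \<mu>" by (rule left_momentum_tube[OF hy(2)])
    finally have cg1: "coAd G g1 \<mu> = fst y + \<mu>" .
    have yTM: "fst y \<in> annih (\<oo> \<union> \<ll> \<union> \<nn>)" "fst (snd y) \<in> \<oo>" "snd (snd y) \<in> annih (\<gg>\<mu> \<union> \<oo> \<union> \<nn>)"
      using U_TM[OF hy(2)] by (auto simp: tube_model_def mem_Times_iff)
    \<comment> \<open>By \<open>left_momentum_tube\<close> this difference is the coordinate
      \<open>fst y\<close>, which annihilates \<open>V\<close>; and \<open>g1\<close> lies in
      \<open>N\<close>.\<close>
    have "coAd G g1 \<mu> - \<mu> \<in> annih V" using annV[OF yTM(1)] by (simp add: cg1)
    then have "coAd G g1 \<mu> = \<mu>" using N(4) hy(5) by (simp add: g1_def)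
    then have g1s: "g1 \<in> stab G \<mu>" and y1: "fst y = 0" using g1C cg1 by (auto simp: stab_iff)
    define g' where "g' = k \<otimes> g1"
    have g's: "g' \<in> stab G \<mu>" "g' \<in> C" using stab_mult[OF kg(1) g1s] by (auto simp: g'_def stab_iff)
    have g'A: "g' \<otimes> A y = g0 \<otimes> h" using C1 hC by (simp add: g'_def g1_def kg(3) m_assoc)
    define x where "x = fst (snd y)"
    define \<epsilon> where "\<epsilon> = snd (snd y)"
    have yeq: "y = (0, x, \<epsilon>)" using y1 by (simp add: x_def \<epsilon>_def prod_eq_iff)
    \<comment> \<open>The source of all bounds on the pair \<open>(a', b')\<close>: its diamond is
      controlled by \<open>B y\<close>, hence by \<open>norm y\<close>, while \<open>b'\<close>
      alone is not controlled.\<close>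
    have Bh: "blinfun_apply (B y) \<eta> = b' (inf_act G H \<rho> \<eta> a')" if "\<eta> \<in> \<hh>" for \<eta>
      by (rule good_h[OF g0h good' that])
    have Bnear: "norm (B y - \<mu>) \<le> KB * norm y"
      using KB(3)[OF hy(2) U_zero] hy(3) r(3) KB(2) by (simp add: AB_zero)
    have nx: "norm x \<le> norm y" unfolding yeq using norm_snd_le[of "(x, \<epsilon>)" "0 :: 'g dual"] norm_fst_le[of x \<epsilon>] by linarith
    have xr: "x \<in> \<oo>r" using yTM(2) nx hy(3) r(4) by (intro ro(2)) (auto simp: x_def)
    \<comment> \<open>As \<open>\<mu>\<close> vanishes on \<open>\<hh>\<close>, the diamond is the
      restriction of \<open>B y - \<mu>\<close>, which is of the order of
      \<open>norm y\<close>.\<close>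
    have dh: "dia_h a' b' \<in> \<hh>r"
    proof (rule rh(2)[OF dia_h_annih])
      have "norm (dia_h a' b') \<le> KB * norm y * Kh"
      proof (rule norm_blinfun_bound)
        fix \<eta>
        have "blinfun_apply (dia_h a' b') \<eta> = blinfun_apply (B y) (Pk \<eta> + Pl \<eta>)" using Bh[OF Pkl_h] by (simp add: dia_h_apply)
        also have "\<dots> = blinfun_apply (B y - \<mu>) (Pk \<eta> + Pl \<eta>)" using \<mu>h Pkl_h by (simp add: blinfun.diff_left)
        finally have "norm (blinfun_apply (dia_h a' b') \<eta>) \<le> norm (B y - \<mu>) * norm (Pk \<eta> + Pl \<eta>)"
          using norm_blinfun by metis
        also have "\<dots> \<le> (KB * norm y) * (norm \<eta> * Kh)" by (intro mult_mono Bnear Kh) (use KB(1) in auto)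
        finally show "norm (blinfun_apply (dia_h a' b') \<eta>) \<le> KB * norm y * Kh * norm \<eta>" by (simp add: algebra_simps)
      qed (use KB Kh in simp)
      also have "\<dots> = norm y * (KB * Kh)" by simp
      also have "\<dots> < rh"
      proof -
        have "norm y < rh / (KB * Kh)" using hy(3) r(7) by simp
        then show ?thesis using KB(1) Kh(1) by (simp add: pos_less_divide_eq)
      qed
      finally show "norm (dia_h a' b') < rh" .
    qed
    \<comment> \<open>Available before \<open>J = 0\<close> is known: the domain of
      \<open>T0\<close> does not mention \<open>J\<close>, and so \<open>T0_form\<close> already
      places \<open>(J, x, \<epsilon>)\<close> in \<open>U\<close>.\<close>
    have dom: "in_dom g'' 0 x a' b'" if "g'' \<in> C" for g'' using that xr dh \<pp>r(2) by (simp add: in_dom_def)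
    have dl: "dia_l a' b' = \<epsilon>"
    proof (rule blinfun_eqI)
      fix \<eta>
      have "blinfun_apply (dia_l a' b') \<eta> = blinfun_apply (B y) (Pl \<eta>)" using Bh[OF ll_h[OF P_mem(5)]] by (simp add: dia_l_apply)
      also have "\<dots> = blinfun_apply \<epsilon> (Pl \<eta>)" using tube_l[OF hy(2) P_mem(5)] by (simp add: \<epsilon>_def)
      also have "\<dots> = blinfun_apply \<epsilon> (Pk \<eta> + Pp \<eta> + Po \<eta> + Pl \<eta> + Pn \<eta>)"
        using yTM(3) P_mem pp_stab[OF P_mem(3)] by (simp add: blinfun.add_right annih_def \<epsilon>_def)
      also have "\<dots> = blinfun_apply \<epsilon> \<eta>" by (rule arg_cong[OF P_sum, symmetric])
      finally show "blinfun_apply (dia_l a' b') \<eta> = blinfun_apply \<epsilon> \<eta>" .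
    qed
    define J where "J = JN (x, a', b')"
    have yv1: "yv 0 x a' b' = (J, x, \<epsilon>)" by (simp add: yv_def dl J_def)
    have nJ: "norm J \<le> KJ * norm y"
    proof (rule norm_blinfun_bound)
      fix \<eta>
      have k: "Pk \<eta> \<in> \<hh>" by (rule P_mem)
      have 1: "norm (blinfun_apply \<mu> (bracket G x (bracket G (Pk \<eta>) x))) \<le> norm \<mu> * Kb * Kb * Kk * norm y * norm \<eta>"
      proof -
        have "norm (bracket G (Pk \<eta>) x) \<le> (norm \<eta> * Kk) * 1 * Kb"
          by (rule order_trans[OF Kb(2)], intro mult_right_mono mult_mono Kk(2)) (use Kk Kb nx hy(3) r(2) in auto)
        then have "norm x * norm (bracket G (Pk \<eta>) x) * Kb \<le> norm y * ((norm \<eta> * Kk) * 1 * Kb) * Kb"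
          using nx Kb(1) by (intro mult_right_mono mult_mono) auto
        then have "norm (bracket G x (bracket G (Pk \<eta>) x)) \<le> norm y * ((norm \<eta> * Kk) * 1 * Kb) * Kb"
          using Kb(2)[of x "bracket G (Pk \<eta>) x"] by linarith
        then have "norm \<mu> * norm (bracket G x (bracket G (Pk \<eta>) x)) \<le> norm \<mu> * (norm y * ((norm \<eta> * Kk) * 1 * Kb) * Kb)"
          by (rule mult_left_mono) simp
        then show ?thesis using norm_blinfun[of \<mu> "bracket G x (bracket G (Pk \<eta>) x)"] by (simp add: algebra_simps)
      qed
      have 2: "norm (blinfun_apply b' (inf_act G H \<rho> (Pk \<eta>) a')) \<le> KB * Kk * norm y * norm \<eta>"
      proof -
        have "blinfun_apply b' (inf_act G H \<rho> (Pk \<eta>) a') = blinfun_apply (B y - \<mu>) (Pk \<eta>)"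
          using Bh[OF k] \<mu>h k by (simp add: blinfun.diff_left)
        then have "norm (blinfun_apply b' (inf_act G H \<rho> (Pk \<eta>) a')) \<le> norm (B y - \<mu>) * norm (Pk \<eta>)"
          using norm_blinfun by metis
        also have "\<dots> \<le> (KB * norm y) * (norm \<eta> * Kk)" by (intro mult_mono Bnear Kk) (use KB(1) in auto)
        finally show ?thesis by (simp add: algebra_simps)
      qed
      have "norm (blinfun_apply J \<eta>) \<le> norm (blinfun_apply \<mu> (bracket G x (bracket G (Pk \<eta>) x))) + norm (blinfun_apply b' (inf_act G H \<rho> (Pk \<eta>) a'))"
        unfolding J_def JN_apply by simp
      also have "\<dots> \<le> norm \<mu> * Kb * Kb * Kk * norm y * norm \<eta> + KB * Kk * norm y * norm \<eta>" using 1 2 by linarith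
      also have "\<dots> \<le> KJ * norm y * norm \<eta>" by (simp add: KJ_def algebra_simps)
      finally show "norm (blinfun_apply J \<eta>) \<le> KJ * norm y * norm \<eta>" .
    qed (use KJ in simp)
    have nJr: "norm J < rJ / 2"
    proof -
      have "norm y < rJ / (2 * KJ)" using hy(3) r(6) by simp
      then have "KJ * norm y < rJ / 2" using KJ by (simp add: field_simps)
      then show ?thesis using nJ by simp
    qed
    \<comment> \<open>On \<open>\<hh>\<close> both values of \<open>B\<close> are the diamond of
      \<open>a'\<close> and \<open>b'\<close>: at \<open>(J, x, \<epsilon>)\<close> by
      \<open>tube_B_on_h\<close>, at \<open>y = (0, x, \<epsilon>)\<close> by
      \<open>Bh\<close>.\<close>
    have J0: "J = 0"
    proof (rule rJ(2))
      show "J \<in> annih (\<pp> \<union> \<oo> \<union> \<ll> \<union> \<nn>)" unfolding J_def by (rule JN_annih)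
      show "(0, x, \<epsilon>) \<in> U" using hy(2) yeq by simp
      show "(J, x, \<epsilon>) \<in> U" using T0_form(1)[OF dom[OF one_closed]] yv1 by simp
      have ny: "norm (0 :: 'g dual, x, \<epsilon>) < rJ / 2" using hy(3) r(5) unfolding yeq by simp
      then show "norm (0 :: 'g dual, x, \<epsilon>) < rJ" using rJ(1) by simp
      have "norm (J, x, \<epsilon>) \<le> norm J + norm (x, \<epsilon>)" by (rule norm_Pair_le)
      moreover have "norm (x, \<epsilon>) = norm (0 :: 'g dual, x, \<epsilon>)" by (simp add: norm_Pair)
      ultimately show "norm (J, x, \<epsilon>) < rJ" using ny nJr by linarith
      show "blinfun_apply (B (J, x, \<epsilon>)) \<eta> = blinfun_apply (B (0, x, \<epsilon>)) \<eta>" if "\<eta> \<in> \<hh>" for \<eta>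
        using tube_B_on_h[OF dom[OF one_closed] that] Bh[OF that] yv1 yeq by simp
    qed
    have yv0: "yv 0 x a' b' = y" using yv1 J0 yeq by simp
    have "T0 (Ycl (g', 0, x, a', b')) = \<phi> G H \<rho> Q (g0 \<otimes> h, B y, a', b')"
      using T0_form(2)[OF dom[OF g's(2)]] by (simp add: yv0 g'A)
    also have "\<dots> = (\<pi> (g0 \<otimes> h, a'), \<alpha>)" by (rule phi_good[OF g0h good'])
    also have "\<dots> = z" using pi_twist[OF C1(3) hy(1), of a] by (simp add: zeq a'_def)
    finally have Tz: "T0 (Ycl (g', 0, x, a', b')) = z" .
    have "Ycl (g', 0, x, a', b') \<in> ?Z"
    proof -
      have "fst (T0 (Ycl (g', 0, x, a', b'))) \<in> UQ" using zL Tz by simp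
      moreover have "JN (x, a', b') = 0" using J0 by (simp add: J_def)
      ultimately show ?thesis using g's xr dh \<pp>r(2) by blast
    qed
    then show "z \<in> T0 ` ?Z" using Tz by blast
  qed
  show ?thesis
  proof (rule exI[of _ UQ], intro conjI)
    show "openin (mtop Q) UQ" unfolding UQ_def by (rule pi_open[OF oW])
    show "\<pi> (\<one>, 0) \<in> UQ" unfolding UQ_def using oneW by blast
    show "\<forall>g\<in>stab G \<mu>. tw_left G g ` UQ \<subseteq> UQ" using UQst by blast
    show "?L = T0 ` ?Z" by (rule equalityI[OF sub sup])
  qed
qed

end

lemma hamiltonian_tube_image:
  assumes "hamiltonian_tube G H \<rho> \<mu> \<pp> \<oo> \<ll> \<nn> Q Y Yr T0 z0"
  shows "inj_on T0 Yr" "openin (mtop (cotangent Q)) (T0 ` Yr)"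
  using assms by (simp_all add: hamiltonian_tube_def diffeo_onto_image_def)

theorem proposition6p2:
  fixes G :: "('a, 'g::real_normed_vector) lie_grp"
    and H :: "'a set"
    and \<rho> :: "'a \<Rightarrow> 's::real_normed_vector \<Rightarrow> 's"
    and \<mu> :: "'g dual"
    and \<pp> \<oo> \<ll> \<nn> :: "'g set"
    and U :: "('g dual \<times> 'g \<times> 'g dual) set"
    and \<Phi> :: "'a \<times> 'g dual \<times> 'g \<times> 'g dual \<Rightarrow> 'a \<times> 'g dual"
    and Q :: "(('a \<times> 's) set, 'q::real_normed_vector) manifold"
    and Y :: "(('a \<times> 'g dual \<times> 'g \<times> 's \<times> 's dual) set, 'y::real_normed_vector) manifold"
    and \<pp>r \<hh>r :: "'g dual set" and \<oo>r :: "'g set"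
    and T0 :: "('a \<times> 'g dual \<times> 'g \<times> 's \<times> 's dual) set \<Rightarrow> ('a \<times> 's) set \<times> 'q dual"
  assumes G: "lie_group G"
    and H: "subgroup H G" "compactin (mtop (mfd G)) H"
    and S: "fin_dim TYPE('s)" "lie_representation G H \<rho>"
    and \<mu>: "\<forall>\<eta>\<in>sub_alg G H. \<mu> \<eta> = 0"
    and splitting: "adapted_splitting G H \<mu> \<oo> \<ll> \<nn>"
    and \<pp>: "direct_sum (stab_alg G \<mu>) [sub_alg G H \<inter> stab_alg G \<mu>, \<pp>]"
      "\<forall>h\<in>H \<inter> stab G \<mu>. Ad G h ` \<pp> \<subseteq> \<pp>"
    and \<Phi>: "restricted_tube G H \<mu> \<oo> \<ll> \<nn> U \<Phi>"
    and Q: "tw_product G H \<rho> UNIV Q"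
    and Y: "tw_product G (H \<inter> stab G \<mu>) (Y_act G \<rho>) (Y_fibre G H \<mu> \<oo> \<ll> \<nn>) Y"
    and \<pp>r: "openin (top_of_set (annih ((sub_alg G H \<inter> stab_alg G \<mu>) \<union> \<oo> \<union> \<ll> \<union> \<nn>))) \<pp>r" "0 \<in> \<pp>r"
      "\<forall>h\<in>H \<inter> stab G \<mu>. coAd G (inv\<^bsub>G\<^esub> h) ` \<pp>r \<subseteq> \<pp>r"
    and \<oo>r: "openin (top_of_set \<oo>) \<oo>r" "0 \<in> \<oo>r" "\<forall>h\<in>H \<inter> stab G \<mu>. Ad G h ` \<oo>r \<subseteq> \<oo>r"
    and \<hh>r: "openin (top_of_set (annih (\<pp> \<union> \<oo> \<union> \<nn>))) \<hh>r" "0 \<in> \<hh>r"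
      "\<forall>h\<in>H. \<forall>\<alpha>\<in>\<hh>r.
         dual_ext (sub_alg G H) (\<pp> \<union> \<oo> \<union> \<nn>) (\<lambda>\<eta>. \<alpha> (Ad G (inv\<^bsub>G\<^esub> h) \<eta>)) \<in> \<hh>r"
    and T0: "\<forall>g\<in>carrier G. \<forall>\<nu>\<in>\<pp>r. \<forall>x\<in>\<oo>r. \<forall>a b.
         diamond (sub_alg G H) (\<pp> \<union> \<oo> \<union> \<nn>) (inf_act G H \<rho>) a b \<in> \<hh>r \<longrightarrow>
         (let y = (\<nu> + J_N0 G H \<rho> \<mu> (\<pp> \<union> \<oo> \<union> \<ll> \<union> \<nn>) (x, a, b), x,
                   diamond \<ll> (stab_alg G \<mu> \<union> \<oo> \<union> \<nn>) (inf_act G H \<rho>) a b)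
          in y \<in> U \<and>
             T0 (Y_class G H \<rho> \<mu> (g, \<nu>, x, a, b)) =
               \<phi> G H \<rho> Q (fst (\<Phi> (g, y)), snd (\<Phi> (g, y)), a, b))"
    and tube: "hamiltonian_tube G H \<rho> \<mu> \<pp> \<oo> \<ll> \<nn> Q Y
         {Y_class G H \<rho> \<mu> (g, \<nu>, x, a, b) | g \<nu> x a b.
            g \<in> carrier G \<and> \<nu> \<in> \<pp>r \<and> x \<in> \<oo>r \<and>
            diamond (sub_alg G H) (\<pp> \<union> \<oo> \<union> \<nn>) (inf_act G H \<rho>) a b \<in> \<hh>r}
         T0 (\<phi> G H \<rho> Q (\<one>\<^bsub>G\<^esub>, \<mu>, 0, 0))"
  shows "\<exists>UQ. openin (mtop Q) UQ \<and> tw_class G H \<rho> (\<one>\<^bsub>G\<^esub>, 0) \<in> UQ \<and>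
     (\<forall>g\<in>stab G \<mu>. tw_left G g ` UQ \<subseteq> UQ) \<and>
     {z \<in> pts (cotangent Q). fst z \<in> UQ \<and> momentum G Q z = \<mu>} =
     T0 ` {Y_class G H \<rho> \<mu> (g, \<nu>, x, a, b) | g \<nu> x a b.
            g \<in> carrier G \<and> \<nu> \<in> \<pp>r \<and> x \<in> \<oo>r \<and>
            diamond (sub_alg G H) (\<pp> \<union> \<oo> \<union> \<nn>) (inf_act G H \<rho>) a b \<in> \<hh>r \<and>
            fst (T0 (Y_class G H \<rho> \<mu> (g, \<nu>, x, a, b))) \<in> UQ \<and>
            g \<in> stab G \<mu> \<and> \<nu> = 0 \<and>
            J_N0 G H \<rho> \<mu> (\<pp> \<union> \<oo> \<union> \<ll> \<union> \<nn>) (x, a, b) = 0}"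
proof -
  have "tube_setting G H \<rho> \<mu> \<pp> \<oo> \<ll> \<nn> U \<Phi> Q \<pp>r \<hh>r \<oo>r T0"
    by (intro tube_setting.intro tube_data.intro lie_gp.intro tube_data_axioms.intro tube_setting_axioms.intro)
      (fact G H S \<mu> splitting \<pp>(1) \<Phi> Q \<pp>r(1,2) \<oo>r(1,2) \<hh>r(1,2) T0 hamiltonian_tube_image[OF tube])+
  then show ?thesis by (rule tube_setting.local_momentum_level)
qed

end
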